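(* Let $k$ be a field, let $\Lambda$ and $\Sigma$ be finite-dimensional Gorenstein $k$-algebras which are singularly equivalent of Morita type with level, and let $M$ (a $\Lambda$--$\Sigma$ bimodule) and $N$ (a $\Sigma$--$\Lambda$ bimodule) be bimodules which induce a singular equivalence of Morita type with level between $\Lambda$ and $\Sigma$. Let $d=\max\{\operatorname{id}_\Lambda\Lambda,\operatorname{id}_\Sigma\Sigma\}$ be the maximum of the injective dimensions of $\Lambda$ and $\Sigma$. Then for every integer $n>d$, the maps $$N\otimes_\Lambda-\colon\operatorname{Ext}^n_\Lambda(A,B)\to\operatorname{Ext}^n_\Sigma(N\otimes_\Lambda A,N\otimes_\Lambda B)\quad\text{for finitely generated }\Lambda\text{-modules }A,B,$$ $$M\otimes_\Sigma-\colon\operatorname{Ext}^n_\Sigma(A',B')\to\operatorname{Ext}^n_\Lambda(M\otimes_\Sigma A',M\otimes_\Sigma B')\quad\text{for finitely generated }\Sigma\text{-modules }A',B'$$ are isomorphisms of $k$-vector spaces.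
   Context: Modules are left modules unless stated otherwise. Bimodules over $k$-algebras have $k$ acting centrally. $\Lambda^{\mathrm e}=\Lambda\otimes_k\Lambda^{\mathrm{op}}$; $\operatorname{mod}$ denotes finitely generated modules and $\underline{\operatorname{mod}}$ the stable category modulo projectives. $\operatorname{id}_\Lambda\Lambda$ is the injective dimension of $\Lambda$ as a left module. $\Lambda$ is Gorenstein if it has finite injective dimension both as a left and as a right module over itself. Singular equivalence of Morita type with level $l\ge0$: bimodules ${}_\Lambda M_\Sigma$ and ${}_\Sigma N_\Lambda$ over finite-dimensional $k$-algebras induce one if (1) $M$ is finitely generated and projective as a left $\Lambda$-module and as a right $\Sigma$-module; (2) $N$ is finitely generated and projective as a left $\Sigma$-module and as a right $\Lambda$-module; (3) $M\otimes_\Sigma N\cong\Omega^l_{\Lambda^{\mathrm e}}(\Lambda)$ (the $l$-th syzygy) in $\underline{\operatorname{mod}}\,\Lambda^{\mathrm e}$; (4) $N\otimes_\Lambda M\cong\Omega^l_{\Sigma^{\mathrm e}}(\Sigma)$ in $\underline{\operatorname{mod}}\,\Sigma^{\mathrm e}$. "With level" means with level $l$ for some $l\ge0$. The map $N\otimes_\Lambda-$ on $\operatorname{Ext}^n$ applies the (exact) functor $N\otimes_\Lambda-$ to all objects and maps in an exact sequence representing an extension; similarly for $M\otimes_\Sigma-$. *)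

theory Defs
  imports "HOL-Library.Extended_Nat" "HOL-Algebra.Free_Abelian_Groups"
    "HOL-Algebra.Generated_Groups" "HOL-Algebra.AbelCoset" "HOL-Algebra.Module"
begin

section \<open>Modules over noncommutative rings\<close>

text \<open>Left modules reuse the library's module record (whose locale asks for a commutative
  ring); the fields \<open>mult\<close> and \<open>one\<close> of such a record are never used.\<close>

locale left_module = R?: ring R + M?: abelian_group M for R (structure) and M (structure) +
  assumes lsmult_closed:
      "\<lbrakk>a \<in> carrier R; x \<in> carrier M\<rbrakk> \<Longrightarrow> a \<odot>\<^bsub>M\<^esub> x \<in> carrier M"
    and lsmult_l_distr:
      "\<lbrakk>a \<in> carrier R; b \<in> carrier R; x \<in> carrier M\<rbrakk> \<Longrightarrow>
        (a \<oplus> b) \<odot>\<^bsub>M\<^esub> x = a \<odot>\<^bsub>M\<^esub> x \<oplus>\<^bsub>M\<^esub> b \<odot>\<^bsub>M\<^esub> x"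
    and lsmult_r_distr:
      "\<lbrakk>a \<in> carrier R; x \<in> carrier M; y \<in> carrier M\<rbrakk> \<Longrightarrow>
        a \<odot>\<^bsub>M\<^esub> (x \<oplus>\<^bsub>M\<^esub> y) = a \<odot>\<^bsub>M\<^esub> x \<oplus>\<^bsub>M\<^esub> a \<odot>\<^bsub>M\<^esub> y"
    and lsmult_assoc:
      "\<lbrakk>a \<in> carrier R; b \<in> carrier R; x \<in> carrier M\<rbrakk> \<Longrightarrow>
        (a \<otimes> b) \<odot>\<^bsub>M\<^esub> x = a \<odot>\<^bsub>M\<^esub> (b \<odot>\<^bsub>M\<^esub> x)"
    and lsmult_one: "x \<in> carrier M \<Longrightarrow> \<one> \<odot>\<^bsub>M\<^esub> x = x"

definition fin_gen :: "('r, 's) ring_scheme \<Rightarrow> ('r, 'x, 'z) module_scheme \<Rightarrow> bool" where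
  "fin_gen R X \<longleftrightarrow> (\<exists>B. finite B \<and> B \<subseteq> carrier X \<and>
     (\<forall>x \<in> carrier X. \<exists>c \<in> B \<rightarrow> carrier R. x = (\<Oplus>\<^bsub>X\<^esub>b\<in>B. c b \<odot>\<^bsub>X\<^esub> b)))"

definition fg_module :: "('r, 's) ring_scheme \<Rightarrow> ('r, 'x, 'z) module_scheme \<Rightarrow> bool" where
  "fg_module R X \<longleftrightarrow> left_module R X \<and> fin_gen R X"

definition lin_hom ::
  "('r, 's) ring_scheme \<Rightarrow> ('r, 'x, 'z) module_scheme \<Rightarrow> ('r, 'y, 'w) module_scheme \<Rightarrow> ('x \<Rightarrow> 'y) set"
where
  "lin_hom R X Y = {f \<in> carrier X \<rightarrow> carrier Y.
     (\<forall>x \<in> carrier X. \<forall>y \<in> carrier X. f (x \<oplus>\<^bsub>X\<^esub> y) = f x \<oplus>\<^bsub>Y\<^esub> f y) \<and>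
     (\<forall>a \<in> carrier R. \<forall>x \<in> carrier X. f (a \<odot>\<^bsub>X\<^esub> x) = a \<odot>\<^bsub>Y\<^esub> f x)}"

definition lin_iso ::
  "('r, 's) ring_scheme \<Rightarrow> ('r, 'x, 'z) module_scheme \<Rightarrow> ('r, 'y, 'w) module_scheme \<Rightarrow> ('x \<Rightarrow> 'y) set"
where
  "lin_iso R X Y = {f \<in> lin_hom R X Y. bij_betw f (carrier X) (carrier Y)}"

definition dsum :: "('r, 'x, 'z) module_scheme \<Rightarrow> ('r, 'y, 'w) module_scheme \<Rightarrow> ('r, 'x \<times> 'y) module" where
  "dsum X Y = \<lparr>carrier = carrier X \<times> carrier Y, mult = undefined, one = undefined,
     ring.zero = (\<zero>\<^bsub>X\<^esub>, \<zero>\<^bsub>Y\<^esub>), add = (\<lambda>(x, y) (x', y'). (x \<oplus>\<^bsub>X\<^esub> x', y \<oplus>\<^bsub>Y\<^esub> y')),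
     smult = (\<lambda>a (x, y). (a \<odot>\<^bsub>X\<^esub> x, a \<odot>\<^bsub>Y\<^esub> y))\<rparr>"

section \<open>Finite-dimensional algebras and bimodules\<close>

text \<open>An algebra over \<open>K\<close> is a \<open>('k, 'l) module\<close> record in which \<open>smult\<close> is the
  scalar multiplication by \<open>K\<close>. The zero algebra is not excluded.\<close>

locale fd_algebra = K?: field K + Module.module K L + L?: ring L for K (structure) and L (structure) +
  assumes smult_mult_left:
      "\<lbrakk>c \<in> carrier K; x \<in> carrier L; y \<in> carrier L\<rbrakk> \<Longrightarrow>
        c \<odot>\<^bsub>L\<^esub> (x \<otimes>\<^bsub>L\<^esub> y) = (c \<odot>\<^bsub>L\<^esub> x) \<otimes>\<^bsub>L\<^esub> y"
    and smult_mult_right: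
      "\<lbrakk>c \<in> carrier K; x \<in> carrier L; y \<in> carrier L\<rbrakk> \<Longrightarrow>
        c \<odot>\<^bsub>L\<^esub> (x \<otimes>\<^bsub>L\<^esub> y) = x \<otimes>\<^bsub>L\<^esub> (c \<odot>\<^bsub>L\<^esub> y)"
    and finite_dimensional: "fin_gen K L"

definition opp :: "('k, 'l) module \<Rightarrow> ('k, 'l) module" where
  "opp L = L\<lparr>mult := (\<lambda>x y. y \<otimes>\<^bsub>L\<^esub> x)\<rparr>"

definition regular :: "('k, 'l) module \<Rightarrow> ('l, 'l) module" where
  "regular L = \<lparr>carrier = carrier L, mult = undefined, one = undefined,
     ring.zero = \<zero>\<^bsub>L\<^esub>, add = add L, smult = mult L\<rparr>"

record ('l, 'r, 'm) bimod = "('l, 'm) module" +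
  rsmult :: "'m \<Rightarrow> 'r \<Rightarrow> 'm"  (infixl \<open>\<triangleleft>\<index>\<close> 70)

text \<open>Right \<open>S\<close>-modules are left modules over \<open>opp S\<close>.\<close>

definition right_part :: "('l, 'r, 'm) bimod \<Rightarrow> ('r, 'm) module" where
  "right_part M = \<lparr>carrier = carrier M, mult = undefined, one = undefined,
     ring.zero = \<zero>\<^bsub>M\<^esub>, add = add M, smult = (\<lambda>r m. m \<triangleleft>\<^bsub>M\<^esub> r)\<rparr>"

definition bimodule ::
  "('k, 'c) ring_scheme \<Rightarrow> ('k, 'l) module \<Rightarrow> ('k, 'r) module \<Rightarrow> ('l, 'r, 'm) bimod \<Rightarrow> bool"
where
  "bimodule K L S M \<longleftrightarrow> left_module L M \<and> left_module (opp S) (right_part M) \<and>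
     (\<forall>a \<in> carrier L. \<forall>s \<in> carrier S. \<forall>m \<in> carrier M.
        (a \<odot>\<^bsub>M\<^esub> m) \<triangleleft>\<^bsub>M\<^esub> s = a \<odot>\<^bsub>M\<^esub> (m \<triangleleft>\<^bsub>M\<^esub> s)) \<and>
     (\<forall>c \<in> carrier K. \<forall>m \<in> carrier M.
        (c \<odot>\<^bsub>L\<^esub> \<one>\<^bsub>L\<^esub>) \<odot>\<^bsub>M\<^esub> m = m \<triangleleft>\<^bsub>M\<^esub> (c \<odot>\<^bsub>S\<^esub> \<one>\<^bsub>S\<^esub>))"

definition regular_bimod :: "('k, 'l) module \<Rightarrow> ('l, 'l, 'l) bimod" where
  "regular_bimod L = \<lparr>carrier = carrier L, mult = undefined, one = undefined,
     ring.zero = \<zero>\<^bsub>L\<^esub>, add = add L, smult = mult L, rsmult = mult L\<rparr>"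

section \<open>Tensor products\<close>

text \<open>\<open>M \<otimes>\<^sub>R Y\<close> is the free abelian group on \<open>M \<times> Y\<close> modulo the usual relations;
  its elements are cosets.\<close>

definition tens_free ::
  "('l, 'r, 'm) bimod \<Rightarrow> ('r, 'y, 'z) module_scheme \<Rightarrow> ('m \<times> 'y \<Rightarrow>\<^sub>0 int) monoid" where
  "tens_free M Y = free_Abelian_group (carrier M \<times> carrier Y)"

definition tens_rel ::
  "('r, 's) ring_scheme \<Rightarrow> ('l, 'r, 'm) bimod \<Rightarrow> ('r, 'y, 'z) module_scheme \<Rightarrow> ('m \<times> 'y \<Rightarrow>\<^sub>0 int) set"
where
  "tens_rel R M Y = generate (tens_free M Y)
    ({frag_of (m \<oplus>\<^bsub>M\<^esub> m', y) - frag_of (m, y) - frag_of (m', y) | m m' y.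
        m \<in> carrier M \<and> m' \<in> carrier M \<and> y \<in> carrier Y} \<union>
     {frag_of (m, y \<oplus>\<^bsub>Y\<^esub> y') - frag_of (m, y) - frag_of (m, y') | m y y'.
        m \<in> carrier M \<and> y \<in> carrier Y \<and> y' \<in> carrier Y} \<union>
     {frag_of (m \<triangleleft>\<^bsub>M\<^esub> r, y) - frag_of (m, r \<odot>\<^bsub>Y\<^esub> y) | m r y.
        m \<in> carrier M \<and> r \<in> carrier R \<and> y \<in> carrier Y})"

definition tens_group ::
  "('r, 's) ring_scheme \<Rightarrow> ('l, 'r, 'm) bimod \<Rightarrow> ('r, 'y, 'z) module_scheme \<Rightarrow>
    ('m \<times> 'y \<Rightarrow>\<^sub>0 int) set ring"
where
  "tens_group R M Y =
     (let Q = tens_free M Y Mod tens_rel R M Y in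
      \<lparr>carrier = carrier Q, mult = undefined, one = undefined, ring.zero = one Q, add = mult Q\<rparr>)"

definition tens ::
  "('r, 's) ring_scheme \<Rightarrow> ('l, 'r, 'm) bimod \<Rightarrow> ('r, 'y, 'z) module_scheme \<Rightarrow> 'm \<Rightarrow> 'y \<Rightarrow>
    ('m \<times> 'y \<Rightarrow>\<^sub>0 int) set"
where
  "tens R M Y m y = tens_rel R M Y #>\<^bsub>tens_free M Y\<^esub> frag_of (m, y)"

text \<open>The additive map out of a tensor product induced by a balanced map \<open>g\<close> into \<open>G\<close>;
  for balanced \<open>g\<close> it does not depend on the representative chosen.\<close>

definition tens_lift :: "('g, 'z) ring_scheme \<Rightarrow> ('m \<Rightarrow> 'y \<Rightarrow> 'g) \<Rightarrow> ('m \<times> 'y \<Rightarrow>\<^sub>0 int) set \<Rightarrow> 'g" where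
  "tens_lift G g T = (let t = (SOME t. t \<in> T) in
     \<Oplus>\<^bsub>G\<^esub>p \<in> Poly_Mapping.keys t. [Poly_Mapping.lookup t p] \<cdot>\<^bsub>G\<^esub> g (fst p) (snd p))"

definition tensor ::
  "('r, 's) ring_scheme \<Rightarrow> ('l, 'r, 'm) bimod \<Rightarrow> ('r, 'y, 'z) module_scheme \<Rightarrow>
    ('l, ('m \<times> 'y \<Rightarrow>\<^sub>0 int) set) module"
where
  "tensor R M Y = \<lparr>carrier = carrier (tens_group R M Y), mult = undefined, one = undefined,
     ring.zero = \<zero>\<^bsub>tens_group R M Y\<^esub>, add = add (tens_group R M Y),
     smult = (\<lambda>a. tens_lift (tens_group R M Y) (\<lambda>m y. tens R M Y (a \<odot>\<^bsub>M\<^esub> m) y))\<rparr>"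

definition bitensor ::
  "('r, 's) ring_scheme \<Rightarrow> ('l, 'r, 'm) bimod \<Rightarrow> ('r, 'q, 'n) bimod \<Rightarrow>
    ('l, 'q, ('m \<times> 'n \<Rightarrow>\<^sub>0 int) set) bimod"
where
  "bitensor R M N = \<lparr>carrier = carrier (tensor R M N), mult = undefined, one = undefined,
     ring.zero = \<zero>\<^bsub>tensor R M N\<^esub>, add = add (tensor R M N), smult = smult (tensor R M N),
     rsmult = (\<lambda>T q. tens_lift (tens_group R M N) (\<lambda>m n. tens R M N m (n \<triangleleft>\<^bsub>N\<^esub> q)) T)\<rparr>"

text \<open>\<open>M \<otimes>\<^sub>R f\<close> for a map \<open>f\<close> with codomain \<open>Y\<close>.\<close>

definition tensor_map ::
  "('r, 's) ring_scheme \<Rightarrow> ('l, 'r, 'm) bimod \<Rightarrow> ('r, 'y, 'z) module_scheme \<Rightarrow> ('x \<Rightarrow> 'y) \<Rightarrow>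
    ('m \<times> 'x \<Rightarrow>\<^sub>0 int) set \<Rightarrow> ('m \<times> 'y \<Rightarrow>\<^sub>0 int) set"
where
  "tensor_map R M Y f = tens_lift (tens_group R M Y) (\<lambda>m x. tens R M Y m (f x))"

section \<open>The enveloping algebra\<close>

definition right_scalar_bimod :: "('k, 'l) module \<Rightarrow> ('l, 'k, 'l) bimod" where
  "right_scalar_bimod L = \<lparr>carrier = carrier L, mult = undefined, one = undefined,
     ring.zero = \<zero>\<^bsub>L\<^esub>, add = add L, smult = mult L, rsmult = (\<lambda>x c. c \<odot>\<^bsub>L\<^esub> x)\<rparr>"

text \<open>\<open>L \<otimes>\<^sub>K L\<^sup>o\<^sup>p\<close>, with \<open>(a \<otimes> b)(a' \<otimes> b') = aa' \<otimes> b'b\<close>, the product on the right being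
  that of \<open>L\<close>.\<close>

definition envel ::
  "('k, 'c) ring_scheme \<Rightarrow> ('k, 'l) module \<Rightarrow> ('k, ('l \<times> 'l \<Rightarrow>\<^sub>0 int) set) module"
where
  "envel K L =
     (let P = right_scalar_bimod L; Q = opp L; G = tens_group K P Q; t = tens K P Q in
      \<lparr>carrier = carrier G,
       mult = (\<lambda>T U. tens_lift G (\<lambda>a b.
                 tens_lift G (\<lambda>a' b'. t (a \<otimes>\<^bsub>L\<^esub> a') (b \<otimes>\<^bsub>Q\<^esub> b')) U) T),
       one = t \<one>\<^bsub>L\<^esub> \<one>\<^bsub>Q\<^esub>, ring.zero = \<zero>\<^bsub>G\<^esub>, add = add G,
       smult = (\<lambda>c. tens_lift G (\<lambda>a b. t (c \<odot>\<^bsub>L\<^esub> a) b))\<rparr>)"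

text \<open>An \<open>L\<close>-\<open>L\<close>-bimodule as a left module over the enveloping algebra:
  \<open>(a \<otimes> b) m = a m b\<close>.\<close>

definition envel_module :: "('l, 'l, 'm) bimod \<Rightarrow> (('l \<times> 'l \<Rightarrow>\<^sub>0 int) set, 'm) module" where
  "envel_module M = \<lparr>carrier = carrier M, mult = undefined, one = undefined,
     ring.zero = \<zero>\<^bsub>M\<^esub>, add = add M,
     smult = (\<lambda>T m. tens_lift M (\<lambda>a b. (a \<odot>\<^bsub>M\<^esub> m) \<triangleleft>\<^bsub>M\<^esub> b) T)\<rparr>"

section \<open>Projectivity, injectivity, syzygies\<close>

text \<open>HOL cannot quantify over types inside a formula, so notions that quantify over all
  modules over a finite-dimensional \<open>K\<close>-algebra quantify over those whose carrier lies in the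
  fixed type \<open>nat \<Rightarrow> 'k\<close>. Every finite-dimensional \<open>K\<close>-space is in bijection with a subset of
  this type, so every finitely generated module has an isomorphic copy there. Hence these
  notions have their usual meaning for finitely generated modules; for injectivity this is
  Baer's criterion, as all left ideals have copies in this type, and it applies to arbitrary
  modules.\<close>

type_synonym 'k univ = "nat \<Rightarrow> 'k"

definition projective :: "('k, 'r) module \<Rightarrow> ('r, 'p, 'z) module_scheme \<Rightarrow> bool" where
  "projective R P \<longleftrightarrow> left_module R P \<and>
     (\<forall>(X :: ('r, 'k univ) module) (Y :: ('r, 'k univ) module) p f.
        left_module R X \<and> left_module R Y \<and> p \<in> lin_hom R X Y \<and>
        p ` carrier X = carrier Y \<and> f \<in> lin_hom R P Y \<longrightarrow>
        (\<exists>h \<in> lin_hom R P X. \<forall>x \<in> carrier P. p (h x) = f x))"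

definition injective :: "('k, 'r) module \<Rightarrow> ('r, 'i, 'z) module_scheme \<Rightarrow> bool" where
  "injective R I \<longleftrightarrow> left_module R I \<and>
     (\<forall>(X :: ('r, 'k univ) module) (Y :: ('r, 'k univ) module) j f.
        left_module R X \<and> left_module R Y \<and> j \<in> lin_hom R X Y \<and>
        inj_on j (carrier X) \<and> f \<in> lin_hom R X I \<longrightarrow>
        (\<exists>h \<in> lin_hom R Y I. \<forall>x \<in> carrier X. h (j x) = f x))"

text \<open>An injective resolution \<open>0 \<rightarrow> X \<rightarrow> I 0 \<rightarrow> \<dots> \<rightarrow> I n \<rightarrow> 0\<close>.\<close>

definition injective_resolution ::
  "('k, 'r) module \<Rightarrow> ('r, 'x, 'z) module_scheme \<Rightarrow> nat \<Rightarrow> (nat \<Rightarrow> ('r, 'i) module) \<Rightarrow>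
    ('x \<Rightarrow> 'i) \<Rightarrow> (nat \<Rightarrow> 'i \<Rightarrow> 'i) \<Rightarrow> bool"
where
  "injective_resolution R X n I e d \<longleftrightarrow>
     (\<forall>i \<le> n. injective R (I i)) \<and>
     e \<in> lin_hom R X (I 0) \<and> inj_on e (carrier X) \<and>
     (\<forall>i < n. d i \<in> lin_hom R (I i) (I (Suc i))) \<and>
     (\<forall>i \<le> n. (case i of 0 \<Rightarrow> e ` carrier X | Suc j \<Rightarrow> d j ` carrier (I j)) =
               (if i = n then carrier (I n) else a_kernel (I i) (I (Suc i)) (d i)))"

definition inj_dim :: "('k, 'r) module \<Rightarrow> ('r, 'x, 'z) module_scheme \<Rightarrow> enat" where
  "inj_dim R X = Inf {enat n | n.
     \<exists>(I :: nat \<Rightarrow> ('r, 'k univ) module) e d. injective_resolution R X n I e d}"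

definition gorenstein :: "('k, 'l) module \<Rightarrow> bool" where
  "gorenstein L \<longleftrightarrow> inj_dim L (regular L) < \<infinity> \<and> inj_dim (opp L) (regular (opp L)) < \<infinity>"

text \<open>Syzygies are kernels of epimorphisms from finitely generated projectives. The projective
  covers of a minimal resolution are one choice; all choices agree in the stable category.\<close>

inductive syzygy ::
  "('k, 'r) module \<Rightarrow> ('r, 'x) module \<Rightarrow> nat \<Rightarrow> ('r, 'k univ) module \<Rightarrow> bool"
  for R X
where
  syzygy_0: "\<lbrakk>left_module R Z; f \<in> lin_iso R X Z\<rbrakk> \<Longrightarrow> syzygy R X 0 Z"
| syzygy_Suc: "\<lbrakk>syzygy R X l Y; fg_module R P; projective R P;
     p \<in> lin_hom R P Y; p ` carrier P = carrier Y\<rbrakk> \<Longrightarrow>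
     syzygy R X (Suc l) (P\<lparr>carrier := a_kernel P Y p\<rparr>)"

definition factors_projective ::
  "('k, 'r) module \<Rightarrow> ('r, 'x, 'z) module_scheme \<Rightarrow> ('r, 'y, 'w) module_scheme \<Rightarrow> ('x \<Rightarrow> 'y) \<Rightarrow> bool"
where
  "factors_projective R X Y h \<longleftrightarrow>
     (\<exists>(P :: ('r, 'k univ) module) a b. fg_module R P \<and> projective R P \<and>
        a \<in> lin_hom R X P \<and> b \<in> lin_hom R P Y \<and> (\<forall>x \<in> carrier X. h x = b (a x)))"

text \<open>Isomorphism in the category of finitely generated modules modulo projectives.\<close>

definition stably_iso ::
  "('k, 'r) module \<Rightarrow> ('r, 'x, 'z) module_scheme \<Rightarrow> ('r, 'y, 'w) module_scheme \<Rightarrow> bool"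
where
  "stably_iso R X Y \<longleftrightarrow> fg_module R X \<and> fg_module R Y \<and>
     (\<exists>f \<in> lin_hom R X Y. \<exists>g \<in> lin_hom R Y X.
        factors_projective R X X (\<lambda>x. g (f x) \<ominus>\<^bsub>X\<^esub> x) \<and>
        factors_projective R Y Y (\<lambda>y. f (g y) \<ominus>\<^bsub>Y\<^esub> y))"

section \<open>Singular equivalences of Morita type with level\<close>

definition fg_projective :: "('k, 'r) module \<Rightarrow> ('r, 'p, 'z) module_scheme \<Rightarrow> bool" where
  "fg_projective R P \<longleftrightarrow> fin_gen R P \<and> projective R P"

definition singular_equivalence_level ::
  "('k, 'c) ring_scheme \<Rightarrow> ('k, 'l) module \<Rightarrow> ('k, 's) module \<Rightarrow>
    ('l, 's, 'm) bimod \<Rightarrow> ('s, 'l, 'n) bimod \<Rightarrow> nat \<Rightarrow> bool"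
where
  "singular_equivalence_level K L S M N l \<longleftrightarrow>
     bimodule K L S M \<and> bimodule K S L N \<and>
     fg_projective L M \<and> fg_projective (opp S) (right_part M) \<and>
     fg_projective S N \<and> fg_projective (opp L) (right_part N) \<and>
     (\<exists>Z. syzygy (envel K L) (envel_module (regular_bimod L)) l Z \<and>
          stably_iso (envel K L) (envel_module (bitensor S M N)) Z) \<and>
     (\<exists>Z. syzygy (envel K S) (envel_module (regular_bimod S)) l Z \<and>
          stably_iso (envel K S) (envel_module (bitensor L N M)) Z)"

definition singular_equivalence ::
  "('k, 'c) ring_scheme \<Rightarrow> ('k, 'l) module \<Rightarrow> ('k, 's) module \<Rightarrow>
    ('l, 's, 'm) bimod \<Rightarrow> ('s, 'l, 'n) bimod \<Rightarrow> bool"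
where
  "singular_equivalence K L S M N \<longleftrightarrow> (\<exists>l. singular_equivalence_level K L S M N l)"

section \<open>Yoneda Ext\<close>

text \<open>An \<open>n\<close>-extension (\<open>n \<ge> 1\<close>)
  \<open>0 \<rightarrow> B \<rightarrow> obj (n-1) \<rightarrow> \<dots> \<rightarrow> obj 0 \<rightarrow> A \<rightarrow> 0\<close>
  has maps \<open>inc : B \<rightarrow> obj (n-1)\<close>, \<open>dif i : obj (i+1) \<rightarrow> obj i\<close> and \<open>prj : obj 0 \<rightarrow> A\<close>;
  \<open>obj i\<close> is irrelevant for \<open>i \<ge> n\<close>, and \<open>dif i\<close> for \<open>i + 1 \<ge> n\<close>.\<close>

record ('r, 'u, 'a, 'b) extension =
  obj :: "nat \<Rightarrow> ('r, 'u) module"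
  dif :: "nat \<Rightarrow> 'u \<Rightarrow> 'u"
  inc :: "'b \<Rightarrow> 'u"
  prj :: "'u \<Rightarrow> 'a"

definition is_extension ::
  "('k, 'r) module \<Rightarrow> nat \<Rightarrow> ('r, 'a) module \<Rightarrow> ('r, 'b) module \<Rightarrow> ('r, 'u, 'a, 'b) extension \<Rightarrow> bool"
where
  "is_extension R n A B E \<longleftrightarrow> 0 < n \<and>
     (\<forall>i < n. fg_module R (obj E i)) \<and>
     inc E \<in> lin_hom R B (obj E (n - 1)) \<and> inj_on (inc E) (carrier B) \<and>
     (\<forall>i. Suc i < n \<longrightarrow> dif E i \<in> lin_hom R (obj E (Suc i)) (obj E i)) \<and>
     prj E \<in> lin_hom R (obj E 0) A \<and> prj E ` carrier (obj E 0) = carrier A \<and>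
     (\<forall>i < n. (if i = n - 1 then inc E ` carrier B else dif E i ` carrier (obj E (Suc i))) =
               (case i of 0 \<Rightarrow> a_kernel (obj E 0) A (prj E)
                | Suc j \<Rightarrow> a_kernel (obj E i) (obj E j) (dif E j)))"

text \<open>\<open>g\<close> is a morphism from the extension \<open>E\<close> (of \<open>A\<close> by \<open>B\<close>) to \<open>E'\<close> inducing \<open>\<beta>\<close> on the
  left ends and \<open>\<alpha>\<close> on the right ends.\<close>

definition ext_hom ::
  "('k, 'r) module \<Rightarrow> nat \<Rightarrow> ('r, 'b) module \<Rightarrow> ('b \<Rightarrow> 'b') \<Rightarrow> ('a \<Rightarrow> 'a') \<Rightarrow>
    ('r, 'u, 'a, 'b) extension \<Rightarrow> ('r, 'v, 'a', 'b') extension \<Rightarrow> (nat \<Rightarrow> 'u \<Rightarrow> 'v) \<Rightarrow> bool"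
where
  "ext_hom R n B \<beta> \<alpha> E E' g \<longleftrightarrow>
     (\<forall>i < n. g i \<in> lin_hom R (obj E i) (obj E' i)) \<and>
     (\<forall>b \<in> carrier B. g (n - 1) (inc E b) = inc E' (\<beta> b)) \<and>
     (\<forall>i. Suc i < n \<longrightarrow> (\<forall>x \<in> carrier (obj E (Suc i)). g i (dif E i x) = dif E' i (g (Suc i) x))) \<and>
     (\<forall>x \<in> carrier (obj E 0). \<alpha> (prj E x) = prj E' (g 0 x))"

abbreviation bij_at ::
  "('r, 'u, 'a, 'b) extension \<Rightarrow> ('r, 'v, 'a', 'b') extension \<Rightarrow> (nat \<Rightarrow> 'u \<Rightarrow> 'v) \<Rightarrow> nat \<Rightarrow> bool"
where
  "bij_at E E' g i \<equiv> bij_betw (g i) (carrier (obj E i)) (carrier (obj E' i))"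

definition ext_iso ::
  "('k, 'r) module \<Rightarrow> nat \<Rightarrow> ('r, 'b) module \<Rightarrow>
    ('r, 'u, 'a, 'b) extension \<Rightarrow> ('r, 'v, 'a, 'b) extension \<Rightarrow> bool"
where
  "ext_iso R n B E E' \<longleftrightarrow> (\<exists>g. ext_hom R n B id id E E' g \<and> (\<forall>i < n. bij_at E E' g i))"

text \<open>\<open>F\<close> is (isomorphic to) the pullback of \<open>E\<close> along \<open>\<alpha>\<close>: for exact rows, if the morphism is
  bijective on every \<open>obj i\<close> with \<open>i > 0\<close> and the identity on the left ends, then its square
  \<open>obj 0 \<rightarrow> A\<close> is cartesian. Dually for the pushout and the square \<open>B \<rightarrow> obj (n-1)\<close>.\<close>

definition is_pullback ::
  "('k, 'r) module \<Rightarrow> nat \<Rightarrow> ('r, 'b) module \<Rightarrow> ('a \<Rightarrow> 'a') \<Rightarrow>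
    ('r, 'u, 'a, 'b) extension \<Rightarrow> ('r, 'v, 'a', 'b) extension \<Rightarrow> bool"
where
  "is_pullback R n B \<alpha> F E \<longleftrightarrow>
     (\<exists>g. ext_hom R n B id \<alpha> F E g \<and> (\<forall>i < n. 0 < i \<longrightarrow> bij_at F E g i))"

definition is_pushout ::
  "('k, 'r) module \<Rightarrow> nat \<Rightarrow> ('r, 'b) module \<Rightarrow> ('b \<Rightarrow> 'b') \<Rightarrow>
    ('r, 'u, 'a, 'b) extension \<Rightarrow> ('r, 'v, 'a, 'b') extension \<Rightarrow> bool"
where
  "is_pushout R n B \<beta> E F \<longleftrightarrow>
     (\<exists>g. ext_hom R n B \<beta> id E F g \<and> (\<forall>i < n - 1. bij_at E F g i))"

definition ext_dsum ::
  "('r, 'u, 'a, 'b) extension \<Rightarrow> ('r, 'v, 'a', 'b') extension \<Rightarrow>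
    ('r, 'u \<times> 'v, 'a \<times> 'a', 'b \<times> 'b') extension"
where
  "ext_dsum E E' = \<lparr>obj = (\<lambda>i. dsum (obj E i) (obj E' i)),
     dif = (\<lambda>i. map_prod (dif E i) (dif E' i)),
     inc = map_prod (inc E) (inc E'), prj = map_prod (prj E) (prj E')\<rparr>"

text \<open>The middle terms of representatives of Ext classes are taken in the type \<open>'k univ\<close>, which
  contains a copy of every finitely generated module.\<close>

definition exts ::
  "('k, 'r) module \<Rightarrow> nat \<Rightarrow> ('r, 'a) module \<Rightarrow> ('r, 'b) module \<Rightarrow>
    ('r, 'k univ, 'a, 'b) extension set"
where
  "exts R n A B = {E. is_extension R n A B E}"

text \<open>Yoneda equivalence: generated by morphisms that are the identity at both ends.\<close>

definition ext_equiv ::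
  "('k, 'r) module \<Rightarrow> nat \<Rightarrow> ('r, 'a) module \<Rightarrow> ('r, 'b) module \<Rightarrow>
    ('r, 'k univ, 'a, 'b) extension rel"
where
  "ext_equiv R n A B =
     {(E, E'). E \<in> exts R n A B \<and> E' \<in> exts R n A B \<and>
        equivclp (\<lambda>F F'. F \<in> exts R n A B \<and> F' \<in> exts R n A B \<and>
                   (\<exists>g. ext_hom R n B id id F F' g)) E E'}"

definition ext_scale ::
  "('k, 'r) module \<Rightarrow> nat \<Rightarrow> ('r, 'a) module \<Rightarrow> ('r, 'b) module \<Rightarrow> 'k \<Rightarrow>
    ('r, 'k univ, 'a, 'b) extension set \<Rightarrow> ('r, 'k univ, 'a, 'b) extension set"
where
  "ext_scale R n A B c C = ext_equiv R n A B ``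
     {F. \<exists>E \<in> C. is_pushout R n B (\<lambda>b. (c \<odot>\<^bsub>R\<^esub> \<one>\<^bsub>R\<^esub>) \<odot>\<^bsub>B\<^esub> b) E F}"

text \<open>The Baer sum of \<open>E\<close> and \<open>E'\<close>: pull \<open>E \<oplus> E'\<close> back along the diagonal of \<open>A\<close> and push the
  result out along the codiagonal of \<open>B\<close>.\<close>

definition baer_sum ::
  "('k, 'r) module \<Rightarrow> nat \<Rightarrow> ('r, 'a) module \<Rightarrow> ('r, 'b) module \<Rightarrow>
    ('r, 'k univ, 'a, 'b) extension set \<Rightarrow> ('r, 'k univ, 'a, 'b) extension set \<Rightarrow>
    ('r, 'k univ, 'a, 'b) extension set"
where
  "baer_sum R n A B C C' = ext_equiv R n A B ``
     {G. \<exists>E \<in> C. \<exists>E' \<in> C'. \<exists>F \<in> exts R n A (dsum B B).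
           is_pullback R n (dsum B B) (\<lambda>a. (a, a)) F (ext_dsum E E') \<and>
           is_pushout R n (dsum B B) (\<lambda>(b, b'). b \<oplus>\<^bsub>B\<^esub> b') F G}"

text \<open>\<open>Ext\<^sup>n(A, B)\<close> for \<open>n \<ge> 1\<close> as a \<open>K\<close>-vector space; the zero class is the pushout of any
  extension along the zero map.\<close>

definition Ext ::
  "('k, 'c) ring_scheme \<Rightarrow> ('k, 'r) module \<Rightarrow> nat \<Rightarrow> ('r, 'a) module \<Rightarrow> ('r, 'b) module \<Rightarrow>
    ('k, ('r, 'k univ, 'a, 'b) extension set) module"
where
  "Ext K R n A B = \<lparr>carrier = exts R n A B // ext_equiv R n A B,
     mult = undefined, one = undefined,
     ring.zero = ext_scale R n A B \<zero>\<^bsub>K\<^esub> (exts R n A B),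
     add = baer_sum R n A B, smult = ext_scale R n A B\<rparr>"

definition tensor_extension ::
  "('k, 'r) module \<Rightarrow> ('s, 'r, 'n) bimod \<Rightarrow> nat \<Rightarrow> ('r, 'a) module \<Rightarrow> ('r, 'u, 'a, 'b) extension \<Rightarrow>
    ('s, ('n \<times> 'u \<Rightarrow>\<^sub>0 int) set, ('n \<times> 'a \<Rightarrow>\<^sub>0 int) set, ('n \<times> 'b \<Rightarrow>\<^sub>0 int) set) extension"
where
  "tensor_extension R N n A E = \<lparr>obj = (\<lambda>i. tensor R N (obj E i)),
     dif = (\<lambda>i. tensor_map R N (obj E i) (dif E i)),
     inc = tensor_map R N (obj E (n - 1)) (inc E),
     prj = tensor_map R N A (prj E)\<rparr>"

text \<open>The map \<open>N \<otimes>\<^sub>R - : Ext\<^sup>n\<^sub>R(A, B) \<rightarrow> Ext\<^sup>n\<^sub>S(N \<otimes>\<^sub>R A, N \<otimes>\<^sub>R B)\<close> for an \<open>S\<close>-\<open>R\<close>-bimodule \<open>N\<close>: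
  apply the functor to a representative, and take the class of an isomorphic copy with middle
  terms in \<open>'k univ\<close>.\<close>

definition Ext_tensor ::
  "('k, 'r) module \<Rightarrow> ('k, 's) module \<Rightarrow> ('s, 'r, 'n) bimod \<Rightarrow> nat \<Rightarrow>
    ('r, 'a) module \<Rightarrow> ('r, 'b) module \<Rightarrow> ('r, 'k univ, 'a, 'b) extension set \<Rightarrow>
    ('s, 'k univ, ('n \<times> 'a \<Rightarrow>\<^sub>0 int) set, ('n \<times> 'b \<Rightarrow>\<^sub>0 int) set) extension set"
where
  "Ext_tensor R S N n A B C = ext_equiv S n (tensor R N A) (tensor R N B) ``
     {G \<in> exts S n (tensor R N A) (tensor R N B).
        \<exists>E \<in> C. ext_iso S n (tensor R N B) (tensor_extension R N n A E) G}"

end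

theory Submission imports Defs begin

text \<open>Let \<open>Z\<close> be an \<open>n\<close>-th syzygy of \<open>A\<close>. A class in \<open>Ext\<^sup>n(A, B)\<close> is the pushout of a projective
  resolution along some \<open>\<phi> : Z \<rightarrow> B\<close>, and it vanishes iff \<open>\<phi>\<close> extends along \<open>Z \<rightarrow> P\<^sub>n\<^sub>-\<^sub>1\<close>. If \<open>n\<close>
  exceeds the injective dimension \<open>d\<close> of the algebra, then \<open>Ext\<^sup>1\<close> of the cokernel of this inclusion
  into the algebra vanishes, so every map from \<open>Z\<close> to a projective extends, and
  \<open>Ext\<^sup>n(A, B)\<close> is \<open>Hom(Z, B)\<close> modulo the maps that factor through projectives. Since \<open>N \<otimes> -\<close> is exact
  and preserves projectives, on Ext it becomes the map \<open>\<phi> \<mapsto> N \<otimes> \<phi>\<close> of stable Hom groups.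

  Tensoring with the \<open>l\<close>-th bimodule syzygy of the algebra shifts dimensions \<open>l\<close> times and is
  therefore bijective on stable maps out of a syzygy of order at least \<open>d\<close>; hence so are \<open>M \<otimes> N \<otimes> -\<close> and
  \<open>N \<otimes> M \<otimes> -\<close>, and both factors are bijective by two out of six.\<close>

section \<open>Modules and additive maps\<close>

text \<open>The shift works because a bimodule syzygy of the algebra stays projective as a right
  module: its defining sequence 0 -> \<Omega> -> P -> Y -> 0 splits on the right, so it remains
  exact after tensoring with a module \<open>A\<close>, and P \<otimes> A is projective because the
  enveloping algebra tensored with \<open>A\<close> is. Passing to kernels is bijective on stable
  maps when functionals extend along the kernel. This must hold at every stage of the shift, and it
  does because the orders of the syzygies only grow. Tensoring with \<open>N\<close> keeps the order
  of a syzygy, so the bound of the one algebra is used on \<open>Z\<close> and that of the other on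
  N \<otimes> Z; this is why d is a maximum.

  The obstacle in HOL is that carriers change their type with every tensor product, while
  \<open>projective\<close> and \<open>exts\<close> speak of one fixed type. Hence stable vanishing
  is expressed by maps of finite rank, syzygies are taken up to isomorphism with copies in the fixed
  type, and Baer sums and pushouts are never compared directly but only through the cocycles that
  they represent.\<close>

context abelian_group begin

lemma diff_self [simp]: "x \<in> carrier G \<Longrightarrow> x \<ominus> x = \<zero>"
  by (simp add: a_minus_def r_neg)

lemma diff_eq_zero_iff: "\<lbrakk>x \<in> carrier G; y \<in> carrier G\<rbrakk> \<Longrightarrow> x \<ominus> y = \<zero> \<longleftrightarrow> x = y"
  by (metis a_minus_def add.inv_closed add.inv_solve_right' add.one_closed add.l_one)

lemma diff_add_cancel: "\<lbrakk>x \<in> carrier G; y \<in> carrier G\<rbrakk> \<Longrightarrow> (x \<ominus> y) \<oplus> y = x"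
  by (simp add: a_minus_def a_assoc l_neg)

lemma add_diff_cancel: "\<lbrakk>x \<in> carrier G; y \<in> carrier G\<rbrakk> \<Longrightarrow> (x \<oplus> y) \<ominus> y = x"
  by (simp add: a_minus_def a_assoc r_neg)

lemma add_diff_cancel': "\<lbrakk>x \<in> carrier G; y \<in> carrier G\<rbrakk> \<Longrightarrow> x \<oplus> (y \<ominus> x) = y"
  by (metis a_comm diff_add_cancel minus_closed)

lemma diff_add_diff: "\<lbrakk>x \<in> carrier G; y \<in> carrier G; z \<in> carrier G\<rbrakk> \<Longrightarrow> (x \<ominus> y) \<oplus> (y \<ominus> z) = x \<ominus> z"
  by (simp add: a_minus_def add.m_assoc[symmetric]) (simp add: a_assoc l_neg)

lemma add_diff_add:
  "\<lbrakk>x \<in> carrier G; y \<in> carrier G; z \<in> carrier G; w \<in> carrier G\<rbrakk> \<Longrightarrow>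
    (x \<oplus> y) \<ominus> (z \<oplus> w) = (x \<ominus> z) \<oplus> (y \<ominus> w)"
  by (simp add: a_minus_def minus_add a_ac)

lemma diff_diff_diff:
  "\<lbrakk>x \<in> carrier G; y \<in> carrier G; z \<in> carrier G; w \<in> carrier G\<rbrakk> \<Longrightarrow>
    (x \<ominus> y) \<ominus> (z \<ominus> w) = (x \<ominus> z) \<ominus> (y \<ominus> w)"
  by (simp add: a_minus_def minus_add a_ac)

lemma neg_diff: "\<lbrakk>x \<in> carrier G; y \<in> carrier G\<rbrakk> \<Longrightarrow> \<ominus> (x \<ominus> y) = y \<ominus> x"
  by (simp add: a_minus_def minus_add a_ac)

lemma diff_zero [simp]: "x \<in> carrier G \<Longrightarrow> x \<ominus> \<zero> = x"
  by (simp add: a_minus_def)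

end

lemma surj_obtain:
  assumes "p ` A = B" "y \<in> B"
  obtains x where "x \<in> A" "p x = y"
  using assms by auto

section \<open>Additive maps between abelian groups\<close>

definition addhom :: "('a, 'p) ring_scheme \<Rightarrow> ('b, 'q) ring_scheme \<Rightarrow> ('a \<Rightarrow> 'b) set" where
  "addhom X Y = {f \<in> carrier X \<rightarrow> carrier Y.
     \<forall>x \<in> carrier X. \<forall>y \<in> carrier X. f (x \<oplus>\<^bsub>X\<^esub> y) = f x \<oplus>\<^bsub>Y\<^esub> f y}"

lemma addhomI:
  "\<lbrakk>\<And>x. x \<in> carrier X \<Longrightarrow> f x \<in> carrier Y;
    \<And>x y. \<lbrakk>x \<in> carrier X; y \<in> carrier X\<rbrakk> \<Longrightarrow> f (x \<oplus>\<^bsub>X\<^esub> y) = f x \<oplus>\<^bsub>Y\<^esub> f y\<rbrakk> \<Longrightarrow> f \<in> addhom X Y"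
  by (auto simp: addhom_def)

lemma addhomD:
  assumes "f \<in> addhom X Y"
  shows addhom_closed: "x \<in> carrier X \<Longrightarrow> f x \<in> carrier Y"
    and addhom_add: "\<lbrakk>x \<in> carrier X; y \<in> carrier X\<rbrakk> \<Longrightarrow> f (x \<oplus>\<^bsub>X\<^esub> y) = f x \<oplus>\<^bsub>Y\<^esub> f y"
  using assms by (auto simp: addhom_def)

lemma addhom_zero:
  fixes X (structure)
  assumes "f \<in> addhom X Y" "abelian_group X" "abelian_group Y"
  shows "f \<zero> = \<zero>\<^bsub>Y\<^esub>"
proof -
  interpret X: abelian_group X by fact
  interpret Y: abelian_group Y by fact
  have c: "f \<zero> \<in> carrier Y" using assms(1) by (simp add: addhom_closed)
  have "f \<zero> \<oplus>\<^bsub>Y\<^esub> f \<zero> = f \<zero>"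
    using addhom_add[OF assms(1), of "\<zero>" "\<zero>"] by simp
  then show ?thesis using c by (metis Y.add.l_cancel_one')
qed

lemma addhom_neg:
  assumes "f \<in> addhom X Y" "abelian_group X" "abelian_group Y" "x \<in> carrier X"
  shows "f (\<ominus>\<^bsub>X\<^esub> x) = \<ominus>\<^bsub>Y\<^esub> f x"
proof -
  interpret X: abelian_group X by fact
  interpret Y: abelian_group Y by fact
  have "f (\<ominus>\<^bsub>X\<^esub> x) \<oplus>\<^bsub>Y\<^esub> f x = \<zero>\<^bsub>Y\<^esub>"
    using addhom_add[OF assms(1), of "\<ominus>\<^bsub>X\<^esub> x" x] addhom_zero[OF assms(1-3)] assms(4)
    by (simp add: X.l_neg)
  then show ?thesis using assms by (metis Y.minus_equality X.a_inv_closed addhom_closed)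
qed

lemma addhom_diff:
  assumes "f \<in> addhom X Y" "abelian_group X" "abelian_group Y" "x \<in> carrier X" "y \<in> carrier X"
  shows "f (x \<ominus>\<^bsub>X\<^esub> y) = f x \<ominus>\<^bsub>Y\<^esub> f y"
  using assms by (simp add: a_minus_def addhom_add addhom_neg abelian_group.a_inv_closed)

lemma addhom_finsum:
  assumes "f \<in> addhom X Y" "abelian_group X" "abelian_group Y" "finite A" "g \<in> A \<rightarrow> carrier X"
  shows "f (finsum X g A) = finsum Y (\<lambda>i. f (g i)) A"
proof -
  interpret X: abelian_group X by fact
  interpret Y: abelian_group Y by fact
  show ?thesis using assms(4,5)
  proof (induction A rule: finite_induct)
    case empty
    then show ?case by (simp add: addhom_zero[OF assms(1-3)])
  next
    case (insert a A)
    have c: "(\<lambda>i. f (g i)) \<in> A \<rightarrow> carrier Y" "f (g a) \<in> carrier Y"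
      using insert assms(1) by (auto simp: addhom_closed Pi_iff)
    with insert show ?case by (simp add: addhom_add[OF assms(1)])
  qed
qed

lemma addhom_comp: "\<lbrakk>f \<in> addhom X Y; g \<in> addhom Y Z\<rbrakk> \<Longrightarrow> (\<lambda>x. g (f x)) \<in> addhom X Z"
  by (auto simp: addhom_def Pi_iff)

lemma addhom_sum:
  assumes "f \<in> addhom X Y" "g \<in> addhom X Y" "abelian_group Y"
  shows "(\<lambda>x. f x \<oplus>\<^bsub>Y\<^esub> g x) \<in> addhom X Y"
proof -
  interpret Y: abelian_group Y by fact
  show ?thesis
    by (rule addhomI) (use assms in \<open>simp_all add: addhomD Y.a_ac\<close>)
qed

lemma addhom_uminus:
  assumes "f \<in> addhom X Y" "abelian_group Y"
  shows "(\<lambda>x. \<ominus>\<^bsub>Y\<^esub> f x) \<in> addhom X Y"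
proof -
  interpret Y: abelian_group Y by fact
  show ?thesis
    by (rule addhomI) (use assms in \<open>simp_all add: addhomD Y.minus_add\<close>)
qed

section \<open>Left modules, linear maps and isomorphisms\<close>

lemma left_module_ring: "left_module R X \<Longrightarrow> ring R"
  and lmod_abelian_group: "left_module R X \<Longrightarrow> abelian_group X"
  by (auto dest: left_module.axioms)

lemma left_moduleI:
  fixes X (structure)
  assumes "ring R" "abelian_group X"
    "\<And>a x. \<lbrakk>a \<in> carrier R; x \<in> carrier X\<rbrakk> \<Longrightarrow> a \<odot> x \<in> carrier X"
    "\<And>a b x. \<lbrakk>a \<in> carrier R; b \<in> carrier R; x \<in> carrier X\<rbrakk> \<Longrightarrow>
        (a \<oplus>\<^bsub>R\<^esub> b) \<odot> x = a \<odot> x \<oplus> b \<odot> x"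
    "\<And>a x y. \<lbrakk>a \<in> carrier R; x \<in> carrier X; y \<in> carrier X\<rbrakk> \<Longrightarrow>
        a \<odot> (x \<oplus> y) = a \<odot> x \<oplus> a \<odot> y"
    "\<And>a b x. \<lbrakk>a \<in> carrier R; b \<in> carrier R; x \<in> carrier X\<rbrakk> \<Longrightarrow>
        (a \<otimes>\<^bsub>R\<^esub> b) \<odot> x = a \<odot> (b \<odot> x)"
    "\<And>x. x \<in> carrier X \<Longrightarrow> \<one>\<^bsub>R\<^esub> \<odot> x = x"
  shows "left_module R X"
  using assms by (intro left_module.intro left_module_axioms.intro) auto

lemma left_moduleD:
  fixes X (structure)
  assumes "left_module R X"
  shows lmod_zero: "\<zero> \<in> carrier X"
    and lmod_add: "\<lbrakk>x \<in> carrier X; y \<in> carrier X\<rbrakk> \<Longrightarrow> x \<oplus> y \<in> carrier X"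
    and lmod_neg: "x \<in> carrier X \<Longrightarrow> \<ominus> x \<in> carrier X"
    and lmod_diff: "\<lbrakk>x \<in> carrier X; y \<in> carrier X\<rbrakk> \<Longrightarrow> x \<ominus> y \<in> carrier X"
    and lmod_smult: "\<lbrakk>a \<in> carrier R; x \<in> carrier X\<rbrakk> \<Longrightarrow> a \<odot> x \<in> carrier X"
    and lmod_l_distr: "\<lbrakk>a \<in> carrier R; b \<in> carrier R; x \<in> carrier X\<rbrakk> \<Longrightarrow>
        (a \<oplus>\<^bsub>R\<^esub> b) \<odot> x = a \<odot> x \<oplus> b \<odot> x"
    and lmod_r_distr: "\<lbrakk>a \<in> carrier R; x \<in> carrier X; y \<in> carrier X\<rbrakk> \<Longrightarrow>
        a \<odot> (x \<oplus> y) = a \<odot> x \<oplus> a \<odot> y"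
    and lmod_assoc: "\<lbrakk>a \<in> carrier R; b \<in> carrier R; x \<in> carrier X\<rbrakk> \<Longrightarrow>
        (a \<otimes>\<^bsub>R\<^esub> b) \<odot> x = a \<odot> (b \<odot> x)"
    and lmod_one: "x \<in> carrier X \<Longrightarrow> \<one>\<^bsub>R\<^esub> \<odot> x = x"
proof -
  interpret left_module R X by fact
  interpret X: abelian_group X by (rule lmod_abelian_group[OF assms])
  show "\<zero> \<in> carrier X"
    "\<lbrakk>x \<in> carrier X; y \<in> carrier X\<rbrakk> \<Longrightarrow> x \<oplus> y \<in> carrier X"
    "x \<in> carrier X \<Longrightarrow> \<ominus> x \<in> carrier X"
    "\<lbrakk>x \<in> carrier X; y \<in> carrier X\<rbrakk> \<Longrightarrow> x \<ominus> y \<in> carrier X"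
    by simp_all
qed (use assms in \<open>simp_all add: left_module.lsmult_closed left_module.lsmult_l_distr
    left_module.lsmult_r_distr left_module.lsmult_assoc left_module.lsmult_one\<close>)

lemma smult_addhom: "\<lbrakk>left_module R X; a \<in> carrier R\<rbrakk> \<Longrightarrow> (\<lambda>x. a \<odot>\<^bsub>X\<^esub> x) \<in> addhom X X"
  by (rule addhomI) (simp_all add: left_moduleD)

lemma smult_addhom_left: "\<lbrakk>left_module R X; x \<in> carrier X\<rbrakk> \<Longrightarrow> (\<lambda>a. a \<odot>\<^bsub>X\<^esub> x) \<in> addhom R X"
  by (rule addhomI) (simp_all add: left_moduleD)

lemma lmod_smult_zero: "\<lbrakk>left_module R X; a \<in> carrier R\<rbrakk> \<Longrightarrow> a \<odot>\<^bsub>X\<^esub> \<zero>\<^bsub>X\<^esub> = \<zero>\<^bsub>X\<^esub>"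
  by (rule addhom_zero[OF smult_addhom]) (assumption | erule lmod_abelian_group)+

lemma lmod_smult_diff: "\<lbrakk>left_module R X; a \<in> carrier R; x \<in> carrier X; y \<in> carrier X\<rbrakk> \<Longrightarrow>
    a \<odot>\<^bsub>X\<^esub> (x \<ominus>\<^bsub>X\<^esub> y) = a \<odot>\<^bsub>X\<^esub> x \<ominus>\<^bsub>X\<^esub> a \<odot>\<^bsub>X\<^esub> y"
  by (rule addhom_diff[OF smult_addhom]) (assumption | erule lmod_abelian_group)+

lemma ring_abelian_group: "ring R \<Longrightarrow> abelian_group R"
  by (rule ringE)

lemma lmod_zero_smult: "\<lbrakk>left_module R X; x \<in> carrier X\<rbrakk> \<Longrightarrow> \<zero>\<^bsub>R\<^esub> \<odot>\<^bsub>X\<^esub> x = \<zero>\<^bsub>X\<^esub>"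
  by (rule addhom_zero[OF smult_addhom_left])
    (assumption | erule lmod_abelian_group ring_abelian_group[OF left_module_ring])+

lemma lmod_neg_smult: "\<lbrakk>left_module R X; a \<in> carrier R; x \<in> carrier X\<rbrakk> \<Longrightarrow>
    (\<ominus>\<^bsub>R\<^esub> a) \<odot>\<^bsub>X\<^esub> x = \<ominus>\<^bsub>X\<^esub> (a \<odot>\<^bsub>X\<^esub> x)"
  by (rule addhom_neg[OF smult_addhom_left])
    (assumption | erule lmod_abelian_group ring_abelian_group[OF left_module_ring])+

lemma lin_hom_iff:
  "f \<in> lin_hom R X Y \<longleftrightarrow> f \<in> addhom X Y \<and>
     (\<forall>a \<in> carrier R. \<forall>x \<in> carrier X. f (a \<odot>\<^bsub>X\<^esub> x) = a \<odot>\<^bsub>Y\<^esub> f x)"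
  by (auto simp: lin_hom_def addhom_def)

lemma lin_homI:
  "\<lbrakk>\<And>x. x \<in> carrier X \<Longrightarrow> f x \<in> carrier Y;
    \<And>x y. \<lbrakk>x \<in> carrier X; y \<in> carrier X\<rbrakk> \<Longrightarrow> f (x \<oplus>\<^bsub>X\<^esub> y) = f x \<oplus>\<^bsub>Y\<^esub> f y;
    \<And>a x. \<lbrakk>a \<in> carrier R; x \<in> carrier X\<rbrakk> \<Longrightarrow> f (a \<odot>\<^bsub>X\<^esub> x) = a \<odot>\<^bsub>Y\<^esub> f x\<rbrakk> \<Longrightarrow>
    f \<in> lin_hom R X Y"
  by (auto simp: lin_hom_def)

lemma lin_hom_addhom: "f \<in> lin_hom R X Y \<Longrightarrow> f \<in> addhom X Y"
  by (simp add: lin_hom_iff)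

lemma lin_homD:
  assumes "f \<in> lin_hom R X Y"
  shows lin_hom_closed: "x \<in> carrier X \<Longrightarrow> f x \<in> carrier Y"
    and lin_hom_add: "\<lbrakk>x \<in> carrier X; y \<in> carrier X\<rbrakk> \<Longrightarrow> f (x \<oplus>\<^bsub>X\<^esub> y) = f x \<oplus>\<^bsub>Y\<^esub> f y"
    and lin_hom_smult: "\<lbrakk>a \<in> carrier R; x \<in> carrier X\<rbrakk> \<Longrightarrow> f (a \<odot>\<^bsub>X\<^esub> x) = a \<odot>\<^bsub>Y\<^esub> f x"
  using assms by (auto simp: lin_hom_def)

lemma lin_hom_zero: "\<lbrakk>f \<in> lin_hom R X Y; left_module R X; left_module R Y\<rbrakk> \<Longrightarrow> f \<zero>\<^bsub>X\<^esub> = \<zero>\<^bsub>Y\<^esub>"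
  by (rule addhom_zero[OF lin_hom_addhom]) (assumption | erule lmod_abelian_group)+

lemma lin_hom_neg: "\<lbrakk>f \<in> lin_hom R X Y; left_module R X; left_module R Y; x \<in> carrier X\<rbrakk> \<Longrightarrow>
    f (\<ominus>\<^bsub>X\<^esub> x) = \<ominus>\<^bsub>Y\<^esub> f x"
  by (rule addhom_neg[OF lin_hom_addhom]) (assumption | erule lmod_abelian_group)+

lemma lin_hom_diff: "\<lbrakk>f \<in> lin_hom R X Y; left_module R X; left_module R Y; x \<in> carrier X; y \<in> carrier X\<rbrakk>
    \<Longrightarrow> f (x \<ominus>\<^bsub>X\<^esub> y) = f x \<ominus>\<^bsub>Y\<^esub> f y"
  by (rule addhom_diff[OF lin_hom_addhom]) (assumption | erule lmod_abelian_group)+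

lemma lin_hom_comp: "\<lbrakk>f \<in> lin_hom R X Y; g \<in> lin_hom R Y Z\<rbrakk> \<Longrightarrow> (\<lambda>x. g (f x)) \<in> lin_hom R X Z"
  by (auto simp: lin_hom_def Pi_iff)

lemma lin_hom_id: "(\<lambda>x. x) \<in> lin_hom R X X"
  by (auto simp: lin_hom_def)

lemma lin_hom_cong: "(\<And>x. x \<in> carrier X \<Longrightarrow> f x = g x) \<Longrightarrow> left_module R X \<Longrightarrow>
    f \<in> lin_hom R X Y \<longleftrightarrow> g \<in> lin_hom R X Y"
  by (auto simp: lin_hom_def Pi_iff lmod_add lmod_smult)

lemma lin_hom_sum:
  "\<lbrakk>f \<in> lin_hom R X Y; g \<in> lin_hom R X Y; left_module R Y\<rbrakk> \<Longrightarrow>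
    (\<lambda>x. f x \<oplus>\<^bsub>Y\<^esub> g x) \<in> lin_hom R X Y"
  by (auto simp: lin_hom_iff addhom_sum lmod_abelian_group lmod_r_distr addhom_closed)

lemma lin_hom_minus:
  assumes "f \<in> lin_hom R X Y" "g \<in> lin_hom R X Y" "left_module R Y"
  shows "(\<lambda>x. f x \<ominus>\<^bsub>Y\<^esub> g x) \<in> lin_hom R X Y"
  using assms addhom_sum[OF lin_hom_addhom addhom_uminus[OF lin_hom_addhom], of f R X Y g R]
  by (auto simp: lin_hom_iff lmod_abelian_group lmod_smult_diff addhom_closed)
    (simp add: a_minus_def lmod_abelian_group)

lemma lin_hom_zero_map: "left_module R Y \<Longrightarrow> (\<lambda>x. \<zero>\<^bsub>Y\<^esub>) \<in> lin_hom R X Y"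
  by (rule lin_homI) (simp_all add: lmod_smult_zero lmod_zero lmod_abelian_group
      abelian_monoid.l_zero abelian_group.axioms(1))

lemma lin_isoD: 
  assumes "f \<in> lin_iso R X Y"
  shows "f \<in> lin_hom R X Y" "inj_on f (carrier X)" "f ` carrier X = carrier Y"
    "bij_betw f (carrier X) (carrier Y)"
  using assms by (auto simp: lin_iso_def bij_betw_def)

lemma lin_iso_inverse:
  assumes "f \<in> lin_iso R X Y" "left_module R X"
  shows "inv_into (carrier X) f \<in> lin_iso R Y X"
    "\<And>x. x \<in> carrier X \<Longrightarrow> inv_into (carrier X) f (f x) = x"
    "\<And>y. y \<in> carrier Y \<Longrightarrow> f (inv_into (carrier X) f y) = y"
    "\<And>y. y \<in> carrier Y \<Longrightarrow> inv_into (carrier X) f y \<in> carrier X"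
proof -
  note f = lin_isoD[OF assms(1)]
  let ?g = "inv_into (carrier X) f"
  show 1: "\<And>x. x \<in> carrier X \<Longrightarrow> ?g (f x) = x" and 2: "\<And>y. y \<in> carrier Y \<Longrightarrow> f (?g y) = y"
    and 3: "\<And>y. y \<in> carrier Y \<Longrightarrow> ?g y \<in> carrier X"
    using f by (auto simp: f_inv_into_f inv_into_into)
  have "?g \<in> lin_hom R Y X"
  proof (rule lin_homI)
    fix x y assume xy: "x \<in> carrier Y" "y \<in> carrier Y"
    show "?g (x \<oplus>\<^bsub>Y\<^esub> y) = ?g x \<oplus>\<^bsub>X\<^esub> ?g y"
      using lin_hom_add[OF f(1) 3[OF xy(1)] 3[OF xy(2)]] 1 2 3 xy lmod_add[OF assms(2)] by metis
  next
    fix a y assume xy: "a \<in> carrier R" "y \<in> carrier Y"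
    show "?g (a \<odot>\<^bsub>Y\<^esub> y) = a \<odot>\<^bsub>X\<^esub> ?g y"
      using lin_hom_smult[OF f(1) xy(1) 3[OF xy(2)]] 1 2 3 xy lmod_smult[OF assms(2)] by metis
  qed (simp add: 3)
  moreover have "bij_betw ?g (carrier Y) (carrier X)"
    using f(4) bij_betw_inv_into by blast
  ultimately show "?g \<in> lin_iso R Y X" by (simp add: lin_iso_def)
qed

lemma lin_iso_comp: "\<lbrakk>f \<in> lin_iso R X Y; g \<in> lin_iso R Y Z\<rbrakk> \<Longrightarrow> (\<lambda>x. g (f x)) \<in> lin_iso R X Z"
  using bij_betw_trans[of f _ _ g] by (fastforce simp: lin_iso_def lin_hom_comp comp_def)

lemma lin_isoI:
  assumes "f \<in> lin_hom R X Y" "g \<in> lin_hom R Y X" "\<And>x. x \<in> carrier X \<Longrightarrow> g (f x) = x"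
    "\<And>y. y \<in> carrier Y \<Longrightarrow> f (g y) = y"
  shows "f \<in> lin_iso R X Y"
  using assms by (auto simp: lin_iso_def lin_homD intro!: bij_betwI[of _ _ _ g])

lemma lin_hom_inj_iff:
  fixes Y (structure)
  assumes "f \<in> lin_hom R X Y" "left_module R X" "left_module R Y"
  shows "inj_on f (carrier X) \<longleftrightarrow> (\<forall>x \<in> carrier X. f x = \<zero> \<longrightarrow> x = \<zero>\<^bsub>X\<^esub>)"
proof -
  interpret X: abelian_group X by (rule lmod_abelian_group[OF assms(2)])
  interpret Y: abelian_group Y by (rule lmod_abelian_group[OF assms(3)])
  show ?thesis
  proof
    assume "inj_on f (carrier X)"
    then show "\<forall>x \<in> carrier X. f x = \<zero> \<longrightarrow> x = \<zero>\<^bsub>X\<^esub>"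
      using lin_hom_zero[OF assms] by (metis X.zero_closed inj_on_def)
  next
    assume 0: "\<forall>x \<in> carrier X. f x = \<zero> \<longrightarrow> x = \<zero>\<^bsub>X\<^esub>"
    show "inj_on f (carrier X)"
    proof (rule inj_onI)
      fix x y assume xy: "x \<in> carrier X" "y \<in> carrier X" "f x = f y"
      then have "f (x \<ominus>\<^bsub>X\<^esub> y) = \<zero>"
        using assms by (simp add: lin_hom_diff lin_hom_closed)
      then show "x = y" using 0 xy by (metis X.diff_eq_zero_iff X.minus_closed)
    qed
  qed
qed

section \<open>Submodules, kernels and factorisation of linear maps\<close>

definition submod :: "('r, 's) ring_scheme \<Rightarrow> ('r, 'x, 'z) module_scheme \<Rightarrow> 'x set \<Rightarrow> bool" where
  "submod R X U \<longleftrightarrow> U \<subseteq> carrier X \<and> \<zero>\<^bsub>X\<^esub> \<in> U \<and> (\<forall>x \<in> U. \<forall>y \<in> U. x \<oplus>\<^bsub>X\<^esub> y \<in> U) \<and>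
     (\<forall>a \<in> carrier R. \<forall>x \<in> U. a \<odot>\<^bsub>X\<^esub> x \<in> U)"

text \<open>Negation is the action of the scalar -1.\<close>

lemma submod_neg:
  assumes "submod R X U" "left_module R X" "x \<in> U"
  shows "\<ominus>\<^bsub>X\<^esub> x \<in> U"
proof -
  interpret R: ring R by (rule left_module_ring[OF assms(2)])
  have x: "x \<in> carrier X" using assms by (auto simp: submod_def)
  have "(\<ominus>\<^bsub>R\<^esub> \<one>\<^bsub>R\<^esub>) \<odot>\<^bsub>X\<^esub> x \<in> U" using assms by (simp add: submod_def)
  then show ?thesis using assms(2) x by (simp add: lmod_neg_smult lmod_one)
qed

lemma submod_diff: "\<lbrakk>submod R X U; left_module R X; x \<in> U; y \<in> U\<rbrakk> \<Longrightarrow> x \<ominus>\<^bsub>X\<^esub> y \<in> U"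
  by (metis a_minus_def submod_def submod_neg)

lemma submod_left_module:
  fixes X (structure)
  assumes "submod R X U" "left_module R X"
  shows "left_module R (X\<lparr>carrier := U\<rparr>)"
proof (rule left_moduleI)
  interpret X: abelian_group X by (rule lmod_abelian_group[OF assms(2)])
  note U = assms(1)[unfolded submod_def]
  have S: "x \<in> U \<Longrightarrow> x \<in> carrier X" for x using U by auto
  show "abelian_group (X\<lparr>carrier := U\<rparr>)"
  proof (rule abelian_groupI)
    fix x assume x: "x \<in> carrier (X\<lparr>carrier := U\<rparr>)"
    then have "\<ominus> x \<in> U" "\<ominus> x \<oplus> x = \<zero>"
      using submod_neg[OF assms] S by (simp_all add: X.l_neg)
    then show "\<exists>y \<in> carrier (X\<lparr>carrier := U\<rparr>). y \<oplus>\<^bsub>X\<lparr>carrier := U\<rparr>\<^esub> x = \<zero>\<^bsub>X\<lparr>carrier := U\<rparr>\<^esub>"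
      by auto
  qed (use U in \<open>simp_all add: S X.a_ac\<close>)
  show "ring R" by (rule left_module_ring[OF assms(2)])
qed (use assms in \<open>auto simp: submod_def left_moduleD subset_iff\<close>)

lemma kernel_submod:
  assumes "f \<in> lin_hom R X Y" "left_module R X" "left_module R Y"
  shows "submod R X (a_kernel X Y f)"
  using assms lmod_zero[OF assms(3)]
  by (auto simp: submod_def a_kernel_def' lin_homD lin_hom_zero lmod_zero lmod_add lmod_smult
     lmod_smult_zero lmod_abelian_group abelian_monoid.l_zero abelian_group.axioms(1))

lemma lin_hom_restrict_codomain:
  "\<lbrakk>f \<in> lin_hom R Y X; \<And>y. y \<in> carrier Y \<Longrightarrow> f y \<in> U\<rbrakk> \<Longrightarrow> f \<in> lin_hom R Y (X\<lparr>carrier := U\<rparr>)"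
  by (auto simp: lin_hom_def)

lemma lin_hom_extend_codomain:
  "\<lbrakk>f \<in> lin_hom R Y (X\<lparr>carrier := U\<rparr>); U \<subseteq> carrier X\<rbrakk> \<Longrightarrow> f \<in> lin_hom R Y X"
  by (auto simp: lin_hom_def)

lemma lin_hom_restrict_domain:
  "\<lbrakk>f \<in> lin_hom R X Y; U \<subseteq> carrier X\<rbrakk> \<Longrightarrow> f \<in> lin_hom R (X\<lparr>carrier := U\<rparr>) Y"
  by (auto simp: lin_hom_def Pi_iff subset_iff)

text \<open>Two preimages of an element under \<open>p\<close> differ by an element of the kernel of
  \<open>p\<close>, which \<open>f\<close> kills; so \<open>f\<close> evaluated on any chosen
  preimage is well defined and linear.\<close>

lemma lin_hom_factor_surj:
  assumes p: "p \<in> lin_hom R X Y" "p ` carrier X = carrier Y" and f: "f \<in> lin_hom R X Z"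
    and m: "left_module R X" "left_module R Y" "left_module R Z"
    and k: "\<And>x. \<lbrakk>x \<in> carrier X; p x = \<zero>\<^bsub>Y\<^esub>\<rbrakk> \<Longrightarrow> f x = \<zero>\<^bsub>Z\<^esub>"
  obtains g where "g \<in> lin_hom R Y Z" "\<And>x. x \<in> carrier X \<Longrightarrow> g (p x) = f x"
proof -
  interpret X: abelian_group X by (rule lmod_abelian_group[OF m(1)])
  interpret Y: abelian_group Y by (rule lmod_abelian_group[OF m(2)])
  interpret Z: abelian_group Z by (rule lmod_abelian_group[OF m(3)])
  let ?s = "inv_into (carrier X) p"
  have s: "?s y \<in> carrier X" "p (?s y) = y" if "y \<in> carrier Y" for y
    using p(2) that by (auto simp: inv_into_into f_inv_into_f)
  have eq: "f x = f x'" if "x \<in> carrier X" "x' \<in> carrier X" "p x = p x'" for x x'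
  proof -
    have "p (x \<ominus>\<^bsub>X\<^esub> x') = \<zero>\<^bsub>Y\<^esub>" using that p m by (simp add: lin_hom_diff lin_hom_closed)
    then have "f (x \<ominus>\<^bsub>X\<^esub> x') = \<zero>\<^bsub>Z\<^esub>" using k that by simp
    then show ?thesis using that f m by (simp add: lin_hom_diff Z.diff_eq_zero_iff lin_hom_closed)
  qed
  define g where "g y = f (?s y)" for y
  have g: "g (p x) = f x" if "x \<in> carrier X" for x
    unfolding g_def using that s p by (intro eq) (auto simp: lin_hom_closed)
  have "g \<in> lin_hom R Y Z"
  proof (rule lin_homI)
    fix y assume "y \<in> carrier Y" then show "g y \<in> carrier Z" using s f by (simp add: g_def lin_hom_closed)
  next
    fix y y' assume y: "y \<in> carrier Y" "y' \<in> carrier Y"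
    have "g (p (?s y \<oplus>\<^bsub>X\<^esub> ?s y')) = f (?s y) \<oplus>\<^bsub>Z\<^esub> f (?s y')"
      using y s f by (subst g) (auto simp: lin_hom_add)
    then show "g (y \<oplus>\<^bsub>Y\<^esub> y') = g y \<oplus>\<^bsub>Z\<^esub> g y'"
      using y s p by (simp add: lin_hom_add g_def)
  next
    fix a y assume y: "a \<in> carrier R" "y \<in> carrier Y"
    have "g (p (a \<odot>\<^bsub>X\<^esub> ?s y)) = a \<odot>\<^bsub>Z\<^esub> f (?s y)"
      using y s f m by (subst g) (auto simp: lin_hom_smult lmod_smult)
    then show "g (a \<odot>\<^bsub>Y\<^esub> y) = a \<odot>\<^bsub>Z\<^esub> g y"
      using y s p by (simp add: lin_hom_smult g_def)
  qed
  then show ?thesis using g that by blast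
qed

lemma lin_hom_factor_inj:
  assumes j: "j \<in> lin_hom R Y' Y" "inj_on j (carrier Y')" and f: "f \<in> lin_hom R X Y"
    and m: "left_module R Y'"
    and k: "\<And>x. x \<in> carrier X \<Longrightarrow> f x \<in> j ` carrier Y'"
  obtains g where "g \<in> lin_hom R X Y'" "\<And>x. x \<in> carrier X \<Longrightarrow> j (g x) = f x"
proof -
  define g where "g x = inv_into (carrier Y') j (f x)" for x
  have g: "g x \<in> carrier Y'" "j (g x) = f x" if "x \<in> carrier X" for x
    using k[OF that] by (auto simp: g_def inv_into_into f_inv_into_f)
  have u: "y = y'" if "j y = j y'" "y \<in> carrier Y'" "y' \<in> carrier Y'" for y y'
    using j(2) that by (auto dest: inj_onD)
  have e: "g x = y" if "f x = j y" "y \<in> carrier Y'" for x y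
    unfolding g_def that(1) using that(2) j(2) by (rule inv_into_f_f[rotated])
  have "g \<in> lin_hom R X Y'"
    by (rule lin_homI) (auto intro!: e simp: g lin_homD[OF f] lin_homD[OF j(1)] lmod_add[OF m] lmod_smult[OF m])
  then show ?thesis using g that by blast
qed

section \<open>Maps of finite rank\<close>

text \<open>The dual Hom(X, R). It is written out instead of using \<open>regular\<close>, because
  the scalars may be a plain ring record such as the field \<open>K\<close>.\<close>

definition functionals :: "('r, 's) ring_scheme \<Rightarrow> ('r, 'x, 'z) module_scheme \<Rightarrow> ('x \<Rightarrow> 'r) set" where
  "functionals R X = {f \<in> addhom X R. \<forall>a \<in> carrier R. \<forall>x \<in> carrier X. f (a \<odot>\<^bsub>X\<^esub> x) = a \<otimes>\<^bsub>R\<^esub> f x}"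

lemma functionalsD:
  assumes "f \<in> functionals R X"
  shows functionals_addhom: "f \<in> addhom X R"
    and functionals_closed: "x \<in> carrier X \<Longrightarrow> f x \<in> carrier R"
    and functionals_add: "\<lbrakk>x \<in> carrier X; y \<in> carrier X\<rbrakk> \<Longrightarrow> f (x \<oplus>\<^bsub>X\<^esub> y) = f x \<oplus>\<^bsub>R\<^esub> f y"
    and functionals_smult: "\<lbrakk>a \<in> carrier R; x \<in> carrier X\<rbrakk> \<Longrightarrow> f (a \<odot>\<^bsub>X\<^esub> x) = a \<otimes>\<^bsub>R\<^esub> f x"
  using assms by (auto simp: functionals_def addhomD)

lemma functionalsI:
  "\<lbrakk>f \<in> addhom X R; \<And>a x. \<lbrakk>a \<in> carrier R; x \<in> carrier X\<rbrakk> \<Longrightarrow> f (a \<odot>\<^bsub>X\<^esub> x) = a \<otimes>\<^bsub>R\<^esub> f x\<rbrakk> \<Longrightarrow>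
    f \<in> functionals R X"
  by (auto simp: functionals_def)

lemma functionals_comp: "\<lbrakk>f \<in> functionals R Y; g \<in> lin_hom R X Y\<rbrakk> \<Longrightarrow> (\<lambda>x. f (g x)) \<in> functionals R X"
  by (rule functionalsI) (auto simp: lin_homD functionalsD intro!: addhomI)

lemma functionals_neg:
  assumes "f \<in> functionals R X" "ring R" 
  shows "(\<lambda>x. \<ominus>\<^bsub>R\<^esub> f x) \<in> functionals R X"
proof -
  interpret ring R by fact
  show ?thesis
    by (rule functionalsI)
      (use assms in \<open>auto simp: functionalsD r_minus intro!: addhom_uminus abelian_group_axioms\<close>)
qed

text \<open>The finite sums of maps \<open>x \<mapsto> f x \<odot> y\<close>; these are the maps that factor through a finitely
  generated projective module, and \<open>P\<close> is finitely generated projective iff its identity is one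
  of them (the dual basis criterion). No module outside the source and the target has to be named,
  so the notion does not depend on the types in which modules are realised.\<close>

inductive finite_rank ::
  "('r, 's) ring_scheme \<Rightarrow> ('r, 'x, 'z) module_scheme \<Rightarrow> ('r, 'y, 'w) module_scheme \<Rightarrow> ('x \<Rightarrow> 'y) \<Rightarrow> bool"
  for R X Y
where
  finite_rank_zero: "(\<And>x. x \<in> carrier X \<Longrightarrow> h x = \<zero>\<^bsub>Y\<^esub>) \<Longrightarrow> finite_rank R X Y h"
| finite_rank_step: "\<lbrakk>finite_rank R X Y h; f \<in> functionals R X; y \<in> carrier Y;
     \<And>x. x \<in> carrier X \<Longrightarrow> h' x = f x \<odot>\<^bsub>Y\<^esub> y \<oplus>\<^bsub>Y\<^esub> h x\<rbrakk> \<Longrightarrow> finite_rank R X Y h'"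

abbreviation fgproj :: "('r, 's) ring_scheme \<Rightarrow> ('r, 'x, 'z) module_scheme \<Rightarrow> bool" where
  "fgproj R P \<equiv> finite_rank R P P (\<lambda>x. x)"

text \<open>The introduction rules constrain a map on the carrier only, so the last rule applied can
  be replayed for any map that agrees there.\<close>

lemma finite_rank_cong:
  assumes "finite_rank R X Y h" "\<And>x. x \<in> carrier X \<Longrightarrow> h x = h' x"
  shows "finite_rank R X Y h'"
  using assms
proof (cases rule: finite_rank.cases)
  case finite_rank_zero then show ?thesis using assms(2) by (metis finite_rank.finite_rank_zero)
next
  case (finite_rank_step h0 f y)
  show ?thesis
    by (rule finite_rank.finite_rank_step[OF finite_rank_step(1-3)])
      (simp add: assms(2)[symmetric] finite_rank_step(4))
qed

lemma finite_rank_closed: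
  "\<lbrakk>finite_rank R X Y h; left_module R Y; x \<in> carrier X\<rbrakk> \<Longrightarrow> h x \<in> carrier Y"
  by (induction rule: finite_rank.induct) (auto simp: lmod_zero lmod_add lmod_smult functionalsD)

lemma finite_rank_add:
  assumes "finite_rank R X Y g" "finite_rank R X Y h" "left_module R Y"
  shows "finite_rank R X Y (\<lambda>x. g x \<oplus>\<^bsub>Y\<^esub> h x)"
  using assms(1)
proof induction
  interpret Y: abelian_group Y by (rule lmod_abelian_group[OF assms(3)])
  case (finite_rank_zero g)
  show ?case
    by (rule finite_rank_cong[OF assms(2)])
      (simp add: finite_rank_zero finite_rank_closed[OF assms(2,3)])
next
  interpret Y: abelian_group Y by (rule lmod_abelian_group[OF assms(3)])
  case (finite_rank_step g f y g')
  show ?case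
    by (rule finite_rank.finite_rank_step[OF finite_rank_step(5,2,3)])
      (simp add: finite_rank_step finite_rank_closed[OF assms(2,3)]
        finite_rank_closed[OF finite_rank_step(1) assms(3)] Y.a_assoc lmod_smult[OF assms(3)]
        functionalsD[OF finite_rank_step(2)])
qed

lemma finite_rank_comp_left:
  assumes "finite_rank R X Y h" "left_module R Y" "left_module R Z" "u \<in> lin_hom R Y Z"
  shows "finite_rank R X Z (\<lambda>x. u (h x))"
  using assms(1)
proof induction
  case (finite_rank_zero h)
  then show ?case using assms by (intro finite_rank.finite_rank_zero) (simp add: lin_hom_zero)
next
  case (finite_rank_step g f y g')
  show ?case
    by (rule finite_rank.finite_rank_step[OF finite_rank_step(5,2) lin_hom_closed[OF assms(4) finite_rank_step(3)]])
      (simp add: finite_rank_step lin_homD[OF assms(4)] finite_rank_closed[OF finite_rank_step(1) assms(2)]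
        functionalsD[OF finite_rank_step(2)] lmod_smult[OF assms(2)])
qed

lemma finite_rank_comp_right:
  assumes "finite_rank R X Y h" "v \<in> lin_hom R W X"
  shows "finite_rank R W Y (\<lambda>x. h (v x))"
  using assms(1)
proof induction
  case (finite_rank_zero h)
  then show ?case using assms by (intro finite_rank.finite_rank_zero) (simp add: lin_hom_closed)
next
  case (finite_rank_step g f y g')
  show ?case
    by (rule finite_rank.finite_rank_step[OF finite_rank_step(5) functionals_comp[OF finite_rank_step(2) assms(2)] finite_rank_step(3)])
      (simp add: finite_rank_step lin_homD[OF assms(2)])
qed

lemma finite_rank_neg:
  assumes "finite_rank R X Y h" "left_module R Y"
  shows "finite_rank R X Y (\<lambda>x. \<ominus>\<^bsub>Y\<^esub> h x)"
proof -
  interpret Y: abelian_group Y by (rule lmod_abelian_group[OF assms(2)])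
  interpret R: ring R by (rule left_module_ring[OF assms(2)])
  show ?thesis
    using assms(1)
  proof induction
    case (finite_rank_zero h)
    then show ?case by (intro finite_rank.finite_rank_zero) simp
  next
    case (finite_rank_step g f y g')
    show ?case
      by (rule finite_rank.finite_rank_step[OF finite_rank_step(5) functionals_neg[OF finite_rank_step(2) R.ring_axioms] finite_rank_step(3)])
        (simp add: finite_rank_step functionalsD[OF finite_rank_step(2)] lmod_neg_smult[OF assms(2)]
          lmod_smult[OF assms(2)] Y.minus_add finite_rank_closed[OF finite_rank_step(1) assms(2)])
  qed
qed

lemma finite_rank_lin_hom:
  assumes "finite_rank R X Y h" "left_module R X" "left_module R Y"
  shows "h \<in> lin_hom R X Y"
  using assms(1)
proof induction
  case (finite_rank_zero h)
  show ?case
    by (rule iffD2[OF lin_hom_cong[OF _ assms(2)] lin_hom_zero_map[OF assms(3)]]) (rule finite_rank_zero)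
next
  case (finite_rank_step h f y h')
  have "(\<lambda>x. f x \<odot>\<^bsub>Y\<^esub> y) \<in> lin_hom R X Y"
    using finite_rank_step(2,3) assms(3)
    by (auto intro!: lin_homI simp: functionalsD lmod_smult lmod_l_distr lmod_assoc)
  then have s: "(\<lambda>x. f x \<odot>\<^bsub>Y\<^esub> y \<oplus>\<^bsub>Y\<^esub> h x) \<in> lin_hom R X Y"
    using finite_rank_step.IH assms(3) by (rule lin_hom_sum)
  show ?case
    by (rule iffD2[OF lin_hom_cong[OF _ assms(2)] s]) (rule finite_rank_step(4))
qed

text \<open>Only the finitely many vectors \<open>y\<close> have to be lifted along
  \<open>p\<close>; the functionals are kept.\<close>

lemma finite_rank_lift:
  assumes "finite_rank R X Y h" "p \<in> lin_hom R Z Y" "p ` carrier Z = carrier Y"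
    "left_module R Z" "left_module R Y"
  obtains g where "finite_rank R X Z g" "\<And>x. x \<in> carrier X \<Longrightarrow> p (g x) = h x"
proof -
  have "\<exists>g. finite_rank R X Z g \<and> (\<forall>x \<in> carrier X. p (g x) = h x)"
    using assms(1)
  proof induction
    case (finite_rank_zero h)
    then show ?case
      using lin_hom_zero[OF assms(2,4,5)]
      by (intro exI[of _ "\<lambda>x. \<zero>\<^bsub>Z\<^esub>"]) (simp add: finite_rank.finite_rank_zero)
  next
    case (finite_rank_step h f y h')
    from finite_rank_step.IH obtain g where g: "finite_rank R X Z g" "\<forall>x \<in> carrier X. p (g x) = h x"
      by auto
    obtain z where z: "z \<in> carrier Z" "p z = y" using surj_obtain[OF assms(3) finite_rank_step(3)] .
    have "finite_rank R X Z (\<lambda>x. f x \<odot>\<^bsub>Z\<^esub> z \<oplus>\<^bsub>Z\<^esub> g x)"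
      using g(1) finite_rank_step(2) z(1) by (rule finite_rank.finite_rank_step) simp
    moreover have "\<forall>x \<in> carrier X. p (f x \<odot>\<^bsub>Z\<^esub> z \<oplus>\<^bsub>Z\<^esub> g x) = h' x"
      using g(2) z finite_rank_closed[OF g(1) assms(4)]
      by (simp add: lin_homD[OF assms(2)] functionalsD[OF finite_rank_step(2)] lmod_smult[OF assms(4)]
          finite_rank_step(4))
    ultimately show ?case by (intro exI conjI)
  qed
  then show ?thesis using that by auto
qed

text \<open>The lifting property for modules of arbitrary types, whereas \<open>projective\<close>
  grants it for modules in the universe. It holds because \<open>f\<close>, composed with the
  identity of \<open>P\<close>, has finite rank.\<close>

lemma fgproj_lift:
  assumes "fgproj R P" "left_module R P" "f \<in> lin_hom R P Y" "p \<in> lin_hom R Z Y" "p ` carrier Z = carrier Y"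
    "left_module R Z" "left_module R Y"
  obtains g where "g \<in> lin_hom R P Z" "\<And>x. x \<in> carrier P \<Longrightarrow> p (g x) = f x"
proof -
  have "finite_rank R P Y f"
    using finite_rank_comp_left[OF assms(1,2,7,3)] by simp
  then obtain g where g: "finite_rank R P Z g" "\<And>x. x \<in> carrier P \<Longrightarrow> p (g x) = f x"
    by (rule finite_rank_lift[OF _ assms(4-7)]) blast
  show ?thesis by (rule that[OF finite_rank_lin_hom[OF g(1) assms(2,6)] g(2)])
qed

text \<open>The identity of \<open>P\<close> has finite rank, and composition on either side
  preserves this.\<close>

lemma finite_rank_through:
  assumes "fgproj R P" "a \<in> lin_hom R X P" "b \<in> lin_hom R P Y" "left_module R P" "left_module R Y"
  shows "finite_rank R X Y (\<lambda>x. b (a x))"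
  using finite_rank_comp_left[OF finite_rank_comp_right[OF assms(1,2)] assms(4,5,3)] .

lemma fgproj_iso:
  assumes "fgproj R P" "u \<in> lin_iso R P Q" "left_module R P" "left_module R Q"
  shows "fgproj R Q"
proof -
  note i = lin_iso_inverse[OF assms(2,3)]
  show ?thesis
    by (rule finite_rank_cong[OF finite_rank_through[OF assms(1) lin_isoD(1)[OF i(1)] lin_isoD(1)[OF assms(2)] assms(3,4)]])
      (simp add: i)
qed

section \<open>Finitely generated modules\<close>

text \<open>The span in a form fit for induction. A generator may occur several times, so no
  bookkeeping of coefficients is required when adding elements.\<close>

inductive_set rspan ::
  "('r, 's) ring_scheme \<Rightarrow> ('r, 'x, 'z) module_scheme \<Rightarrow> 'x set \<Rightarrow> 'x set"
  for R X B
where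
  rspan_zero: "\<zero>\<^bsub>X\<^esub> \<in> rspan R X B"
| rspan_step: "\<lbrakk>a \<in> carrier R; b \<in> B; v \<in> rspan R X B\<rbrakk> \<Longrightarrow> a \<odot>\<^bsub>X\<^esub> b \<oplus>\<^bsub>X\<^esub> v \<in> rspan R X B"

lemma rspan_mono: "x \<in> rspan R X B \<Longrightarrow> B \<subseteq> C \<Longrightarrow> x \<in> rspan R X C"
  by (induction rule: rspan.induct) (auto intro: rspan.intros)

lemma rspan_closed:
  assumes "left_module R X" "B \<subseteq> carrier X" "x \<in> rspan R X B"
  shows "x \<in> carrier X"
  using assms(3) by induction (use assms(2) in \<open>auto simp: left_moduleD[OF assms(1)]\<close>)

lemma rspan_add:
  fixes X (structure)
  assumes "left_module R X" "B \<subseteq> carrier X" "x \<in> rspan R X B" "y \<in> rspan R X B"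
  shows "x \<oplus> y \<in> rspan R X B"
proof -
  interpret X: abelian_group X by (rule lmod_abelian_group[OF assms(1)])
  show ?thesis using assms(3)
  proof induction
    case rspan_zero
    then show ?case using assms(4) rspan_closed[OF assms(1,2,4)] by simp
  next
    case (rspan_step a b v)
    have "(a \<odot> b \<oplus> v) \<oplus> y = a \<odot> b \<oplus> (v \<oplus> y)"
      using rspan_step assms(2) rspan_closed[OF assms(1,2)] assms(4)
      by (intro X.a_assoc lmod_smult[OF assms(1)]) auto
    then show ?case using rspan.rspan_step[OF rspan_step(1,2,4)] by simp
  qed
qed

lemma finsum_in_rspan:
  fixes X (structure)
  assumes X: "left_module R X" and "finite A" "A \<subseteq> B" "B \<subseteq> carrier X" "c \<in> A \<rightarrow> carrier R"
  shows "(\<Oplus>b\<in>A. c b \<odot> b) \<in> rspan R X B"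
proof -
  interpret X: abelian_group X by (rule lmod_abelian_group[OF assms(1)])
  show ?thesis using assms(2-)
  proof (induction A rule: finite_induct)
    case empty
    then show ?case by (simp add: rspan_zero)
  next
    case (insert b A)
    have c: "(\<lambda>b. c b \<odot> b) \<in> A \<rightarrow> carrier X" "c b \<odot> b \<in> carrier X"
      using insert.prems by (auto simp: Pi_iff subset_iff lmod_smult[OF X])
    then show ?case
      using insert c by (simp add: rspan_step)
  qed
qed

lemma rspan_finsum:
  fixes X (structure)
  assumes X: "left_module R X" and B: "finite B" "B \<subseteq> carrier X" and x: "x \<in> rspan R X B"
  shows "\<exists>c \<in> B \<rightarrow> carrier R. x = (\<Oplus>b\<in>B. c b \<odot> b)"
  using x
proof induction
  interpret X: abelian_group X by (rule lmod_abelian_group[OF X])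
  interpret R: ring R by (rule left_module_ring[OF X])
  case rspan_zero
  have "(\<Oplus>b\<in>B. \<zero>\<^bsub>R\<^esub> \<odot> b) = (\<Oplus>b\<in>B. \<zero>)"
    using B(2) by (intro X.finsum_cong') (auto simp: lmod_zero_smult[OF X])
  then show ?case by (intro bexI[of _ "\<lambda>_. \<zero>\<^bsub>R\<^esub>"]) simp_all
next
  interpret X: abelian_group X by (rule lmod_abelian_group[OF X])
  interpret R: ring R by (rule left_module_ring[OF X])
  case (rspan_step a b v)
  then obtain c where c: "c \<in> B \<rightarrow> carrier R" "v = (\<Oplus>b\<in>B. c b \<odot> b)" by auto
  \<comment> \<open>A repeated generator adds its new coefficient to the one it already has.\<close>
  let ?c = "c(b := a \<oplus>\<^bsub>R\<^esub> c b)"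
  let ?B = "B - {b}"
  have Bb: "insert b ?B = B" using rspan_step(2) by auto
  have m: "(\<lambda>b. c b \<odot> b) \<in> ?B \<rightarrow> carrier X" "b \<in> carrier X" "c b \<in> carrier R" "finite ?B" "b \<notin> ?B"
    using c(1) B rspan_step(2) by (auto simp: Pi_iff subset_iff lmod_smult[OF X])
  let ?s = "\<Oplus>b\<in>?B. c b \<odot> b"
  have s: "?s \<in> carrier X" using m(1) by (rule X.finsum_closed)
  have "(\<Oplus>b\<in>?B. ?c b \<odot> b) = ?s"
    using m(1) by (intro X.finsum_cong') auto
  moreover have "(\<lambda>b. ?c b \<odot> b) \<in> ?B \<rightarrow> carrier X" using m(1) by (simp add: Pi_iff)
  ultimately have "(\<Oplus>b\<in>insert b ?B. ?c b \<odot> b) = (a \<oplus>\<^bsub>R\<^esub> c b) \<odot> b \<oplus> ?s"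
    using m rspan_step(1) by (subst X.finsum_insert) (auto simp: lmod_smult[OF X])
  moreover have "(\<Oplus>b\<in>insert b ?B. c b \<odot> b) = c b \<odot> b \<oplus> ?s"
    using m by (subst X.finsum_insert) (auto simp: lmod_smult[OF X])
  ultimately have "(\<Oplus>b\<in>B. ?c b \<odot> b) = a \<odot> b \<oplus> v"
    unfolding Bb c(2) using m(2,3) rspan_step(1) s
    by (simp add: lmod_l_distr[OF X] X.a_assoc lmod_smult[OF X])
  moreover have "?c \<in> B \<rightarrow> carrier R" using c(1) rspan_step(1) m(3) by auto
  ultimately show ?case by (intro bexI[of _ ?c]) simp_all
qed

lemma fin_gen_rspan:
  assumes X: "left_module R X"
  shows "fin_gen R X \<longleftrightarrow> (\<exists>B. finite B \<and> B \<subseteq> carrier X \<and> carrier X \<subseteq> rspan R X B)"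
proof
  assume "fin_gen R X"
  then obtain B where B: "finite B" "B \<subseteq> carrier X"
    "\<forall>x \<in> carrier X. \<exists>c \<in> B \<rightarrow> carrier R. x = (\<Oplus>\<^bsub>X\<^esub>b\<in>B. c b \<odot>\<^bsub>X\<^esub> b)"
    unfolding fin_gen_def by auto
  have "carrier X \<subseteq> rspan R X B"
    using B(3) finsum_in_rspan[OF X B(1) _ B(2)] by force
  with B show "\<exists>B. finite B \<and> B \<subseteq> carrier X \<and> carrier X \<subseteq> rspan R X B" by auto
next
  assume "\<exists>B. finite B \<and> B \<subseteq> carrier X \<and> carrier X \<subseteq> rspan R X B"
  then obtain B where B: "finite B" "B \<subseteq> carrier X" "carrier X \<subseteq> rspan R X B" by auto
  show "fin_gen R X"
    unfolding fin_gen_def using B rspan_finsum[OF X B(1,2)] by (intro exI[of _ B]) auto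
qed

lemma rspan_image:
  assumes "q \<in> lin_hom R X Y" "left_module R X" "left_module R Y" "B \<subseteq> carrier X" "x \<in> rspan R X B"
  shows "q x \<in> rspan R Y (q ` B)"
  using assms(5)
proof induction
  case rspan_zero
  then show ?case by (simp add: lin_hom_zero[OF assms(1-3)] rspan.rspan_zero)
next
  case (rspan_step a b v)
  have "q (a \<odot>\<^bsub>X\<^esub> b \<oplus>\<^bsub>X\<^esub> v) = a \<odot>\<^bsub>Y\<^esub> q b \<oplus>\<^bsub>Y\<^esub> q v"
    using rspan_step assms(4) rspan_closed[OF assms(2,4)]
    by (simp add: lin_homD[OF assms(1)] left_moduleD[OF assms(2)] subset_iff)
  then show ?case using rspan_step by (simp add: rspan.rspan_step)
qed

lemma fin_gen_image:
  assumes "fin_gen R X" "q \<in> lin_hom R X Y" "q ` carrier X = carrier Y" "left_module R X" "left_module R Y"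
  shows "fin_gen R Y"
proof -
  obtain B where B: "finite B" "B \<subseteq> carrier X" "carrier X \<subseteq> rspan R X B"
    using assms(1) fin_gen_rspan[OF assms(4)] by auto
  have "carrier Y \<subseteq> rspan R Y (q ` B)"
    unfolding assms(3)[symmetric] using B(3) rspan_image[OF assms(2,4,5) B(2)] by auto
  moreover have "q ` B \<subseteq> carrier Y" using B(2) assms(3) by auto
  ultimately show ?thesis using B(1) fin_gen_rspan[OF assms(5)] by auto
qed

lemma fg_moduleD: "fg_module R X \<Longrightarrow> left_module R X" "fg_module R X \<Longrightarrow> fin_gen R X"
  by (simp_all add: fg_module_def)

lemma fg_module_image:
  assumes "fg_module R X" "q \<in> lin_hom R X Y" "q ` carrier X = carrier Y" "left_module R Y"
  shows "fg_module R Y"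
  using fin_gen_image[OF _ assms(2,3) _ assms(4)] assms(1,4) by (simp add: fg_module_def)

lemma finite_rank_rspan:
  assumes "finite_rank R X Y h"
  shows "\<exists>B. finite B \<and> B \<subseteq> carrier Y \<and> (\<forall>x \<in> carrier X. h x \<in> rspan R Y B)"
  using assms
proof induction
  case (finite_rank_zero h)
  then show ?case by (intro exI[of _ "{}"]) (simp add: rspan.rspan_zero)
next
  case (finite_rank_step h f y h')
  then obtain B where B: "finite B" "B \<subseteq> carrier Y" "\<forall>x \<in> carrier X. h x \<in> rspan R Y B" by auto
  have "h' x \<in> rspan R Y (insert y B)" if "x \<in> carrier X" for x
  proof -
    have "h x \<in> rspan R Y (insert y B)" by (rule rspan_mono[of _ _ _ B]) (use B that in auto)
    then show ?thesis
      unfolding finite_rank_step(4)[OF that]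
      using functionals_closed[OF finite_rank_step(2) that] by (intro rspan.rspan_step) auto
  qed
  then show ?case using B finite_rank_step(3) by (intro exI[of _ "insert y B"]) auto
qed

lemma fgproj_fin_gen:
  assumes "fgproj R P" "left_module R P"
  shows "fin_gen R P"
  using finite_rank_rspan[OF assms(1)] unfolding fin_gen_rspan[OF assms(2)] by auto

text \<open>The module laws are equations, so they descend along a surjection that respects the
  operations. This is how a freshly built quotient record is seen to be a module.\<close>

lemma left_module_image:
  fixes Q (structure)
  assumes X: "left_module R X" and q: "q \<in> lin_hom R X Q" "q ` carrier X = carrier Q" "q \<zero>\<^bsub>X\<^esub> = \<zero>"
  shows "left_module R Q"
proof -
  interpret X: abelian_group X by (rule lmod_abelian_group[OF X])
  note qs = lin_homD[OF q(1)]
  have E: "\<exists>x \<in> carrier X. q x = u" if "u \<in> carrier Q" for u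
    using surj_obtain[OF q(2) that] by auto
  have P: "P u" if "u \<in> carrier Q" "\<And>x. x \<in> carrier X \<Longrightarrow> P (q x)" for P u
    using E that by auto
  have Q: "abelian_group Q"
  proof (rule abelian_groupI)
    show "\<zero> \<in> carrier Q" using qs(1)[of "\<zero>\<^bsub>X\<^esub>"] q(3) by simp
    fix u assume u: "u \<in> carrier Q"
    show "\<zero> \<oplus> u = u"
      using u by (rule P) (simp add: qs(2)[symmetric] q(3)[symmetric])
    show "\<exists>y \<in> carrier Q. y \<oplus> u = \<zero>"
    proof (rule P[OF u])
      fix x assume x: "x \<in> carrier X"
      have "q (\<ominus>\<^bsub>X\<^esub> x) \<oplus> q x = \<zero>"
        using x by (simp add: qs(2)[symmetric] X.l_neg q(3))
      then show "\<exists>y \<in> carrier Q. y \<oplus> q x = \<zero>"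
        using x by (intro bexI[of _ "q (\<ominus>\<^bsub>X\<^esub> x)"]) (simp_all add: qs(1))
    qed
    fix v assume v: "v \<in> carrier Q"
    show "u \<oplus> v \<in> carrier Q"
      using u by (rule P) (rule P[OF v], simp add: qs(2)[symmetric] qs(1))
    show "u \<oplus> v = v \<oplus> u"
      using u by (rule P) (rule P[OF v], simp add: qs(2)[symmetric] X.a_comm)
    fix w assume w: "w \<in> carrier Q"
    show "u \<oplus> v \<oplus> w = u \<oplus> (v \<oplus> w)"
      using u by (rule P) (rule P[OF v], rule P[OF w], simp add: qs(2)[symmetric] X.a_assoc)
  qed
  interpret R: ring R by (rule left_module_ring[OF X])
  show ?thesis
  proof (rule left_moduleI[OF left_module_ring[OF X] Q])
    fix a u assume a: "a \<in> carrier R" and u: "u \<in> carrier Q"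
    show "a \<odot> u \<in> carrier Q"
      using u by (rule P) (simp add: qs(3)[symmetric] a qs(1) lmod_smult[OF X])
    {
      fix b assume b: "b \<in> carrier R"
      show "(a \<oplus>\<^bsub>R\<^esub> b) \<odot> u = a \<odot> u \<oplus> b \<odot> u"
        using u by (rule P) (simp add: qs(2,3)[symmetric] a b left_moduleD[OF X])
      show "(a \<otimes>\<^bsub>R\<^esub> b) \<odot> u = a \<odot> (b \<odot> u)"
        using u by (rule P) (simp add: qs(3)[symmetric] a b left_moduleD[OF X])
    }
    fix v assume v: "v \<in> carrier Q"
    show "a \<odot> (u \<oplus> v) = a \<odot> u \<oplus> a \<odot> v"
      using u by (rule P) (rule P[OF v], simp add: qs(2,3)[symmetric] a left_moduleD[OF X])
  next
    fix u assume u: "u \<in> carrier Q"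
    show "\<one>\<^bsub>R\<^esub> \<odot> u = u"
      using u by (rule P) (simp add: qs(3)[symmetric] lmod_one[OF X])
  qed
qed

section \<open>Copies in the universe\<close>

text \<open>The embedding of the scalars is what gives finitely generated modules copies in
  \<open>'k univ\<close>. It will be verified for the algebras, their opposites and their enveloping
  algebras.\<close>

definition small_ring :: "('k, 'r) module \<Rightarrow> bool" where
  "small_ring R \<longleftrightarrow> ring R \<and> (\<exists>e :: 'r \<Rightarrow> 'k univ. inj_on e (carrier R))"

text \<open>Each element is coded by one coefficient sequence that yields it. A sequence of elements
  of \<open>'k univ\<close> is again an element of \<open>'k univ\<close>, through the pairing
  function on the naturals.\<close>

lemma inj_coefficients:
  fixes e :: "'z \<Rightarrow> 'k univ" and h :: "(nat \<Rightarrow> 'z) \<Rightarrow> 'x"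
  assumes e: "inj_on e Z" and D: "\<And>x. x \<in> D \<Longrightarrow> \<exists>c. (\<forall>i. c i \<in> Z) \<and> x = h c"
  shows "\<exists>q :: 'x \<Rightarrow> 'k univ. inj_on q D"
proof -
  have "\<forall>x. \<exists>c. x \<in> D \<longrightarrow> (\<forall>i. c i \<in> Z) \<and> x = h c" using D by auto
  then obtain c where c: "\<And>x. x \<in> D \<Longrightarrow> (\<forall>i. c x i \<in> Z) \<and> x = h (c x)"
    using choice[of "\<lambda>x c. x \<in> D \<longrightarrow> (\<forall>i. c i \<in> Z) \<and> x = h c"] by auto
  define q where "q x = (\<lambda>k. e (c x (fst (prod_decode k))) (snd (prod_decode k)))" for x
  have "inj_on q D"
  proof (rule inj_onI)
    fix x y assume xy: "x \<in> D" "y \<in> D" "q x = q y"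
    have "c x i = c y i" for i
    proof -
      have "e (c x i) j = e (c y i) j" for j
        using fun_cong[OF xy(3), of "prod_encode (i, j)"] by (simp add: q_def)
      then have "e (c x i) = e (c y i)" by auto
      then show ?thesis using inj_onD[OF e] c xy by auto
    qed
    then have "c x = c y" by auto
    then show "x = y" using c[OF xy(1)] c[OF xy(2)] by simp
  qed
  then show ?thesis by auto
qed

lemma fin_gen_embed:
  fixes X :: "('r, 'x, 'z) module_scheme" (structure) and e :: "'r \<Rightarrow> 'k univ"
  assumes "inj_on e (carrier R)" "ring R" "abelian_group X"
    "\<And>a x. \<lbrakk>a \<in> carrier R; x \<in> carrier X\<rbrakk> \<Longrightarrow> a \<odot> x \<in> carrier X" "fin_gen R X"
  shows "\<exists>q :: 'x \<Rightarrow> 'k univ. inj_on q (carrier X)"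
proof -
  interpret X: abelian_group X by fact
  interpret R: ring R by fact
  obtain B where B: "finite B" "B \<subseteq> carrier X"
    "\<And>x. x \<in> carrier X \<Longrightarrow> \<exists>c \<in> B \<rightarrow> carrier R. x = (\<Oplus>b\<in>B. c b \<odot> b)"
    using assms(5) unfolding fin_gen_def by auto
  obtain f :: "'x \<Rightarrow> nat" where f: "inj_on f B"
    using finite_imp_inj_to_nat_seg[OF B(1)] by auto
  show ?thesis
  proof (rule inj_coefficients[OF assms(1), where h = "\<lambda>c. \<Oplus>b\<in>B. c (f b) \<odot> b"])
    fix x assume "x \<in> carrier X"
    then obtain c where c: "c \<in> B \<rightarrow> carrier R" "x = (\<Oplus>b\<in>B. c b \<odot> b)" using B(3) by auto
    \<comment> \<open>The generators are numbered by \<open>f\<close>, and the coefficients are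
      padded with zeros to a full sequence.\<close>
    define c' where "c' i = (if i \<in> f ` B then c (inv_into B f i) else \<zero>\<^bsub>R\<^esub>)" for i
    have "c' i \<in> carrier R" for i using c(1) by (auto simp: c'_def inv_into_into Pi_iff)
    moreover have "x = (\<Oplus>b\<in>B. c' (f b) \<odot> b)"
      unfolding c(2) using c(1) B(2) f by (intro X.finsum_cong') (auto simp: c'_def assms(4) Pi_iff)
    ultimately show "\<exists>c. (\<forall>i. c i \<in> carrier R) \<and> x = (\<Oplus>b\<in>B. c (f b) \<odot> b)" by auto
  qed
qed

text \<open>A coset is coded by the image of one chosen element of it under an embedding of
  \<open>X\<close>, so the quotient lies in the universe and not in a type of sets.\<close>

lemma quotient_copy:
  fixes X :: "('r, 'x, 'z) module_scheme" (structure) and R :: "('k, 'r) module"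
  assumes R: "small_ring R" and X: "left_module R X" "fin_gen R X" and U: "submod R X U"
  obtains Q :: "('r, 'k univ) module" and q where "left_module R Q" "q \<in> lin_hom R X Q"
    "q ` carrier X = carrier Q" "\<And>x. x \<in> carrier X \<Longrightarrow> q x = \<zero>\<^bsub>Q\<^esub> \<longleftrightarrow> x \<in> U"
proof -
  interpret X: abelian_group X by (rule lmod_abelian_group[OF X(1)])
  obtain e0 :: "'r \<Rightarrow> 'k univ" where e0: "inj_on e0 (carrier R)" and rR: "ring R"
    using R by (auto simp: small_ring_def)
  obtain e :: "'x \<Rightarrow> 'k univ" where e: "inj_on e (carrier X)"
    using fin_gen_embed[OF e0 rR X.abelian_group_axioms lmod_smult[OF X(1)] X(2)] by auto
  have U0: "\<zero> \<in> U" and Uc: "\<And>x. x \<in> U \<Longrightarrow> x \<in> carrier X" using U by (auto simp: submod_def)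
  note Ud = submod_diff[OF U X(1)]
  have Ua: "x \<oplus> y \<in> U" if "x \<in> U" "y \<in> U" for x y using U that by (auto simp: submod_def)
  define S where "S x = {y \<in> carrier X. x \<ominus> y \<in> U}" for x
  \<comment> \<open>The choice depends on \<open>x\<close> only through the coset
    \<open>S x\<close>; hence \<open>q\<close> below is constant on cosets.\<close>
  define r where "r x = (SOME y. y \<in> S x)" for x
  have r: "r x \<in> carrier X" "x \<ominus> r x \<in> U" if "x \<in> carrier X" for x
  proof -
    have "x \<in> S x" using that U0 by (simp add: S_def)
    then have "r x \<in> S x" unfolding r_def by (rule someI)
    then show "r x \<in> carrier X" "x \<ominus> r x \<in> U" by (simp_all add: S_def)
  qed
  have Seq: "S x = S y" if "x \<in> carrier X" "y \<in> carrier X" "x \<ominus> y \<in> U" for x y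
  proof -
    have "x \<ominus> z \<in> U \<longleftrightarrow> y \<ominus> z \<in> U" if z: "z \<in> carrier X" for z
    proof -
      have "y \<ominus> x \<in> U"
        using Ud[OF U0 \<open>x \<ominus> y \<in> U\<close>] \<open>x \<in> carrier X\<close> \<open>y \<in> carrier X\<close>
        by (simp add: a_minus_def X.minus_add X.a_ac)
      then show ?thesis
        using Ua[of "x \<ominus> y" "y \<ominus> z"] Ua[of "y \<ominus> x" "x \<ominus> z"] that
          \<open>x \<ominus> y \<in> U\<close> z by (auto simp: X.diff_add_diff \<open>x \<in> carrier X\<close> \<open>y \<in> carrier X\<close>)
    qed
    then show ?thesis by (auto simp: S_def)
  qed
  define q where "q x = e (r x)" for x
  have q: "q x = q y \<longleftrightarrow> x \<ominus> y \<in> U" if xy: "x \<in> carrier X" "y \<in> carrier X" for x y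
  proof
    assume "q x = q y"
    then have rr: "r x = r y" using e r(1)[OF xy(1)] r(1)[OF xy(2)] by (auto simp: q_def dest: inj_onD)
    have "(x \<ominus> r x) \<ominus> (y \<ominus> r y) \<in> U" using Ud r xy by simp
    then show "x \<ominus> y \<in> U" using xy r[OF xy(2)] unfolding rr by (simp add: X.diff_diff_diff)
  next
    assume "x \<ominus> y \<in> U"
    then show "q x = q y" using Seq[OF xy] by (simp add: q_def r_def)
  qed
  define s where "s = inv_into (carrier X) q"
  define Q :: "('r, 'k univ) module" where "Q = \<lparr>carrier = q ` carrier X, mult = undefined, one = undefined,
    ring.zero = q \<zero>, add = (\<lambda>u v. q (s u \<oplus> s v)), smult = (\<lambda>a u. q (a \<odot> s u))\<rparr>"
  have s: "s (q x) \<in> carrier X" "q (s (q x)) = q x" if "x \<in> carrier X" for x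
    using that by (auto simp: s_def inv_into_into f_inv_into_f)
  have sU: "s (q x) \<ominus> x \<in> U" if "x \<in> carrier X" for x
    using q[OF s(1)[OF that] that] s(2)[OF that] by simp
  have qh: "q \<in> lin_hom R X Q"
  proof (rule lin_homI)
    fix x y assume xy: "x \<in> carrier X" "y \<in> carrier X"
    note c = s(1)[OF xy(1)] s(1)[OF xy(2)] xy
    have "(s (q x) \<oplus> s (q y)) \<ominus> (x \<oplus> y) \<in> U"
      using Ua[OF sU[OF xy(1)] sU[OF xy(2)]] c by (simp add: X.add_diff_add)
    then have "q (s (q x) \<oplus> s (q y)) = q (x \<oplus> y)" using q c by simp
    then show "q (x \<oplus> y) = q x \<oplus>\<^bsub>Q\<^esub> q y" by (simp add: Q_def)
  next
    fix a x assume ax: "a \<in> carrier R" "x \<in> carrier X"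
    note c = s(1)[OF ax(2)] ax
    have "a \<odot> (s (q x) \<ominus> x) \<in> U" using U sU[OF ax(2)] ax by (simp add: submod_def)
    then have "a \<odot> s (q x) \<ominus> a \<odot> x \<in> U" using lmod_smult_diff[OF X(1)] c by simp
    then have "q (a \<odot> s (q x)) = q (a \<odot> x)" using q c by (simp add: lmod_smult[OF X(1)])
    then show "q (a \<odot> x) = a \<odot>\<^bsub>Q\<^esub> q x" by (simp add: Q_def)
  qed (simp add: Q_def)
  have qs: "q ` carrier X = carrier Q" by (simp add: Q_def)
  have "left_module R Q" by (rule left_module_image[OF X(1) qh qs]) (simp add: Q_def)
  moreover have "q x = \<zero>\<^bsub>Q\<^esub> \<longleftrightarrow> x \<in> U" if "x \<in> carrier X" for x
    using q[OF that X.zero_closed] that by (simp add: Q_def)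
  ultimately show ?thesis using that qh qs by blast
qed

text \<open>The quotient by the zero submodule.\<close>

lemma univ_copy:
  fixes X :: "('r, 'x, 'z) module_scheme" and R :: "('k, 'r) module"
  assumes R: "small_ring R" and X: "fg_module R X"
  obtains Q :: "('r, 'k univ) module" and q where "fg_module R Q" "q \<in> lin_iso R X Q"
proof -
  note Xm = fg_moduleD[OF X]
  interpret X: abelian_group X by (rule lmod_abelian_group[OF Xm(1)])
  have "submod R X {\<zero>\<^bsub>X\<^esub>}" by (simp add: submod_def lmod_smult_zero[OF Xm(1)])
  then obtain Q :: "('r, 'k univ) module" and q where Q: "left_module R Q" "q \<in> lin_hom R X Q"
    "q ` carrier X = carrier Q" "\<And>x. x \<in> carrier X \<Longrightarrow> q x = \<zero>\<^bsub>Q\<^esub> \<longleftrightarrow> x \<in> {\<zero>\<^bsub>X\<^esub>}"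
    using quotient_copy[OF R Xm] by metis
  have "inj_on q (carrier X)" unfolding lin_hom_inj_iff[OF Q(2) Xm(1) Q(1)] using Q(4) by simp
  then have "q \<in> lin_iso R X Q" using Q(2,3) by (simp add: lin_iso_def bij_betw_def)
  then show ?thesis using that fg_module_image[OF X Q(2,3,1)] by blast
qed

text \<open>\<open>F\<close> consists of the functions supported on a finite generating set
  \<open>B\<close>. Its identity is the sum over \<open>B\<close> of the coordinate functional at
  \<open>b\<close> times the indicator of \<open>b\<close>.\<close>

lemma free_cover:
  fixes X :: "('r, 'x, 'z) module_scheme" (structure)
  assumes X: "left_module R X" "fin_gen R X"
  obtains F :: "('r, 'x \<Rightarrow> 'r) module" and p where "left_module R F" "fgproj R F"
    "p \<in> lin_hom R F X" "p ` carrier F = carrier X"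
proof -
  interpret X: abelian_group X by (rule lmod_abelian_group[OF X(1)])
  interpret R: ring R by (rule left_module_ring[OF X(1)])
  obtain B where B: "finite B" "B \<subseteq> carrier X"
    "\<And>x. x \<in> carrier X \<Longrightarrow> \<exists>c \<in> B \<rightarrow> carrier R. x = (\<Oplus>b\<in>B. c b \<odot> b)"
    using X(2) unfolding fin_gen_def by auto
  define C where "C = {c :: 'x \<Rightarrow> 'r. (\<forall>x. c x \<in> carrier R) \<and> (\<forall>x. x \<notin> B \<longrightarrow> c x = \<zero>\<^bsub>R\<^esub>)}"
  define F :: "('r, 'x \<Rightarrow> 'r) module" where "F = \<lparr>carrier = C, mult = undefined, one = undefined,
    ring.zero = (\<lambda>_. \<zero>\<^bsub>R\<^esub>), add = (\<lambda>u v x. u x \<oplus>\<^bsub>R\<^esub> v x), smult = (\<lambda>a u x. a \<otimes>\<^bsub>R\<^esub> u x)\<rparr>"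
  have Fs: "carrier F = C" "\<zero>\<^bsub>F\<^esub> = (\<lambda>_. \<zero>\<^bsub>R\<^esub>)" "add F = (\<lambda>u v x. u x \<oplus>\<^bsub>R\<^esub> v x)"
    "smult F = (\<lambda>a u x. a \<otimes>\<^bsub>R\<^esub> u x)" by (simp_all add: F_def)
  have Cc: "c x \<in> carrier R" if "c \<in> C" for c x using that by (simp add: C_def)
  have "abelian_group F"
  proof (rule abelian_groupI)
    fix x assume x: "x \<in> carrier F"
    show "\<exists>y \<in> carrier F. y \<oplus>\<^bsub>F\<^esub> x = \<zero>\<^bsub>F\<^esub>"
      by (intro bexI[of _ "\<lambda>i. \<ominus>\<^bsub>R\<^esub> x i"]) (use x in \<open>auto simp: Fs C_def R.l_neg fun_eq_iff\<close>)
  qed (auto simp: Fs C_def R.a_ac fun_eq_iff)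
  then have F: "left_module R F"
    by (rule left_moduleI[OF R.ring_axioms]) (auto simp: Fs C_def R.l_distr R.r_distr R.m_assoc fun_eq_iff)
  define p where "p c = (\<Oplus>b\<in>B. c b \<odot> b)" for c
  have pc: "(\<lambda>b. c b \<odot> b) \<in> B \<rightarrow> carrier X" if "c \<in> C" for c
    using B(2) Cc[OF that] by (auto simp: lmod_smult[OF X(1)])
  have p: "p \<in> lin_hom R F X"
  proof (rule lin_homI)
    fix c assume "c \<in> carrier F" then show "p c \<in> carrier X" by (simp add: p_def Fs pc)
  next
    fix c d assume cd: "c \<in> carrier F" "d \<in> carrier F"
    have "p (c \<oplus>\<^bsub>F\<^esub> d) = (\<Oplus>b\<in>B. c b \<odot> b \<oplus> d b \<odot> b)"
      unfolding p_def using cd pc B(2)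
      by (intro X.finsum_cong') (auto simp: Fs Cc lmod_l_distr[OF X(1)] lmod_smult[OF X(1)])
    also have "\<dots> = p c \<oplus> p d" unfolding p_def using cd pc by (intro X.finsum_addf) (auto simp: Fs)
    finally show "p (c \<oplus>\<^bsub>F\<^esub> d) = p c \<oplus> p d" .
  next
    fix a c assume ac: "a \<in> carrier R" "c \<in> carrier F"
    have "p (a \<odot>\<^bsub>F\<^esub> c) = (\<Oplus>b\<in>B. a \<odot> (c b \<odot> b))"
      unfolding p_def using ac pc B(2)
      by (intro X.finsum_cong') (auto simp: Fs Cc lmod_assoc[OF X(1)] lmod_smult[OF X(1)])
    also have "\<dots> = a \<odot> p c"
      unfolding p_def using ac(2) pc
      by (intro addhom_finsum[OF smult_addhom[OF X(1) ac(1)], symmetric]) (auto simp: Fs B X.abelian_group_axioms)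
    finally show "p (a \<odot>\<^bsub>F\<^esub> c) = a \<odot> p c" .
  qed
  have ps: "p ` carrier F = carrier X"
  proof
    show "p ` carrier F \<subseteq> carrier X" by (auto simp: lin_hom_closed[OF p])
    show "carrier X \<subseteq> p ` carrier F"
    proof
      fix x assume "x \<in> carrier X"
      then obtain c where c: "c \<in> B \<rightarrow> carrier R" "x = (\<Oplus>b\<in>B. c b \<odot> b)" using B(3) by auto
      define c' where "c' i = (if i \<in> B then c i else \<zero>\<^bsub>R\<^esub>)" for i
      have "c' \<in> carrier F" using c(1) by (auto simp: c'_def Fs C_def Pi_iff)
      moreover have "x = p c'"
        unfolding c(2) p_def using c(1) B(2)
        by (intro X.finsum_cong') (auto simp: c'_def lmod_smult[OF X(1)] Pi_iff)
      ultimately show "x \<in> p ` carrier F" by auto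
    qed
  qed
  \<comment> \<open>Truncation to a subset \<open>A\<close> of \<open>B\<close>, enlarged by one
    coordinate at a time; for \<open>A = B\<close> it is the identity.\<close>
  have "finite_rank R F F (\<lambda>c x. if x \<in> A then c x else \<zero>\<^bsub>R\<^esub>)" if "A \<subseteq> B" for A
    using finite_subset[OF that B(1)] that
  proof (induction A rule: finite_induct)
    case empty
    show ?case by (rule finite_rank_zero) (simp add: Fs)
  next
    case (insert b A)
    let ?d = "\<lambda>x. if x = b then \<one>\<^bsub>R\<^esub> else \<zero>\<^bsub>R\<^esub>"
    show ?case
    proof (rule finite_rank_step)
      show "finite_rank R F F (\<lambda>c x. if x \<in> A then c x else \<zero>\<^bsub>R\<^esub>)" using insert by simp
      show "(\<lambda>c. c b) \<in> functionals R F" by (auto intro!: functionalsI addhomI simp: Fs Cc)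
      show "?d \<in> carrier F" using insert.prems by (auto simp: Fs C_def)
      fix c assume "c \<in> carrier F"
      then show "(\<lambda>x. if x \<in> insert b A then c x else \<zero>\<^bsub>R\<^esub>) =
          c b \<odot>\<^bsub>F\<^esub> ?d \<oplus>\<^bsub>F\<^esub> (\<lambda>x. if x \<in> A then c x else \<zero>\<^bsub>R\<^esub>)"
        using insert(2) by (auto simp: Fs Cc fun_eq_iff)
    qed
  qed
  from this[of B] have "fgproj R F"
    by (rule finite_rank_cong) (auto simp: Fs C_def fun_eq_iff)
  then show ?thesis using that F p ps by blast
qed

lemma projectiveD:
  fixes R :: "('k, 'r) module" and X Y :: "('r, 'k univ) module"
  assumes "projective R P" "left_module R X" "left_module R Y" "p \<in> lin_hom R X Y"
    "p ` carrier X = carrier Y" "f \<in> lin_hom R P Y"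
  obtains h where "h \<in> lin_hom R P X" "\<And>x. x \<in> carrier P \<Longrightarrow> p (h x) = f x"
proof -
  have "\<exists>h \<in> lin_hom R P X. \<forall>x \<in> carrier P. p (h x) = f x"
    using assms(1) unfolding projective_def using assms(2-) by (elim conjE allE impE) (intro conjI)
  then show ?thesis using that by auto
qed

text \<open>\<open>P\<close> is a retract of a finite free module. The lifting property in
  \<open>projective\<close> concerns modules of the universe, so the free cover and \<open>P\<close>
  itself are copied there before the cover is split.\<close>

lemma projective_fgproj:
  fixes R :: "('k, 'r) module" and P :: "('r, 'p, 'z) module_scheme"
  assumes R: "small_ring R" and P: "fin_gen R P" "projective R P"
  shows "fgproj R P"
proof -
  have Pm: "left_module R P" using P(2) by (simp add: projective_def)
  then have Pf: "fg_module R P" using P(1) by (simp add: fg_module_def)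
  obtain F :: "('r, 'p \<Rightarrow> 'r) module" and p where F: "left_module R F" "fgproj R F"
    "p \<in> lin_hom R F P" "p ` carrier F = carrier P" using free_cover[OF Pm P(1)] by metis
  have "fg_module R F" using F(1) fgproj_fin_gen[OF F(2,1)] by (simp add: fg_module_def)
  then obtain F0 :: "('r, 'k univ) module" and u where F0: "fg_module R F0" "u \<in> lin_iso R F F0"
    by (rule univ_copy[OF R])
  obtain P0 :: "('r, 'k univ) module" and v where P0: "fg_module R P0" "v \<in> lin_iso R P P0"
    by (rule univ_copy[OF R Pf])
  note u = lin_iso_inverse[OF F0(2) F(1)] lin_isoD[OF F0(2)]
  note v = lin_iso_inverse[OF P0(2) Pm] lin_isoD[OF P0(2)]
  let ?u = "inv_into (carrier F) u" and ?v = "inv_into (carrier P) v"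
  let ?p = "\<lambda>x. v (p (?u x))"
  have "?p \<in> lin_hom R F0 P0"
    using lin_hom_comp[OF lin_hom_comp[OF lin_isoD(1)[OF u(1)] F(3)] v(5)] .
  moreover have "?p ` carrier F0 = carrier P0"
  proof -
    have "?p ` carrier F0 = v ` p ` ?u ` carrier F0" by (simp add: image_image)
    then show ?thesis using lin_isoD(3)[OF u(1)] F(4) v(7) by simp
  qed
  ultimately obtain h where h: "h \<in> lin_hom R P F0" "\<And>x. x \<in> carrier P \<Longrightarrow> ?p (h x) = v x"
    by (rule projectiveD[OF P(2) fg_moduleD(1)[OF F0(1)] fg_moduleD(1)[OF P0(1)] _ _ v(5)]) blast
  have "finite_rank R P P (\<lambda>x. p (?u (h x)))"
    using finite_rank_through[OF F(2) lin_hom_comp[OF h(1) lin_isoD(1)[OF u(1)]] F(3) F(1) Pm] .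
  then show ?thesis
  proof (rule finite_rank_cong)
    fix x assume x: "x \<in> carrier P"
    have "p (?u (h x)) \<in> carrier P" using h(1) x u(4) F(3) by (simp add: lin_hom_closed)
    then have "?v (?p (h x)) = p (?u (h x))" by (rule v(2))
    then show "p (?u (h x)) = x" unfolding h(2)[OF x] v(2)[OF x] by simp
  qed
qed

text \<open>The cover is a copy of a finite free module and in general not a minimal one.\<close>

lemma projective_cover:
  fixes R :: "('k, 'r) module" and X :: "('r, 'x, 'z) module_scheme"
  assumes R: "small_ring R" and X: "fg_module R X"
  obtains P :: "('r, 'k univ) module" and p where "fg_module R P" "fgproj R P"
    "p \<in> lin_hom R P X" "p ` carrier P = carrier X"
proof -
  obtain F :: "('r, 'x \<Rightarrow> 'r) module" and p where F: "left_module R F" "fgproj R F"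
    "p \<in> lin_hom R F X" "p ` carrier F = carrier X" using free_cover[OF fg_moduleD[OF X]] by metis
  have "fg_module R F" using F(1) fgproj_fin_gen[OF F(2,1)] by (simp add: fg_module_def)
  then obtain F0 :: "('r, 'k univ) module" and u where F0: "fg_module R F0" "u \<in> lin_iso R F F0"
    by (rule univ_copy[OF R])
  note u = lin_iso_inverse[OF F0(2) F(1)] lin_isoD[OF F0(2)]
  show ?thesis
  proof (rule that[OF F0(1)])
    show "fgproj R F0" using fgproj_iso[OF F(2) F0(2) F(1) fg_moduleD(1)[OF F0(1)]] .
    show "(\<lambda>x. p (inv_into (carrier F) u x)) \<in> lin_hom R F0 X"
      using lin_hom_comp[OF lin_isoD(1)[OF u(1)] F(3)] .
    show "(\<lambda>x. p (inv_into (carrier F) u x)) ` carrier F0 = carrier X"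
      using lin_isoD(3)[OF u(1)] F(4) by (simp add: image_image[symmetric])
  qed
qed

lemma factors_projective_finite_rank:
  fixes R :: "('k, 'r) module"
  assumes R: "small_ring R" and m: "left_module R Y" and f: "factors_projective R X Y h"
  shows "finite_rank R X Y h"
proof -
  obtain P :: "('r, 'k univ) module" and a b where P: "fg_module R P" "projective R P"
    "a \<in> lin_hom R X P" "b \<in> lin_hom R P Y" "\<forall>x \<in> carrier X. h x = b (a x)"
    using f unfolding factors_projective_def by auto
  have "finite_rank R X Y (\<lambda>x. b (a x))"
    using finite_rank_through[OF projective_fgproj[OF R fg_moduleD(2)[OF P(1)] P(2)] P(3,4) fg_moduleD(1)[OF P(1)] m] .
  then show ?thesis by (rule finite_rank_cong) (simp add: P(5))
qed

section \<open>Finite-dimensional algebras\<close>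

text \<open>Gaussian elimination on a finite-rank map \<open>h\<close> that is the identity on
  \<open>U\<close>. If the outermost functional vanishes on \<open>U\<close>, then \<open>h\<close>
  may be shortened; otherwise a vector of \<open>U\<close> with value 1 is split off, and the
  induction goes on with the kernel of the functional in \<open>U\<close>.\<close>

lemma subspace_retraction:
  fixes V (structure)
  assumes K: "field K" and V: "left_module K V" and h: "finite_rank K V V h" and U: "submod K V U"
    and hU: "\<And>x. x \<in> U \<Longrightarrow> h x = x"
  shows "\<exists>r. finite_rank K V (V\<lparr>carrier := U\<rparr>) r \<and> (\<forall>x \<in> U. r x = x)"
  using h U hU
proof (induction arbitrary: U)
  case (finite_rank_zero h)
  have "finite_rank K V (V\<lparr>carrier := U\<rparr>) h"
    using finite_rank_zero.hyps by (intro finite_rank.finite_rank_zero) simp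
  then show ?case using finite_rank_zero.prems(2) by auto
next
  case (finite_rank_step h f y h')
  interpret K: field K by fact
  interpret V: abelian_group V by (rule lmod_abelian_group[OF V])
  note lm = left_moduleD[OF V] and f = functionalsD[OF finite_rank_step.hyps(2)]
  note U = finite_rank_step.prems(1)
  have Uc: "x \<in> carrier V" if "x \<in> U" for x using U that by (auto simp: submod_def)
  have hx: "h x = x" if x: "x \<in> U" "f x = \<zero>\<^bsub>K\<^esub>" for x
    using finite_rank_step.hyps(4)[OF Uc[OF x(1)]] finite_rank_step.prems(2)[OF x(1)] x(2) finite_rank_step.hyps(3)
      finite_rank_closed[OF finite_rank_step.hyps(1) V Uc[OF x(1)]] by (simp add: lmod_zero_smult[OF V])
  show ?case
  proof (cases "\<forall>x \<in> U. f x = \<zero>\<^bsub>K\<^esub>")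
    case True
    then show ?thesis by (intro finite_rank_step.IH[OF U] hx) simp_all
  next
    case False
    then obtain u where u: "u \<in> U" "f u \<noteq> \<zero>\<^bsub>K\<^esub>" by auto
    define v where "v = inv\<^bsub>K\<^esub> f u \<odot> u"
    have i: "inv\<^bsub>K\<^esub> f u \<in> carrier K" "inv\<^bsub>K\<^esub> f u \<otimes>\<^bsub>K\<^esub> f u = \<one>\<^bsub>K\<^esub>"
      using f(2)[OF Uc[OF u(1)]] u(2) K.field_Units by auto
    have v: "v \<in> U" "f v = \<one>\<^bsub>K\<^esub>"
      using U u(1) i f(4)[OF i(1) Uc[OF u(1)]] by (simp_all add: v_def submod_def)
    \<comment> \<open>Projection along \<open>v\<close>, with f v = 1, onto the kernel of
      \<open>f\<close>; it maps \<open>U\<close> into \<open>?W\<close>. The retraction onto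
      \<open>U\<close> will be f x v + r (?p x).\<close>
    let ?p = "\<lambda>x. x \<ominus> f x \<odot> v" and ?W = "{x \<in> U. f x = \<zero>\<^bsub>K\<^esub>}"
    have fv: "(\<lambda>x. f x \<odot> v) \<in> lin_hom K V V" by (rule lin_homI) (simp_all add: f lm Uc[OF v(1)])
    note p = lin_hom_minus[OF lin_hom_id fv V]
    have f0: "f \<zero> = \<zero>\<^bsub>K\<^esub>" by (rule addhom_zero[OF f(1) V.abelian_group_axioms K.abelian_group_axioms])
    have W: "submod K V ?W" using U by (auto simp: submod_def subset_iff f f0)
    have pW: "?p x \<in> ?W" if x: "x \<in> U" for x
    proof -
      note xc = Uc[OF x]
      have fx: "f x \<odot> v \<in> U" using U v(1) f(2)[OF xc] by (simp add: submod_def)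
      have "f (?p x) = f x \<ominus>\<^bsub>K\<^esub> f (f x \<odot> v)"
        using addhom_diff[OF f(1) V.abelian_group_axioms K.abelian_group_axioms xc Uc[OF fx]] .
      then show ?thesis using submod_diff[OF U V x fx] f(2)[OF xc] f(4)[OF f(2)[OF xc] Uc[OF v(1)]] v(2) by simp
    qed
    have hW: "h x = x" if "x \<in> ?W" for x using hx that by simp
    obtain r where r: "finite_rank K V (V\<lparr>carrier := ?W\<rparr>) r" "\<And>x. x \<in> ?W \<Longrightarrow> r x = x"
      using finite_rank_step.IH[OF W hW] by blast
    have j: "(\<lambda>x. x) \<in> lin_hom K (V\<lparr>carrier := ?W\<rparr>) (V\<lparr>carrier := U\<rparr>)" by (rule lin_homI) simp_all
    have "finite_rank K V (V\<lparr>carrier := U\<rparr>) (\<lambda>x. r (?p x))"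
      by (rule finite_rank_comp_left[OF finite_rank_comp_right[OF r(1) p] submod_left_module[OF W V] submod_left_module[OF U V] j])
    then have "finite_rank K V (V\<lparr>carrier := U\<rparr>) (\<lambda>x. f x \<odot> v \<oplus> r (?p x))"
      by (rule finite_rank.finite_rank_step[OF _ finite_rank_step.hyps(2)]) (simp_all add: v(1))
    moreover have "f x \<odot> v \<oplus> r (?p x) = x" if x: "x \<in> U" for x
      unfolding r(2)[OF pW[OF x]] using Uc[OF x] Uc[OF v(1)] f(2) by (simp add: V.add_diff_cancel' lm)
    ultimately show ?thesis by blast
  qed
qed

text \<open>The kernel of a free cover has a retraction \<open>r\<close>. Then x - r x depends only
  on the image of \<open>x\<close>, which gives a section of the cover.\<close>

lemma vector_space_fgproj:
  fixes V :: "('k, 'v, 'z) module_scheme"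
  assumes K: "field K" and V: "left_module K V" "fin_gen K V"
  shows "fgproj K V"
proof -
  obtain F :: "('k, 'v \<Rightarrow> 'k) module" and p where F: "left_module K F" "fgproj K F" "p \<in> lin_hom K F V" "p ` carrier F = carrier V"
    by (rule free_cover[OF V])
  let ?U = "a_kernel F V p"
  note U = kernel_submod[OF F(3,1) V(1)]
  interpret F: abelian_group F by (rule lmod_abelian_group[OF F(1)])
  interpret V: abelian_group V by (rule lmod_abelian_group[OF V(1)])
  obtain r where r: "finite_rank K F (F\<lparr>carrier := ?U\<rparr>) r" "\<And>x. x \<in> ?U \<Longrightarrow> r x = x"
    using subspace_retraction[OF K F(1,2) U] by auto
  have k: "x \<in> ?U \<longleftrightarrow> x \<in> carrier F \<and> p x = \<zero>\<^bsub>V\<^esub>" for x by (simp add: a_kernel_def')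
  note rU = finite_rank_lin_hom[OF r(1) F(1) submod_left_module[OF U F(1)]]
  have rl: "r \<in> lin_hom K F F" by (rule lin_hom_extend_codomain[OF rU]) (auto simp: k)
  obtain s where s: "s \<in> lin_hom K V F" "\<And>x. x \<in> carrier F \<Longrightarrow> s (p x) = x \<ominus>\<^bsub>F\<^esub> r x"
    by (rule lin_hom_factor_surj[OF F(3,4) lin_hom_minus[OF lin_hom_id rl F(1)] F(1) V(1) F(1)]) (simp_all add: r k)
  show ?thesis
  proof (rule finite_rank_cong[OF finite_rank_through[OF F(2) s(1) F(3,1) V(1)]])
    fix v assume "v \<in> carrier V"
    then obtain x where x: "x \<in> carrier F" "p x = v" using surj_obtain[OF F(4)] by blast
    have "p (r x) = \<zero>\<^bsub>V\<^esub>" using lin_hom_closed[OF rU x(1)] by (simp add: k)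
    then show "p (s v) = v"
      using lin_hom_diff[OF F(3,1) V(1) x(1) lin_hom_closed[OF rl x(1)]] s(2)[OF x(1)] x lin_hom_closed[OF F(3) x(1)] by simp
  qed
qed

lemma subspace_fgproj:
  assumes K: "field K" and V: "left_module K V" "fin_gen K V" and U: "submod K V U"
  shows "fgproj K (V\<lparr>carrier := U\<rparr>)"
proof -
  obtain r where r: "finite_rank K V (V\<lparr>carrier := U\<rparr>) r" "\<And>x. x \<in> U \<Longrightarrow> r x = x"
    using subspace_retraction[OF K V(1) vector_space_fgproj[OF K V] U] by auto
  have "U \<subseteq> carrier V" using U by (simp add: submod_def)
  then show ?thesis
    by (intro finite_rank_cong[OF finite_rank_comp_right[OF r(1) lin_hom_restrict_domain[OF lin_hom_id]]]) (simp_all add: r)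
qed

section \<open>Restriction of scalars to the ground field\<close>

definition scalar_module ::
  "('k, 'r, 'w) module_scheme \<Rightarrow> ('r, 'x, 'z) module_scheme \<Rightarrow> ('k, 'x) module"
where
  "scalar_module R X = \<lparr>carrier = carrier X, mult = undefined, one = undefined,
     ring.zero = \<zero>\<^bsub>X\<^esub>, add = add X, smult = (\<lambda>c x. (c \<odot>\<^bsub>R\<^esub> \<one>\<^bsub>R\<^esub>) \<odot>\<^bsub>X\<^esub> x)\<rparr>"

lemma scalar_module_simps [simp]:
  "carrier (scalar_module R X) = carrier X" "add (scalar_module R X) = add X"
  "\<zero>\<^bsub>scalar_module R X\<^esub> = \<zero>\<^bsub>X\<^esub>"
  "c \<odot>\<^bsub>scalar_module R X\<^esub> x = (c \<odot>\<^bsub>R\<^esub> \<one>\<^bsub>R\<^esub>) \<odot>\<^bsub>X\<^esub> x"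
  by (simp_all add: scalar_module_def)

context fd_algebra
begin

lemma field_K: "field K" ..

lemma ring_L: "ring L" ..

lemma scalar_closed: "c \<in> carrier K \<Longrightarrow> c \<odot>\<^bsub>L\<^esub> \<one>\<^bsub>L\<^esub> \<in> carrier L"
  by (rule smult_closed) auto

lemma scalar_mult: "\<lbrakk>c \<in> carrier K; a \<in> carrier L\<rbrakk> \<Longrightarrow> (c \<odot>\<^bsub>L\<^esub> \<one>\<^bsub>L\<^esub>) \<otimes>\<^bsub>L\<^esub> a = c \<odot>\<^bsub>L\<^esub> a"
  using smult_mult_left[of c "\<one>\<^bsub>L\<^esub>" a] by simp

lemma mult_scalar: "\<lbrakk>c \<in> carrier K; a \<in> carrier L\<rbrakk> \<Longrightarrow> a \<otimes>\<^bsub>L\<^esub> (c \<odot>\<^bsub>L\<^esub> \<one>\<^bsub>L\<^esub>) = c \<odot>\<^bsub>L\<^esub> a"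
  using smult_mult_right[of c a "\<one>\<^bsub>L\<^esub>"] by simp

lemma left_module_K: "left_module K L"
  by (rule left_moduleI)
    (simp_all add: K.ring_axioms ring_abelian_group[OF ring_L] smult_l_distr smult_r_distr smult_assoc1)

lemma fgproj_K: "fgproj K L"
  by (rule vector_space_fgproj[OF field_K left_module_K finite_dimensional])

lemma scalar_left_module:
  assumes "left_module L X"
  shows "left_module K (scalar_module L X)"
proof (rule left_moduleI)
  interpret X: abelian_group X by (rule lmod_abelian_group[OF assms])
  note lm = left_moduleD[OF assms]
  show "abelian_group (scalar_module L X)"
  proof (rule abelian_groupI)
    fix x assume "x \<in> carrier (scalar_module L X)"
    then show "\<exists>y \<in> carrier (scalar_module L X). y \<oplus>\<^bsub>scalar_module L X\<^esub> x = \<zero>\<^bsub>scalar_module L X\<^esub>"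
      by (intro bexI[of _ "\<ominus>\<^bsub>X\<^esub> x"]) (simp_all add: X.l_neg)
  qed (simp_all add: X.a_ac)
  fix a b x y
  assume "a \<in> carrier K" "b \<in> carrier K" "x \<in> carrier (scalar_module L X)"
  then show "(a \<otimes>\<^bsub>K\<^esub> b) \<odot>\<^bsub>scalar_module L X\<^esub> x = a \<odot>\<^bsub>scalar_module L X\<^esub> (b \<odot>\<^bsub>scalar_module L X\<^esub> x)"
    by (simp add: lm scalar_closed lmod_assoc[OF assms, symmetric] scalar_mult smult_assoc1)
qed (simp_all add: left_moduleD[OF assms] scalar_closed smult_l_distr K.ring_axioms)

text \<open>The products of \<open>K\<close>-generators of \<open>L\<close> with
  \<open>L\<close>-generators of \<open>X\<close> generate \<open>X\<close> over
  \<open>K\<close>.\<close>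

lemma scalar_fin_gen:
  assumes X: "left_module L X" "fin_gen L X"
  shows "fin_gen K (scalar_module L X)"
proof -
  note lm = left_moduleD[OF X(1)]
  interpret X: abelian_group X by (rule lmod_abelian_group[OF X(1)])
  let ?X = "scalar_module L X"
  obtain B where B: "finite B" "B \<subseteq> carrier X" "carrier X \<subseteq> rspan L X B"
    using X(2) fin_gen_rspan[OF X(1)] by auto
  obtain E where E: "finite E" "E \<subseteq> carrier L" "carrier L \<subseteq> rspan K L E"
    using finite_dimensional fin_gen_rspan[OF left_module_K] by auto
  let ?C = "(\<lambda>(e, b). e \<odot>\<^bsub>X\<^esub> b) ` (E \<times> B)"
  have Cc: "?C \<subseteq> carrier X" using E(2) B(2) by (auto simp: subset_iff lm)
  have "x \<in> rspan K ?X ?C" if "x \<in> rspan L X B" for x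
    using that
  proof induction
    case rspan_zero
    show ?case using rspan.rspan_zero[of ?X] by simp
  next
    case (rspan_step a b v)
    have b: "b \<in> carrier X" and v: "v \<in> carrier X"
      using rspan_step(2) B(2) rspan_closed[OF X(1) B(2) rspan_step(3)] by auto
    have "a \<in> rspan K L E" using rspan_step(1) E(3) by auto
    then show ?case
    proof induction
      case rspan_zero
      show ?case using rspan_step b v by (simp add: lmod_zero_smult[OF X(1)])
    next
      case (rspan_step c e a)
      have a: "a \<in> carrier L" "e \<in> carrier L"
        using rspan_closed[OF left_module_K E(2) rspan_step(3)] rspan_step(2) E(2) by auto
      have "(c \<odot>\<^bsub>L\<^esub> e \<oplus>\<^bsub>L\<^esub> a) \<odot>\<^bsub>X\<^esub> b \<oplus>\<^bsub>X\<^esub> v = c \<odot>\<^bsub>?X\<^esub> (e \<odot>\<^bsub>X\<^esub> b) \<oplus>\<^bsub>?X\<^esub> (a \<odot>\<^bsub>X\<^esub> b \<oplus>\<^bsub>X\<^esub> v)"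
        using a b v rspan_step(1)
        by (simp add: lm scalar_closed lmod_assoc[OF X(1), symmetric] scalar_mult X.a_assoc)
      then show ?case
        using rspan.rspan_step[of c K "e \<odot>\<^bsub>X\<^esub> b" ?C "a \<odot>\<^bsub>X\<^esub> b \<oplus>\<^bsub>X\<^esub> v" ?X]
          rspan_step \<open>b \<in> B\<close> by auto
    qed
  qed
  then show ?thesis
    unfolding fin_gen_rspan[OF scalar_left_module[OF X(1)]]
    using B(3) E(1) B(1) Cc by (intro exI[of _ ?C]) auto
qed

text \<open>Finite-dimensional algebras are noetherian: a submodule is a subspace of a
  finite-dimensional space, and its generators over \<open>K\<close> also generate it over
  \<open>L\<close>.\<close>

lemma fg_module_submod:
  assumes X: "fg_module L X" and U: "submod L X U"
  shows "fg_module L (X\<lparr>carrier := U\<rparr>)"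
proof -
  note Xm = fg_moduleD[OF X]
  let ?X = "scalar_module L X"
  have sU: "submod K ?X U" using U by (simp add: submod_def scalar_closed)
  have lU: "left_module L (X\<lparr>carrier := U\<rparr>)" using submod_left_module[OF U Xm(1)] .
  have kU: "left_module K (?X\<lparr>carrier := U\<rparr>)"
    using submod_left_module[OF sU scalar_left_module[OF Xm(1)]] .
  have "fgproj K (?X\<lparr>carrier := U\<rparr>)"
    using subspace_fgproj[OF field_K scalar_left_module[OF Xm(1)] scalar_fin_gen[OF Xm] sU] .
  then have "fin_gen K (?X\<lparr>carrier := U\<rparr>)" using kU by (rule fgproj_fin_gen)
  then obtain B where B: "finite B" "B \<subseteq> U" "U \<subseteq> rspan K (?X\<lparr>carrier := U\<rparr>) B"
    using fin_gen_rspan[OF kU] by auto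
  have "x \<in> rspan L (X\<lparr>carrier := U\<rparr>) B" if "x \<in> rspan K (?X\<lparr>carrier := U\<rparr>) B" for x
    using that
  proof induction
    case rspan_zero
    show ?case using rspan.rspan_zero[of "X\<lparr>carrier := U\<rparr>"] by simp
  next
    case (rspan_step a b v)
    show ?case
      using rspan.rspan_step[OF scalar_closed[OF rspan_step(1)] rspan_step(2,4)] by simp
  qed
  then show ?thesis
    unfolding fg_module_def fin_gen_rspan[OF lU] using lU B by (intro conjI exI[of _ B]) auto
qed

end

lemma fd_algebra_small_ring:
  fixes K :: "('k, 'c) ring_scheme" and L :: "('k, 'l) module"
  assumes "fd_algebra K L"
  shows "small_ring L"
proof -
  interpret fd_algebra K L by fact
  \<comment> \<open>The field embeds into the universe as constant sequences.\<close>
  have e: "inj_on (\<lambda>c (_ :: nat). c) (carrier K)" by (auto intro!: inj_onI dest: fun_cong)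
  show ?thesis
    unfolding small_ring_def
    using fin_gen_embed[OF e K.ring_axioms ring_abelian_group[OF ring_L] _ finite_dimensional] ring_L
    by simp
qed

section \<open>Tensor products\<close>

definition tensorable :: "('r, 's) ring_scheme \<Rightarrow> ('l, 'r, 'm) bimod \<Rightarrow> ('r, 'y, 'z) module_scheme \<Rightarrow> bool" where
  "tensorable R M Y \<longleftrightarrow> abelian_group M \<and> abelian_group Y \<and>
     (\<forall>m \<in> carrier M. \<forall>r \<in> carrier R. m \<triangleleft>\<^bsub>M\<^esub> r \<in> carrier M) \<and>
     (\<forall>r \<in> carrier R. \<forall>y \<in> carrier Y. r \<odot>\<^bsub>Y\<^esub> y \<in> carrier Y)"

definition balanced ::
  "('r, 's) ring_scheme \<Rightarrow> ('l, 'r, 'm) bimod \<Rightarrow> ('r, 'y, 'z) module_scheme \<Rightarrow> ('g, 'w) ring_scheme \<Rightarrow>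
    ('m \<Rightarrow> 'y \<Rightarrow> 'g) \<Rightarrow> bool"
where
  "balanced R M Y G g \<longleftrightarrow>
     (\<forall>m \<in> carrier M. g m \<in> addhom Y G) \<and> (\<forall>y \<in> carrier Y. (\<lambda>m. g m y) \<in> addhom M G) \<and>
     (\<forall>m \<in> carrier M. \<forall>r \<in> carrier R. \<forall>y \<in> carrier Y. g (m \<triangleleft>\<^bsub>M\<^esub> r) y = g m (r \<odot>\<^bsub>Y\<^esub> y))"

lemma balancedI:
  assumes "\<And>m y. \<lbrakk>m \<in> carrier M; y \<in> carrier Y\<rbrakk> \<Longrightarrow> g m y \<in> carrier G"
    "\<And>m y y'. \<lbrakk>m \<in> carrier M; y \<in> carrier Y; y' \<in> carrier Y\<rbrakk> \<Longrightarrow> g m (y \<oplus>\<^bsub>Y\<^esub> y') = g m y \<oplus>\<^bsub>G\<^esub> g m y'"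
    "\<And>m m' y. \<lbrakk>m \<in> carrier M; m' \<in> carrier M; y \<in> carrier Y\<rbrakk> \<Longrightarrow> g (m \<oplus>\<^bsub>M\<^esub> m') y = g m y \<oplus>\<^bsub>G\<^esub> g m' y"
    "\<And>m r y. \<lbrakk>m \<in> carrier M; r \<in> carrier R; y \<in> carrier Y\<rbrakk> \<Longrightarrow> g (m \<triangleleft>\<^bsub>M\<^esub> r) y = g m (r \<odot>\<^bsub>Y\<^esub> y)"
  shows "balanced R M Y G g"
  using assms by (auto simp: balanced_def intro!: addhomI)

lemma balancedD:
  assumes "balanced R M Y G g"
  shows "\<lbrakk>m \<in> carrier M; y \<in> carrier Y\<rbrakk> \<Longrightarrow> g m y \<in> carrier G"
    "\<lbrakk>m \<in> carrier M; y \<in> carrier Y; y' \<in> carrier Y\<rbrakk> \<Longrightarrow> g m (y \<oplus>\<^bsub>Y\<^esub> y') = g m y \<oplus>\<^bsub>G\<^esub> g m y'"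
    "\<lbrakk>m \<in> carrier M; m' \<in> carrier M; y \<in> carrier Y\<rbrakk> \<Longrightarrow> g (m \<oplus>\<^bsub>M\<^esub> m') y = g m y \<oplus>\<^bsub>G\<^esub> g m' y"
    "\<lbrakk>m \<in> carrier M; r \<in> carrier R; y \<in> carrier Y\<rbrakk> \<Longrightarrow> g (m \<triangleleft>\<^bsub>M\<^esub> r) y = g m (r \<odot>\<^bsub>Y\<^esub> y)"
  using assms unfolding balanced_def addhom_def by auto

section \<open>Universal property of the tensor product\<close>

locale tensor_product =
  fixes R :: "('r, 's) ring_scheme" and M :: "('l, 'r, 'm) bimod" and Y :: "('r, 'y, 'z) module_scheme"
  assumes tensorable: "tensorable R M Y"
begin

abbreviation "F \<equiv> tens_free M Y"
abbreviation "H \<equiv> tens_rel R M Y"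
abbreviation "T \<equiv> tens_group R M Y"
abbreviation "cls t \<equiv> H #>\<^bsub>F\<^esub> t"

lemma abM: "abelian_group M" and abY: "abelian_group Y"
  and act_closed: "\<lbrakk>m \<in> carrier M; r \<in> carrier R\<rbrakk> \<Longrightarrow> m \<triangleleft>\<^bsub>M\<^esub> r \<in> carrier M"
    "\<lbrakk>r \<in> carrier R; y \<in> carrier Y\<rbrakk> \<Longrightarrow> r \<odot>\<^bsub>Y\<^esub> y \<in> carrier Y"
  using tensorable by (auto simp: tensorable_def)

sublocale M: abelian_group M by (rule abM)
sublocale Y: abelian_group Y by (rule abY)

sublocale F: comm_group F
  unfolding tens_free_def by (rule abelian_free_Abelian_group)

lemma F_simps [simp]:
  "x \<in> carrier F \<longleftrightarrow> Poly_Mapping.keys x \<subseteq> carrier M \<times> carrier Y"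
  "x \<otimes>\<^bsub>F\<^esub> y = x + y" "\<one>\<^bsub>F\<^esub> = 0"
  by (simp_all add: tens_free_def)

lemma F_diff: "\<lbrakk>x \<in> carrier F; y \<in> carrier F\<rbrakk> \<Longrightarrow> x - y \<in> carrier F"
  using keys_diff[of x y] by auto

definition "gens = {frag_of (m \<oplus>\<^bsub>M\<^esub> m', y) - frag_of (m, y) - frag_of (m', y) | m m' y.
        m \<in> carrier M \<and> m' \<in> carrier M \<and> y \<in> carrier Y} \<union>
     {frag_of (m, y \<oplus>\<^bsub>Y\<^esub> y') - frag_of (m, y) - frag_of (m, y') | m y y'.
        m \<in> carrier M \<and> y \<in> carrier Y \<and> y' \<in> carrier Y} \<union>
     {frag_of (m \<triangleleft>\<^bsub>M\<^esub> r, y) - frag_of (m, r \<odot>\<^bsub>Y\<^esub> y) | m r y.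
        m \<in> carrier M \<and> r \<in> carrier R \<and> y \<in> carrier Y}"

lemma H_eq: "H = generate F gens"
  by (simp add: tens_rel_def gens_def)

lemma frag_F: "\<lbrakk>m \<in> carrier M; y \<in> carrier Y\<rbrakk> \<Longrightarrow> frag_of (m, y) \<in> carrier F"
  by simp

lemma gens_F: "gens \<subseteq> carrier F"
  unfolding gens_def
  by (intro Un_least subsetI; elim CollectE exE conjE; hypsubst; intro F_diff frag_F)
    (simp_all add: act_closed)

lemma H_subgroup: "subgroup H F"
  unfolding H_eq using gens_F by (rule F.generate_is_subgroup)

lemma H_normal: "H \<lhd> F"
  using H_subgroup by (rule F.subgroup_imp_normal)

lemma T_simps:
  "carrier T = (\<lambda>t. cls t) ` carrier F" "\<zero>\<^bsub>T\<^esub> = H"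
  "\<lbrakk>s \<in> carrier F; t \<in> carrier F\<rbrakk> \<Longrightarrow> cls s \<oplus>\<^bsub>T\<^esub> cls t = cls (s + t)"
  using normal.rcos_sum[OF H_normal, of s t]
  by (auto simp: tens_group_def Let_def carrier_FactGroup)

lemma cls_closed: "t \<in> carrier F \<Longrightarrow> cls t \<in> carrier T"
  by (simp add: T_simps)

lemma cls_H: "t \<in> H \<Longrightarrow> cls t = \<zero>\<^bsub>T\<^esub>"
  using subgroup.rcos_const[OF H_subgroup F.group_axioms] by (simp add: T_simps)

lemma T_abelian_group: "abelian_group T"
proof (rule comm_group_abelian_groupI)
  have "add_monoid T = F Mod H"
    by (simp add: tens_group_def Let_def FactGroup_def)
  then show "comm_group (add_monoid T)"
    using F.abelian_FactGroup[OF H_subgroup] by simp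
qed

sublocale T: abelian_group T by (rule T_abelian_group)

lemma tens_cls: "tens R M Y m y = cls (frag_of (m, y))"
  by (simp add: tens_def)

lemma tens_closed: "\<lbrakk>m \<in> carrier M; y \<in> carrier Y\<rbrakk> \<Longrightarrow> tens R M Y m y \<in> carrier T"
  by (simp add: tens_cls cls_closed)

lemma cls_diff3:
  assumes "a \<in> carrier F" "b \<in> carrier F" "c \<in> carrier F" "a - b - c \<in> H"
  shows "cls a = cls b \<oplus>\<^bsub>T\<^esub> cls c"
proof -
  have bc: "b + c \<in> carrier F" using F.m_closed[OF assms(2,3)] by (simp only: F_simps(2))
  have d: "a - b - c \<in> carrier F" by (intro F_diff assms)
  have "cls (a - b - c) \<oplus>\<^bsub>T\<^esub> cls (b + c) = cls a"
    using T_simps(3)[OF d bc] by (simp add: algebra_simps)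
  then show ?thesis
    using cls_H[OF assms(4)] cls_closed[OF bc] T_simps(3)[OF assms(2,3)] by simp
qed

lemma tens_add_left:
  assumes "m \<in> carrier M" "m' \<in> carrier M" "y \<in> carrier Y"
  shows "tens R M Y (m \<oplus>\<^bsub>M\<^esub> m') y = tens R M Y m y \<oplus>\<^bsub>T\<^esub> tens R M Y m' y"
proof -
  have "frag_of (m \<oplus>\<^bsub>M\<^esub> m', y) - frag_of (m, y) - frag_of (m', y) \<in> H"
    unfolding H_eq gens_def using assms by (intro generate.incl UnI1) blast
  then show ?thesis unfolding tens_cls using assms by (intro cls_diff3) simp_all
qed

lemma tens_add_right:
  assumes "m \<in> carrier M" "y \<in> carrier Y" "y' \<in> carrier Y"
  shows "tens R M Y m (y \<oplus>\<^bsub>Y\<^esub> y') = tens R M Y m y \<oplus>\<^bsub>T\<^esub> tens R M Y m y'"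
proof -
  have "frag_of (m, y \<oplus>\<^bsub>Y\<^esub> y') - frag_of (m, y) - frag_of (m, y') \<in> H"
    unfolding H_eq gens_def using assms by (intro generate.incl UnI1 UnI2) blast
  then show ?thesis unfolding tens_cls using assms by (intro cls_diff3) simp_all
qed

lemma tens_balanced:
  assumes "m \<in> carrier M" "r \<in> carrier R" "y \<in> carrier Y"
  shows "tens R M Y (m \<triangleleft>\<^bsub>M\<^esub> r) y = tens R M Y m (r \<odot>\<^bsub>Y\<^esub> y)"
proof -
  have h: "frag_of (m \<triangleleft>\<^bsub>M\<^esub> r, y) - frag_of (m, r \<odot>\<^bsub>Y\<^esub> y) \<in> H"
    unfolding H_eq gens_def using assms by (intro generate.incl UnI2) blast
  have "tens R M Y (m \<triangleleft>\<^bsub>M\<^esub> r) y = cls (frag_of (m, r \<odot>\<^bsub>Y\<^esub> y)) \<oplus>\<^bsub>T\<^esub> cls 0"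
    unfolding tens_cls using assms h by (intro cls_diff3) (simp_all add: act_closed)
  also have "cls 0 = \<zero>\<^bsub>T\<^esub>" using subgroup.one_closed[OF H_subgroup] by (intro cls_H) simp
  finally show ?thesis using assms by (simp add: tens_cls cls_closed act_closed)
qed

lemma tens_addhom:
  "m \<in> carrier M \<Longrightarrow> tens R M Y m \<in> addhom Y T"
  "y \<in> carrier Y \<Longrightarrow> (\<lambda>m. tens R M Y m y) \<in> addhom M T"
  by (simp_all add: addhomI tens_closed tens_add_left tens_add_right)

text \<open>There is no case for negatives since -(m \<otimes> y) is the pure tensor of -m and
  y.\<close>

lemma tensor_induct [consumes 1, case_names zero tens add]:
  assumes t: "t \<in> carrier T" and z: "P \<zero>\<^bsub>T\<^esub>"
    and g: "\<And>m y. \<lbrakk>m \<in> carrier M; y \<in> carrier Y\<rbrakk> \<Longrightarrow> P (tens R M Y m y)"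
    and a: "\<And>u v. \<lbrakk>u \<in> carrier T; v \<in> carrier T; P u; P v\<rbrakk> \<Longrightarrow> P (u \<oplus>\<^bsub>T\<^esub> v)"
  shows "P t"
proof -
  have c0: "cls 0 = \<zero>\<^bsub>T\<^esub>" using subgroup.one_closed[OF H_subgroup] by (intro cls_H) simp
  have neg: "cls (- t) = \<ominus>\<^bsub>T\<^esub> cls t" if "t \<in> carrier F" for t
  proof -
    have "cls (- t) \<oplus>\<^bsub>T\<^esub> cls t = \<zero>\<^bsub>T\<^esub>" using that by (subst T_simps) (auto simp: c0)
    then show ?thesis using that by (intro T.minus_equality[symmetric]) (simp_all add: cls_closed)
  qed
  \<comment> \<open>Induction over the free group closes under differences, so the claim is carried
    for \<open>x\<close> and \<open>- x\<close> together.\<close>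
  have "P (cls x) \<and> P (cls (- x))" if "Poly_Mapping.keys x \<subseteq> carrier M \<times> carrier Y" for x
    using that
  proof (induction rule: free_Abelian_group_induct[consumes 1])
    case 1
    show ?case using c0 z by simp
  next
    case (2 x y)
    have "cls (x - y) = cls x \<oplus>\<^bsub>T\<^esub> cls (- y)" "cls (- (x - y)) = cls (- x) \<oplus>\<^bsub>T\<^esub> cls y"
      using 2(1,2) by (simp_all add: T_simps)
    then show ?case using 2 by (auto intro!: a cls_closed)
  next
    case (3 p)
    then obtain m y where p: "p = (m, y)" "m \<in> carrier M" "y \<in> carrier Y" by auto
    have "cls (- frag_of p) = tens R M Y (\<ominus>\<^bsub>M\<^esub> m) y"
      using p by (simp add: neg tens_cls[symmetric] addhom_neg[OF tens_addhom(2) abM T_abelian_group])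
    then show ?case using p g by (simp add: tens_cls[symmetric])
  qed
  then show ?thesis using t by (auto simp: T_simps)
qed

lemma addhom_tensor_eq:
  assumes "f \<in> addhom T G" "g \<in> addhom T G" "abelian_group G"
    "\<And>m y. \<lbrakk>m \<in> carrier M; y \<in> carrier Y\<rbrakk> \<Longrightarrow> f (tens R M Y m y) = g (tens R M Y m y)" "t \<in> carrier T"
  shows "f t = g t"
  using assms(5)
  by (induction rule: tensor_induct)
    (simp_all add: assms(4) addhom_zero[OF assms(1) T_abelian_group assms(3)]
      addhom_zero[OF assms(2) T_abelian_group assms(3)] addhom_add[OF assms(1)] addhom_add[OF assms(2)])

text \<open>The map \<open>g\<close> extends to a homomorphism \<open>h\<close> on the free group;
  balancedness says that \<open>h\<close> kills the relations. Hence the value of \<open>h\<close>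
  on a coset does not depend on the representative that \<open>tens_lift\<close> happens to
  choose.\<close>

lemma tens_lift:
  fixes G (structure)
  assumes G: "abelian_group G" and g: "balanced R M Y G g"
  shows tens_lift_addhom: "tens_lift G g \<in> addhom T G"
    and tens_lift_tens: "\<lbrakk>m \<in> carrier M; y \<in> carrier Y\<rbrakk> \<Longrightarrow> tens_lift G g (tens R M Y m y) = g m y"
proof -
  interpret G: abelian_group G by fact
  have gc: "g m y \<in> carrier G" if "m \<in> carrier M" "y \<in> carrier Y" for m y
    using balancedD[OF g] that by simp
  have im: "(\<lambda>p. g (fst p) (snd p)) ` (carrier M \<times> carrier Y) \<subseteq> carrier (add_monoid G)"
    using gc by auto
  obtain h where h: "h \<in> hom F (add_monoid G)"
    "\<And>p. p \<in> carrier M \<times> carrier Y \<Longrightarrow> h (frag_of p) = g (fst p) (snd p)"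
    using comm_group.free_Abelian_group_universal[OF G.a_comm_group im] unfolding tens_free_def by blast
  have hF: "h x \<in> carrier G" if "x \<in> carrier F" for x using h(1) that by (auto simp: hom_def)
  have hadd: "h (x + y) = h x \<oplus> h y" if "x \<in> carrier F" "y \<in> carrier F" for x y
    using h(1) that by (auto simp: hom_def)
  have h0: "h 0 = \<zero>"
    using hadd[of 0 0] hF[of 0] G.add.l_cancel_one'[of "h 0" "h 0"] by simp
  have hd: "h (x - y) = h x \<ominus> h y" if "x \<in> carrier F" "y \<in> carrier F" for x y
    using hadd[OF F_diff[OF that] that(2)] hF[OF that(1)] hF[OF that(2)] hF[OF F_diff[OF that]]
    by (simp add: G.add_diff_cancel)
  have hgen: "h x = \<zero>" if "x \<in> gens" for x
  proof -
    have 3: "h (frag_of (m, y) - frag_of (m', y') - frag_of (m'', y'')) = g m y \<ominus> g m' y' \<ominus> g m'' y''"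
      if "m \<in> carrier M" "m' \<in> carrier M" "m'' \<in> carrier M" "y \<in> carrier Y" "y' \<in> carrier Y" "y'' \<in> carrier Y"
      for m m' m'' y y' y''
      using that by (simp add: hd h(2) F_diff del: F_simps(1) add: frag_F)
    show ?thesis using that unfolding gens_def
    proof (elim UnE CollectE exE conjE)
      fix m m' y assume a: "x = frag_of (m \<oplus>\<^bsub>M\<^esub> m', y) - frag_of (m, y) - frag_of (m', y)"
        "m \<in> carrier M" "m' \<in> carrier M" "y \<in> carrier Y"
      then have "g (m \<oplus>\<^bsub>M\<^esub> m') y = g m y \<oplus> g m' y" using balancedD[OF g] by simp
      with a show ?thesis by (simp add: 3 gc a_minus_def G.minus_add G.a_ac G.r_neg G.r_neg1 G.r_neg2)
    next
      fix m y y' assume a: "x = frag_of (m, y \<oplus>\<^bsub>Y\<^esub> y') - frag_of (m, y) - frag_of (m, y')"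
        "m \<in> carrier M" "y \<in> carrier Y" "y' \<in> carrier Y"
      then have "g m (y \<oplus>\<^bsub>Y\<^esub> y') = g m y \<oplus> g m y'" using balancedD[OF g] by simp
      with a show ?thesis by (simp add: 3 gc a_minus_def G.minus_add G.a_ac G.r_neg G.r_neg1 G.r_neg2)
    next
      fix m r y assume a: "x = frag_of (m \<triangleleft>\<^bsub>M\<^esub> r, y) - frag_of (m, r \<odot>\<^bsub>Y\<^esub> y)"
        "m \<in> carrier M" "r \<in> carrier R" "y \<in> carrier Y"
      then have "g (m \<triangleleft>\<^bsub>M\<^esub> r) y = g m (r \<odot>\<^bsub>Y\<^esub> y)" using balancedD[OF g] by simp
      with a show ?thesis by (simp add: hd h(2) gc act_closed frag_F del: F_simps(1))
    qed
  qed
  have hH: "h x = \<zero>" if "x \<in> H" for x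
    using that unfolding H_eq
  proof induction
    case one show ?case by (simp add: h0)
  next
    case (incl x) then show ?case by (rule hgen)
  next
    case (inv x)
    have x: "x \<in> carrier F" by (rule subsetD[OF gens_F inv])
    have "inv\<^bsub>F\<^esub> x = 0 - x" using x by (simp add: tens_free_def)
    moreover have "h (0 - x) = h 0 \<ominus> h x" by (rule hd) (use x in simp_all)
    ultimately show ?case using hgen[OF inv] h0 by simp
  next
    case (eng x y)
    have "x \<in> carrier F" "y \<in> carrier F"
      by (rule F.generate_in_carrier[OF gens_F], rule eng)+
    then show ?case using eng hadd by simp
  qed
  \<comment> \<open>The finite sum in the definition of \<open>tens_lift\<close> is the value of
    \<open>h\<close> at the chosen representative.\<close>
  have expand: "h t = (\<Oplus>p \<in> Poly_Mapping.keys t. [Poly_Mapping.lookup t p] \<cdot> g (fst p) (snd p))"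
    if t: "t \<in> carrier F" for t
  proof -
    have *: "(\<Sum>p\<in>A. frag_cmul (c p) (frag_of p)) \<in> carrier F \<and>
        h (\<Sum>p\<in>A. frag_cmul (c p) (frag_of p)) = (\<Oplus>p \<in> A. [c p] \<cdot> g (fst p) (snd p))"
      if "finite A" "A \<subseteq> carrier M \<times> carrier Y" for A c
      using that
    proof (induction A rule: finite_induct)
      case empty show ?case by (simp add: h0)
    next
      case (insert p A)
      have p: "p \<in> carrier M \<times> carrier Y" using insert.prems by auto
      have IH: "(\<Sum>p\<in>A. frag_cmul (c p) (frag_of p)) \<in> carrier F"
        "h (\<Sum>p\<in>A. frag_cmul (c p) (frag_of p)) = (\<Oplus>p \<in> A. [c p] \<cdot> g (fst p) (snd p))"
        using insert by auto
      have pF: "frag_of p \<in> carrier F" using p by simp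
      have pow: "frag_cmul (c p) (frag_of p) = frag_of p [^]\<^bsub>F\<^esub> c p"
        using p by (simp add: tens_free_def)
      have fF: "frag_cmul (c p) (frag_of p) \<in> carrier F" unfolding pow using pF by (rule F.int_pow_closed)
      have "h (frag_of p [^]\<^bsub>F\<^esub> c p) = pow (add_monoid G) (h (frag_of p)) (c p)"
        using hom_int_pow[OF h(1) pF F.group_axioms G.a_group] .
      then have hp: "h (frag_cmul (c p) (frag_of p)) = [c p] \<cdot> g (fst p) (snd p)"
        unfolding pow using h(2)[OF p] by (simp add: add_pow_def)
      have gA: "(\<lambda>p. [c p] \<cdot> g (fst p) (snd p)) \<in> A \<rightarrow> carrier G" "[c p] \<cdot> g (fst p) (snd p) \<in> carrier G"
        using insert.prems p gc by (auto intro!: G.add.int_pow_closed)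
      have "frag_cmul (c p) (frag_of p) + (\<Sum>p\<in>A. frag_cmul (c p) (frag_of p)) \<in> carrier F"
        using F.m_closed[OF fF IH(1)] by (simp only: F_simps(2))
      moreover have "h (frag_cmul (c p) (frag_of p) + (\<Sum>p\<in>A. frag_cmul (c p) (frag_of p))) =
          [c p] \<cdot> g (fst p) (snd p) \<oplus> (\<Oplus>p \<in> A. [c p] \<cdot> g (fst p) (snd p))"
        using hadd[OF fF IH(1)] hp IH(2) by simp
      ultimately show ?case
        unfolding sum.insert[OF insert.hyps(1,2)] G.finsum_insert[OF insert.hyps(1,2) gA] by simp
    qed
    have "t = (\<Sum>p\<in>Poly_Mapping.keys t. frag_cmul (Poly_Mapping.lookup t p) (frag_of p))"
      using frag_expansion[of t] by (simp add: frag_extend_def)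
    then show ?thesis
      using *[of "Poly_Mapping.keys t" "Poly_Mapping.lookup t"] t by simp
  qed
  \<comment> \<open>The chosen representative is k + t with \<open>k\<close> a relation, so
    \<open>h\<close> takes the same value as at \<open>t\<close>.\<close>
  have lift: "tens_lift G g (cls t) = h t" if t: "t \<in> carrier F" for t
  proof -
    let ?s = "SOME s. s \<in> cls t"
    have "t \<in> cls t" using F.rcos_self[OF t H_subgroup] .
    then have "?s \<in> cls t" by (rule someI)
    then obtain k where k: "k \<in> H" "?s = k + t" by (auto simp: r_coset_def)
    have kF: "k \<in> carrier F" using subgroup.mem_carrier[OF H_subgroup k(1)] .
    have sF: "?s \<in> carrier F" unfolding k(2) using F.m_closed[OF kF t] by (simp only: F_simps(2))
    have "tens_lift G g (cls t) = h ?s"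
      unfolding tens_lift_def Let_def using expand[OF sF] by simp
    also have "\<dots> = h k \<oplus> h t" unfolding k(2) by (rule hadd[OF kF t])
    also have "\<dots> = h t" using hH[OF k(1)] hF[OF t] by simp
    finally show ?thesis .
  qed
  show "tens_lift G g (tens R M Y m y) = g m y" if "m \<in> carrier M" "y \<in> carrier Y" for m y
    using lift[OF frag_F[OF that]] h(2) that by (simp add: tens_cls)
  show "tens_lift G g \<in> addhom T G"
  proof (rule addhomI)
    fix x assume "x \<in> carrier T"
    then obtain s where s: "s \<in> carrier F" "x = cls s" unfolding T_simps(1) by blast
    show "tens_lift G g x \<in> carrier G" unfolding s(2) lift[OF s(1)] by (rule hF[OF s(1)])
    fix y assume "y \<in> carrier T"
    then obtain t where t: "t \<in> carrier F" "y = cls t" unfolding T_simps(1) by blast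
    have st: "s + t \<in> carrier F" using F.m_closed[OF s(1) t(1)] by (simp only: F_simps(2))
    show "tens_lift G g (x \<oplus>\<^bsub>T\<^esub> y) = tens_lift G g x \<oplus> tens_lift G g y"
      unfolding s(2) t(2) T_simps(3)[OF s(1) t(1)] lift[OF s(1)] lift[OF t(1)] lift[OF st]
      by (rule hadd[OF s(1) t(1)])
  qed
qed

end

section \<open>Right modules and bimodules\<close>

lemma opp_simps [simp]:
  "carrier (opp R) = carrier R" "add (opp R) = add R" "\<zero>\<^bsub>opp R\<^esub> = \<zero>\<^bsub>R\<^esub>" "\<one>\<^bsub>opp R\<^esub> = \<one>\<^bsub>R\<^esub>"
  "smult (opp R) = smult R" "x \<otimes>\<^bsub>opp R\<^esub> y = y \<otimes>\<^bsub>R\<^esub> x"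
  by (simp_all add: opp_def)

lemma right_part_simps [simp]:
  "carrier (right_part M) = carrier M" "add (right_part M) = add M" "\<zero>\<^bsub>right_part M\<^esub> = \<zero>\<^bsub>M\<^esub>"
  "r \<odot>\<^bsub>right_part M\<^esub> m = m \<triangleleft>\<^bsub>M\<^esub> r"
  by (simp_all add: right_part_def)

lemma addhom_right_part [simp]:
  "addhom (right_part M) Y = addhom M Y" "addhom Y (right_part M) = addhom Y M" "addhom Y (opp R) = addhom Y R"
  by (simp_all add: addhom_def)

abbreviation right_module :: "('k, 'r) module \<Rightarrow> ('l, 'r, 'm) bimod \<Rightarrow> bool" where
  "right_module R M \<equiv> left_module (opp R) (right_part M)"

lemma right_module_abelian_group:
  assumes "right_module R M"
  shows "abelian_group M"
  using abelian_groupE[OF lmod_abelian_group[OF assms]]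
  by (intro abelian_groupI) (simp_all, blast?)

lemma right_moduleD:
  fixes M (structure)
  assumes "right_module R M"
  shows rmod_smult: "\<lbrakk>m \<in> carrier M; r \<in> carrier R\<rbrakk> \<Longrightarrow> m \<triangleleft> r \<in> carrier M"
    and rmod_distr_add: "\<lbrakk>m \<in> carrier M; r \<in> carrier R; s \<in> carrier R\<rbrakk> \<Longrightarrow>
      m \<triangleleft> (r \<oplus>\<^bsub>R\<^esub> s) = m \<triangleleft> r \<oplus> m \<triangleleft> s"
    and rmod_add: "\<lbrakk>m \<in> carrier M; m' \<in> carrier M; r \<in> carrier R\<rbrakk> \<Longrightarrow>
      (m \<oplus> m') \<triangleleft> r = m \<triangleleft> r \<oplus> m' \<triangleleft> r"
    and rmod_assoc: "\<lbrakk>m \<in> carrier M; r \<in> carrier R; s \<in> carrier R\<rbrakk> \<Longrightarrow>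
      m \<triangleleft> (r \<otimes>\<^bsub>R\<^esub> s) = (m \<triangleleft> r) \<triangleleft> s"
    and rmod_one: "m \<in> carrier M \<Longrightarrow> m \<triangleleft> \<one>\<^bsub>R\<^esub> = m"
  using left_moduleD[OF assms] by simp_all

text \<open>\<open>bimodule\<close> without the centrality of \<open>K\<close>: the tensor
  constructions depend on commuting actions alone, and this form also fits scalars that are not
  algebras over \<open>K\<close>.\<close>

definition bimod_over :: "('l, 'c) ring_scheme \<Rightarrow> ('k, 'r) module \<Rightarrow> ('l, 'r, 'm) bimod \<Rightarrow> bool" where
  "bimod_over L R M \<longleftrightarrow> left_module L M \<and> right_module R M \<and>
     (\<forall>a \<in> carrier L. \<forall>r \<in> carrier R. \<forall>m \<in> carrier M.
        (a \<odot>\<^bsub>M\<^esub> m) \<triangleleft>\<^bsub>M\<^esub> r = a \<odot>\<^bsub>M\<^esub> (m \<triangleleft>\<^bsub>M\<^esub> r))"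

lemma bimod_overD:
  fixes M (structure)
  assumes "bimod_over L R M"
  shows "left_module L M" "right_module R M"
    "\<lbrakk>a \<in> carrier L; r \<in> carrier R; m \<in> carrier M\<rbrakk> \<Longrightarrow>
        (a \<odot> m) \<triangleleft> r = a \<odot> (m \<triangleleft> r)"
  using assms by (auto simp: bimod_over_def)

lemma bimodule_bimod_over: "bimodule K L S M \<Longrightarrow> bimod_over L S M"
  by (simp add: bimodule_def bimod_over_def)

definition right_lin :: "('r, 's) ring_scheme \<Rightarrow> ('l, 'r, 'm) bimod \<Rightarrow> ('l, 'r, 'n) bimod \<Rightarrow> ('m \<Rightarrow> 'n) set" where
  "right_lin R M N = {f \<in> addhom M N. \<forall>m \<in> carrier M. \<forall>r \<in> carrier R. f (m \<triangleleft>\<^bsub>M\<^esub> r) = f m \<triangleleft>\<^bsub>N\<^esub> r}"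

lemma right_linD:
  assumes "f \<in> right_lin R M N"
  shows "f \<in> addhom M N" "\<lbrakk>m \<in> carrier M; r \<in> carrier R\<rbrakk> \<Longrightarrow> f (m \<triangleleft>\<^bsub>M\<^esub> r) = f m \<triangleleft>\<^bsub>N\<^esub> r"
  using assms by (auto simp: right_lin_def)

lemma right_linI:
  "\<lbrakk>f \<in> addhom M N; \<And>m r. \<lbrakk>m \<in> carrier M; r \<in> carrier R\<rbrakk> \<Longrightarrow> f (m \<triangleleft>\<^bsub>M\<^esub> r) = f m \<triangleleft>\<^bsub>N\<^esub> r\<rbrakk> \<Longrightarrow>
    f \<in> right_lin R M N"
  by (auto simp: right_lin_def)

lemma right_lin_id: "(\<lambda>m. m) \<in> right_lin R M M"
  by (auto simp: right_lin_def addhom_def)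

lemma right_lin_comp: "\<lbrakk>f \<in> right_lin R M N; g \<in> right_lin R N P\<rbrakk> \<Longrightarrow> (\<lambda>x. g (f x)) \<in> right_lin R M P"
  by (auto simp: right_lin_def addhom_comp addhom_closed)

lemma right_lin_lin_hom:
  "f \<in> lin_hom (opp R) (right_part M) (right_part N) \<longleftrightarrow> f \<in> right_lin R M N"
  by (auto simp: right_lin_def lin_hom_iff)

lemma smult_right_lin: "\<lbrakk>bimod_over L R M; a \<in> carrier L\<rbrakk> \<Longrightarrow> (\<lambda>m. a \<odot>\<^bsub>M\<^esub> m) \<in> right_lin R M M"
  by (rule right_linI[OF smult_addhom[OF bimod_overD(1)]]) (simp_all add: bimod_overD)

lemma rsmult_lin_hom: "\<lbrakk>bimod_over L R M; r \<in> carrier R\<rbrakk> \<Longrightarrow> (\<lambda>m. m \<triangleleft>\<^bsub>M\<^esub> r) \<in> lin_hom L M M"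
  by (rule lin_homI) (simp_all add: bimod_overD right_moduleD[OF bimod_overD(2)])

section \<open>Functoriality of the tensor product\<close>

lemma tensorableI: "\<lbrakk>right_module R M; left_module R Y\<rbrakk> \<Longrightarrow> tensorable R M Y"
  by (simp add: tensorable_def right_module_abelian_group lmod_abelian_group rmod_smult lmod_smult)

lemma tensor_productI: "\<lbrakk>right_module R M; left_module R Y\<rbrakk> \<Longrightarrow> tensor_product R M Y"
  by (intro tensor_product.intro tensorableI)

text \<open>The map f \<otimes> g. Left action, right action and \<open>tensor_map\<close> are all
  of this form, so the module laws of a tensor product and the linearity of induced maps reduce to
  functoriality.\<close>

definition tmap ::
  "('r, 's) ring_scheme \<Rightarrow> ('l, 'r, 'm) bimod \<Rightarrow> ('r, 'y, 'z) module_scheme \<Rightarrow> ('n \<Rightarrow> 'm) \<Rightarrow> ('x \<Rightarrow> 'y) \<Rightarrow>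
    ('n \<times> 'x \<Rightarrow>\<^sub>0 int) set \<Rightarrow> ('m \<times> 'y \<Rightarrow>\<^sub>0 int) set"
where
  "tmap R M Y f g = tens_lift (tens_group R M Y) (\<lambda>m y. tens R M Y (f m) (g y))"

lemma tensor_map_tmap: "tensor_map R M Y g = tmap R M Y (\<lambda>m. m) g"
  by (simp add: tensor_map_def tmap_def)

lemma tensor_simps [simp]:
  "carrier (tensor R M Y) = carrier (tens_group R M Y)"
  "add (tensor R M Y) = add (tens_group R M Y)" "\<zero>\<^bsub>tensor R M Y\<^esub> = \<zero>\<^bsub>tens_group R M Y\<^esub>"
  "a \<odot>\<^bsub>tensor R M Y\<^esub> t = tmap R M Y (\<lambda>m. a \<odot>\<^bsub>M\<^esub> m) (\<lambda>y. y) t"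
  by (simp_all add: tensor_def tmap_def)

lemma bitensor_simps [simp]:
  "carrier (bitensor R M N) = carrier (tens_group R M N)"
  "add (bitensor R M N) = add (tens_group R M N)" "\<zero>\<^bsub>bitensor R M N\<^esub> = \<zero>\<^bsub>tens_group R M N\<^esub>"
  "a \<odot>\<^bsub>bitensor R M N\<^esub> t = tmap R M N (\<lambda>m. a \<odot>\<^bsub>M\<^esub> m) (\<lambda>y. y) t"
  "t \<triangleleft>\<^bsub>bitensor R M N\<^esub> q = tmap R M N (\<lambda>m. m) (\<lambda>n. n \<triangleleft>\<^bsub>N\<^esub> q) t"
  by (simp_all add: bitensor_def) (simp_all add: tensor_def tmap_def)

lemma addhom_tensor [simp]:
  "addhom (tensor R M Y) Z = addhom (tens_group R M Y) Z" "addhom Z (tensor R M Y) = addhom Z (tens_group R M Y)"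
  "addhom (bitensor R M N) Z = addhom (tens_group R M N) Z" "addhom Z (bitensor R M N) = addhom Z (tens_group R M N)"
  by (simp_all add: addhom_def)

lemma abelian_group_cong:
  assumes "abelian_group G" "carrier H = carrier G" "add H = add G" "\<zero>\<^bsub>H\<^esub> = \<zero>\<^bsub>G\<^esub>"
  shows "abelian_group H"
  using abelian_groupE[OF assms(1)] by (intro abelian_groupI) (simp_all add: assms(2-4))

lemma tens_abelian_group:
  assumes "tensorable R M Y"
  shows "abelian_group (tens_group R M Y)" "abelian_group (tensor R M Y)"
proof -
  interpret tensor_product R M Y by (rule tensor_product.intro[OF assms])
  show *: "abelian_group (tens_group R M Y)" by (rule T_abelian_group)
  show "abelian_group (tensor R M Y)" by (rule abelian_group_cong[OF *]) simp_all
qed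

lemma tmap:
  assumes t: "tensorable R M Y" "tensorable R M' Y'"
    and f: "f \<in> right_lin R M M'" and g: "g \<in> lin_hom R Y Y'"
  shows tmap_addhom: "tmap R M' Y' f g \<in> addhom (tens_group R M Y) (tens_group R M' Y')"
    and tmap_tens: "\<lbrakk>m \<in> carrier M; y \<in> carrier Y\<rbrakk> \<Longrightarrow>
      tmap R M' Y' f g (tens R M Y m y) = tens R M' Y' (f m) (g y)"
proof -
  interpret T: tensor_product R M Y by (rule tensor_product.intro[OF t(1)])
  interpret T': tensor_product R M' Y' by (rule tensor_product.intro[OF t(2)])
  note f' = right_linD[OF f] addhomD[OF right_linD(1)[OF f]]
  have b: "balanced R M Y (tens_group R M' Y') (\<lambda>m y. tens R M' Y' (f m) (g y))"
    by (rule balancedI) (simp_all add: f' lin_homD[OF g] T'.tens_closed T'.tens_add_left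
        T'.tens_add_right T'.tens_balanced)
  show "tmap R M' Y' f g \<in> addhom (tens_group R M Y) (tens_group R M' Y')"
    unfolding tmap_def by (rule T.tens_lift_addhom[OF T'.T_abelian_group b])
  show "\<lbrakk>m \<in> carrier M; y \<in> carrier Y\<rbrakk> \<Longrightarrow>
      tmap R M' Y' f g (tens R M Y m y) = tens R M' Y' (f m) (g y)"
    unfolding tmap_def by (rule T.tens_lift_tens[OF T'.T_abelian_group b])
qed

lemma tmap_comp:
  assumes t: "tensorable R M Y" "tensorable R M' Y'" "tensorable R M'' Y''"
    and f: "f \<in> right_lin R M M'" "g \<in> lin_hom R Y Y'" "f' \<in> right_lin R M' M''" "g' \<in> lin_hom R Y' Y''"
    and x: "x \<in> carrier (tens_group R M Y)"
  shows "tmap R M'' Y'' f' g' (tmap R M' Y' f g x) = tmap R M'' Y'' (\<lambda>m. f' (f m)) (\<lambda>y. g' (g y)) x"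
proof -
  interpret T: tensor_product R M Y by (rule tensor_product.intro[OF t(1)])
  interpret T'': tensor_product R M'' Y'' by (rule tensor_product.intro[OF t(3)])
  note 1 = tmap[OF t(1,2) f(1,2)] and 2 = tmap[OF t(2,3) f(3,4)]
    and 3 = tmap[OF t(1,3) right_lin_comp[OF f(1,3)] lin_hom_comp[OF f(2,4)]]
  show ?thesis
    by (rule T.addhom_tensor_eq[OF addhom_comp[OF 1(1) 2(1)] 3(1) T''.T_abelian_group _ x])
      (simp add: 1 2 3 addhomD[OF right_linD(1)[OF f(1)]] lin_homD[OF f(2)])
qed

lemma tmap_cong:
  assumes t: "tensorable R M Y" "tensorable R M' Y'"
    and f: "f \<in> right_lin R M M'" "g \<in> lin_hom R Y Y'" "f' \<in> right_lin R M M'" "g' \<in> lin_hom R Y Y'"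
    and e: "\<And>m. m \<in> carrier M \<Longrightarrow> f m = f' m" "\<And>y. y \<in> carrier Y \<Longrightarrow> g y = g' y"
    and x: "x \<in> carrier (tens_group R M Y)"
  shows "tmap R M' Y' f g x = tmap R M' Y' f' g' x"
proof -
  interpret T: tensor_product R M Y by (rule tensor_product.intro[OF t(1)])
  interpret T': tensor_product R M' Y' by (rule tensor_product.intro[OF t(2)])
  show ?thesis
    by (rule T.addhom_tensor_eq[OF tmap_addhom[OF t f(1,2)] tmap_addhom[OF t f(3,4)] T'.T_abelian_group _ x])
      (simp add: tmap_tens[OF t f(1,2)] tmap_tens[OF t f(3,4)] e)
qed

lemma tmap_id:
  assumes t: "tensorable R M Y" and x: "x \<in> carrier (tens_group R M Y)"
    and e: "\<And>m. m \<in> carrier M \<Longrightarrow> f m = m" "\<And>y. y \<in> carrier Y \<Longrightarrow> g y = y"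
    and f: "f \<in> right_lin R M M" "g \<in> lin_hom R Y Y"
  shows "tmap R M Y f g x = x"
proof -
  interpret T: tensor_product R M Y by (rule tensor_product.intro[OF t(1)])
  have i: "(\<lambda>x. x) \<in> addhom (tens_group R M Y) (tens_group R M Y)" by (simp add: addhom_def)
  show ?thesis
    by (rule T.addhom_tensor_eq[OF tmap_addhom[OF t t f] i T.T_abelian_group _ x])
      (simp add: tmap_tens[OF t t f] e)
qed

lemma tmap_add_right:
  assumes t: "tensorable R M Y" "tensorable R M' Y'" and Y': "left_module R Y'"
    and f: "f \<in> right_lin R M M'" "g \<in> lin_hom R Y Y'" "g' \<in> lin_hom R Y Y'"
    and x: "x \<in> carrier (tens_group R M Y)"
  shows "tmap R M' Y' f (\<lambda>y. g y \<oplus>\<^bsub>Y'\<^esub> g' y) x = tmap R M' Y' f g x \<oplus>\<^bsub>tens_group R M' Y'\<^esub> tmap R M' Y' f g' x"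
proof -
  interpret T: tensor_product R M Y by (rule tensor_product.intro[OF t(1)])
  interpret T': tensor_product R M' Y' by (rule tensor_product.intro[OF t(2)])
  note s = lin_hom_sum[OF f(2,3) Y']
  show ?thesis
    by (rule T.addhom_tensor_eq[OF tmap_addhom[OF t f(1) s]
        addhom_sum[OF tmap_addhom[OF t f(1,2)] tmap_addhom[OF t f(1,3)] T'.T_abelian_group] T'.T_abelian_group _ x])
      (simp add: tmap_tens[OF t f(1) s] tmap_tens[OF t f(1,2)] tmap_tens[OF t f(1,3)] T'.tens_add_right
        addhomD[OF right_linD(1)[OF f(1)]] lin_homD[OF f(2)] lin_homD[OF f(3)])
qed

lemma tmap_add_left:
  assumes t: "tensorable R M Y" "tensorable R M' Y'"
    and f: "f \<in> right_lin R M M'" "f' \<in> right_lin R M M'" "h \<in> right_lin R M M'" "g \<in> lin_hom R Y Y'"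
    and h: "\<And>m. m \<in> carrier M \<Longrightarrow> h m = f m \<oplus>\<^bsub>M'\<^esub> f' m"
    and x: "x \<in> carrier (tens_group R M Y)"
  shows "tmap R M' Y' h g x = tmap R M' Y' f g x \<oplus>\<^bsub>tens_group R M' Y'\<^esub> tmap R M' Y' f' g x"
proof -
  interpret T: tensor_product R M Y by (rule tensor_product.intro[OF t(1)])
  interpret T': tensor_product R M' Y' by (rule tensor_product.intro[OF t(2)])
  show ?thesis
    by (rule T.addhom_tensor_eq[OF tmap_addhom[OF t f(3,4)]
        addhom_sum[OF tmap_addhom[OF t f(1,4)] tmap_addhom[OF t f(2,4)] T'.T_abelian_group] T'.T_abelian_group _ x])
      (simp add: tmap_tens[OF t f(3,4)] tmap_tens[OF t f(1,4)] tmap_tens[OF t f(2,4)] T'.tens_add_left h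
        addhomD[OF right_linD(1)[OF f(1)]] addhomD[OF right_linD(1)[OF f(2)]] lin_homD[OF f(4)])
qed

lemma tensor_smult_tens:
  assumes M: "bimod_over L R M" and Y: "left_module R Y" and x: "a \<in> carrier L" "m \<in> carrier M" "y \<in> carrier Y"
  shows "tmap R M Y (\<lambda>m. a \<odot>\<^bsub>M\<^esub> m) (\<lambda>y. y) (tens R M Y m y) = tens R M Y (a \<odot>\<^bsub>M\<^esub> m) y"
  using x by (intro tmap_tens tensorableI bimod_overD[OF M] Y smult_right_lin[OF M] lin_hom_id)

lemma tensor_left_module:
  fixes L (structure)
  assumes M: "bimod_over L R M" and Y: "left_module R Y"
  shows "left_module L (tensor R M Y)"
proof -
  let ?F = "tensor R M Y"
  note m = bimod_overD[OF M]
  note t = tensorableI[OF m(2) Y]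
  note lm = left_moduleD[OF m(1)]
  interpret L: ring L by (rule left_module_ring[OF m(1)])
  let ?T = "tens_group R M Y"
  interpret T: tensor_product R M Y by (rule tensor_product.intro[OF t])
  let ?s = "\<lambda>a. tmap R M Y (\<lambda>m. a \<odot>\<^bsub>M\<^esub> m) (\<lambda>y. y)"
  note s = smult_right_lin[OF M]
  note i = lin_hom_id[of R Y]
  note ah = tmap_addhom[OF t t s i]
  show ?thesis
  proof (rule left_moduleI)
    fix a x assume a: "a \<in> carrier L" and x: "x \<in> carrier (?F)"
    show "a \<odot>\<^bsub>?F\<^esub> x \<in> carrier (?F)" using x addhom_closed[OF ah[OF a]] by simp
    {
      fix b assume b: "b \<in> carrier L"
      show "(a \<oplus> b) \<odot>\<^bsub>?F\<^esub> x = a \<odot>\<^bsub>?F\<^esub> x \<oplus>\<^bsub>?F\<^esub> b \<odot>\<^bsub>?F\<^esub> x"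
        using x by (simp, intro tmap_add_left[OF t t s s s i]) (simp_all add: a b lm)
      have "?s a (?s b x) = tmap R M Y (\<lambda>m. a \<odot>\<^bsub>M\<^esub> (b \<odot>\<^bsub>M\<^esub> m)) (\<lambda>y. y) x"
        using x by (intro tmap_comp[OF t t t] s a b i) simp
      also have "\<dots> = ?s (a \<otimes> b) x"
        using x by (intro tmap_cong[OF t t] right_lin_comp[OF s s] s a b i L.m_closed) (simp_all add: a b lm)
      finally show "(a \<otimes> b) \<odot>\<^bsub>?F\<^esub> x = a \<odot>\<^bsub>?F\<^esub> (b \<odot>\<^bsub>?F\<^esub> x)"
        by simp
    }
    fix y assume y: "y \<in> carrier (?F)"
    show "a \<odot>\<^bsub>?F\<^esub> (x \<oplus>\<^bsub>?F\<^esub> y) = a \<odot>\<^bsub>?F\<^esub> x \<oplus>\<^bsub>?F\<^esub> a \<odot>\<^bsub>?F\<^esub> y"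
      using x y addhom_add[OF ah[OF a]] by simp
  next
    fix x assume x: "x \<in> carrier (?F)"
    show "\<one> \<odot>\<^bsub>?F\<^esub> x = x"
      using x by (simp, intro tmap_id[OF t]) (simp_all add: s i lm)
  qed (use m tens_abelian_group[OF t] in \<open>auto intro: left_module_ring\<close>)
qed

lemma tmap_lin_hom:
  assumes M: "bimod_over L R M" "bimod_over L R M'" and Y: "left_module R Y" "left_module R Y'"
    and f: "f \<in> lin_hom L M M'" "f \<in> right_lin R M M'" and g: "g \<in> lin_hom R Y Y'"
  shows "tmap R M' Y' f g \<in> lin_hom L (tensor R M Y) (tensor R M' Y')"
  unfolding lin_hom_iff
proof (intro conjI ballI)
  note t = tensorableI[OF bimod_overD(2)[OF M(1)] Y(1)] tensorableI[OF bimod_overD(2)[OF M(2)] Y(2)]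
  show "tmap R M' Y' f g \<in> addhom (tensor R M Y) (tensor R M' Y')"
    using tmap_addhom[OF t f(2) g] by simp
  fix a x assume a: "a \<in> carrier L" and x: "x \<in> carrier (tensor R M Y)"
  note s = smult_right_lin[OF M(1) a] smult_right_lin[OF M(2) a]
  have x': "x \<in> carrier (tens_group R M Y)" using x by simp
  have "tmap R M' Y' f g (tmap R M Y (\<lambda>m. a \<odot>\<^bsub>M\<^esub> m) (\<lambda>y. y) x) = tmap R M' Y' (\<lambda>m. f (a \<odot>\<^bsub>M\<^esub> m)) g x"
    by (rule tmap_comp[OF t(1,1,2) s(1) lin_hom_id f(2) g x'])
  also have "\<dots> = tmap R M' Y' (\<lambda>m. a \<odot>\<^bsub>M'\<^esub> f m) g x"
    by (rule tmap_cong[OF t right_lin_comp[OF s(1) f(2)] g right_lin_comp[OF f(2) s(2)] g _ _ x'])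
      (simp_all add: lin_homD[OF f(1)] a)
  also have "\<dots> = tmap R M' Y' (\<lambda>m. a \<odot>\<^bsub>M'\<^esub> m) (\<lambda>y. y) (tmap R M' Y' f g x)"
    by (rule tmap_comp[OF t(1,2,2) f(2) g s(2) lin_hom_id x', symmetric])
  finally show "tmap R M' Y' f g (a \<odot>\<^bsub>tensor R M Y\<^esub> x) = a \<odot>\<^bsub>tensor R M' Y'\<^esub> tmap R M' Y' f g x"
    by simp
qed

lemma tensor_map_lin_hom:
  assumes "bimod_over L R M" "left_module R Y" "left_module R Y'" "g \<in> lin_hom R Y Y'"
  shows "tensor_map R M Y' g \<in> lin_hom L (tensor R M Y) (tensor R M Y')"
  unfolding tensor_map_tmap by (rule tmap_lin_hom[OF assms(1,1-3) lin_hom_id right_lin_id assms(4)])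

lemma tensor_map_tens:
  assumes "right_module R M" "left_module R Y" "left_module R Y'" "g \<in> lin_hom R Y Y'"
    "m \<in> carrier M" "y \<in> carrier Y"
  shows "tensor_map R M Y' g (tens R M Y m y) = tens R M Y' m (g y)"
  unfolding tensor_map_tmap
  by (rule tmap_tens[OF tensorableI[OF assms(1,2)] tensorableI[OF assms(1,3)] right_lin_id assms(4-6)])

lemma tensor_map_comp:
  assumes "right_module R M" "left_module R X" "left_module R Y" "left_module R Z"
    "f \<in> lin_hom R X Y" "g \<in> lin_hom R Y Z" "t \<in> carrier (tensor R M X)"
  shows "tensor_map R M Z g (tensor_map R M Y f t) = tensor_map R M Z (\<lambda>x. g (f x)) t"
  unfolding tensor_map_tmap
  by (rule tmap_comp[OF tensorableI[OF assms(1,2)] tensorableI[OF assms(1,3)] tensorableI[OF assms(1,4)]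
      right_lin_id assms(5) right_lin_id assms(6)]) (use assms(7) in simp)

lemma tensor_map_cong:
  assumes "right_module R M" "left_module R X" "left_module R Y"
    "f \<in> lin_hom R X Y" "g \<in> lin_hom R X Y" "\<And>x. x \<in> carrier X \<Longrightarrow> f x = g x" "t \<in> carrier (tensor R M X)"
  shows "tensor_map R M Y f t = tensor_map R M Y g t"
  unfolding tensor_map_tmap
  by (rule tmap_cong[OF tensorableI[OF assms(1,2)] tensorableI[OF assms(1,3)]
      right_lin_id assms(4) right_lin_id assms(5)]) (use assms(6,7) in simp_all)

lemma tensor_map_id:
  assumes "right_module R M" "left_module R X" "f \<in> lin_hom R X X" "\<And>x. x \<in> carrier X \<Longrightarrow> f x = x"
    "t \<in> carrier (tensor R M X)"
  shows "tensor_map R M X f t = t"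
  unfolding tensor_map_tmap
  by (rule tmap_id[OF tensorableI[OF assms(1,2)]]) (use assms right_lin_id in simp_all)

lemma tensor_map_add:
  assumes "right_module R M" "left_module R X" "left_module R Y"
    "f \<in> lin_hom R X Y" "g \<in> lin_hom R X Y" "t \<in> carrier (tensor R M X)"
  shows "tensor_map R M Y (\<lambda>x. f x \<oplus>\<^bsub>Y\<^esub> g x) t =
    tensor_map R M Y f t \<oplus>\<^bsub>tensor R M Y\<^esub> tensor_map R M Y g t"
  using tmap_add_right[OF tensorableI[OF assms(1,2)] tensorableI[OF assms(1,3)] assms(3) right_lin_id
      assms(4,5), of t] assms(6)
  by (simp add: tensor_map_tmap)

lemma tensor_map_diff:
  fixes Y (structure)
  assumes M: "bimod_over L R M" and m: "left_module R X" "left_module R Y"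
    and f: "f \<in> lin_hom R X Y" "g \<in> lin_hom R X Y" and t: "t \<in> carrier (tensor R M X)"
  shows "tensor_map R M Y (\<lambda>x. f x \<ominus> g x) t =
    tensor_map R M Y f t \<ominus>\<^bsub>tensor R M Y\<^esub> tensor_map R M Y g t"
proof -
  interpret Y: abelian_group Y by (rule lmod_abelian_group[OF m(2)])
  note r = bimod_overD(2)[OF M]
  interpret T: abelian_group "tensor R M Y"
    using tensor_left_module[OF M m(2)] by (rule lmod_abelian_group)
  note d = lin_hom_minus[OF f m(2)]
  have "tensor_map R M Y (\<lambda>x. (f x \<ominus> g x) \<oplus> g x) t = tensor_map R M Y f t"
    by (rule tensor_map_cong[OF r m lin_hom_sum[OF d f(2) m(2)] f(1) _ t])
      (simp add: lin_homD[OF f(1)] lin_homD[OF f(2)] Y.diff_add_cancel)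
  then have "tensor_map R M Y f t =
      tensor_map R M Y (\<lambda>x. f x \<ominus> g x) t \<oplus>\<^bsub>tensor R M Y\<^esub> tensor_map R M Y g t"
    using tensor_map_add[OF r m d f(2) t] by simp
  then show ?thesis
    using lin_hom_closed[OF tensor_map_lin_hom[OF M m d] t] lin_hom_closed[OF tensor_map_lin_hom[OF M m f(2)] t]
    by (simp add: T.add_diff_cancel del: tensor_simps)
qed

lemma tensor_map_iso:
  assumes M: "bimod_over L R M" and m: "left_module R X" "left_module R Y" and f: "f \<in> lin_iso R X Y"
  shows "tensor_map R M Y f \<in> lin_iso L (tensor R M X) (tensor R M Y)"
proof -
  note r = bimod_overD(2)[OF M]
  note i = lin_iso_inverse[OF f m(1)] and f1 = lin_isoD(1)[OF f]
  note g1 = lin_isoD(1)[OF i(1)]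
  show ?thesis
  proof (rule lin_isoI[OF tensor_map_lin_hom[OF M m f1] tensor_map_lin_hom[OF M m(2,1) g1]])
    fix t assume t: "t \<in> carrier (tensor R M X)"
    show "tensor_map R M X (inv_into (carrier X) f) (tensor_map R M Y f t) = t"
      unfolding tensor_map_comp[OF r m m(1) f1 g1 t]
      by (rule tensor_map_id[OF r m(1) lin_hom_comp[OF f1 g1] _ t]) (simp add: i)
  next
    fix t assume t: "t \<in> carrier (tensor R M Y)"
    show "tensor_map R M Y f (tensor_map R M X (inv_into (carrier X) f) t) = t"
      unfolding tensor_map_comp[OF r m(2,1,2) g1 f1 t]
      by (rule tensor_map_id[OF r m(2) lin_hom_comp[OF g1 f1] _ t]) (simp add: i)
  qed
qed

text \<open>Pure tensors of generators suffice: in x \<otimes> y expand \<open>y\<close>, move its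
  coefficients across the tensor sign to \<open>x\<close>, and expand the resulting elements of
  \<open>M\<close> over \<open>L\<close>.\<close>

lemma tensor_fg_module:
  fixes M (structure)
  assumes M: "bimod_over L R M" "fin_gen L M" and Y: "fg_module R Y"
  shows "fg_module L (tensor R M Y)"
proof -
  note Ym = fg_moduleD[OF Y]
  note m = bimod_overD[OF M(1)]
  note t = tensorableI[OF m(2) Ym(1)]
  interpret T: tensor_product R M Y by (rule tensor_product.intro[OF t])
  note lT = tensor_left_module[OF M(1) Ym(1)]
  obtain A where A: "finite A" "A \<subseteq> carrier M" "carrier M \<subseteq> rspan L M A"
    using M(2) fin_gen_rspan[OF m(1)] by auto
  obtain B where B: "finite B" "B \<subseteq> carrier Y" "carrier Y \<subseteq> rspan R Y B"
    using Ym(2) fin_gen_rspan[OF Ym(1)] by auto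
  let ?C = "(\<lambda>(m, y). tens R M Y m y) ` (A \<times> B)"
  have C: "?C \<subseteq> carrier (tensor R M Y)"
    using A(2) B(2) T.tens_closed by (auto simp: subset_iff)
  note radd = rspan_add[OF lT C, unfolded tensor_simps]
  have z0: "\<zero>\<^bsub>tens_group R M Y\<^esub> \<in> rspan L (tensor R M Y) ?C"
    using rspan_zero[of "tensor R M Y" L ?C] by simp
  have 1: "tens R M Y x b \<in> rspan L (tensor R M Y) ?C" if "x \<in> rspan L M A" "b \<in> B" for x b
    using that(1)
  proof induction
    case rspan_zero
    have "tens R M Y \<zero> b = \<zero>\<^bsub>tens_group R M Y\<^esub>"
      using that(2) B(2) addhom_zero[OF T.tens_addhom(2) T.abM T.T_abelian_group] by auto
    then show ?case using z0 by simp
  next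
    case (rspan_step a e v)
    have c: "e \<in> carrier M" "v \<in> carrier M" "b \<in> carrier Y"
      using rspan_step(2) A(2) rspan_closed[OF m(1) A(2) rspan_step(3)] that(2) B(2) by auto
    have "tens R M Y (a \<odot> e \<oplus> v) b =
        a \<odot>\<^bsub>tensor R M Y\<^esub> tens R M Y e b \<oplus>\<^bsub>tensor R M Y\<^esub> tens R M Y v b"
      using c rspan_step(1)
      by (simp add: T.tens_add_left lmod_smult[OF m(1)] tensor_smult_tens[OF M(1) Ym(1)])
    then show ?case
      using rspan.rspan_step[OF rspan_step(1), of "tens R M Y e b" ?C "tens R M Y v b" "tensor R M Y"]
        rspan_step that(2) by auto
  qed
  have 2: "tens R M Y x y \<in> rspan L (tensor R M Y) ?C" if "y \<in> rspan R Y B" "x \<in> carrier M" for x y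
    using that
  proof (induction arbitrary: x)
    case rspan_zero
    have "tens R M Y x \<zero>\<^bsub>Y\<^esub> = \<zero>\<^bsub>tens_group R M Y\<^esub>"
      using rspan_zero addhom_zero[OF T.tens_addhom(1) T.abY T.T_abelian_group] by auto
    then show ?case using z0 by simp
  next
    case (rspan_step r b v)
    have c: "b \<in> carrier Y" "v \<in> carrier Y"
      using rspan_step(2) B(2) rspan_closed[OF Ym(1) B(2) rspan_step(3)] by auto
    have "tens R M Y x (r \<odot>\<^bsub>Y\<^esub> b \<oplus>\<^bsub>Y\<^esub> v) = tens R M Y (x \<triangleleft> r) b \<oplus>\<^bsub>tens_group R M Y\<^esub> tens R M Y x v"
      using c rspan_step(1,5) by (simp add: T.tens_add_right T.act_closed T.tens_balanced)
    moreover have "x \<triangleleft> r \<in> rspan L M A" using A(3) T.act_closed(1)[OF rspan_step(5,1)] by auto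
    ultimately show ?case using radd[OF 1[OF _ rspan_step(2)] rspan_step(4)[OF rspan_step(5)]] by simp
  qed
  have "t \<in> rspan L (tensor R M Y) ?C" if "t \<in> carrier (tens_group R M Y)" for t
    using that
  proof (induction rule: T.tensor_induct)
    case zero show ?case by (rule z0)
  next
    case (tens x y) then show ?case using 2 B(3) by auto
  next
    case (add u v) then show ?case using radd by simp
  qed
  then show ?thesis
    unfolding fg_module_def fin_gen_rspan[OF lT] using lT A(1) B(1) C by (intro conjI exI[of _ ?C]) auto
qed

text \<open>Tensoring the map x \<mapsto> f(x) y with \<open>M\<close> gives the composite M
  \<otimes> Y -> M -> M \<otimes> Y' of m \<otimes> x \<mapsto> m f(x) and m \<mapsto> m \<otimes>
  y, which factors through the projective left module \<open>M\<close>.\<close>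

lemma finite_rank_tensor:
  fixes M (structure)
  assumes M: "bimod_over L R M" "fgproj L M" and Y: "left_module R Y" "left_module R Y'"
    and h: "finite_rank R Y Y' h"
  shows "finite_rank L (tensor R M Y) (tensor R M Y') (tensor_map R M Y' h)"
  using h
proof induction
  note m = bimod_overD[OF M(1)]
  case (finite_rank_zero h)
  have t: "tensorable R M Y" "tensorable R M Y'" using m Y by (auto intro: tensorableI)
  interpret T: tensor_product R M Y by (rule tensor_product.intro[OF t(1)])
  interpret T': tensor_product R M Y' by (rule tensor_product.intro[OF t(2)])
  have hl: "h \<in> lin_hom R Y Y'"
    by (rule finite_rank_lin_hom[OF finite_rank.finite_rank_zero[OF finite_rank_zero] Y])
  have z: "(\<lambda>_. \<zero>\<^bsub>tens_group R M Y'\<^esub>) \<in> addhom (tens_group R M Y) (tens_group R M Y')"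
    by (rule addhomI) simp_all
  show ?case
  proof (rule finite_rank.finite_rank_zero)
    fix x assume "x \<in> carrier (tensor R M Y)"
    then have x: "x \<in> carrier (tens_group R M Y)" by simp
    have "tmap R M Y' (\<lambda>m. m) h x = \<zero>\<^bsub>tens_group R M Y'\<^esub>"
      by (rule T.addhom_tensor_eq[OF tmap_addhom[OF t right_lin_id hl] z T'.T_abelian_group _ x])
        (simp add: tmap_tens[OF t right_lin_id hl] finite_rank_zero
          addhom_zero[OF T'.tens_addhom(1) T'.abY T'.T_abelian_group])
    then show "tensor_map R M Y' h x = \<zero>\<^bsub>tensor R M Y'\<^esub>" by (simp add: tensor_map_tmap)
  qed
next
  note m = bimod_overD[OF M(1)]
  case (finite_rank_step h f y h')
  have t: "tensorable R M Y" "tensorable R M Y'" using m Y by (auto intro: tensorableI)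
  interpret T: tensor_product R M Y by (rule tensor_product.intro[OF t(1)])
  interpret T': tensor_product R M Y' by (rule tensor_product.intro[OF t(2)])
  note lT = tensor_left_module[OF M(1) Y(1)] tensor_left_module[OF M(1) Y(2)]
  note f = functionalsD[OF finite_rank_step(2)]
  note rm = right_moduleD[OF m(2)]
  have b: "balanced R M Y M (\<lambda>m y. m \<triangleleft> f y)"
    by (rule balancedI) (simp_all add: f rm)
  \<comment> \<open>The first factor m \<otimes> x \<mapsto> m f(x); it is left linear because the
    two actions on \<open>M\<close> commute.\<close>
  let ?e = "tens_lift M (\<lambda>m y. m \<triangleleft> f y)"
  note e = T.tens_lift_addhom[OF T.abM b] T.tens_lift_tens[OF T.abM b]
  note s = smult_right_lin[OF M(1)]
  have el: "?e \<in> lin_hom L (tensor R M Y) M"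
    unfolding lin_hom_iff
  proof (intro conjI ballI)
    show "?e \<in> addhom (tensor R M Y) M" using e(1) by simp
    fix a x assume a: "a \<in> carrier L" and "x \<in> carrier (tensor R M Y)"
    then have x: "x \<in> carrier (tens_group R M Y)" by simp
    have "?e (tmap R M Y (\<lambda>m. a \<odot> m) (\<lambda>y. y) x) = a \<odot> ?e x"
      by (rule T.addhom_tensor_eq[OF addhom_comp[OF tmap_addhom[OF t(1,1) s[OF a] lin_hom_id] e(1)]
          addhom_comp[OF e(1) smult_addhom[OF m(1) a]] T.abM _ x])
        (simp add: tensor_smult_tens[OF M(1) Y(1) a] e(2) lmod_smult[OF m(1) a] m(3) a f)
    then show "?e (a \<odot>\<^bsub>tensor R M Y\<^esub> x) = a \<odot> ?e x" by simp
  qed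
  have tl: "(\<lambda>m. tens R M Y' m y) \<in> lin_hom L M (tensor R M Y')"
    unfolding lin_hom_iff using T'.tens_addhom(2)[OF finite_rank_step(3)] finite_rank_step(3)
    by (simp add: tensor_smult_tens[OF M(1) Y(2)])
  have fr: "finite_rank L (tensor R M Y) (tensor R M Y') (\<lambda>x. tens R M Y' (?e x) y)"
    by (rule finite_rank_through[OF M(2) el tl m(1) lT(2)])
  have hl: "h \<in> lin_hom R Y Y'" "h' \<in> lin_hom R Y Y'"
    by (rule finite_rank_lin_hom[OF _ Y], (rule finite_rank_step finite_rank.finite_rank_step[OF finite_rank_step(1-4)], assumption?)+)+
  have "finite_rank L (tensor R M Y) (tensor R M Y')
      (\<lambda>x. tens R M Y' (?e x) y \<oplus>\<^bsub>tensor R M Y'\<^esub> tensor_map R M Y' h x)"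
    by (rule finite_rank_add[OF fr finite_rank_step(5) lT(2)])
  then show ?case
  proof (rule finite_rank_cong)
    fix x assume "x \<in> carrier (tensor R M Y)"
    then have x: "x \<in> carrier (tens_group R M Y)" by simp
    have "tens R M Y' (?e x) y \<oplus>\<^bsub>tens_group R M Y'\<^esub> tmap R M Y' (\<lambda>m. m) h x = tmap R M Y' (\<lambda>m. m) h' x"
      by (rule T.addhom_tensor_eq[OF addhom_sum[OF addhom_comp[OF e(1) T'.tens_addhom(2)[OF finite_rank_step(3)]]
            tmap_addhom[OF t right_lin_id hl(1)] T'.T_abelian_group]
          tmap_addhom[OF t right_lin_id hl(2)] T'.T_abelian_group _ x])
        (simp add: e(2) tmap_tens[OF t right_lin_id hl(1)] tmap_tens[OF t right_lin_id hl(2)] f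
          T'.tens_balanced finite_rank_step(3,4) T'.tens_add_right lmod_smult[OF Y(2)] lin_homD[OF hl(1)])
    then show "tens R M Y' (?e x) y \<oplus>\<^bsub>tensor R M Y'\<^esub> tensor_map R M Y' h x = tensor_map R M Y' h' x"
      by (simp add: tensor_map_tmap)
  qed
qed

lemma fgproj_tensor:
  assumes M: "bimod_over L R M" "fgproj L M" and Y: "left_module R Y" "fgproj R Y"
  shows "fgproj L (tensor R M Y)"
  by (rule finite_rank_cong[OF finite_rank_tensor[OF M Y(1,1,2)]])
    (rule tensor_map_id[OF bimod_overD(2)[OF M(1)] Y(1) lin_hom_id], simp_all)

section \<open>Exactness of the tensor product\<close>

text \<open>Contraction of M \<otimes> Y by a functional on the right module \<open>M\<close>. These
  contractions serve as coordinates when \<open>M\<close> is projective on the right.\<close>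

definition tens_eval ::
  "('r, 'y, 'z) module_scheme \<Rightarrow> ('m \<Rightarrow> 'r) \<Rightarrow> ('m \<times> 'y \<Rightarrow>\<^sub>0 int) set \<Rightarrow> 'y"
where
  "tens_eval Y f = tens_lift Y (\<lambda>m y. f m \<odot>\<^bsub>Y\<^esub> y)"

lemma tens_eval:
  assumes M: "right_module R M" and Y: "left_module R Y" and f: "f \<in> functionals (opp R) (right_part M)"
  shows tens_eval_addhom: "tens_eval Y f \<in> addhom (tens_group R M Y) Y"
    and tens_eval_tens: "\<lbrakk>m \<in> carrier M; y \<in> carrier Y\<rbrakk> \<Longrightarrow> tens_eval Y f (tens R M Y m y) = f m \<odot>\<^bsub>Y\<^esub> y"
proof -
  interpret T: tensor_product R M Y using M Y by (rule tensor_productI)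
  note f' = functionalsD[OF f, simplified]
  have b: "balanced R M Y Y (\<lambda>m y. f m \<odot>\<^bsub>Y\<^esub> y)"
    by (rule balancedI) (simp_all add: f' left_moduleD[OF Y])
  show "tens_eval Y f \<in> addhom (tens_group R M Y) Y"
    unfolding tens_eval_def by (rule T.tens_lift_addhom[OF T.abY b])
  show "\<lbrakk>m \<in> carrier M; y \<in> carrier Y\<rbrakk> \<Longrightarrow> tens_eval Y f (tens R M Y m y) = f m \<odot>\<^bsub>Y\<^esub> y"
    unfolding tens_eval_def by (rule T.tens_lift_tens[OF T.abY b])
qed

lemma tens_eval_natural:
  assumes M: "right_module R M" and Y: "left_module R Y" "left_module R Y'"
    and f: "f \<in> functionals (opp R) (right_part M)" and g: "g \<in> lin_hom R Y Y'"
    and x: "x \<in> carrier (tensor R M Y)"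
  shows "tens_eval Y' f (tensor_map R M Y' g x) = g (tens_eval Y f x)"
proof -
  interpret T: tensor_product R M Y using M Y(1) by (rule tensor_productI)
  note t = tensorableI[OF M Y(1)] tensorableI[OF M Y(2)]
  note f' = functionalsD[OF f, simplified]
  have x': "x \<in> carrier (tens_group R M Y)" using x by simp
  show ?thesis
    unfolding tensor_map_tmap
    by (rule T.addhom_tensor_eq[OF addhom_comp[OF tmap_addhom[OF t right_lin_id g] tens_eval_addhom[OF M Y(2) f]]
          addhom_comp[OF tens_eval_addhom[OF M Y(1) f] lin_hom_addhom[OF g]] lmod_abelian_group[OF Y(2)] _ x'])
      (simp add: tmap_tens[OF t right_lin_id g] tens_eval_tens[OF M Y(2) f] tens_eval_tens[OF M Y(1) f]
        lin_homD[OF g] f')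
qed

text \<open>If \<open>h\<close> is the sum of the maps m \<mapsto> p f(m), then (h \<otimes> 1)(x)
  is the sum of the tensors of p with the contraction of x by f. The statement is an induction
  principle, so the sum never has to be indexed.\<close>

lemma tmap_finite_rank_induct:
  assumes M: "right_module R M" and Y: "left_module R Y"
    and h: "finite_rank (opp R) (right_part M) (right_part M) h"
    and x: "x \<in> carrier (tens_group R M Y)"
    and zero: "P \<zero>\<^bsub>tens_group R M Y\<^esub>"
    and step: "\<And>f p u. \<lbrakk>f \<in> functionals (opp R) (right_part M); p \<in> carrier M; u \<in> carrier (tens_group R M Y); P u\<rbrakk> \<Longrightarrow>
      P (tens R M Y p (tens_eval Y f x) \<oplus>\<^bsub>tens_group R M Y\<^esub> u)"
  shows "P (tmap R M Y h (\<lambda>y. y) x)"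
  using h
proof induction
  note t = tensorableI[OF M Y]
  interpret T: tensor_product R M Y by (rule tensor_product.intro[OF t])
  case (finite_rank_zero h)
  have hl: "h \<in> right_lin R M M"
    unfolding right_lin_lin_hom[symmetric]
    by (rule finite_rank_lin_hom[OF finite_rank.finite_rank_zero[OF finite_rank_zero] M M])
  have z: "(\<lambda>_. \<zero>\<^bsub>tens_group R M Y\<^esub>) \<in> addhom (tens_group R M Y) (tens_group R M Y)"
    by (rule addhomI) simp_all
  have "tmap R M Y h (\<lambda>y. y) x = \<zero>\<^bsub>tens_group R M Y\<^esub>"
    by (rule T.addhom_tensor_eq[OF tmap_addhom[OF t t hl lin_hom_id] z T.T_abelian_group _ x])
      (simp add: tmap_tens[OF t t hl lin_hom_id] finite_rank_zero
        addhom_zero[OF T.tens_addhom(2) T.abM T.T_abelian_group])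
  then show ?case using zero by simp
next
  note t = tensorableI[OF M Y]
  interpret T: tensor_product R M Y by (rule tensor_product.intro[OF t])
  case (finite_rank_step h f p h')
  have p: "p \<in> carrier M" using finite_rank_step(3) by simp
  note f = functionalsD[OF finite_rank_step(2), simplified]
  have h1: "h \<in> right_lin R M M"
    unfolding right_lin_lin_hom[symmetric] by (rule finite_rank_lin_hom[OF finite_rank_step(1) M M])
  have h2: "h' \<in> right_lin R M M"
    unfolding right_lin_lin_hom[symmetric]
    by (rule finite_rank_lin_hom[OF finite_rank.finite_rank_step[OF finite_rank_step(1-4)] M M])
  note ev = tens_eval[OF M Y finite_rank_step(2)]
  have "tmap R M Y h' (\<lambda>y. y) x =
      tens R M Y p (tens_eval Y f x) \<oplus>\<^bsub>tens_group R M Y\<^esub> tmap R M Y h (\<lambda>y. y) x"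
    by (rule T.addhom_tensor_eq[OF tmap_addhom[OF t t h2 lin_hom_id] addhom_sum[OF addhom_comp[OF ev(1) T.tens_addhom(1)[OF p]]
          tmap_addhom[OF t t h1 lin_hom_id] T.T_abelian_group] T.T_abelian_group _ x])
      (simp add: tmap_tens[OF t t h2 lin_hom_id] tmap_tens[OF t t h1 lin_hom_id] ev finite_rank_step(4)
        T.tens_add_left p f rmod_smult[OF M] T.tens_balanced addhomD[OF right_linD(1)[OF h1]])
  then show ?case
    using step[OF finite_rank_step(2) p addhom_closed[OF tmap_addhom[OF t t h1 lin_hom_id] x] finite_rank_step(5)]
    by simp
qed

text \<open>The dual basis expansion of \<open>x\<close>, obtained for \<open>h\<close> the identity
  of \<open>M\<close>.\<close>

lemma right_projective_induct:
  assumes M: "right_module R M" "fgproj (opp R) (right_part M)" and Y: "left_module R Y"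
    and x: "x \<in> carrier (tensor R M Y)"
    and zero: "P \<zero>\<^bsub>tensor R M Y\<^esub>"
    and step: "\<And>f p u. \<lbrakk>f \<in> functionals (opp R) (right_part M); p \<in> carrier M; u \<in> carrier (tensor R M Y); P u\<rbrakk> \<Longrightarrow>
      P (tens R M Y p (tens_eval Y f x) \<oplus>\<^bsub>tensor R M Y\<^esub> u)"
  shows "P x"
proof -
  have "P (tmap R M Y (\<lambda>m. m) (\<lambda>y. y) x)"
    by (rule tmap_finite_rank_induct[OF M(1) Y M(2)]) (use x zero step in simp_all)
  moreover have "tmap R M Y (\<lambda>m. m) (\<lambda>y. y) x = x"
    by (rule tmap_id[OF tensorableI[OF M(1) Y]]) (use x right_lin_id lin_hom_id in simp_all)
  ultimately show ?thesis by simp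
qed

text \<open>Contractions are natural. So every contraction of an element of the kernel is killed by
  the injective \<open>j\<close>, and the dual basis expansion makes the element zero.\<close>

lemma tensor_map_inj:
  assumes M: "bimod_over L R M" "fgproj (opp R) (right_part M)" and m: "left_module R X" "left_module R Y"
    and j: "j \<in> lin_hom R X Y" "inj_on j (carrier X)"
  shows "inj_on (tensor_map R M Y j) (carrier (tensor R M X))"
proof -
  note r = bimod_overD(2)[OF M(1)]
  note t = tensorableI[OF r m(1)]
  interpret T: tensor_product R M X by (rule tensor_product.intro[OF t])
  note lT = tensor_left_module[OF M(1) m(1)] tensor_left_module[OF M(1) m(2)]
  show ?thesis
    unfolding lin_hom_inj_iff[OF tensor_map_lin_hom[OF M(1) m j(1)] lT]
  proof (intro ballI impI)
    fix x assume x: "x \<in> carrier (tensor R M X)" and 0: "tensor_map R M Y j x = \<zero>\<^bsub>tensor R M Y\<^esub>"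
    have ev: "tens_eval X f x = \<zero>\<^bsub>X\<^esub>" if f: "f \<in> functionals (opp R) (right_part M)" for f
    proof -
      have "j (tens_eval X f x) = tens_eval Y f \<zero>\<^bsub>tens_group R M Y\<^esub>"
        using tens_eval_natural[OF r m f j(1) x] 0 by simp
      also have "\<dots> = \<zero>\<^bsub>Y\<^esub>"
        by (rule addhom_zero[OF tens_eval_addhom[OF r m(2) f] tens_abelian_group(1)[OF tensorableI[OF r m(2)]]
            lmod_abelian_group[OF m(2)]])
      finally show ?thesis
        using j(2) addhom_closed[OF tens_eval_addhom[OF r m(1) f]] x
        unfolding lin_hom_inj_iff[OF j(1) m] by simp
    qed
    show "x = \<zero>\<^bsub>tensor R M X\<^esub>"
    proof (rule right_projective_induct[OF r M(2) m(1) x, where P = "\<lambda>u. u = \<zero>\<^bsub>tensor R M X\<^esub>"])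
      fix f p u assume "f \<in> functionals (opp R) (right_part M)" "p \<in> carrier M"
        "u \<in> carrier (tensor R M X)" "u = \<zero>\<^bsub>tensor R M X\<^esub>"
      then show "tens R M X p (tens_eval X f x) \<oplus>\<^bsub>tensor R M X\<^esub> u = \<zero>\<^bsub>tensor R M X\<^esub>"
        using ev addhom_zero[OF T.tens_addhom(1) T.abY T.T_abelian_group] by simp
    qed simp
  qed
qed

lemma tensor_map_surj:
  assumes M: "bimod_over L R M" and m: "left_module R X" "left_module R Y"
    and p: "p \<in> lin_hom R X Y" "p ` carrier X = carrier Y"
  shows "tensor_map R M Y p ` carrier (tensor R M X) = carrier (tensor R M Y)"
proof
  note r = bimod_overD(2)[OF M(1)]
  interpret T: tensor_product R M X using r m(1) by (rule tensor_productI)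
  interpret T': tensor_product R M Y using r m(2) by (rule tensor_productI)
  note pl = tensor_map_lin_hom[OF M m p(1)]
  show "tensor_map R M Y p ` carrier (tensor R M X) \<subseteq> carrier (tensor R M Y)"
    by (rule image_subsetI) (rule lin_hom_closed[OF pl])
  have "t \<in> tensor_map R M Y p ` carrier (tens_group R M X)" if "t \<in> carrier (tens_group R M Y)" for t
    using that
  proof (induction rule: T'.tensor_induct)
    case zero
    show ?case using lin_hom_zero[OF pl tensor_left_module[OF M m(1)] tensor_left_module[OF M m(2)]]
      by (intro rev_image_eqI[of "\<zero>\<^bsub>tens_group R M X\<^esub>"]) simp_all
  next
    case (tens u y)
    obtain x where x: "x \<in> carrier X" "p x = y" using surj_obtain[OF p(2) tens(2)] .
    show ?case
      using x tens(1) tensor_map_tens[OF r m p(1) tens(1) x(1)]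
      by (intro rev_image_eqI[of "tens R M X u x"]) (simp_all add: T.tens_closed)
  next
    case (add u v)
    obtain u' v' where u: "u' \<in> carrier (tens_group R M X)" "u = tensor_map R M Y p u'"
      "v' \<in> carrier (tens_group R M X)" "v = tensor_map R M Y p v'" using add by auto
    show ?case
      using u lin_hom_add[OF pl, of u' v']
      by (intro rev_image_eqI[of "u' \<oplus>\<^bsub>tens_group R M X\<^esub> v'"]) simp_all
  qed
  then show "carrier (tensor R M Y) \<subseteq> tensor_map R M Y p ` carrier (tensor R M X)" by auto
qed

text \<open>If \<open>t\<close> is killed by 1 \<otimes> g, then its contractions are killed by
  \<open>g\<close> and hence lie in the image of \<open>j\<close>; the dual basis expansion writes
  \<open>t\<close> as the image of a sum of pure tensors.\<close>

lemma tensor_map_exact: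
  fixes Z (structure)
  assumes M: "bimod_over L R M" "fgproj (opp R) (right_part M)"
    and m: "left_module R X" "left_module R Y" "left_module R Z"
    and j: "j \<in> lin_hom R X Y" and g: "g \<in> lin_hom R Y Z"
    and ex: "j ` carrier X = {y \<in> carrier Y. g y = \<zero>}"
  shows "tensor_map R M Y j ` carrier (tensor R M X) =
    {t \<in> carrier (tensor R M Y). tensor_map R M Z g t = \<zero>\<^bsub>tensor R M Z\<^esub>}"
proof
  let ?F = "tensor R M" and ?f = "tensor_map R M"
  note r = bimod_overD(2)[OF M(1)]
  interpret TX: tensor_product R M X using r m(1) by (rule tensor_productI)
  interpret TY: tensor_product R M Y using r m(2) by (rule tensor_productI)
  note lT = tensor_left_module[OF M(1) m(1)] tensor_left_module[OF M(1) m(2)] tensor_left_module[OF M(1) m(3)]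
  note jl = tensor_map_lin_hom[OF M(1) m(1,2) j] and gl = tensor_map_lin_hom[OF M(1) m(2,3) g]
  have z: "(\<lambda>_. \<zero>) \<in> lin_hom R X Z" by (rule lin_hom_zero_map[OF m(3)])
  have gj: "g (j x) = \<zero>" if "x \<in> carrier X" for x using ex that by auto
  have zf: "?f Z (\<lambda>_. \<zero>) x = \<zero>\<^bsub>?F Z\<^esub>" if x: "x \<in> carrier (?F X)" for x
  proof -
    interpret Z: abelian_group Z by (rule lmod_abelian_group[OF m(3)])
    interpret TZ: abelian_group "?F Z" by (rule lmod_abelian_group[OF lT(3)])
    have "?f Z (\<lambda>_. \<zero>) x =
      ?f Z (\<lambda>_. \<zero>) x \<oplus>\<^bsub>?F Z\<^esub> ?f Z (\<lambda>_. \<zero>) x"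
      using tensor_map_add[OF r m(1,3) z z x] by simp
    then show ?thesis
      using lin_hom_closed[OF tensor_map_lin_hom[OF M(1) m(1,3) z] x] by (metis TZ.add.l_cancel_one')
  qed
  show "?f Y j ` carrier (?F X) \<subseteq>
    {t \<in> carrier (?F Y). ?f Z g t = \<zero>\<^bsub>?F Z\<^esub>}"
  proof (rule image_subsetI, rule CollectI, rule conjI)
    fix x assume x: "x \<in> carrier (?F X)"
    show "?f Y j x \<in> carrier (?F Y)" by (rule lin_hom_closed[OF jl x])
    have "?f Z (\<lambda>x. g (j x)) x = ?f Z (\<lambda>_. \<zero>) x"
      by (rule tensor_map_cong[OF r m(1,3) lin_hom_comp[OF j g] z gj x])
    then show "?f Z g (?f Y j x) = \<zero>\<^bsub>?F Z\<^esub>"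
      using zf[OF x] tensor_map_comp[OF r m j g x] by simp
  qed
  show "{t \<in> carrier (?F Y). ?f Z g t = \<zero>\<^bsub>?F Z\<^esub>} \<subseteq>
    ?f Y j ` carrier (?F X)"
  proof clarify
    fix t assume t: "t \<in> carrier (?F Y)" and 0: "?f Z g t = \<zero>\<^bsub>?F Z\<^esub>"
    show "t \<in> ?f Y j ` carrier (?F X)"
    proof (rule right_projective_induct[OF r M(2) m(2) t])
      show "\<zero>\<^bsub>?F Y\<^esub> \<in> ?f Y j ` carrier (?F X)"
        using lin_hom_zero[OF jl lT(1,2)] by (intro rev_image_eqI[OF lmod_zero[OF lT(1)]]) simp
    next
      fix f p u assume f: "f \<in> functionals (opp R) (right_part M)" and p: "p \<in> carrier M"
        and "u \<in> carrier (?F Y)" and "u \<in> ?f Y j ` carrier (?F X)"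
      then obtain v where v: "v \<in> carrier (?F X)" "u = ?f Y j v" by blast
      have "g (tens_eval Y f t) = tens_eval Z f \<zero>\<^bsub>tens_group R M Z\<^esub>"
        using tens_eval_natural[OF r m(2,3) f g t] 0 by simp
      also have "\<dots> = \<zero>"
        by (rule addhom_zero[OF tens_eval_addhom[OF r m(3) f] tens_abelian_group(1)[OF tensorableI[OF r m(3)]]
            lmod_abelian_group[OF m(3)]])
      finally have "tens_eval Y f t \<in> j ` carrier X"
        unfolding ex using addhom_closed[OF tens_eval_addhom[OF r m(2) f]] t by simp
      then obtain x where x: "x \<in> carrier X" "tens_eval Y f t = j x" by blast
      have tx: "tens R M X p x \<in> carrier (?F X)" using TX.tens_closed[OF p x(1)] by simp
      have "tens R M Y p (tens_eval Y f t) \<oplus>\<^bsub>?F Y\<^esub> u =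
          ?f Y j (tens R M X p x \<oplus>\<^bsub>?F X\<^esub> v)"
        unfolding lin_hom_add[OF jl tx v(1)] tensor_map_tens[OF r m(1,2) j p x(1)] x(2) v(2) ..
      then show "tens R M Y p (tens_eval Y f t) \<oplus>\<^bsub>?F Y\<^esub> u \<in> ?f Y j ` carrier (?F X)"
        using lmod_add[OF lT(1) tx v(1)] by (rule image_eqI)
    qed
  qed
qed

section \<open>Associativity of the tensor product\<close>

lemma left_module_cong:
  assumes "left_module L X" "carrier Y = carrier X" "add Y = add X" "\<zero>\<^bsub>Y\<^esub> = \<zero>\<^bsub>X\<^esub>"
    "\<And>a x. \<lbrakk>a \<in> carrier L; x \<in> carrier X\<rbrakk> \<Longrightarrow> a \<odot>\<^bsub>Y\<^esub> x = a \<odot>\<^bsub>X\<^esub> x"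
  shows "left_module L Y"
proof -
  interpret L: ring L by (rule left_module_ring[OF assms(1)])
  have "abelian_group Y" by (rule abelian_group_cong[OF lmod_abelian_group[OF assms(1)] assms(2-4)])
  then show ?thesis
    by (rule left_moduleI[OF left_module_ring[OF assms(1)]])
      (simp_all add: assms(2-5) left_moduleD[OF assms(1)])
qed

lemma bitensor_bimod_over:
  fixes N (structure)
  assumes M: "bimod_over L R M" and N: "bimod_over R Q N"
  shows "bimod_over L Q (bitensor R M N)"
proof -
  let ?B = "right_part (bitensor R M N)"
  note m = bimod_overD[OF M] and n = bimod_overD[OF N]
  note t = tensorableI[OF m(2) n(1)]
  note rn = right_moduleD[OF n(2)]
  interpret Q: ring "opp Q" by (rule left_module_ring[OF n(2)])
  interpret T: tensor_product R M N by (rule tensor_product.intro[OF t])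
  note s = smult_right_lin[OF M] and r = rsmult_lin_hom[OF N]
  note i = right_lin_id[of R M] and i' = lin_hom_id[of R N]
  have l: "left_module L (bitensor R M N)"
    by (rule left_module_cong[OF tensor_left_module[OF M n(1)]]) simp_all
  let ?s = "\<lambda>q. tmap R M N (\<lambda>m. m) (\<lambda>n. n \<triangleleft> q)"
  note ah = tmap_addhom[OF t t i r]
  have rt: "left_module (opp Q) (?B)"
  proof (rule left_moduleI[OF Q.ring_axioms])
    show "abelian_group (?B)"
      by (rule abelian_group_cong[OF T.T_abelian_group]) simp_all
    fix a x assume a: "a \<in> carrier (opp Q)" and x: "x \<in> carrier (?B)"
    have a': "a \<in> carrier Q" and x': "x \<in> carrier (tens_group R M N)" using a x by simp_all
    show "a \<odot>\<^bsub>?B\<^esub> x \<in> carrier (?B)"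
      using x addhom_closed[OF ah[OF a']] by simp
    {
      fix b assume b: "b \<in> carrier (opp Q)"
      have b': "b \<in> carrier Q" and ab: "a \<oplus>\<^bsub>Q\<^esub> b \<in> carrier Q" "b \<otimes>\<^bsub>Q\<^esub> a \<in> carrier Q"
        using Q.a_closed[OF a b] Q.m_closed[OF a b] b by simp_all
      have "?s (a \<oplus>\<^bsub>Q\<^esub> b) x = tmap R M N (\<lambda>m. m) (\<lambda>n. n \<triangleleft> a \<oplus> n \<triangleleft> b) x"
        by (rule tmap_cong[OF t t i r[OF ab(1)] i lin_hom_sum[OF r[OF a'] r[OF b'] n(1)] _ _ x'])
          (simp_all add: rn a' b')
      also have "\<dots> = ?s a x \<oplus>\<^bsub>tens_group R M N\<^esub> ?s b x"
        by (rule tmap_add_right[OF t t n(1) i r[OF a'] r[OF b'] x'])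
      finally show "(a \<oplus>\<^bsub>opp Q\<^esub> b) \<odot>\<^bsub>?B\<^esub> x = a \<odot>\<^bsub>?B\<^esub> x
          \<oplus>\<^bsub>?B\<^esub> b \<odot>\<^bsub>?B\<^esub> x" by simp
      have "?s a (?s b x) = tmap R M N (\<lambda>m. m) (\<lambda>n. (n \<triangleleft> b) \<triangleleft> a) x"
        by (rule tmap_comp[OF t t t i r[OF b'] i r[OF a'] x'])
      also have "\<dots> = ?s (b \<otimes>\<^bsub>Q\<^esub> a) x"
        by (rule tmap_cong[OF t t i lin_hom_comp[OF r[OF b'] r[OF a']] i r[OF ab(2)] _ _ x'])
          (simp_all add: rn a' b')
      finally show "(a \<otimes>\<^bsub>opp Q\<^esub> b) \<odot>\<^bsub>?B\<^esub> x =
          a \<odot>\<^bsub>?B\<^esub> (b \<odot>\<^bsub>?B\<^esub> x)" by simp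
    }
    fix y assume y: "y \<in> carrier (?B)"
    show "a \<odot>\<^bsub>?B\<^esub> (x \<oplus>\<^bsub>?B\<^esub> y) =
       a \<odot>\<^bsub>?B\<^esub> x \<oplus>\<^bsub>?B\<^esub> a \<odot>\<^bsub>?B\<^esub> y"
      using x y addhom_add[OF ah[OF a']] by simp
  next
    fix x assume x: "x \<in> carrier (?B)"
    have o: "\<one>\<^bsub>Q\<^esub> \<in> carrier Q" using Q.one_closed by simp
    show "\<one>\<^bsub>opp Q\<^esub> \<odot>\<^bsub>?B\<^esub> x = x"
      using x by (simp, intro tmap_id[OF t]) (simp_all add: i r[OF o] rn)
  qed
  have "tmap R M N (\<lambda>m. m) (\<lambda>n. n \<triangleleft> q) (tmap R M N (\<lambda>m. a \<odot>\<^bsub>M\<^esub> m) (\<lambda>n. n) x) =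
      tmap R M N (\<lambda>m. a \<odot>\<^bsub>M\<^esub> m) (\<lambda>n. n) (tmap R M N (\<lambda>m. m) (\<lambda>n. n \<triangleleft> q) x)"
    if a: "a \<in> carrier L" and q: "q \<in> carrier Q" and x: "x \<in> carrier (tens_group R M N)" for a q x
    unfolding tmap_comp[OF t t t s[OF a] i' i r[OF q] x] tmap_comp[OF t t t i r[OF q] s[OF a] i' x] ..
  then show ?thesis using l rt by (simp add: bimod_over_def)
qed

text \<open>The associator m \<otimes> (n \<otimes> a) \<mapsto> (m \<otimes> n) \<otimes> a as an
  iterated lift.\<close>

definition tens_assoc ::
  "('k, 's) module \<Rightarrow> ('l, 's, 'm) bimod \<Rightarrow> ('k, 'r) module \<Rightarrow> ('s, 'r, 'n) bimod \<Rightarrow> ('r, 'a, 'z) module_scheme \<Rightarrow>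
    ('m \<times> ('n \<times> 'a \<Rightarrow>\<^sub>0 int) set \<Rightarrow>\<^sub>0 int) set \<Rightarrow> (('m \<times> 'n \<Rightarrow>\<^sub>0 int) set \<times> 'a \<Rightarrow>\<^sub>0 int) set"
where
  "tens_assoc S M R N A = tens_lift (tens_group R (bitensor S M N) A)
     (\<lambda>m. tens_lift (tens_group R (bitensor S M N) A) (\<lambda>n a. tens R (bitensor S M N) A (tens S M N m n) a))"

locale triple_tensor =
  fixes L :: "('k, 'l) module" and S :: "('k, 's) module" and R :: "('k, 'r) module"
    and M :: "('l, 's, 'm) bimod" and N :: "('s, 'r, 'n) bimod" and A :: "('r, 'a) module"
  assumes M: "bimod_over L S M" and N: "bimod_over S R N" and A: "left_module R A"
begin

abbreviation "B \<equiv> bitensor S M N"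
abbreviation "NA \<equiv> tensor R N A"

lemma B: "bimod_over L R B" by (rule bitensor_bimod_over[OF M N])
lemma NAm: "left_module S NA" by (rule tensor_left_module[OF N A])

sublocale MN: tensor_product S M N by (rule tensor_productI[OF bimod_overD(2)[OF M] bimod_overD(1)[OF N]])
sublocale NA: tensor_product R N A by (rule tensor_productI[OF bimod_overD(2)[OF N] A])
sublocale P: tensor_product S M NA by (rule tensor_productI[OF bimod_overD(2)[OF M] NAm])
sublocale Q: tensor_product R B A by (rule tensor_productI[OF bimod_overD(2)[OF B] A])

text \<open>Additive maps on a triple tensor product are compared one factor at a time: for fixed
  \<open>m\<close>, both sides are additive in the inner tensor.\<close>

lemma P_eq:
  assumes f: "f \<in> addhom P.T G" "g \<in> addhom P.T G" and G: "abelian_group G"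
    and e: "\<And>m n a. \<lbrakk>m \<in> carrier M; n \<in> carrier N; a \<in> carrier A\<rbrakk> \<Longrightarrow>
      f (tens S M NA m (tens R N A n a)) = g (tens S M NA m (tens R N A n a))" and x: "x \<in> carrier P.T"
  shows "f x = g x"
proof (rule P.addhom_tensor_eq[OF f G _ x])
  fix m t assume m: "m \<in> carrier M" and "t \<in> carrier NA"
  then have t: "t \<in> carrier NA.T" by simp
  have h: "tens S M NA m \<in> addhom NA.T P.T" using P.tens_addhom(1)[OF m] by simp
  show "f (tens S M NA m t) = g (tens S M NA m t)"
    by (rule NA.addhom_tensor_eq[OF addhom_comp[OF h f(1)] addhom_comp[OF h f(2)] G e[OF m] t])
qed

lemma Q_eq:
  assumes f: "f \<in> addhom Q.T G" "g \<in> addhom Q.T G" and G: "abelian_group G"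
    and e: "\<And>m n a. \<lbrakk>m \<in> carrier M; n \<in> carrier N; a \<in> carrier A\<rbrakk> \<Longrightarrow>
      f (tens R B A (tens S M N m n) a) = g (tens R B A (tens S M N m n) a)" and x: "x \<in> carrier Q.T"
  shows "f x = g x"
proof (rule Q.addhom_tensor_eq[OF f G _ x])
  fix u a assume "u \<in> carrier B" and a: "a \<in> carrier A"
  then have u: "u \<in> carrier MN.T" by simp
  have h: "(\<lambda>u. tens R B A u a) \<in> addhom MN.T Q.T" using Q.tens_addhom(2)[OF a] by simp
  show "f (tens R B A u a) = g (tens R B A u a)"
    by (rule MN.addhom_tensor_eq[OF addhom_comp[OF h f(1)] addhom_comp[OF h f(2)] G e[OF _ _ a] u])
qed

lemma act_tens: "\<lbrakk>m \<in> carrier M; n \<in> carrier N; r \<in> carrier R\<rbrakk> \<Longrightarrow>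
    tmap S M N (\<lambda>m. m) (\<lambda>n. n \<triangleleft>\<^bsub>N\<^esub> r) (tens S M N m n) = tens S M N m (n \<triangleleft>\<^bsub>N\<^esub> r)"
  by (rule tmap_tens[OF MN.tensorable MN.tensorable right_lin_id rsmult_lin_hom[OF N]])

lemmas smN = tensor_smult_tens[OF N A]
lemmas smM = tensor_smult_tens[OF M bimod_overD(1)[OF N]]
lemmas smP = tensor_smult_tens[OF M NAm]
lemmas smQ = tensor_smult_tens[OF B A]

text \<open>Balanced over \<open>R\<close> because \<open>R\<close> acts on M \<otimes> N through
  \<open>N\<close>.\<close>

lemma inner:
  assumes m: "m \<in> carrier M"
  shows "tens_lift Q.T (\<lambda>n a. tens R B A (tens S M N m n) a) \<in> addhom NA.T Q.T"
    and "\<lbrakk>n \<in> carrier N; a \<in> carrier A\<rbrakk> \<Longrightarrow>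
      tens_lift Q.T (\<lambda>n a. tens R B A (tens S M N m n) a) (tens R N A n a) = tens R B A (tens S M N m n) a"
proof -
  have b: "balanced R N A Q.T (\<lambda>n a. tens R B A (tens S M N m n) a)"
    using Q.tens_add_left Q.tens_balanced
    by (intro balancedI) (simp_all add: m MN.tens_closed Q.tens_closed MN.tens_add_right Q.tens_add_right
        act_tens[symmetric])
  show "tens_lift Q.T (\<lambda>n a. tens R B A (tens S M N m n) a) \<in> addhom NA.T Q.T"
    "\<lbrakk>n \<in> carrier N; a \<in> carrier A\<rbrakk> \<Longrightarrow>
      tens_lift Q.T (\<lambda>n a. tens R B A (tens S M N m n) a) (tens R N A n a) = tens R B A (tens S M N m n) a"
    by (rule NA.tens_lift_addhom[OF Q.T_abelian_group b] NA.tens_lift_tens[OF Q.T_abelian_group b]; assumption)+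
qed

text \<open>Additivity and balancedness in \<open>m\<close> are identities between additive maps on
  N \<otimes> A, so they may be tested on the elements n \<otimes> a, where \<open>inner\<close>
  evaluates both sides.\<close>

lemma outer:
  shows assoc_addhom: "tens_assoc S M R N A \<in> addhom P.T Q.T"
    and assoc_tens: "\<lbrakk>m \<in> carrier M; n \<in> carrier N; a \<in> carrier A\<rbrakk> \<Longrightarrow>
      tens_assoc S M R N A (tens S M NA m (tens R N A n a)) = tens R B A (tens S M N m n) a"
proof -
  let ?i = "\<lambda>m. tens_lift Q.T (\<lambda>n a. tens R B A (tens S M N m n) a)"
  have b: "balanced S M NA Q.T ?i"
  proof (rule balancedI)
    fix m y assume m: "m \<in> carrier M" and "y \<in> carrier NA"
    then have y: "y \<in> carrier NA.T" by simp
    show "?i m y \<in> carrier Q.T" by (rule addhom_closed[OF inner(1)[OF m] y])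
    show "?i m (y \<oplus>\<^bsub>NA\<^esub> y') = ?i m y \<oplus>\<^bsub>Q.T\<^esub> ?i m y'" if "y' \<in> carrier NA" for y'
      using addhom_add[OF inner(1)[OF m] y] that by simp
    show "?i (m \<oplus>\<^bsub>M\<^esub> m') y = ?i m y \<oplus>\<^bsub>Q.T\<^esub> ?i m' y" if m': "m' \<in> carrier M" for m'
    proof -
      have mm: "m \<oplus>\<^bsub>M\<^esub> m' \<in> carrier M" using m m' by simp
      show ?thesis
        using Q.tens_add_left
        by (intro NA.addhom_tensor_eq[OF inner(1)[OF mm] addhom_sum[OF inner(1)[OF m] inner(1)[OF m'] Q.T_abelian_group]
            Q.T_abelian_group _ y]) (simp add: inner(2) m m' mm MN.tens_add_left MN.tens_closed)
    qed
    show "?i (m \<triangleleft>\<^bsub>M\<^esub> r) y = ?i m (r \<odot>\<^bsub>NA\<^esub> y)" if r: "r \<in> carrier S" for r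
    proof -
      have mr: "m \<triangleleft>\<^bsub>M\<^esub> r \<in> carrier M" using MN.act_closed(1)[OF m r] .
      have "?i (m \<triangleleft>\<^bsub>M\<^esub> r) y = ?i m (tmap R N A (\<lambda>n. r \<odot>\<^bsub>N\<^esub> n) (\<lambda>a. a) y)"
        by (rule NA.addhom_tensor_eq[OF inner(1)[OF mr] addhom_comp[OF tmap_addhom[OF NA.tensorable NA.tensorable
            smult_right_lin[OF N r] lin_hom_id] inner(1)[OF m]] Q.T_abelian_group _ y])
          (simp add: smN r inner(2) m mr MN.act_closed MN.tens_balanced)
      then show ?thesis by simp
    qed
  qed
  show "tens_assoc S M R N A \<in> addhom P.T Q.T"
    unfolding tens_assoc_def by (rule P.tens_lift_addhom[OF Q.T_abelian_group b])
  show "\<lbrakk>m \<in> carrier M; n \<in> carrier N; a \<in> carrier A\<rbrakk> \<Longrightarrow>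
      tens_assoc S M R N A (tens S M NA m (tens R N A n a)) = tens R B A (tens S M N m n) a"
    unfolding tens_assoc_def using P.tens_lift_tens[OF Q.T_abelian_group b, of m "tens R N A n a"]
    by (simp add: NA.tens_closed inner(2))
qed

lemma coinner:
  assumes a: "a \<in> carrier A"
  shows "tens_lift P.T (\<lambda>m n. tens S M NA m (tens R N A n a)) \<in> addhom MN.T P.T"
    and "\<lbrakk>m \<in> carrier M; n \<in> carrier N\<rbrakk> \<Longrightarrow>
      tens_lift P.T (\<lambda>m n. tens S M NA m (tens R N A n a)) (tens S M N m n) = tens S M NA m (tens R N A n a)"
proof -
  have b: "balanced S M N P.T (\<lambda>m n. tens S M NA m (tens R N A n a))"
    using P.tens_balanced P.tens_add_right
    by (intro balancedI) (simp_all add: a NA.tens_closed P.tens_closed NA.tens_add_left P.tens_add_left smN)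
  show "tens_lift P.T (\<lambda>m n. tens S M NA m (tens R N A n a)) \<in> addhom MN.T P.T"
    "\<lbrakk>m \<in> carrier M; n \<in> carrier N\<rbrakk> \<Longrightarrow>
      tens_lift P.T (\<lambda>m n. tens S M NA m (tens R N A n a)) (tens S M N m n) = tens S M NA m (tens R N A n a)"
    by (rule MN.tens_lift_addhom[OF P.T_abelian_group b] MN.tens_lift_tens[OF P.T_abelian_group b]; assumption)+
qed

text \<open>The inverse of the associator, built symmetrically by lifting first over M \<otimes> N
  with \<open>a\<close> fixed.\<close>

lemma coouter:
  obtains h where "h \<in> addhom Q.T P.T" "\<And>m n a. \<lbrakk>m \<in> carrier M; n \<in> carrier N; a \<in> carrier A\<rbrakk> \<Longrightarrow>
      h (tens R B A (tens S M N m n) a) = tens S M NA m (tens R N A n a)"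
proof -
  let ?i = "\<lambda>u a. tens_lift P.T (\<lambda>m n. tens S M NA m (tens R N A n a)) u"
  have b: "balanced R B A P.T ?i"
  proof (rule balancedI)
    fix u a assume "u \<in> carrier B" and a: "a \<in> carrier A"
    then have u: "u \<in> carrier MN.T" by simp
    show "?i u a \<in> carrier P.T" by (rule addhom_closed[OF coinner(1)[OF a] u])
    show "?i (u \<oplus>\<^bsub>B\<^esub> u') a = ?i u a \<oplus>\<^bsub>P.T\<^esub> ?i u' a" if "u' \<in> carrier B" for u'
      using addhom_add[OF coinner(1)[OF a] u] that by simp
    show "?i u (a \<oplus>\<^bsub>A\<^esub> a') = ?i u a \<oplus>\<^bsub>P.T\<^esub> ?i u a'" if a': "a' \<in> carrier A" for a'
    proof -
      have aa: "a \<oplus>\<^bsub>A\<^esub> a' \<in> carrier A" using a a' by simp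
      show ?thesis
        using P.tens_add_right
        by (intro MN.addhom_tensor_eq[OF coinner(1)[OF aa] addhom_sum[OF coinner(1)[OF a] coinner(1)[OF a'] P.T_abelian_group]
            P.T_abelian_group _ u]) (simp add: coinner(2) a a' aa NA.tens_add_right NA.tens_closed)
    qed
    show "?i (u \<triangleleft>\<^bsub>B\<^esub> r) a = ?i u (r \<odot>\<^bsub>A\<^esub> a)" if r: "r \<in> carrier R" for r
    proof -
      have ra: "r \<odot>\<^bsub>A\<^esub> a \<in> carrier A" using NA.act_closed(2)[OF r a] .
      have "?i (tmap S M N (\<lambda>m. m) (\<lambda>n. n \<triangleleft>\<^bsub>N\<^esub> r) u) a = ?i u (r \<odot>\<^bsub>A\<^esub> a)"
        by (rule MN.addhom_tensor_eq[OF addhom_comp[OF tmap_addhom[OF MN.tensorable MN.tensorable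
            right_lin_id rsmult_lin_hom[OF N r]] coinner(1)[OF a]] coinner(1)[OF ra] P.T_abelian_group _ u])
          (simp add: act_tens r coinner(2) a ra NA.act_closed NA.tens_balanced)
      then show ?thesis by simp
    qed
  qed
  show ?thesis
  proof (rule that[OF Q.tens_lift_addhom[OF P.T_abelian_group b]])
    fix m n a assume "m \<in> carrier M" "n \<in> carrier N" "a \<in> carrier A"
    then show "tens_lift P.T ?i (tens R B A (tens S M N m n) a) = tens S M NA m (tens R N A n a)"
      using Q.tens_lift_tens[OF P.T_abelian_group b, of "tens S M N m n" a] by (simp add: MN.tens_closed coinner(2))
  qed
qed

lemma assoc_lin_iso: "tens_assoc S M R N A \<in> lin_iso L (tensor S M NA) (tensor R B A)"
proof -
  obtain h where h: "h \<in> addhom Q.T P.T" "\<And>m n a. \<lbrakk>m \<in> carrier M; n \<in> carrier N; a \<in> carrier A\<rbrakk> \<Longrightarrow>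
      h (tens R B A (tens S M N m n) a) = tens S M NA m (tens R N A n a)" by (rule coouter) blast
  have idP: "(\<lambda>x. x) \<in> addhom P.T P.T" and idQ: "(\<lambda>x. x) \<in> addhom Q.T Q.T" by (simp_all add: addhom_def)
  have 1: "h (tens_assoc S M R N A x) = x" if "x \<in> carrier P.T" for x
    by (rule P_eq[OF addhom_comp[OF assoc_addhom h(1)] idP P.T_abelian_group _ that]) (simp add: assoc_tens h(2))
  have 2: "tens_assoc S M R N A (h x) = x" if "x \<in> carrier Q.T" for x
    by (rule Q_eq[OF addhom_comp[OF h(1) assoc_addhom] idQ Q.T_abelian_group _ that]) (simp add: assoc_tens h(2))
  have "bij_betw (tens_assoc S M R N A) (carrier P.T) (carrier Q.T)"
    by (rule bij_betwI[of _ _ _ h]) (use 1 2 assoc_addhom h(1) in \<open>auto simp: addhom_closed\<close>)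
  moreover have "tens_assoc S M R N A (tmap S M NA (\<lambda>m. l \<odot>\<^bsub>M\<^esub> m) (\<lambda>y. y) x) =
      tmap R B A (\<lambda>m. l \<odot>\<^bsub>B\<^esub> m) (\<lambda>y. y) (tens_assoc S M R N A x)" if l: "l \<in> carrier L" and x: "x \<in> carrier P.T" for l x
  proof (rule P_eq[OF addhom_comp[OF tmap_addhom[OF P.tensorable P.tensorable smult_right_lin[OF M l] lin_hom_id] assoc_addhom]
      addhom_comp[OF assoc_addhom tmap_addhom[OF Q.tensorable Q.tensorable smult_right_lin[OF B l] lin_hom_id]] Q.T_abelian_group _ x])
    fix m n a assume c: "m \<in> carrier M" "n \<in> carrier N" "a \<in> carrier A"
    have lm: "l \<odot>\<^bsub>M\<^esub> m \<in> carrier M" using lmod_smult[OF bimod_overD(1)[OF M] l c(1)] .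
    have "tmap R B A (\<lambda>m. l \<odot>\<^bsub>B\<^esub> m) (\<lambda>y. y) (tens R B A (tens S M N m n) a) = tens R B A (l \<odot>\<^bsub>B\<^esub> tens S M N m n) a"
      using smQ[OF l _ c(3)] MN.tens_closed[OF c(1,2)] by simp
    also have "l \<odot>\<^bsub>B\<^esub> tens S M N m n = tens S M N (l \<odot>\<^bsub>M\<^esub> m) n"
      using smM[OF l c(1,2)] by simp
    finally show "tens_assoc S M R N A (tmap S M NA (\<lambda>m. l \<odot>\<^bsub>M\<^esub> m) (\<lambda>y. y) (tens S M NA m (tens R N A n a))) =
      tmap R B A (\<lambda>m. l \<odot>\<^bsub>B\<^esub> m) (\<lambda>y. y) (tens_assoc S M R N A (tens S M NA m (tens R N A n a)))"
      using smP[OF l c(1), of "tens R N A n a"] NA.tens_closed[OF c(2,3)]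
      by (simp add: assoc_tens c lm del: bitensor_simps)
  qed
  ultimately show ?thesis
    using assoc_addhom by (simp add: lin_iso_def lin_hom_iff del: bitensor_simps)
qed

end

lemma tens_assoc_natural:
  fixes L :: "('k, 'l) module" and S :: "('k, 's) module" and R :: "('k, 'r) module"
    and A :: "('r, 'a) module" and A' :: "('r, 'b) module"
  assumes M: "bimod_over L S M" and N: "bimod_over S R N" and A: "left_module R A" "left_module R A'"
    and f: "f \<in> lin_hom R A A'" and x: "x \<in> carrier (tensor S M (tensor R N A))"
  shows "tens_assoc S M R N A' (tensor_map S M (tensor R N A') (tensor_map R N A' f) x) =
    tensor_map R (bitensor S M N) A' f (tens_assoc S M R N A x)"
proof -
  interpret T: triple_tensor L S R M N A using M N A(1) by (rule triple_tensor.intro)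
  interpret T': triple_tensor L S R M N A' using M N A(2) by (rule triple_tensor.intro)
  have x': "x \<in> carrier (tens_group S M (tensor R N A))" using x by simp
  note r = bimod_overD(2)[OF M] bimod_overD(2)[OF N] bimod_overD(2)[OF T.B]
  note fl = tensor_map_lin_hom[OF N A f]
  have 1: "tensor_map S M (tensor R N A') (tensor_map R N A' f) \<in>
      addhom (tens_group S M (tensor R N A)) (tens_group S M (tensor R N A'))"
    using lin_hom_addhom[OF tensor_map_lin_hom[OF M T.NAm T'.NAm fl]] by simp
  have 2: "tensor_map R (bitensor S M N) A' f \<in>
      addhom (tens_group R (bitensor S M N) A) (tens_group R (bitensor S M N) A')"
    using lin_hom_addhom[OF tensor_map_lin_hom[OF T.B A f]] by simp
  show ?thesis
  proof (rule T.P_eq[OF addhom_comp[OF 1 T'.assoc_addhom] addhom_comp[OF T.assoc_addhom 2] T'.Q.T_abelian_group _ x'])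
    fix m n a assume c: "m \<in> carrier M" "n \<in> carrier N" "a \<in> carrier A"
    have na: "tens R N A n a \<in> carrier (tensor R N A)" using T.NA.tens_closed[OF c(2,3)] by simp
    have mn: "tens S M N m n \<in> carrier (bitensor S M N)" using T.MN.tens_closed[OF c(1,2)] by simp
    show "tens_assoc S M R N A' (tensor_map S M (tensor R N A') (tensor_map R N A' f) (tens S M (tensor R N A) m (tens R N A n a))) =
      tensor_map R (bitensor S M N) A' f (tens_assoc S M R N A (tens S M (tensor R N A) m (tens R N A n a)))"
      unfolding tensor_map_tens[OF r(1) T.NAm T'.NAm fl c(1) na] tensor_map_tens[OF r(2) A f c(2,3)]
        T.assoc_tens[OF c] tensor_map_tens[OF r(3) A f mn c(3)]
        T'.assoc_tens[OF c(1,2) lin_hom_closed[OF f c(3)]] ..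
  qed
qed

section \<open>Stable homomorphisms\<close>

definition short_exact ::
  "('r, 's) ring_scheme \<Rightarrow> ('r, 'x, 'z) module_scheme \<Rightarrow> ('r, 'p, 'w) module_scheme \<Rightarrow> ('r, 'y, 'v) module_scheme \<Rightarrow>
    ('x \<Rightarrow> 'p) \<Rightarrow> ('p \<Rightarrow> 'y) \<Rightarrow> bool"
where
  "short_exact R X' P X j p \<longleftrightarrow> j \<in> lin_hom R X' P \<and> inj_on j (carrier X') \<and> p \<in> lin_hom R P X \<and>
     p ` carrier P = carrier X \<and> j ` carrier X' = {x \<in> carrier P. p x = \<zero>\<^bsub>X\<^esub>}"

lemma short_exactD:
  assumes "short_exact R X' P X j p"
  shows "j \<in> lin_hom R X' P" "inj_on j (carrier X')" "p \<in> lin_hom R P X" "p ` carrier P = carrier X"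
    "j ` carrier X' = {x \<in> carrier P. p x = \<zero>\<^bsub>X\<^esub>}" "\<And>x. x \<in> carrier X' \<Longrightarrow> p (j x) = \<zero>\<^bsub>X\<^esub>"
    "\<And>x. x \<in> carrier X' \<Longrightarrow> j x \<in> carrier P"
  using assms unfolding short_exact_def by auto

text \<open>Surjectivity of Hom(P, R) -> Hom(X, R). For the kernel \<open>X\<close> of an
  epimorphism from a projective \<open>P\<close> it says that Ext^1 of the quotient into
  \<open>R\<close> vanishes. This is the form in which the injective dimension enters.\<close>

definition extends :: "('r, 's) ring_scheme \<Rightarrow> ('r, 'x, 'z) module_scheme \<Rightarrow> ('r, 'p, 'w) module_scheme \<Rightarrow>
    ('x \<Rightarrow> 'p) \<Rightarrow> bool"
where
  "extends R X P j \<longleftrightarrow> (\<forall>f \<in> functionals R X. \<exists>g \<in> functionals R P. \<forall>x \<in> carrier X. g (j x) = f x)"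

text \<open>The functionals are extended one by one, and the vectors stay.\<close>

lemma extends_finite_rank:
  assumes e: "extends R X P j" and h: "finite_rank R X Y h" and j: "j \<in> lin_hom R X P"
  obtains h' where "finite_rank R P Y h'" "\<And>x. x \<in> carrier X \<Longrightarrow> h' (j x) = h x"
proof -
  have "\<exists>h'. finite_rank R P Y h' \<and> (\<forall>x \<in> carrier X. h' (j x) = h x)"
    using h
  proof induction
    case (finite_rank_zero h)
    then show ?case by (intro exI[of _ "\<lambda>_. \<zero>\<^bsub>Y\<^esub>"]) (simp add: finite_rank.finite_rank_zero)
  next
    case (finite_rank_step h f y h1)
    obtain h' where h': "finite_rank R P Y h'" "\<forall>x \<in> carrier X. h' (j x) = h x"
      using finite_rank_step(5) by auto
    obtain g where g: "g \<in> functionals R P" "\<forall>x \<in> carrier X. g (j x) = f x"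
      using e finite_rank_step(2) unfolding extends_def by auto
    have "finite_rank R P Y (\<lambda>x. g x \<odot>\<^bsub>Y\<^esub> y \<oplus>\<^bsub>Y\<^esub> h' x)"
      by (rule finite_rank.finite_rank_step[OF h'(1) g(1) finite_rank_step(3)]) simp
    moreover have "\<forall>x \<in> carrier X. g (j x) \<odot>\<^bsub>Y\<^esub> y \<oplus>\<^bsub>Y\<^esub> h' (j x) = h1 x"
      using g(2) h'(2) finite_rank_step(4) by simp
    ultimately show ?case by (intro exI conjI)
  qed
  then show ?thesis using that by auto
qed

text \<open>Extend f' from X' to a finite-rank map h : P -> Y'. Then F - j' h vanishes on X' and
  descends to u : X -> Q; since q j' = 0, the map q u is \<open>f\<close>, which thus factors
  through the projective \<open>Q\<close>.\<close>

lemma syzygy_map_reflect: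
  assumes X: "short_exact R X' P X j p" and Y: "short_exact R Y' Q Y j' q" and e: "extends R X' P j"
    and m: "left_module R X'" "left_module R P" "left_module R X" "left_module R Y'" "left_module R Q" "left_module R Y"
    and Q: "fgproj R Q"
    and f: "f \<in> lin_hom R X Y" "F \<in> lin_hom R P Q" "f' \<in> lin_hom R X' Y'"
    and c: "\<And>x. x \<in> carrier P \<Longrightarrow> q (F x) = f (p x)" "\<And>x. x \<in> carrier X' \<Longrightarrow> F (j x) = j' (f' x)"
    and fr: "finite_rank R X' Y' f'"
  shows "finite_rank R X Y f"
proof -
  note x = short_exactD[OF X] and y = short_exactD[OF Y]
  interpret Q: abelian_group Q by (rule lmod_abelian_group[OF m(5)])
  interpret Y: abelian_group Y by (rule lmod_abelian_group[OF m(6)])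
  obtain h where h: "finite_rank R P Y' h" "\<And>x. x \<in> carrier X' \<Longrightarrow> h (j x) = f' x"
    by (rule extends_finite_rank[OF e fr x(1)]) blast
  note hl = finite_rank_lin_hom[OF h(1) m(2,4)]
  note d = lin_hom_minus[OF f(2) lin_hom_comp[OF hl y(1)] m(5)]
  have "F z \<ominus>\<^bsub>Q\<^esub> j' (h z) = \<zero>\<^bsub>Q\<^esub>" if z: "z \<in> carrier P" "p z = \<zero>\<^bsub>X\<^esub>" for z
  proof -
    have "z \<in> j ` carrier X'" using x(5) z by simp
    then obtain w where w: "w \<in> carrier X'" "z = j w" by blast
    show ?thesis unfolding w(2) using c(2)[OF w(1)] h(2)[OF w(1)] y(7)[OF lin_hom_closed[OF f(3) w(1)]] by simp
  qed
  then obtain u where u: "u \<in> lin_hom R X Q" "\<And>z. z \<in> carrier P \<Longrightarrow> u (p z) = F z \<ominus>\<^bsub>Q\<^esub> j' (h z)"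
    using lin_hom_factor_surj[OF x(3,4) d m(2,3,5)] by blast
  have "finite_rank R X Y (\<lambda>w. q (u w))" by (rule finite_rank_through[OF Q u(1) y(3) m(5,6)])
  then show ?thesis
  proof (rule finite_rank_cong)
    fix w assume "w \<in> carrier X"
    then obtain z where z: "z \<in> carrier P" "p z = w" using surj_obtain[OF x(4)] by blast
    have hz: "h z \<in> carrier Y'" by (rule lin_hom_closed[OF hl z(1)])
    have "q (u (p z)) = q (F z) \<ominus>\<^bsub>Y\<^esub> q (j' (h z))"
      unfolding u(2)[OF z(1)]
      by (rule lin_hom_diff[OF y(3) m(5,6) lin_hom_closed[OF f(2) z(1)] y(7)[OF hz]])
    then show "q (u w) = f w"
      using z(2) c(1)[OF z(1)] y(6)[OF hz] lin_hom_closed[OF f(1) \<open>w \<in> carrier X\<close>] by simp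
  qed
qed

text \<open>Lift \<open>f\<close> to u : X -> Q. Then F - u p lands in Y', and its restriction to X'
  is f' because p j = 0; so f' factors through the projective \<open>P\<close>.\<close>

lemma syzygy_map_preserve:
  assumes X: "short_exact R X' P X j p" and Y: "short_exact R Y' Q Y j' q"
    and m: "left_module R X'" "left_module R P" "left_module R X" "left_module R Y'" "left_module R Q" "left_module R Y"
    and P: "fgproj R P"
    and f: "f \<in> lin_hom R X Y" "F \<in> lin_hom R P Q" "f' \<in> lin_hom R X' Y'"
    and c: "\<And>x. x \<in> carrier P \<Longrightarrow> q (F x) = f (p x)" "\<And>x. x \<in> carrier X' \<Longrightarrow> F (j x) = j' (f' x)"
    and fr: "finite_rank R X Y f"
  shows "finite_rank R X' Y' f'"
proof -
  note x = short_exactD[OF X] and y = short_exactD[OF Y]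
  interpret Q: abelian_group Q by (rule lmod_abelian_group[OF m(5)])
  interpret Y: abelian_group Y by (rule lmod_abelian_group[OF m(6)])
  obtain u where u: "finite_rank R X Q u" "\<And>z. z \<in> carrier X \<Longrightarrow> q (u z) = f z"
    using finite_rank_lift[OF fr y(3,4) m(5,6)] by blast
  note ul = finite_rank_lin_hom[OF u(1) m(3,5)]
  note d = lin_hom_minus[OF f(2) lin_hom_comp[OF x(3) ul] m(5)]
  have "F z \<ominus>\<^bsub>Q\<^esub> u (p z) \<in> j' ` carrier Y'" if z: "z \<in> carrier P" for z
  proof -
    have "q (F z \<ominus>\<^bsub>Q\<^esub> u (p z)) = q (F z) \<ominus>\<^bsub>Y\<^esub> q (u (p z))"
      by (rule lin_hom_diff[OF y(3) m(5,6) lin_hom_closed[OF f(2) z] lin_hom_closed[OF lin_hom_comp[OF x(3) ul] z]])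
    also have "\<dots> = \<zero>\<^bsub>Y\<^esub>"
      using c(1)[OF z] u(2)[OF lin_hom_closed[OF x(3) z]] lin_hom_closed[OF lin_hom_comp[OF x(3) f(1)] z] by simp
    finally show ?thesis unfolding y(5) using lin_hom_closed[OF d z] by simp
  qed
  then obtain h where h: "h \<in> lin_hom R P Y'" "\<And>z. z \<in> carrier P \<Longrightarrow> j' (h z) = F z \<ominus>\<^bsub>Q\<^esub> u (p z)"
    using lin_hom_factor_inj[OF y(1,2) d m(4)] by blast
  have "finite_rank R X' Y' (\<lambda>w. h (j w))" by (rule finite_rank_through[OF P x(1) h(1) m(2,4)])
  then show ?thesis
  proof (rule finite_rank_cong)
    fix w assume w: "w \<in> carrier X'"
    have "j' (h (j w)) = j' (f' w)"
      using h(2)[OF x(7)[OF w]] c(2)[OF w] x(6)[OF w] lin_hom_zero[OF ul m(3,5)]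
        y(7)[OF lin_hom_closed[OF f(3) w]] by simp
    then show "h (j w) = f' w"
      by (rule inj_onD[OF y(2) _ lin_hom_closed[OF h(1) x(7)[OF w]] lin_hom_closed[OF f(3) w]])
  qed
qed

text \<open>The map j' f' has finite rank since its target \<open>Q\<close> is projective, so it
  extends to F : P -> Q, and \<open>F\<close> induces a map on cokernels.\<close>

lemma syzygy_map_full:
  assumes X: "short_exact R X' P X j p" and Y: "short_exact R Y' Q Y j' q" and e: "extends R X' P j"
    and m: "left_module R X'" "left_module R P" "left_module R X" "left_module R Y'" "left_module R Q" "left_module R Y"
    and Q: "fgproj R Q" and f': "f' \<in> lin_hom R X' Y'"
  obtains f F where "f \<in> lin_hom R X Y" "F \<in> lin_hom R P Q"
    "\<And>x. x \<in> carrier P \<Longrightarrow> q (F x) = f (p x)" "\<And>x. x \<in> carrier X' \<Longrightarrow> F (j x) = j' (f' x)"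
proof -
  note x = short_exactD[OF X] and y = short_exactD[OF Y]
  have "finite_rank R X' Q (\<lambda>w. j' (f' w))"
    by (rule finite_rank_comp_right[OF Q lin_hom_comp[OF f' y(1)]])
  then obtain F where F: "finite_rank R P Q F" "\<And>w. w \<in> carrier X' \<Longrightarrow> F (j w) = j' (f' w)"
    using extends_finite_rank[OF e _ x(1)] by blast
  note Fl = finite_rank_lin_hom[OF F(1) m(2,5)]
  have "q (F z) = \<zero>\<^bsub>Y\<^esub>" if z: "z \<in> carrier P" "p z = \<zero>\<^bsub>X\<^esub>" for z
  proof -
    have "z \<in> j ` carrier X'" using x(5) z by simp
    then obtain w where w: "w \<in> carrier X'" "z = j w" by blast
    show ?thesis unfolding w(2) F(2)[OF w(1)] by (rule y(6)[OF lin_hom_closed[OF f' w(1)]])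
  qed
  then obtain f where "f \<in> lin_hom R X Y" "\<And>z. z \<in> carrier P \<Longrightarrow> f (p z) = q (F z)"
    using lin_hom_factor_surj[OF x(3,4) lin_hom_comp[OF Fl y(3)] m(2,3,6)] by blast
  then show ?thesis using that[OF _ Fl _ F(2)] by simp
qed

text \<open>\<open>W\<close> is a map \<open>Hom(X, Y) \<rightarrow> Hom(X', Y')\<close>; the condition says that it induces a bijection
  modulo maps factoring through finitely generated projectives.\<close>

definition stably_bij :: "('r, 's) ring_scheme \<Rightarrow> ('r, 'x, 'z) module_scheme \<Rightarrow> ('r, 'y, 'w) module_scheme \<Rightarrow>
  ('r, 'u, 'c) module_scheme \<Rightarrow> ('r, 'v, 'd) module_scheme \<Rightarrow> (('x \<Rightarrow> 'y) \<Rightarrow> 'u \<Rightarrow> 'v) \<Rightarrow> bool"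
where
  "stably_bij R X Y X' Y' W \<longleftrightarrow>
     (\<forall>f \<in> lin_hom R X Y. finite_rank R X' Y' (W f) \<longrightarrow> finite_rank R X Y f) \<and>
     (\<forall>g \<in> lin_hom R X' Y'. \<exists>f \<in> lin_hom R X Y. finite_rank R X' Y' (\<lambda>x. g x \<ominus>\<^bsub>Y'\<^esub> W f x))"

lemma stably_bijD:
  assumes "stably_bij R X Y X' Y' W"
  shows "\<lbrakk>f \<in> lin_hom R X Y; finite_rank R X' Y' (W f)\<rbrakk> \<Longrightarrow> finite_rank R X Y f"
    "g \<in> lin_hom R X' Y' \<Longrightarrow> \<exists>f \<in> lin_hom R X Y. finite_rank R X' Y' (\<lambda>x. g x \<ominus>\<^bsub>Y'\<^esub> W f x)"
  using assms unfolding stably_bij_def by auto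

lemma finite_rank_diffD:
  assumes "finite_rank R X Y (\<lambda>x. f x \<ominus>\<^bsub>Y\<^esub> g x)" "finite_rank R X Y g" "left_module R Y"
    "\<And>x. x \<in> carrier X \<Longrightarrow> f x \<in> carrier Y"
  shows "finite_rank R X Y f"
proof -
  interpret Y: abelian_group Y by (rule lmod_abelian_group[OF assms(3)])
  show ?thesis
    by (rule finite_rank_cong[OF finite_rank_add[OF assms(1-3)]])
      (simp add: Y.diff_add_cancel assms(4) finite_rank_closed[OF assms(2,3)])
qed

lemma finite_rank_diff_commute:
  assumes "finite_rank R X Y (\<lambda>x. f x \<ominus>\<^bsub>Y\<^esub> g x)" "left_module R Y"
    "\<And>x. x \<in> carrier X \<Longrightarrow> f x \<in> carrier Y" "\<And>x. x \<in> carrier X \<Longrightarrow> g x \<in> carrier Y"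
  shows "finite_rank R X Y (\<lambda>x. g x \<ominus>\<^bsub>Y\<^esub> f x)"
proof -
  interpret Y: abelian_group Y by (rule lmod_abelian_group[OF assms(2)])
  show ?thesis
    by (rule finite_rank_cong[OF finite_rank_neg[OF assms(1,2)]]) (simp add: Y.neg_diff assms(3,4))
qed

text \<open>A stable bijection passes along a natural stable isomorphism \<open>aX\<close>,
  \<open>aY\<close> with stable inverses \<open>bX\<close>, \<open>bY\<close>: all required
  identities hold up to maps of finite rank, and these are closed under sums and
  compositions.\<close>

lemma stably_bij_transfer:
  fixes WY (structure)
  assumes m: "left_module R WX" "left_module R WY" "left_module R VX" "left_module R VY"
    and W: "\<And>f. f \<in> lin_hom R X Y \<Longrightarrow> W f \<in> lin_hom R WX WY"
    and V: "\<And>f. f \<in> lin_hom R X Y \<Longrightarrow> V f \<in> lin_hom R VX VY"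
    and a: "aX \<in> lin_hom R WX VX" "bX \<in> lin_hom R VX WX" "aY \<in> lin_hom R WY VY" "bY \<in> lin_hom R VY WY"
    and nat: "\<And>f x. \<lbrakk>f \<in> lin_hom R X Y; x \<in> carrier WX\<rbrakk> \<Longrightarrow> aY (W f x) = V f (aX x)"
    and s: "finite_rank R WX WX (\<lambda>x. bX (aX x) \<ominus>\<^bsub>WX\<^esub> x)" "finite_rank R VX VX (\<lambda>x. aX (bX x) \<ominus>\<^bsub>VX\<^esub> x)"
      "finite_rank R WY WY (\<lambda>x. bY (aY x) \<ominus> x)"
    and good: "stably_bij R X Y VX VY V"
  shows "stably_bij R X Y WX WY W"
  unfolding stably_bij_def
proof (intro conjI ballI impI)
  interpret WY: abelian_group WY by (rule lmod_abelian_group[OF m(2)])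
  note A = lin_hom_closed[OF a(1)] lin_hom_closed[OF a(2)] lin_hom_closed[OF a(3)] lin_hom_closed[OF a(4)]
  {
    fix f assume f: "f \<in> lin_hom R X Y" and fr: "finite_rank R WX WY (W f)"
    have 1: "finite_rank R VX VY (\<lambda>x. V f (aX (bX x)))"
      by (rule finite_rank_cong[OF finite_rank_comp_left[OF finite_rank_comp_right[OF fr a(2)] m(2,4) a(3)]])
        (simp add: nat f A)
    have 2: "finite_rank R VX VY (\<lambda>x. V f (aX (bX x)) \<ominus>\<^bsub>VY\<^esub> V f x)"
      by (rule finite_rank_cong[OF finite_rank_comp_left[OF s(2) m(3,4) V[OF f]]])
        (simp add: lin_hom_diff[OF V[OF f] m(3,4)] A)
    have "finite_rank R VX VY (V f)"
      by (rule finite_rank_diffD[OF finite_rank_diff_commute[OF 2 m(4)] 1 m(4)])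
        (simp_all add: lin_hom_closed[OF V[OF f]] A)
    then show "finite_rank R X Y f" by (rule stably_bijD(1)[OF good f])
  next
    fix g assume g: "g \<in> lin_hom R WX WY"
    obtain f where f: "f \<in> lin_hom R X Y" "finite_rank R VX VY (\<lambda>x. aY (g (bX x)) \<ominus>\<^bsub>VY\<^esub> V f x)"
      using stably_bijD(2)[OF good lin_hom_comp[OF lin_hom_comp[OF a(2) g] a(3)]] by blast
    note G = lin_hom_closed[OF g] and Wc = lin_hom_closed[OF W[OF f(1)]] and Vc = lin_hom_closed[OF V[OF f(1)]]
    \<comment> \<open>The error left after replacing \<open>g\<close> by g bX aX, which is stably
      equal to it. Applying \<open>aY\<close> makes the error of finite rank, and bY aY is stably
      the identity.\<close>
    define u where "u x = g (bX (aX x)) \<ominus> W f x" for x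
    have uc: "u x \<in> carrier WY" if "x \<in> carrier WX" for x using that by (simp add: u_def G Wc A)
    have ul: "u \<in> lin_hom R WX WY"
      unfolding u_def by (rule lin_hom_minus[OF lin_hom_comp[OF lin_hom_comp[OF a(1,2)] g] W[OF f(1)] m(2)])
    have 1: "finite_rank R WX WY (\<lambda>x. bY (aY (u x)))"
      by (rule finite_rank_cong[OF finite_rank_comp_left[OF finite_rank_comp_right[OF f(2) a(1)] m(4,2) a(4)]])
        (simp add: u_def lin_hom_diff[OF a(3) m(2,4)] G A Wc nat[OF f(1)] Vc)
    have 2: "finite_rank R WX WY (\<lambda>x. bY (aY (u x)) \<ominus> u x)"
      by (rule finite_rank_comp_right[OF s(3) ul])
    have u: "finite_rank R WX WY u"
      by (rule finite_rank_diffD[OF finite_rank_diff_commute[OF 2 m(2)] 1 m(2)]) (simp_all add: uc A)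
    have "finite_rank R WX WY (\<lambda>x. g (bX (aX x)) \<ominus> g x)"
      by (rule finite_rank_cong[OF finite_rank_comp_left[OF s(1) m(1,2) g]])
        (simp add: lin_hom_diff[OF g m(1,2)] A)
    then have v: "finite_rank R WX WY (\<lambda>x. g x \<ominus> g (bX (aX x)))"
      by (rule finite_rank_diff_commute[OF _ m(2)]) (simp_all add: G A)
    have "finite_rank R WX WY (\<lambda>x. g x \<ominus> W f x)"
      by (rule finite_rank_cong[OF finite_rank_add[OF v u m(2)]])
        (simp add: u_def G A Wc WY.diff_add_diff)
    then show "\<exists>f \<in> lin_hom R X Y. finite_rank R WX WY (\<lambda>x. g x \<ominus> W f x)"
      using f(1) by (intro bexI)
  }
qed

text \<open>One step of dimension shifting. A stably trivial map on the syzygies is reflected to the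
  quotients; a map on the syzygies is pushed up to the quotients by fullness, corrected there, and
  the stable equality is brought back down.\<close>

lemma stably_bij_syzygy:
  assumes X: "short_exact R X' P X jX pX" and Y: "short_exact R Y' Q Y jY pY" and e: "extends R X' P jX"
    and m: "left_module R X'" "left_module R P" "left_module R X" "left_module R Y'" "left_module R Q" "left_module R Y"
    and P: "fgproj R P" and Q: "fgproj R Q"
    and W: "\<And>f. f \<in> lin_hom R U V \<Longrightarrow> W f \<in> lin_hom R X Y"
      "\<And>f. f \<in> lin_hom R U V \<Longrightarrow> WP f \<in> lin_hom R P Q" "\<And>f. f \<in> lin_hom R U V \<Longrightarrow> W' f \<in> lin_hom R X' Y'"
    and nat: "\<And>f x. \<lbrakk>f \<in> lin_hom R U V; x \<in> carrier P\<rbrakk> \<Longrightarrow> pY (WP f x) = W f (pX x)"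
      "\<And>f x. \<lbrakk>f \<in> lin_hom R U V; x \<in> carrier X'\<rbrakk> \<Longrightarrow> WP f (jX x) = jY (W' f x)"
    and good: "stably_bij R U V X Y W"
  shows "stably_bij R U V X' Y' W'"
  unfolding stably_bij_def
proof (intro conjI ballI impI)
  note x = short_exactD[OF X] and y = short_exactD[OF Y]
  fix f assume f: "f \<in> lin_hom R U V" and fr: "finite_rank R X' Y' (W' f)"
  have "finite_rank R X Y (W f)"
    by (rule syzygy_map_reflect[OF X Y e m Q W(1)[OF f] W(2)[OF f] W(3)[OF f] nat(1)[OF f] nat(2)[OF f] fr])
  then show "finite_rank R U V f" by (rule stably_bijD(1)[OF good f])
next
  note x = short_exactD[OF X] and y = short_exactD[OF Y]
  fix g' assume g': "g' \<in> lin_hom R X' Y'"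
  obtain g G where g: "g \<in> lin_hom R X Y" "G \<in> lin_hom R P Q"
    "\<And>x. x \<in> carrier P \<Longrightarrow> pY (G x) = g (pX x)" "\<And>x. x \<in> carrier X' \<Longrightarrow> G (jX x) = jY (g' x)"
    using syzygy_map_full[OF X Y e m Q g'] by metis
  obtain f where f: "f \<in> lin_hom R U V" "finite_rank R X Y (\<lambda>x. g x \<ominus>\<^bsub>Y\<^esub> W f x)"
    using stably_bijD(2)[OF good g(1)] by blast
  note Wl = W(1)[OF f(1)] W(2)[OF f(1)] W(3)[OF f(1)]
  have "finite_rank R X' Y' (\<lambda>x. g' x \<ominus>\<^bsub>Y'\<^esub> W' f x)"
  proof (rule syzygy_map_preserve[OF X Y m P lin_hom_minus[OF g(1) Wl(1) m(6)] lin_hom_minus[OF g(2) Wl(2) m(5)]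
        lin_hom_minus[OF g' Wl(3) m(4)] _ _ f(2)])
    fix z assume z: "z \<in> carrier P"
    show "pY (G z \<ominus>\<^bsub>Q\<^esub> WP f z) = g (pX z) \<ominus>\<^bsub>Y\<^esub> W f (pX z)"
      unfolding lin_hom_diff[OF y(3) m(5,6) lin_hom_closed[OF g(2) z] lin_hom_closed[OF Wl(2) z]] g(3)[OF z] nat(1)[OF f(1) z] ..
  next
    fix z assume z: "z \<in> carrier X'"
    show "G (jX z) \<ominus>\<^bsub>Q\<^esub> WP f (jX z) = jY (g' z \<ominus>\<^bsub>Y'\<^esub> W' f z)"
      unfolding lin_hom_diff[OF y(1) m(4,5) lin_hom_closed[OF g' z] lin_hom_closed[OF Wl(3) z]] g(4)[OF z] nat(2)[OF f(1) z] ..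
  qed
  then show "\<exists>f \<in> lin_hom R U V. finite_rank R X' Y' (\<lambda>x. g' x \<ominus>\<^bsub>Y'\<^esub> W' f x)"
    using f(1) by (intro bexI)
qed

section \<open>Syzygies and vanishing\<close>

lemma (in fd_algebra) short_exact_fg:
  assumes "short_exact L X' P X j p" "fg_module L P" "left_module L X'" "left_module L X"
  shows "fg_module L X'"
proof -
  note x = short_exactD[OF assms(1)] and P = fg_moduleD[OF assms(2)]
  have k: "submod L P (a_kernel P X p)" by (rule kernel_submod[OF x(3) P(1) assms(4)])
  have kx: "a_kernel P X p = j ` carrier X'" using x(5) by (simp add: a_kernel_def')
  have kf: "fg_module L (P\<lparr>carrier := a_kernel P X p\<rparr>)" by (rule fg_module_submod[OF assms(2) k])
  have "j \<in> lin_iso L X' (P\<lparr>carrier := a_kernel P X p\<rparr>)"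
    unfolding kx using x(1,2) by (simp add: lin_iso_def bij_betw_def lin_hom_restrict_codomain)
  note i = lin_iso_inverse(1)[OF this assms(3)]
  show ?thesis by (rule fg_module_image[OF kf lin_isoD(1)[OF i] lin_isoD(3)[OF i] assms(3)])
qed

text \<open>Used to move a sequence with arbitrary types into the universe, where sequences can be
  chained.\<close>

lemma short_exact_iso:
  fixes X (structure)
  assumes e: "short_exact R X' P X j p" and m: "left_module R X'" "left_module R P" "left_module R X" "left_module R X0"
    and a: "a \<in> lin_iso R X' X0'" and c: "c \<in> lin_iso R P P0" and u: "u \<in> lin_iso R X X0"
  shows "short_exact R X0' P0 X0 (\<lambda>x. c (j (inv_into (carrier X') a x))) (\<lambda>x. u (p (inv_into (carrier P) c x)))"
proof -
  note x = short_exactD[OF e]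
  note ai = lin_iso_inverse[OF a m(1)] and ci = lin_iso_inverse[OF c m(2)]
  note ad = lin_isoD[OF a] and cd = lin_isoD[OF c] and ud = lin_isoD[OF u] and aid = lin_isoD[OF ai(1)] and cid = lin_isoD[OF ci(1)]
  let ?a = "inv_into (carrier X') a" and ?c = "inv_into (carrier P) c"
  show ?thesis
    unfolding short_exact_def
  proof (intro conjI)
    show "(\<lambda>x. c (j (?a x))) \<in> lin_hom R X0' P0"
      by (rule lin_hom_comp[OF lin_hom_comp[OF aid(1) x(1)] cd(1)])
    show "(\<lambda>x. u (p (?c x))) \<in> lin_hom R P0 X0"
      by (rule lin_hom_comp[OF lin_hom_comp[OF cid(1) x(3)] ud(1)])
    show "inj_on (\<lambda>x. c (j (?a x))) (carrier X0')"
    proof (rule inj_onI)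
      fix y z assume yz: "y \<in> carrier X0'" "z \<in> carrier X0'" "c (j (?a y)) = c (j (?a z))"
      have "j (?a y) = j (?a z)" by (rule inj_onD[OF cd(2) yz(3) x(7)[OF ai(4)[OF yz(1)]] x(7)[OF ai(4)[OF yz(2)]]])
      then have "?a y = ?a z" by (rule inj_onD[OF x(2) _ ai(4)[OF yz(1)] ai(4)[OF yz(2)]])
      then have "a (?a y) = a (?a z)" by (rule arg_cong)
      then show "y = z" unfolding ai(3)[OF yz(1)] ai(3)[OF yz(2)] .
    qed
    have "(\<lambda>x. u (p (?c x))) ` carrier P0 = u ` p ` ?c ` carrier P0" by (simp add: image_image)
    then show "(\<lambda>x. u (p (?c x))) ` carrier P0 = carrier X0" using x(4) cid(3) ud(3) by simp
    have "(\<lambda>x. c (j (?a x))) ` carrier X0' = c ` j ` ?a ` carrier X0'" by (simp add: image_image)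
    also have "\<dots> = c ` {x \<in> carrier P. p x = \<zero>}" using aid(3) x(5) by simp
    also have "\<dots> = {y \<in> carrier P0. u (p (?c y)) = \<zero>\<^bsub>X0\<^esub>}"
    proof (intro subset_antisym subsetI)
      fix y assume "y \<in> c ` {x \<in> carrier P. p x = \<zero>}"
      then obtain z where z: "z \<in> carrier P" "p z = \<zero>" "y = c z" by blast
      then show "y \<in> {y \<in> carrier P0. u (p (?c y)) = \<zero>\<^bsub>X0\<^esub>}"
        using ci(2)[OF z(1)] lin_hom_zero[OF ud(1) m(3,4)] lin_hom_closed[OF cd(1) z(1)] by simp
    next
      fix y assume y: "y \<in> {y \<in> carrier P0. u (p (?c y)) = \<zero>\<^bsub>X0\<^esub>}"
      then have c: "?c y \<in> carrier P" "c (?c y) = y" using ci(3,4) by simp_all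
      have "u (p (?c y)) = u \<zero>" using y lin_hom_zero[OF ud(1) m(3,4)] by simp
      then have "p (?c y) = \<zero>"
        by (rule inj_onD[OF ud(2) _ lin_hom_closed[OF x(3) c(1)] lmod_zero[OF m(3)]])
      then show "y \<in> c ` {x \<in> carrier P. p x = \<zero>}" using c by (intro image_eqI[of _ _ "?c y"]) simp_all
    qed
    finally show "(\<lambda>x. c (j (?a x))) ` carrier X0' = {y \<in> carrier P0. u (p (?c y)) = \<zero>\<^bsub>X0\<^esub>}" .
  qed
qed

lemma short_exact_tensor:
  assumes N: "bimod_over L R N" "fgproj (opp R) (right_part N)"
    and m: "left_module R X'" "left_module R P" "left_module R X" and e: "short_exact R X' P X j p"
  shows "short_exact L (tensor R N X') (tensor R N P) (tensor R N X) (tensor_map R N P j) (tensor_map R N X p)"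
proof -
  note x = short_exactD[OF e]
  show ?thesis
    unfolding short_exact_def
    by (intro conjI tensor_map_lin_hom[OF N(1) m(1,2) x(1)] tensor_map_inj[OF N m(1,2) x(1,2)]
        tensor_map_lin_hom[OF N(1) m(2,3) x(3)] tensor_map_surj[OF N(1) m(2,3) x(3,4)] tensor_map_exact[OF N m x(1,3,5)])
qed

text \<open>The chain of sequences stays in the single type \<open>'k univ\<close>, as an inductive
  definition requires; \<open>is_syzygy\<close> then closes up under isomorphism across types, so
  that tensor products can be syzygies.\<close>

inductive syz :: "('k, 'r) module \<Rightarrow> nat \<Rightarrow> ('r, 'k univ) module \<Rightarrow> bool" for R :: "('k, 'r) module" where
  syz_0: "fg_module R X \<Longrightarrow> syz R 0 X"
| syz_Suc: "\<lbrakk>syz R m X; fg_module R (P :: ('r, 'k univ) module); fgproj R P; fg_module R X';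
     short_exact R X' P X j p\<rbrakk> \<Longrightarrow> syz R (Suc m) X'"

definition is_syzygy :: "('k, 'r) module \<Rightarrow> nat \<Rightarrow> ('r, 'x, 'z) module_scheme \<Rightarrow> bool" where
  "is_syzygy R m X \<longleftrightarrow> left_module R X \<and> (\<exists>X0 u. syz R m X0 \<and> u \<in> lin_iso R X X0)"

lemma syz_fg: "syz R m X \<Longrightarrow> fg_module R X"
  by (induction rule: syz.induct)

lemma is_syzygy_iso:
  assumes "is_syzygy R m X" "u \<in> lin_iso R Y X" "left_module R Y"
  shows "is_syzygy R m Y"
proof -
  obtain X0 v where "syz R m X0" "v \<in> lin_iso R X X0" using assms(1) by (auto simp: is_syzygy_def)
  then show ?thesis unfolding is_syzygy_def by (intro conjI assms(3) exI) (assumption, rule lin_iso_comp[OF assms(2)])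
qed

lemma is_syzygy_fg:
  assumes "is_syzygy R m X"
  shows "fg_module R X"
proof -
  obtain X0 v where X: "left_module R X" "syz R m X0" "v \<in> lin_iso R X X0"
    using assms by (auto simp: is_syzygy_def)
  note i = lin_iso_inverse(1)[OF X(3,1)]
  show ?thesis by (rule fg_module_image[OF syz_fg[OF X(2)] lin_isoD(1)[OF i] lin_isoD(3)[OF i] X(1)])
qed

lemma is_syzygy_0:
  fixes R :: "('k, 'r) module"
  assumes "small_ring R" "fg_module R X"
  shows "is_syzygy R 0 X"
proof -
  obtain X0 :: "('r, 'k univ) module" and u where "fg_module R X0" "u \<in> lin_iso R X X0"
    by (rule univ_copy[OF assms])
  then show ?thesis unfolding is_syzygy_def by (intro conjI fg_moduleD(1)[OF assms(2)] exI) (rule syz_0)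
qed

text \<open>All three modules of the sequence have copies in the universe, and the copied sequence
  continues the chain of \<open>X\<close>.\<close>

lemma is_syzygy_Suc:
  fixes R :: "('k, 'r) module"
  assumes R: "small_ring R" and X: "is_syzygy R m X" and P: "fg_module R P" "fgproj R P" and X': "fg_module R X'"
    and e: "short_exact R X' P X j p"
  shows "is_syzygy R (Suc m) X'"
proof -
  obtain X0 u where X0: "left_module R X" "syz R m X0" "u \<in> lin_iso R X X0"
    using X by (auto simp: is_syzygy_def)
  obtain P0 :: "('r, 'k univ) module" and c where P0: "fg_module R P0" "c \<in> lin_iso R P P0"
    by (rule univ_copy[OF R P(1)])
  obtain X0' :: "('r, 'k univ) module" and a where X0': "fg_module R X0'" "a \<in> lin_iso R X' X0'"
    by (rule univ_copy[OF R X'])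
  note m = fg_moduleD(1)[OF X'] fg_moduleD(1)[OF P(1)] X0(1) fg_moduleD(1)[OF syz_fg[OF X0(2)]]
  have "syz R (Suc m) X0'"
    by (rule syz_Suc[OF X0(2) P0(1) fgproj_iso[OF P(2) P0(2) m(2) fg_moduleD(1)[OF P0(1)]] X0'(1)
        short_exact_iso[OF e m X0'(2) P0(2) X0(3)]])
  then show ?thesis unfolding is_syzygy_def using X0'(2) m(1) by blast
qed

text \<open>Tensoring with \<open>N\<close> is exact since \<open>N\<close> is projective on the
  right, and preserves projectives since \<open>N\<close> is projective on the left; so the order is
  kept.\<close>

lemma is_syzygy_tensor:
  assumes S: "small_ring S" and N: "bimod_over S L N" "fgproj S N" "fgproj (opp L) (right_part N)" and X: "is_syzygy L m X"
  shows "is_syzygy S m (tensor L N X)"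
proof -
  have fgN: "fin_gen S N" by (rule fgproj_fin_gen[OF N(2) bimod_overD(1)[OF N(1)]])
  have "is_syzygy S m (tensor L N X)" if "syz L m X" for X
    using that
  proof induction
    case (syz_0 X)
    show ?case by (rule is_syzygy_0[OF S tensor_fg_module[OF N(1) fgN syz_0]])
  next
    case (syz_Suc m X P X' j p)
    note lm = fg_moduleD(1)[OF syz_Suc(4)] fg_moduleD(1)[OF syz_Suc(2)] fg_moduleD(1)[OF syz_fg[OF syz_Suc(1)]]
    show ?case
      by (rule is_syzygy_Suc[OF S syz_Suc(6) tensor_fg_module[OF N(1) fgN syz_Suc(2)] fgproj_tensor[OF N(1,2) lm(2) syz_Suc(3)]
          tensor_fg_module[OF N(1) fgN syz_Suc(4)] short_exact_tensor[OF N(1,3) lm syz_Suc(5)]])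
  qed
  moreover obtain X0 u where X0: "left_module L X" "syz L m X0" "u \<in> lin_iso L X X0"
    using X by (auto simp: is_syzygy_def)
  ultimately show ?thesis
    using is_syzygy_iso[OF _ tensor_map_iso[OF N(1) X0(1) fg_moduleD(1)[OF syz_fg[OF X0(2)]] X0(3)]]
      tensor_left_module[OF N(1) X0(1)] by blast
qed

section \<open>Extension of functionals on syzygies by injective resolutions\<close>

lemma regular_simps [simp]:
  "carrier (regular L) = carrier L" "add (regular L) = add L" "\<zero>\<^bsub>regular L\<^esub> = \<zero>\<^bsub>L\<^esub>"
  "a \<odot>\<^bsub>regular L\<^esub> x = a \<otimes>\<^bsub>L\<^esub> x"
  by (simp_all add: regular_def)

lemma regular_left_module: "ring L \<Longrightarrow> left_module L (regular L)"
proof -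
  assume "ring L"
  then interpret ring L .
  show ?thesis
    by (rule left_moduleI[OF ring_axioms abelian_group_cong[OF abelian_group_axioms]])
      (simp_all add: l_distr r_distr m_assoc)
qed

lemma functionals_regular: "functionals L X = lin_hom L X (regular L)"
  by (auto simp: functionals_def lin_hom_iff addhom_def)

lemma image_submod:
  assumes "f \<in> lin_hom R X Y" "left_module R X" "left_module R Y"
  shows "submod R Y (f ` carrier X)"
  unfolding submod_def
proof (intro conjI ballI)
  show "f ` carrier X \<subseteq> carrier Y" using lin_hom_closed[OF assms(1)] by auto
  show "\<zero>\<^bsub>Y\<^esub> \<in> f ` carrier X"
    using lin_hom_zero[OF assms] by (intro rev_image_eqI[OF lmod_zero[OF assms(2)]]) simp
  fix x assume "x \<in> f ` carrier X"
  then obtain x' where x: "x' \<in> carrier X" "x = f x'" by blast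
  show "a \<odot>\<^bsub>Y\<^esub> x \<in> f ` carrier X" if "a \<in> carrier R" for a
    using x lin_hom_smult[OF assms(1) that x(1)] by (intro rev_image_eqI[OF lmod_smult[OF assms(2) that x(1)]]) simp
  fix y assume "y \<in> f ` carrier X"
  then obtain y' where y: "y' \<in> carrier X" "y = f y'" by blast
  show "x \<oplus>\<^bsub>Y\<^esub> y \<in> f ` carrier X"
    using x y lin_hom_add[OF assms(1) x(1) y(1)] by (intro rev_image_eqI[OF lmod_add[OF assms(2) x(1) y(1)]]) simp
qed

lemma injectiveD:
  fixes R :: "('k, 'r) module" and X Y :: "('r, 'k univ) module"
  assumes "injective R I" "left_module R X" "left_module R Y" "j \<in> lin_hom R X Y"
    "inj_on j (carrier X)" "f \<in> lin_hom R X I"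
  obtains h where "h \<in> lin_hom R Y I" "\<And>x. x \<in> carrier X \<Longrightarrow> h (j x) = f x"
proof -
  have "\<exists>h \<in> lin_hom R Y I. \<forall>x \<in> carrier X. h (j x) = f x"
    using assms(1) unfolding injective_def using assms(2-) by (elim conjE allE impE) (intro conjI)
  then show ?thesis using that by auto
qed

text \<open>Dimension shifting along a finite injective resolution: \<open>Ext\<^sup>1(X, C)\<close> vanishes for an \<open>m\<close>-th
  syzygy \<open>X\<close> and the \<open>i\<close>-th cosyzygy \<open>C\<close> of \<open>R\<close> as soon as \<open>m + i \<ge> d\<close>.\<close>

lemma cosyzygy_extension:
  fixes R :: "('k, 'r) module" and I :: "nat \<Rightarrow> ('r, 'k univ) module" and P X' :: "('r, 'k univ) module"
  assumes res: "injective_resolution R (regular R) d I e \<delta>" and R: "ring R"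
  defines "C \<equiv> \<lambda>i. case i of 0 \<Rightarrow> e ` carrier R | Suc j \<Rightarrow> \<delta> j ` carrier (I j)"
  assumes "syz R m X" "i \<le> d" "d \<le> m + i" "fg_module R P" "fgproj R P" "left_module R X'"
    "short_exact R X' P X j p" "f \<in> lin_hom R X' (I i)" "\<And>x. x \<in> carrier X' \<Longrightarrow> f x \<in> C i"
  shows "\<exists>g \<in> lin_hom R P (I i). (\<forall>x \<in> carrier P. g x \<in> C i) \<and> (\<forall>x \<in> carrier X'. g (j x) = f x)"
  using assms(4-)
proof (induction arbitrary: i P X' j p f)
  have inj: "injective R (I i)" if "i \<le> d" for i using res that by (simp add: injective_resolution_def)
  then have Im: "left_module R (I i)" if "i \<le> d" for i using that by (simp add: injective_def)
  have \<delta>: "\<delta> i \<in> lin_hom R (I i) (I (Suc i))" if "i < d" for i using res that by (simp add: injective_resolution_def)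
  have "\<forall>i \<le> d. C i = (if i = d then carrier (I d) else a_kernel (I i) (I (Suc i)) (\<delta> i))"
    using res unfolding injective_resolution_def C_def regular_simps by (elim conjE)
  then have C: "C i = (if i = d then carrier (I i) else a_kernel (I i) (I (Suc i)) (\<delta> i))" if "i \<le> d" for i
    using that by simp
  \<comment> \<open>The last cosyzygy is all of \<open>I d\<close>, which is injective.\<close>
  have last: "\<exists>g \<in> lin_hom R P (I d). (\<forall>x \<in> carrier P. g x \<in> C d) \<and> (\<forall>x \<in> carrier X'. g (j x) = f x)"
    if lm: "left_module R P" "left_module R X'" "short_exact R X' P X j p" "f \<in> lin_hom R X' (I d)"
    for P X' X :: "('r, 'k univ) module" and j p f
  proof -
    note x = short_exactD[OF lm(3)]
    obtain g where "g \<in> lin_hom R P (I d)" "\<And>x. x \<in> carrier X' \<Longrightarrow> g (j x) = f x"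
      using injectiveD[OF inj[OF order_refl] lm(2,1) x(1,2) lm(4)] by blast
    then show ?thesis using C[of d] by (intro bexI[of _ g]) (simp_all add: lin_hom_closed)
  qed
  {
    case (syz_0 X)
    then have "i = d" by simp
    then show ?case using last[OF fg_moduleD(1)[OF syz_0(4)] syz_0(6,7)] syz_0(8) by simp
  next
    case (syz_Suc m X1 P1 X j1 p1)
    note lm = fg_moduleD(1)[OF syz_Suc(4)] fg_moduleD(1)[OF syz_Suc(2)]
    note lP = fg_moduleD(1)[OF \<open>fg_module R P\<close>] and lX' = \<open>left_module R X'\<close> and se = \<open>short_exact R X' P X j p\<close>
    note fh = \<open>f \<in> lin_hom R X' (I i)\<close> and fC = \<open>\<And>x. x \<in> carrier X' \<Longrightarrow> f x \<in> C i\<close>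
    note x = short_exactD[OF se] and x1 = short_exactD[OF syz_Suc(5)]
    show ?case
    proof (cases "i = d")
      case True
      then show ?thesis using last[OF lP lX' se] fh by simp
    next
      case False
      then have i: "i < d" "i \<le> d" "Suc i \<le> d" using \<open>i \<le> d\<close> by simp_all
      interpret Ii: abelian_group "I i" using Im[OF i(2)] by (rule lmod_abelian_group)
      interpret Is: abelian_group "I (Suc i)" using Im[OF i(3)] by (rule lmod_abelian_group)
      have Ci: "C i = a_kernel (I i) (I (Suc i)) (\<delta> i)" using C[OF i(2)] False by simp
      have Cs: "C (Suc i) = \<delta> i ` carrier (I i)" by (simp add: C_def)
      note d = \<delta>[OF i(1)]
      \<comment> \<open>An extension of \<open>f\<close> exists in the injective \<open>I i\<close>,
        but its values may leave the cosyzygy \<open>C i\<close>. The defect \<delta> g0 vanishes on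
        X' and so descends to h : X -> C (Suc i), a problem for the next lower syzygy and the next
        higher cosyzygy.\<close>
      obtain g0 where g0: "g0 \<in> lin_hom R P (I i)" "\<And>x. x \<in> carrier X' \<Longrightarrow> g0 (j x) = f x"
        using injectiveD[OF inj[OF i(2)] lX' lP x(1,2) fh] by blast
      have "\<delta> i (g0 z) = \<zero>\<^bsub>I (Suc i)\<^esub>" if z: "z \<in> carrier P" "p z = \<zero>\<^bsub>X\<^esub>" for z
      proof -
        have "z \<in> j ` carrier X'" using x(5) z by simp
        then obtain w where w: "w \<in> carrier X'" "z = j w" by blast
        show ?thesis unfolding w(2) g0(2)[OF w(1)] using fC[OF w(1)] unfolding Ci by (simp add: a_kernel_def')
      qed
      then obtain h where h: "h \<in> lin_hom R X (I (Suc i))" "\<And>z. z \<in> carrier P \<Longrightarrow> h (p z) = \<delta> i (g0 z)"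
        using lin_hom_factor_surj[OF x(3,4) lin_hom_comp[OF g0(1) d] lP lm(1) Im[OF i(3)]] by blast
      have hC: "h w \<in> C (Suc i)" if w: "w \<in> carrier X" for w
      proof -
        obtain z where z: "z \<in> carrier P" "p z = w" using surj_obtain[OF x(4) w] by blast
        show ?thesis unfolding Cs z(2)[symmetric] h(2)[OF z(1)] by (rule imageI[OF lin_hom_closed[OF g0(1) z(1)]])
      qed
      have dm: "d \<le> m + Suc i" using \<open>d \<le> Suc m + i\<close> by simp
      obtain g1 where g1: "g1 \<in> lin_hom R P1 (I (Suc i))" "\<And>x. x \<in> carrier P1 \<Longrightarrow> g1 x \<in> C (Suc i)"
        "\<And>x. x \<in> carrier X \<Longrightarrow> g1 (j1 x) = h x"
        using syz_Suc.IH[OF i(3) dm syz_Suc(2,3) lm(1) syz_Suc(5) h(1) hC] by blast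
      have sC: "submod R (I (Suc i)) (C (Suc i))" unfolding Cs by (rule image_submod[OF d Im[OF i(2)] Im[OF i(3)]])
      let ?C = "I (Suc i)\<lparr>carrier := C (Suc i)\<rparr>"
      have d': "\<delta> i \<in> lin_hom R (I i) ?C" by (rule lin_hom_restrict_codomain[OF d]) (simp add: Cs)
      have ds: "\<delta> i ` carrier (I i) = carrier ?C" by (simp add: Cs)
      \<comment> \<open>The solution \<open>g1\<close> of that problem is lifted to
        \<open>I i\<close>, which covers C (Suc i), using that \<open>P1\<close> is projective.
        Subtracting k j1 p from \<open>g0\<close> cancels the defect and changes nothing on X',
        where \<open>p\<close> vanishes.\<close>
      obtain k where k: "k \<in> lin_hom R P1 (I i)" "\<And>x. x \<in> carrier P1 \<Longrightarrow> \<delta> i (k x) = g1 x"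
        using fgproj_lift[OF syz_Suc(3) lm(2) lin_hom_restrict_codomain[OF g1(1,2)] d' ds Im[OF i(2)]
            submod_left_module[OF sC Im[OF i(3)]]] by blast
      note kp = lin_hom_comp[OF lin_hom_comp[OF x(3) x1(1)] k(1)]
      note gl = lin_hom_minus[OF g0(1) kp Im[OF i(2)]]
      show ?thesis
      proof (intro bexI[OF _ gl] conjI ballI)
        fix z assume z: "z \<in> carrier P"
        note pz = lin_hom_closed[OF x(3) z]
        have "\<delta> i (g0 z \<ominus>\<^bsub>I i\<^esub> k (j1 (p z))) = \<delta> i (g0 z) \<ominus>\<^bsub>I (Suc i)\<^esub> \<delta> i (k (j1 (p z)))"
          by (rule lin_hom_diff[OF d Im[OF i(2)] Im[OF i(3)] lin_hom_closed[OF g0(1) z] lin_hom_closed[OF kp z]])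
        also have "\<dots> = \<zero>\<^bsub>I (Suc i)\<^esub>"
          using k(2)[OF x1(7)[OF pz]] g1(3)[OF pz] h(2)[OF z] lin_hom_closed[OF h(1) pz] by simp
        finally show "g0 z \<ominus>\<^bsub>I i\<^esub> k (j1 (p z)) \<in> C i"
          unfolding Ci using lin_hom_closed[OF gl z] by (simp add: a_kernel_def')
      next
        fix w assume w: "w \<in> carrier X'"
        have "k (j1 (p (j w))) = \<zero>\<^bsub>I i\<^esub>"
          using x(6)[OF w] lin_hom_zero[OF x1(1) lm] lin_hom_zero[OF k(1) lm(2) Im[OF i(2)]] by simp
        then show "g0 (j w) \<ominus>\<^bsub>I i\<^esub> k (j1 (p (j w))) = f w"
          using g0(2)[OF w] lin_hom_closed[OF fh w] by simp
      qed
    qed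
  }
qed

text \<open>The case i = 0 of \<open>cosyzygy_extension\<close>: C 0 is the copy e(R) of the algebra
  in \<open>I 0\<close>, so an extension with values in C 0 is again a functional.\<close>

lemma syzygy_extends:
  fixes R :: "('k, 'r) module" and I :: "nat \<Rightarrow> ('r, 'k univ) module"
  assumes res: "injective_resolution R (regular R) d I e \<delta>" and R: "small_ring R"
    and X: "is_syzygy R m X" and d: "d \<le> m" and P: "fg_module R P" "fgproj R P" and X': "fg_module R X'"
    and se: "short_exact R X' P X j p"
  shows "extends R X' P j"
  unfolding extends_def
proof
  fix f assume f: "f \<in> functionals R X'"
  have rR: "ring R" using R by (simp add: small_ring_def)
  obtain X0 u where X0: "left_module R X" "syz R m X0" "u \<in> lin_iso R X X0"
    using X by (auto simp: is_syzygy_def)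
  obtain P0 :: "('r, 'k univ) module" and c where P0: "fg_module R P0" "c \<in> lin_iso R P P0"
    by (rule univ_copy[OF R P(1)])
  obtain X0' :: "('r, 'k univ) module" and a where X0': "fg_module R X0'" "a \<in> lin_iso R X' X0'"
    by (rule univ_copy[OF R X'])
  note m = fg_moduleD(1)[OF X'] fg_moduleD(1)[OF P(1)] X0(1) fg_moduleD(1)[OF syz_fg[OF X0(2)]]
  note P0p = fgproj_iso[OF P(2) P0(2) m(2) fg_moduleD(1)[OF P0(1)]]
  note se0 = short_exact_iso[OF se m X0'(2) P0(2) X0(3)]
  note ai = lin_iso_inverse[OF X0'(2) m(1)] and ci = lin_iso_inverse[OF P0(2) m(2)]
  let ?a = "inv_into (carrier X') a" and ?c = "inv_into (carrier P) c"
  note x = short_exactD[OF se]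
  have e: "e \<in> lin_hom R (regular R) (I 0)" "inj_on e (carrier (regular R))"
    using res by (simp_all add: injective_resolution_def)
  have fl: "(\<lambda>x. e (f (?a x))) \<in> lin_hom R X0' (I 0)"
    using lin_hom_comp[OF lin_hom_comp[OF lin_isoD(1)[OF ai(1)] f[unfolded functionals_regular]] e(1)] .
  have "e (f (?a y)) \<in> e ` carrier R" if "y \<in> carrier X0'" for y
    using functionals_closed[OF f ai(4)[OF that]] by simp
  then obtain g where g: "g \<in> lin_hom R P0 (I 0)" "\<And>y. y \<in> carrier P0 \<Longrightarrow> g y \<in> e ` carrier R"
    "\<And>y. y \<in> carrier X0' \<Longrightarrow> g (c (j (?a y))) = e (f (?a y))"
    using cosyzygy_extension[OF res rR X0(2) le0 _ P0(1) P0p fg_moduleD(1)[OF X0'(1)] se0 fl] d by auto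
  obtain g' where g': "g' \<in> lin_hom R P0 (regular R)" "\<And>y. y \<in> carrier P0 \<Longrightarrow> e (g' y) = g y"
    using lin_hom_factor_inj[OF e g(1) regular_left_module[OF rR]] g(2) by (simp, blast)
  show "\<exists>g \<in> functionals R P. \<forall>x \<in> carrier X'. g (j x) = f x"
  proof (intro bexI[of _ "\<lambda>x. g' (c x)"] ballI)
    show "(\<lambda>x. g' (c x)) \<in> functionals R P"
      unfolding functionals_regular by (rule lin_hom_comp[OF lin_isoD(1)[OF P0(2)] g'(1)])
    fix w assume w: "w \<in> carrier X'"
    have aw: "a w \<in> carrier X0'" by (rule lin_hom_closed[OF lin_isoD(1)[OF X0'(2)] w])
    have cj: "c (j w) \<in> carrier P0" by (rule lin_hom_closed[OF lin_isoD(1)[OF P0(2)] x(7)[OF w]])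
    have "e (g' (c (j w))) = e (f w)" using g'(2)[OF cj] g(3)[OF aw] ai(2)[OF w] by simp
    then show "g' (c (j w)) = f w"
      using e(2) lin_hom_closed[OF g'(1) cj] functionals_closed[OF f w] by (auto dest: inj_onD)
  qed
qed

lemma inj_dim_resolution:
  fixes R :: "('k, 'r) module"
  assumes "inj_dim R X < enat n"
  obtains d I e \<delta> where "d < n" "injective_resolution R X d (I :: nat \<Rightarrow> ('r, 'k univ) module) e \<delta>"
  using assms unfolding inj_dim_def Inf_less_iff by auto

section \<open>Modules over the enveloping algebra\<close>

lemma right_scalar_bimod_simps [simp]:
  "carrier (right_scalar_bimod L) = carrier L" "add (right_scalar_bimod L) = add L"
  "\<zero>\<^bsub>right_scalar_bimod L\<^esub> = \<zero>\<^bsub>L\<^esub>" "a \<odot>\<^bsub>right_scalar_bimod L\<^esub> x = a \<otimes>\<^bsub>L\<^esub> x"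
  "x \<triangleleft>\<^bsub>right_scalar_bimod L\<^esub> c = c \<odot>\<^bsub>L\<^esub> x"
  by (simp_all add: right_scalar_bimod_def)

lemma ring_opp:
  assumes "ring R"
  shows "ring (opp R)"
proof -
  interpret ring R by fact
  show ?thesis
    by (rule ringI[OF abelian_group_cong[OF abelian_group_axioms] monoidI]) (simp_all add: l_distr r_distr m_assoc)
qed

text \<open>The inverse of \<open>envel_module\<close>: restriction of the action along a \<mapsto>
  a \<otimes> 1 and b \<mapsto> 1 \<otimes> b.\<close>

definition envel_bimod ::
  "('k, 'c) ring_scheme \<Rightarrow> ('k, 'l) module \<Rightarrow> (('l \<times> 'l \<Rightarrow>\<^sub>0 int) set, 'z, 'w) module_scheme \<Rightarrow> ('l, 'l, 'z) bimod"
where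
  "envel_bimod K L Z = \<lparr>carrier = carrier Z, mult = undefined, one = undefined, ring.zero = \<zero>\<^bsub>Z\<^esub>, add = add Z,
     smult = (\<lambda>a z. tens K (right_scalar_bimod L) (opp L) a \<one>\<^bsub>L\<^esub> \<odot>\<^bsub>Z\<^esub> z),
     rsmult = (\<lambda>z b. tens K (right_scalar_bimod L) (opp L) \<one>\<^bsub>L\<^esub> b \<odot>\<^bsub>Z\<^esub> z)\<rparr>"

text \<open>In use, \<open>ringE\<close> is supplied by the modules in a stable isomorphism over
  \<open>envel K L\<close>, since \<open>left_module\<close> includes that the scalars form a
  ring.\<close>

locale enveloping =
  fixes K :: "('k, 'c) ring_scheme" and L :: "('k, 'l) module" (structure)
  assumes fd: "fd_algebra K L" and ringE: "ring (envel K L)"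
begin

abbreviation "P \<equiv> right_scalar_bimod L"
abbreviation "Q \<equiv> opp L"
abbreviation "E \<equiv> envel K L"
abbreviation "t \<equiv> tens K P Q"
abbreviation "bim \<equiv> envel_bimod K L"
abbreviation "RE \<equiv> bim (regular E)"

lemma ringL: "ring L" by (rule fd_algebra.ring_L[OF fd])
lemma fieldK: "field K" by (rule fd_algebra.field_K[OF fd])

sublocale Lr: ring L by (rule ringL)
sublocale Kr: field K by (rule fieldK)
sublocale Er: ring E by (rule ringE)

lemmas KL = fd_algebra.left_module_K[OF fd]
lemmas sm = left_moduleD[OF KL]
lemmas sm_left = fd_algebra.smult_mult_left[OF fd]
lemmas sm_right = fd_algebra.smult_mult_right[OF fd]
lemmas scalar = fd_algebra.scalar_closed[OF fd] fd_algebra.scalar_mult[OF fd] fd_algebra.mult_scalar[OF fd]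

lemma KQ: "left_module K Q"
  by (rule left_module_cong[OF KL]) simp_all

lemma abelian_P: "abelian_group P"
  by (rule abelian_group_cong[OF Lr.abelian_group_axioms]) simp_all

lemma tensorable_PQ: "tensorable K P Q"
  by (simp add: tensorable_def abelian_P lmod_abelian_group[OF KQ] sm)

sublocale T: tensor_product K P Q by (rule tensor_product.intro[OF tensorable_PQ])

lemma E_simps:
  "carrier E = carrier T.T" "add E = add T.T" "\<zero>\<^bsub>E\<^esub> = \<zero>\<^bsub>T.T\<^esub>" "\<one>\<^bsub>E\<^esub> = t \<one> \<one>"
  "U \<otimes>\<^bsub>E\<^esub> V = tens_lift T.T (\<lambda>a b. tmap K P Q (\<lambda>x. a \<otimes> x) (\<lambda>y. y \<otimes> b) V) U"
  by (simp_all add: envel_def Let_def tmap_def)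

lemma t_closed: "\<lbrakk>a \<in> carrier L; b \<in> carrier L\<rbrakk> \<Longrightarrow> t a b \<in> carrier E"
  by (simp add: E_simps T.tens_closed)

lemma t_add_left: "\<lbrakk>a \<in> carrier L; a' \<in> carrier L; b \<in> carrier L\<rbrakk> \<Longrightarrow> t (a \<oplus> a') b = t a b \<oplus>\<^bsub>E\<^esub> t a' b"
  using T.tens_add_left[of a a' b] by (simp add: E_simps)

lemma t_add_right: "\<lbrakk>a \<in> carrier L; b \<in> carrier L; b' \<in> carrier L\<rbrakk> \<Longrightarrow> t a (b \<oplus> b') = t a b \<oplus>\<^bsub>E\<^esub> t a b'"
  using T.tens_add_right[of a b b'] by (simp add: E_simps)

lemma t_balanced: "\<lbrakk>a \<in> carrier L; b \<in> carrier L; c \<in> carrier K\<rbrakk> \<Longrightarrow> t (c \<odot> a) b = t a (c \<odot> b)"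
  using T.tens_balanced[of a c b] by simp

lemma lin_left: "a \<in> carrier L \<Longrightarrow> (\<lambda>x. a \<otimes> x) \<in> right_lin K P P"
  by (auto intro!: right_linI addhomI simp: Lr.r_distr sm_right)

lemma lin_right: "b \<in> carrier L \<Longrightarrow> (\<lambda>y. y \<otimes> b) \<in> lin_hom K Q Q"
  by (auto intro!: lin_homI simp: Lr.l_distr sm_left)

lemmas tm = tmap[OF tensorable_PQ tensorable_PQ]

text \<open>The product is a lift in its first argument, so it can be evaluated once the assignment
  (a, b) \<mapsto> (a \<otimes> -)(- \<otimes> b) V is seen to be balanced over \<open>K\<close>,
  for arbitrary \<open>V\<close>.\<close>

lemma E_mult:
  assumes a: "a \<in> carrier L" "b \<in> carrier L" and V: "V \<in> carrier E"
  shows "t a b \<otimes>\<^bsub>E\<^esub> V = tmap K P Q (\<lambda>x. a \<otimes> x) (\<lambda>y. y \<otimes> b) V"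
proof -
  have V': "V \<in> carrier T.T" using V by (simp add: E_simps)
  have b: "balanced K P Q T.T (\<lambda>a b. tmap K P Q (\<lambda>x. a \<otimes> x) (\<lambda>y. y \<otimes> b) V)"
  proof (rule balancedI)
    fix a b assume "a \<in> carrier P" and "b \<in> carrier Q"
    then have a: "a \<in> carrier L" and b: "b \<in> carrier L" by simp_all
    show "tmap K P Q (\<lambda>x. a \<otimes> x) (\<lambda>y. y \<otimes> b) V \<in> carrier T.T"
      by (rule addhom_closed[OF tm(1)[OF lin_left[OF a] lin_right[OF b]] V'])
    {
      fix b' assume "b' \<in> carrier Q"
      then have b': "b' \<in> carrier L" by simp
      have s: "b \<oplus> b' \<in> carrier L" using b b' by simp
      have "tmap K P Q (\<lambda>x. a \<otimes> x) (\<lambda>y. y \<otimes> (b \<oplus> b')) V =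
          tmap K P Q (\<lambda>x. a \<otimes> x) (\<lambda>y. y \<otimes> b \<oplus>\<^bsub>Q\<^esub> y \<otimes> b') V"
        by (rule tmap_cong[OF tensorable_PQ tensorable_PQ lin_left[OF a] lin_right[OF s] lin_left[OF a]
            lin_hom_sum[OF lin_right[OF b] lin_right[OF b'] KQ] _ _ V']) (simp_all add: b b' Lr.r_distr)
      also have "\<dots> = tmap K P Q (\<lambda>x. a \<otimes> x) (\<lambda>y. y \<otimes> b) V \<oplus>\<^bsub>T.T\<^esub>
          tmap K P Q (\<lambda>x. a \<otimes> x) (\<lambda>y. y \<otimes> b') V"
        by (rule tmap_add_right[OF tensorable_PQ tensorable_PQ KQ lin_left[OF a] lin_right[OF b] lin_right[OF b'] V'])
      finally show "tmap K P Q (\<lambda>x. a \<otimes> x) (\<lambda>y. y \<otimes> (b \<oplus>\<^bsub>Q\<^esub> b')) V =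
          tmap K P Q (\<lambda>x. a \<otimes> x) (\<lambda>y. y \<otimes> b) V \<oplus>\<^bsub>T.T\<^esub>
          tmap K P Q (\<lambda>x. a \<otimes> x) (\<lambda>y. y \<otimes> b') V" by simp
    }
    {
      fix a' assume "a' \<in> carrier P"
      then have a': "a' \<in> carrier L" by simp
      have s: "a \<oplus> a' \<in> carrier L" using a a' by simp
      show "tmap K P Q (\<lambda>x. (a \<oplus>\<^bsub>P\<^esub> a') \<otimes> x) (\<lambda>y. y \<otimes> b) V =
          tmap K P Q (\<lambda>x. a \<otimes> x) (\<lambda>y. y \<otimes> b) V \<oplus>\<^bsub>T.T\<^esub>
          tmap K P Q (\<lambda>x. a' \<otimes> x) (\<lambda>y. y \<otimes> b) V"
        using tmap_add_left[OF tensorable_PQ tensorable_PQ lin_left[OF a] lin_left[OF a'] lin_left[OF s] lin_right[OF b] _ V']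
        by (simp add: a a' Lr.l_distr)
    }
    fix c assume c: "c \<in> carrier K"
    have ca: "c \<odot> a \<in> carrier L" and cb: "c \<odot> b \<in> carrier L" using a b c by (simp_all add: sm)
    have "tmap K P Q (\<lambda>x. (c \<odot> a) \<otimes> x) (\<lambda>y. y \<otimes> b) V =
        tmap K P Q (\<lambda>x. a \<otimes> x) (\<lambda>y. y \<otimes> (c \<odot> b)) V"
      by (rule T.addhom_tensor_eq[OF tm(1)[OF lin_left[OF ca] lin_right[OF b]] tm(1)[OF lin_left[OF a] lin_right[OF cb]]
          T.T_abelian_group _ V'])
        (simp add: tm(2)[OF lin_left[OF ca] lin_right[OF b]] tm(2)[OF lin_left[OF a] lin_right[OF cb]]
          a b c sm_left[symmetric] sm_right[symmetric] t_balanced)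
    then show "tmap K P Q (\<lambda>x. (a \<triangleleft>\<^bsub>P\<^esub> c) \<otimes> x) (\<lambda>y. y \<otimes> b) V =
        tmap K P Q (\<lambda>x. a \<otimes> x) (\<lambda>y. y \<otimes> (c \<odot>\<^bsub>Q\<^esub> b)) V" by simp
  qed
  show ?thesis unfolding E_simps(5) using T.tens_lift_tens[OF T.T_abelian_group b, of a b] a by simp
qed

lemma E_mult_tens:
  "\<lbrakk>a \<in> carrier L; b \<in> carrier L; a' \<in> carrier L; b' \<in> carrier L\<rbrakk> \<Longrightarrow>
    t a b \<otimes>\<^bsub>E\<^esub> t a' b' = t (a \<otimes> a') (b' \<otimes> b)"
  by (simp add: E_mult t_closed tm(2) lin_left lin_right)

lemma bim_simps [simp]:
  "carrier (bim Z) = carrier Z" "add (bim Z) = add Z" "\<zero>\<^bsub>bim Z\<^esub> = \<zero>\<^bsub>Z\<^esub>"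
  "a \<odot>\<^bsub>bim Z\<^esub> z = t a \<one> \<odot>\<^bsub>Z\<^esub> z" "z \<triangleleft>\<^bsub>bim Z\<^esub> b = t \<one> b \<odot>\<^bsub>Z\<^esub> z"
  by (simp_all add: envel_bimod_def)

lemma addhom_bim [simp]: "addhom (bim Z) X = addhom Z X" "addhom X (bim Z) = addhom X Z"
  by (simp_all add: addhom_def)

lemma t_mult_smult: "\<lbrakk>left_module E Z; a \<in> carrier L; b \<in> carrier L; a' \<in> carrier L; b' \<in> carrier L; z \<in> carrier Z\<rbrakk> \<Longrightarrow>
    t a b \<odot>\<^bsub>Z\<^esub> (t a' b' \<odot>\<^bsub>Z\<^esub> z) = t (a \<otimes> a') (b' \<otimes> b) \<odot>\<^bsub>Z\<^esub> z"
  by (simp add: lmod_assoc[symmetric] t_closed E_mult_tens)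

lemma bim_over:
  assumes Z: "left_module E Z"
  shows "bimod_over L L (bim Z)"
  unfolding bimod_over_def
proof (intro conjI ballI)
  note lm = left_moduleD[OF Z]
  have ab: "abelian_group (bim Z)" "abelian_group (right_part (bim Z))"
    by (rule abelian_group_cong[OF lmod_abelian_group[OF Z]]; simp)+
  have one: "t \<one> \<one> \<odot>\<^bsub>Z\<^esub> z = z" if "z \<in> carrier Z" for z
    using lm(9)[OF that] by (simp add: E_simps)
  show "left_module L (bim Z)"
    by (rule left_moduleI[OF ringL ab(1)])
      (simp_all add: lm t_closed t_add_left t_mult_smult[OF Z] one)
  show "left_module (opp L) (right_part (bim Z))"
    by (rule left_moduleI[OF ring_opp[OF ringL] ab(2)])
      (simp_all add: lm t_closed t_add_right t_mult_smult[OF Z] one)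
  fix a r m assume "a \<in> carrier L" "r \<in> carrier L" "m \<in> carrier (bim Z)"
  then show "(a \<odot>\<^bsub>bim Z\<^esub> m) \<triangleleft>\<^bsub>bim Z\<^esub> r = a \<odot>\<^bsub>bim Z\<^esub> (m \<triangleleft>\<^bsub>bim Z\<^esub> r)"
    by (simp add: t_mult_smult[OF Z])
qed

lemma bim_lin:
  assumes "h \<in> lin_hom E Z Z'"
  shows "h \<in> lin_hom L (bim Z) (bim Z')" "h \<in> right_lin L (bim Z) (bim Z')"
  using assms by (auto simp: lin_hom_iff right_lin_def t_closed)

lemma REm: "left_module E (regular E)" by (rule regular_left_module[OF ringE])

lemmas RE_over = bim_over[OF REm]

lemma RE_act: "\<lbrakk>r \<in> carrier L; U \<in> carrier E\<rbrakk> \<Longrightarrow>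
    U \<triangleleft>\<^bsub>RE\<^esub> r = tmap K P Q (\<lambda>x. \<one> \<otimes> x) (\<lambda>y. y \<otimes> r) U"
  by (simp add: E_mult)

text \<open>On the right, \<open>L\<close> acts on the second tensor factor only. So L \<otimes> L
  is induced from the finite-dimensional space \<open>L\<close>, and a dual basis of
  \<open>L\<close> over \<open>K\<close> yields one of the enveloping algebra over
  \<open>L\<close>.\<close>

lemma RE_fgproj: "fgproj (opp L) (right_part RE)"
proof -
  let ?R = "right_part RE"
  have Rm: "left_module (opp L) ?R" by (rule bimod_overD(2)[OF RE_over])
  have i: "(\<lambda>y. y) \<in> lin_hom K Q Q" by (rule lin_hom_id)
  have rl: "g \<in> right_lin K P P" if "g \<in> lin_hom K L L" for g
    using that by (auto simp: right_lin_def addhom_def lin_hom_def)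
  have "finite_rank (opp L) ?R ?R (tmap K P Q g (\<lambda>y. y))" if "finite_rank K L L g" for g
    using that
  proof induction
    case (finite_rank_zero g)
    have gl: "g \<in> lin_hom K L L"
      by (rule finite_rank_lin_hom[OF finite_rank.finite_rank_zero[OF finite_rank_zero] KL KL])
    have z: "(\<lambda>_. \<zero>\<^bsub>T.T\<^esub>) \<in> addhom T.T T.T" by (rule addhomI) simp_all
    show ?case
    proof (rule finite_rank.finite_rank_zero)
      fix U assume "U \<in> carrier ?R"
      then have U: "U \<in> carrier T.T" by (simp add: E_simps)
      have "tmap K P Q g (\<lambda>y. y) U = \<zero>\<^bsub>T.T\<^esub>"
        by (rule T.addhom_tensor_eq[OF tm(1)[OF rl[OF gl] i] z T.T_abelian_group _ U])
          (use addhom_zero[OF T.tens_addhom(2) T.abM T.T_abelian_group] in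
            \<open>simp add: tm(2)[OF rl[OF gl] i] finite_rank_zero\<close>)
      then show "tmap K P Q g (\<lambda>y. y) U = \<zero>\<^bsub>?R\<^esub>" by (simp add: E_simps)
    qed
  next
    case (finite_rank_step g c e g')
    have gl: "g \<in> lin_hom K L L" by (rule finite_rank_lin_hom[OF finite_rank_step(1) KL KL])
    have gl': "g' \<in> lin_hom K L L"
      by (rule finite_rank_lin_hom[OF finite_rank.finite_rank_step[OF finite_rank_step(1-4)] KL KL])
    note c = functionalsD[OF finite_rank_step(2)] and e = finite_rank_step(3)
    \<comment> \<open>The \<open>K\<close>-functional \<open>c\<close> on \<open>L\<close> induces
      the right functional a \<otimes> b \<mapsto> c(a) b; the matching vector is e \<otimes>
      1.\<close>
    have b: "balanced K P Q L (\<lambda>a b. c a \<odot> b)"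
      by (rule balancedI) (simp_all add: c sm Kr.m_comm flip: sm(8))
    let ?y = "tens_lift L (\<lambda>a b. c a \<odot> b)"
    note y = T.tens_lift_addhom[OF Lr.abelian_group_axioms b] T.tens_lift_tens[OF Lr.abelian_group_axioms b]
    have yE: "?y \<in> functionals (opp L) ?R"
    proof (rule functionalsI)
      show "?y \<in> addhom ?R (opp L)" using y(1) by (simp add: addhom_def E_simps)
      fix r U assume "r \<in> carrier (opp L)" "U \<in> carrier ?R"
      then have r: "r \<in> carrier L" and U: "U \<in> carrier T.T" and U': "U \<in> carrier E" by (simp_all add: E_simps)
      have m: "(\<lambda>x. x \<otimes> r) \<in> addhom L L" using r by (auto intro!: addhomI simp: Lr.l_distr)
      have "?y (tmap K P Q (\<lambda>x. \<one> \<otimes> x) (\<lambda>y. y \<otimes> r) U) = ?y U \<otimes> r"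
        by (rule T.addhom_tensor_eq[OF addhom_comp[OF tm(1)[OF lin_left[OF Lr.one_closed] lin_right[OF r]] y(1)]
            addhom_comp[OF y(1) m] Lr.abelian_group_axioms _ U])
          (simp add: tm(2)[OF lin_left[OF Lr.one_closed] lin_right[OF r]] y(2) r c sm_left)
      then show "?y (r \<odot>\<^bsub>?R\<^esub> U) = r \<otimes>\<^bsub>opp L\<^esub> ?y U" using RE_act[OF r U'] by simp
    qed
    show ?case
    proof (rule finite_rank.finite_rank_step[OF finite_rank_step(5) yE])
      show "t e \<one> \<in> carrier ?R" using e by (simp add: t_closed)
      fix U assume "U \<in> carrier ?R"
      then have U: "U \<in> carrier T.T" by (simp add: E_simps)
      have yU: "?y U \<in> carrier L" by (rule addhom_closed[OF y(1) U])
      have te: "t e \<in> addhom L T.T" using T.tens_addhom(1)[of e] e by (simp add: addhom_def)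
      have "tmap K P Q g' (\<lambda>y. y) U = t e (?y U) \<oplus>\<^bsub>T.T\<^esub> tmap K P Q g (\<lambda>y. y) U"
        using T.tens_add_left
        by (intro T.addhom_tensor_eq[OF tm(1)[OF rl[OF gl'] i]
            addhom_sum[OF addhom_comp[OF y(1) te] tm(1)[OF rl[OF gl] i] T.T_abelian_group] T.T_abelian_group _ U])
          (simp add: tm(2)[OF rl[OF gl'] i] tm(2)[OF rl[OF gl] i] y(2) e c sm finite_rank_step(4)
            lin_hom_closed[OF gl] t_balanced)
      moreover have "?y U \<odot>\<^bsub>?R\<^esub> t e \<one> = t e (?y U)" using e yU by (simp add: E_mult_tens)
      ultimately show "tmap K P Q g' (\<lambda>y. y) U = ?y U \<odot>\<^bsub>?R\<^esub> t e \<one> \<oplus>\<^bsub>?R\<^esub> tmap K P Q g (\<lambda>y. y) U"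
        by (simp add: E_simps)
    qed
  qed
  from this[OF fd_algebra.fgproj_K[OF fd]] show ?thesis
  proof (rule finite_rank_cong)
    fix U assume "U \<in> carrier ?R"
    then show "tmap K P Q (\<lambda>x. x) (\<lambda>y. y) U = U"
      by (intro tmap_id[OF tensorable_PQ]) (simp_all add: E_simps right_lin_id lin_hom_id)
  qed
qed

text \<open>The enveloping algebra is finitely generated over the opposite algebra, whose elements
  already embed into the universe.\<close>

lemma small_E: "small_ring E"
proof -
  have Rm: "left_module (opp L) (right_part RE)" by (rule bimod_overD(2)[OF RE_over])
  obtain e :: "'l \<Rightarrow> 'k univ" where e: "inj_on e (carrier L)"
    using fd_algebra_small_ring[OF fd] by (auto simp: small_ring_def)
  have "\<exists>q :: ('l \<times> 'l \<Rightarrow>\<^sub>0 int) set \<Rightarrow> 'k univ. inj_on q (carrier (right_part RE))"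
    by (rule fin_gen_embed[OF _ left_module_ring[OF Rm] lmod_abelian_group[OF Rm] lmod_smult[OF Rm]
        fgproj_fin_gen[OF RE_fgproj Rm]]) (use e in simp_all)
  then show ?thesis by (simp add: small_ring_def ringE)
qed

text \<open>Each step of finite rank over the enveloping algebra factors through its regular module,
  which is projective on the right.\<close>

lemma finite_rank_right:
  assumes V: "left_module E V" "left_module E V'" and h: "finite_rank E V V' h"
  shows "finite_rank (opp L) (right_part (bim V)) (right_part (bim V')) h"
  using h
proof induction
  case (finite_rank_zero h)
  then show ?case by (intro finite_rank.finite_rank_zero) simp
next
  case (finite_rank_step h f y h')
  note r = bimod_overD(2)[OF bim_over[OF V(1)]] bimod_overD(2)[OF bim_over[OF V(2)]] bimod_overD(2)[OF RE_over]
  have f: "f \<in> lin_hom (opp L) (right_part (bim V)) (right_part RE)"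
    unfolding right_lin_lin_hom by (rule bim_lin(2)) (use finite_rank_step(2) in \<open>simp add: functionals_regular\<close>)
  have "(\<lambda>U. U \<odot>\<^bsub>V'\<^esub> y) \<in> lin_hom E (regular E) V'"
    using finite_rank_step(3) by (auto intro!: lin_homI simp: left_moduleD[OF V(2)])
  then have p: "(\<lambda>U. U \<odot>\<^bsub>V'\<^esub> y) \<in> lin_hom (opp L) (right_part RE) (right_part (bim V'))"
    unfolding right_lin_lin_hom by (rule bim_lin(2))
  show ?case
    by (rule finite_rank_cong[OF finite_rank_add[OF finite_rank_through[OF RE_fgproj f p r(3,2)] finite_rank_step(5) r(2)]])
      (simp add: finite_rank_step(4))
qed

text \<open>\<open>K\<close> rewrapped as an algebra over itself, since \<open>bimod_over\<close>
  takes its right scalars as such a record.\<close>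

definition "Kmod = \<lparr>carrier = carrier K, mult = mult K, one = one K, ring.zero = \<zero>\<^bsub>K\<^esub>, add = add K, smult = mult K\<rparr>"

lemma Kmod_simps [simp]:
  "carrier Kmod = carrier K" "mult Kmod = mult K" "one Kmod = one K" "\<zero>\<^bsub>Kmod\<^esub> = \<zero>\<^bsub>K\<^esub>" "add Kmod = add K"
  by (simp_all add: Kmod_def)

lemma tensor_Kmod: "tensor Kmod M Y = tensor K M Y"
  by (simp add: tensor_def tens_group_def tens_rel_def tens_def)

lemma ring_Kmod: "ring Kmod"
  by (rule ringI[OF abelian_group_cong[OF Kr.abelian_group_axioms] monoidI]) (simp_all add: Kr.l_distr Kr.r_distr Kr.m_assoc)

lemma left_module_Kmod: "left_module K X \<Longrightarrow> left_module Kmod X"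
  by (rule left_moduleI[OF ring_Kmod lmod_abelian_group]) (simp_all add: left_moduleD)

lemma finite_rank_Kmod: "finite_rank K X Y h \<Longrightarrow> finite_rank Kmod X Y h"
proof (induction rule: finite_rank.induct)
  case (finite_rank_step h f y h')
  have "f \<in> functionals Kmod X" using finite_rank_step(2) by (simp add: functionals_def addhom_def)
  then show ?case by (rule finite_rank.finite_rank_step[OF finite_rank_step(5) _ finite_rank_step(3,4)])
qed (rule finite_rank.finite_rank_zero)

lemma P_over: "bimod_over L Kmod P"
  unfolding bimod_over_def
proof (intro conjI ballI)
  show "left_module L P"
    by (rule left_module_cong[OF regular_left_module[OF ringL]]) simp_all
  show "left_module (opp Kmod) (right_part P)"
    by (rule left_moduleI[OF ring_opp[OF ring_Kmod] abelian_group_cong[OF Lr.abelian_group_axioms]])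
      (simp_all add: sm Kr.m_comm flip: sm(8))
qed (simp add: sm_right)

lemma P_fgproj: "fgproj L P"
proof -
  have z: "finite_rank L P P (\<lambda>_. \<zero>)" by (rule finite_rank_zero) simp
  have f: "(\<lambda>x. x) \<in> functionals L P" by (rule functionalsI) (auto intro: addhomI)
  show ?thesis
  proof (rule finite_rank_step[OF z f])
    show "\<one> \<in> carrier P" by simp
    fix x assume "x \<in> carrier P"
    then have x: "x \<in> carrier L" by simp
    show "x = x \<odot>\<^bsub>P\<^esub> \<one> \<oplus>\<^bsub>P\<^esub> \<zero>" using Lr.r_one[OF x] Lr.r_zero[OF x] by simp
  qed
qed

text \<open>Extension of scalars from \<open>K\<close> to \<open>L\<close> turns a
  finite-dimensional space into a projective module.\<close>

lemma scalar_tensor_fgproj: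
  assumes A: "fg_module L A"
  shows "fgproj L (tensor K P (scalar_module L A))" "left_module L (tensor K P (scalar_module L A))"
proof -
  note Am = fg_moduleD[OF A]
  note K = fd_algebra.scalar_left_module[OF fd Am(1)]
  show "fgproj L (tensor K P (scalar_module L A))"
    using fgproj_tensor[OF P_over P_fgproj left_module_Kmod[OF K] finite_rank_Kmod[OF vector_space_fgproj[OF fieldK K
        fd_algebra.scalar_fin_gen[OF fd Am]]]] unfolding tensor_Kmod .
  show "left_module L (tensor K P (scalar_module L A))"
    using tensor_left_module[OF P_over left_module_Kmod[OF K]] unfolding tensor_Kmod .
qed

text \<open>\<open>L\<^sup>e \<otimes>\<^sub>L A\<close> is a retract of the projective module \<open>L \<otimes>\<^sub>K A\<close>.\<close>

lemma RE_tensor_fgproj: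
  assumes A: "fg_module L A"
  shows "fgproj L (tensor L RE A)"
proof -
  note Am = fg_moduleD(1)[OF A]
  note lm = left_moduleD[OF Am]
  let ?A = "scalar_module L A"
  let ?G = "tens_group L RE A"
  let ?H = "tens_group K P ?A"
  note KA = fd_algebra.scalar_left_module[OF fd Am]
  have tPA: "tensorable K P ?A"
    by (simp add: tensorable_def abelian_P lmod_abelian_group[OF KA] sm lmod_smult[OF Am] scalar)
  interpret H: tensor_product K P ?A by (rule tensor_product.intro[OF tPA])
  interpret G: tensor_product L RE A by (rule tensor_productI[OF bimod_overD(2)[OF RE_over] Am])
  have ev: "(\<lambda>m. m \<odot>\<^bsub>A\<^esub> a) \<in> lin_hom K Q ?A" if "a \<in> carrier A" for a
    using that by (intro lin_homI) (simp_all add: lm scalar flip: lm(8))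
  have i: "(\<lambda>x. x) \<in> right_lin K P P" by (rule right_lin_id)
  note ta = tmap[OF tensorable_PQ tPA i ev]
  \<comment> \<open>The map (l \<otimes> m) \<otimes> a \<mapsto> l \<otimes> m a, given here for an
    arbitrary element \<open>U\<close> of the enveloping algebra.\<close>
  let ?u = "\<lambda>U a. tmap K P ?A (\<lambda>x. x) (\<lambda>m. m \<odot>\<^bsub>A\<^esub> a) U"
  have bu: "balanced L RE A ?H ?u"
  proof (rule balancedI)
    fix U a assume "U \<in> carrier RE" and a: "a \<in> carrier A"
    then have U: "U \<in> carrier T.T" and U': "U \<in> carrier E" by (simp_all add: E_simps)
    show "?u U a \<in> carrier ?H" by (rule addhom_closed[OF ta(1)[OF a] U])
    show "?u (U \<oplus>\<^bsub>RE\<^esub> U') a = ?u U a \<oplus>\<^bsub>?H\<^esub> ?u U' a" if "U' \<in> carrier RE" for U'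
      using addhom_add[OF ta(1)[OF a] U, of U'] that by (simp add: E_simps)
    {
      fix a' assume a': "a' \<in> carrier A"
      have s: "a \<oplus>\<^bsub>A\<^esub> a' \<in> carrier A" using a a' by (rule lm)
      have "?u U (a \<oplus>\<^bsub>A\<^esub> a') = tmap K P ?A (\<lambda>x. x) (\<lambda>m. m \<odot>\<^bsub>A\<^esub> a \<oplus>\<^bsub>?A\<^esub> m \<odot>\<^bsub>A\<^esub> a') U"
        by (rule tmap_cong[OF tensorable_PQ tPA i ev[OF s] i lin_hom_sum[OF ev[OF a] ev[OF a'] KA] _ _ U])
          (simp_all add: lm a a')
      also have "\<dots> = ?u U a \<oplus>\<^bsub>?H\<^esub> ?u U a'"
        by (rule tmap_add_right[OF tensorable_PQ tPA KA i ev[OF a] ev[OF a'] U])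
      finally show "?u U (a \<oplus>\<^bsub>A\<^esub> a') = ?u U a \<oplus>\<^bsub>?H\<^esub> ?u U a'" .
    }
    fix r assume r: "r \<in> carrier L"
    have ra: "r \<odot>\<^bsub>A\<^esub> a \<in> carrier A" using r a by (rule lm)
    note l1 = lin_left[OF Lr.one_closed]
    have "?u (tmap K P Q (\<lambda>x. \<one> \<otimes> x) (\<lambda>y. y \<otimes> r) U) a =
        tmap K P ?A (\<lambda>x. \<one> \<otimes> x) (\<lambda>y. (y \<otimes> r) \<odot>\<^bsub>A\<^esub> a) U"
      by (rule tmap_comp[OF tensorable_PQ tensorable_PQ tPA l1 lin_right[OF r] i ev[OF a] U])
    also have "\<dots> = ?u U (r \<odot>\<^bsub>A\<^esub> a)"
      by (rule tmap_cong[OF tensorable_PQ tPA right_lin_comp[OF l1 i] lin_hom_comp[OF lin_right[OF r] ev[OF a]]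
          i ev[OF ra] _ _ U]) (simp_all add: lm r a)
    finally show "?u (U \<triangleleft>\<^bsub>RE\<^esub> r) a = ?u U (r \<odot>\<^bsub>A\<^esub> a)" unfolding RE_act[OF r U'] .
  qed
  let ?U = "tens_lift ?H ?u"
  note U = G.tens_lift_addhom[OF H.T_abelian_group bu] G.tens_lift_tens[OF H.T_abelian_group bu]
  have Ut: "?U (tens L RE A (t l m) a) = tens K P ?A l (m \<odot>\<^bsub>A\<^esub> a)"
    if "l \<in> carrier L" "m \<in> carrier L" "a \<in> carrier A" for l m a
    using U(2)[of "t l m" a] ta(2)[OF that(3), of l m] that by (simp add: t_closed)
  \<comment> \<open>The way back, l \<otimes> a \<mapsto> (l \<otimes> 1) \<otimes> a. After
    \<open>?U\<close> it gives the identity, because (l \<otimes> m) \<otimes> a = (l \<otimes> 1)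
    \<otimes> m a by moving \<open>m\<close> across the tensor sign.\<close>
  let ?v = "\<lambda>l a. tens L RE A (t l \<one>) a"
  have bv: "balanced K P ?A ?G ?v"
  proof (rule balancedI)
    fix l a assume "l \<in> carrier P" "a \<in> carrier ?A"
    then have l: "l \<in> carrier L" and a: "a \<in> carrier A" by simp_all
    have tl: "t l \<one> \<in> carrier RE" using l by (simp add: t_closed)
    show "?v l a \<in> carrier ?G" using tl a by (rule G.tens_closed)
    show "?v l (a \<oplus>\<^bsub>?A\<^esub> a') = ?v l a \<oplus>\<^bsub>?G\<^esub> ?v l a'" if "a' \<in> carrier ?A" for a'
      using G.tens_add_right[OF tl a, of a'] that by simp
    show "?v (l \<oplus>\<^bsub>P\<^esub> l') a = ?v l a \<oplus>\<^bsub>?G\<^esub> ?v l' a" if "l' \<in> carrier P" for l'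
      using G.tens_add_left[OF tl _ a, of "t l' \<one>"] that l by (simp add: t_closed t_add_left)
    fix c assume c: "c \<in> carrier K"
    have k: "c \<odot> \<one> \<in> carrier L" by (rule scalar(1)[OF c])
    have "t (c \<odot> l) \<one> = t l \<one> \<triangleleft>\<^bsub>RE\<^esub> (c \<odot> \<one>)"
      using l c k by (simp add: E_mult_tens t_balanced)
    then show "?v (l \<triangleleft>\<^bsub>P\<^esub> c) a = ?v l (c \<odot>\<^bsub>?A\<^esub> a)"
      using G.tens_balanced[OF tl k a] by simp
  qed
  let ?V = "tens_lift ?G ?v"
  note V = H.tens_lift_addhom[OF G.T_abelian_group bv] H.tens_lift_tens[OF G.T_abelian_group bv]
  have Vt: "?V (tens K P ?A l a) = tens L RE A (t l \<one>) a" if "l \<in> carrier L" "a \<in> carrier A" for l a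
    using V(2)[of l a] that by simp
  have G_eq: "f w = g w"
    if f: "f \<in> addhom ?G X" "g \<in> addhom ?G X" "abelian_group X" and
      e: "\<And>l m a. \<lbrakk>l \<in> carrier L; m \<in> carrier L; a \<in> carrier A\<rbrakk> \<Longrightarrow>
        f (tens L RE A (t l m) a) = g (tens L RE A (t l m) a)" and w: "w \<in> carrier ?G"
    for f g w and X :: "('x, 'y) ring_scheme"
  proof (rule G.addhom_tensor_eq[OF f _ w])
    fix Y a assume Y: "Y \<in> carrier RE" and a: "a \<in> carrier A"
    have Y': "Y \<in> carrier T.T" using Y by (simp add: E_simps)
    have h: "(\<lambda>Y. tens L RE A Y a) \<in> addhom T.T ?G"
      using G.tens_addhom(2)[OF a] by (simp add: addhom_def E_simps)
    show "f (tens L RE A Y a) = g (tens L RE A Y a)"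
      by (rule T.addhom_tensor_eq[OF addhom_comp[OF h f(1)] addhom_comp[OF h f(2)] f(3) _ Y']) (simp add: e a)
  qed
  note RP = P_over
  have Ul: "?U \<in> lin_hom L (tensor L RE A) (tensor K P ?A)"
    unfolding lin_hom_iff
  proof (intro conjI ballI)
    show "?U \<in> addhom (tensor L RE A) (tensor K P ?A)" using U(1) by simp
    fix x w assume x: "x \<in> carrier L" and "w \<in> carrier (tensor L RE A)"
    then have w: "w \<in> carrier ?G" by simp
    note s = smult_right_lin[OF RE_over x]
    have "?U (tmap L RE A (\<lambda>m. x \<odot>\<^bsub>RE\<^esub> m) (\<lambda>y. y) w) = tmap K P ?A (\<lambda>m. x \<otimes> m) (\<lambda>y. y) (?U w)"
    proof (rule G_eq[OF addhom_comp[OF tmap_addhom[OF G.tensorable G.tensorable s lin_hom_id] U(1)]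
        addhom_comp[OF U(1) tmap_addhom[OF tPA tPA lin_left[OF x] lin_hom_id]] H.T_abelian_group _ w])
      fix l m a assume c: "l \<in> carrier L" "m \<in> carrier L" "a \<in> carrier A"
      have tl: "t l m \<in> carrier RE" using c by (simp add: t_closed)
      have "tmap L RE A (\<lambda>m. x \<odot>\<^bsub>RE\<^esub> m) (\<lambda>y. y) (tens L RE A (t l m) a) = tens L RE A (x \<odot>\<^bsub>RE\<^esub> t l m) a"
        by (rule tmap_tens[OF G.tensorable G.tensorable s lin_hom_id tl c(3)])
      also have "x \<odot>\<^bsub>RE\<^esub> t l m = t (x \<otimes> l) m" using c x by (simp add: E_mult_tens)
      finally show "?U (tmap L RE A (\<lambda>m. x \<odot>\<^bsub>RE\<^esub> m) (\<lambda>y. y) (tens L RE A (t l m) a)) =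
          tmap K P ?A (\<lambda>m. x \<otimes> m) (\<lambda>y. y) (?U (tens L RE A (t l m) a))"
        using c x tmap_tens[OF tPA tPA lin_left[OF x] lin_hom_id, of l "m \<odot>\<^bsub>A\<^esub> a"] by (simp add: Ut lm)
    qed
    then show "?U (x \<odot>\<^bsub>tensor L RE A\<^esub> w) = x \<odot>\<^bsub>tensor K P ?A\<^esub> ?U w" by simp
  qed
  have Vl: "?V \<in> lin_hom L (tensor K P ?A) (tensor L RE A)"
    unfolding lin_hom_iff
  proof (intro conjI ballI)
    show "?V \<in> addhom (tensor K P ?A) (tensor L RE A)" using V(1) by simp
    fix x w assume x: "x \<in> carrier L" and "w \<in> carrier (tensor K P ?A)"
    then have w: "w \<in> carrier ?H" by simp
    note s = smult_right_lin[OF RE_over x]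
    have "?V (tmap K P ?A (\<lambda>m. x \<otimes> m) (\<lambda>y. y) w) = tmap L RE A (\<lambda>m. x \<odot>\<^bsub>RE\<^esub> m) (\<lambda>y. y) (?V w)"
    proof (rule H.addhom_tensor_eq[OF addhom_comp[OF tmap_addhom[OF tPA tPA lin_left[OF x] lin_hom_id] V(1)]
        addhom_comp[OF V(1) tmap_addhom[OF G.tensorable G.tensorable s lin_hom_id]] G.T_abelian_group _ w])
      fix l a assume "l \<in> carrier P" "a \<in> carrier ?A"
      then have c: "l \<in> carrier L" "a \<in> carrier A" by simp_all
      have tl: "t l \<one> \<in> carrier RE" using c by (simp add: t_closed)
      have "tmap L RE A (\<lambda>m. x \<odot>\<^bsub>RE\<^esub> m) (\<lambda>y. y) (tens L RE A (t l \<one>) a) = tens L RE A (x \<odot>\<^bsub>RE\<^esub> t l \<one>) a"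
        by (rule tmap_tens[OF G.tensorable G.tensorable s lin_hom_id tl c(2)])
      also have "x \<odot>\<^bsub>RE\<^esub> t l \<one> = t (x \<otimes> l) \<one>" using c x by (simp add: E_mult_tens)
      finally show "?V (tmap K P ?A (\<lambda>m. x \<otimes> m) (\<lambda>y. y) (tens K P ?A l a)) =
          tmap L RE A (\<lambda>m. x \<odot>\<^bsub>RE\<^esub> m) (\<lambda>y. y) (?V (tens K P ?A l a))"
        using c x tmap_tens[OF tPA tPA lin_left[OF x] lin_hom_id, of l a] by (simp add: Vt)
    qed
    then show "?V (x \<odot>\<^bsub>tensor K P ?A\<^esub> w) = x \<odot>\<^bsub>tensor L RE A\<^esub> ?V w" by simp
  qed
  have iG: "(\<lambda>w. w) \<in> addhom ?G ?G" by (simp add: addhom_def)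
  have VU: "?V (?U w) = w" if w: "w \<in> carrier ?G" for w
  proof (rule G_eq[OF addhom_comp[OF U(1) V(1)] iG G.T_abelian_group _ w])
    fix l m a assume c: "l \<in> carrier L" "m \<in> carrier L" "a \<in> carrier A"
    have tl: "t l \<one> \<in> carrier RE" using c by (simp add: t_closed)
    have "t l m = t l \<one> \<triangleleft>\<^bsub>RE\<^esub> m" using c by (simp add: E_mult_tens)
    then have "tens L RE A (t l m) a = tens L RE A (t l \<one>) (m \<odot>\<^bsub>A\<^esub> a)"
      using G.tens_balanced[OF tl c(2,3)] by simp
    then show "?V (?U (tens L RE A (t l m) a)) = tens L RE A (t l m) a"
      using c by (simp add: Ut Vt lm)
  qed
  show ?thesis
    by (rule finite_rank_cong[OF finite_rank_through[OF scalar_tensor_fgproj(1)[OF A] Ul Vl scalar_tensor_fgproj(2)[OF A]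
        tensor_left_module[OF RE_over Am]]]) (simp add: VU)
qed

text \<open>Here the finite-rank map sits on the bimodule side, unlike in
  \<open>finite_rank_tensor\<close>. Each step factors through the regular module of the enveloping
  algebra, and tensoring that module with \<open>A\<close> gives a projective module.\<close>

lemma finite_rank_bim_tensor:
  assumes V: "left_module E V" "left_module E V'" and A: "fg_module L A" and h: "finite_rank E V V' h"
  shows "finite_rank L (tensor L (bim V) A) (tensor L (bim V') A) (tmap L (bim V') A h (\<lambda>a. a))"
  using h
proof induction
  note Am = fg_moduleD(1)[OF A]
  case (finite_rank_zero h)
  have hl: "h \<in> right_lin L (bim V) (bim V')"
    by (rule bim_lin(2)[OF finite_rank_lin_hom[OF finite_rank.finite_rank_zero[OF finite_rank_zero] V]])
  interpret G: tensor_product L "bim V" A by (rule tensor_productI[OF bimod_overD(2)[OF bim_over[OF V(1)]] Am])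
  interpret G': tensor_product L "bim V'" A by (rule tensor_productI[OF bimod_overD(2)[OF bim_over[OF V(2)]] Am])
  have z: "(\<lambda>_. \<zero>\<^bsub>G'.T\<^esub>) \<in> addhom G.T G'.T" by (rule addhomI) simp_all
  show ?case
  proof (rule finite_rank.finite_rank_zero)
    fix w assume "w \<in> carrier (tensor L (bim V) A)"
    then have w: "w \<in> carrier G.T" by simp
    have "tmap L (bim V') A h (\<lambda>a. a) w = \<zero>\<^bsub>G'.T\<^esub>"
      by (rule G.addhom_tensor_eq[OF tmap_addhom[OF G.tensorable G'.tensorable hl lin_hom_id] z G'.T_abelian_group _ w])
        (use addhom_zero[OF G'.tens_addhom(2) G'.abM G'.T_abelian_group] in
          \<open>simp add: tmap_tens[OF G.tensorable G'.tensorable hl lin_hom_id] finite_rank_zero\<close>)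
    then show "tmap L (bim V') A h (\<lambda>a. a) w = \<zero>\<^bsub>tensor L (bim V') A\<^esub>" by simp
  qed
next
  note Am = fg_moduleD(1)[OF A]
  case (finite_rank_step h f y h')
  note b = bim_over[OF V(1)] bim_over[OF V(2)]
  note tt = tensorableI[OF bimod_overD(2)[OF b(1)] Am] tensorableI[OF bimod_overD(2)[OF b(2)] Am]
    tensorableI[OF bimod_overD(2)[OF RE_over] Am]
  note hl = finite_rank_lin_hom[OF finite_rank_step(1) V]
    finite_rank_lin_hom[OF finite_rank.finite_rank_step[OF finite_rank_step(1-4)] V]
  have f: "f \<in> lin_hom E V (regular E)" using finite_rank_step(2) by (simp add: functionals_regular)
  have p: "(\<lambda>U. U \<odot>\<^bsub>V'\<^esub> y) \<in> lin_hom E (regular E) V'"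
    using finite_rank_step(3) by (auto intro!: lin_homI simp: left_moduleD[OF V(2)])
  have "finite_rank L (tensor L (bim V) A) (tensor L (bim V') A)
      (\<lambda>w. tmap L (bim V') A (\<lambda>U. U \<odot>\<^bsub>V'\<^esub> y) (\<lambda>a. a) (tmap L RE A f (\<lambda>a. a) w))"
    by (rule finite_rank_through[OF RE_tensor_fgproj[OF A] tmap_lin_hom[OF b(1) RE_over Am Am bim_lin[OF f] lin_hom_id]
        tmap_lin_hom[OF RE_over b(2) Am Am bim_lin[OF p] lin_hom_id] tensor_left_module[OF RE_over Am] tensor_left_module[OF b(2) Am]])
  from finite_rank_add[OF this finite_rank_step(5) tensor_left_module[OF b(2) Am]] show ?case
  proof (rule finite_rank_cong)
    fix w assume "w \<in> carrier (tensor L (bim V) A)"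
    then have w: "w \<in> carrier (tens_group L (bim V) A)" by simp
    have "tmap L (bim V') A h' (\<lambda>a. a) w =
        tmap L (bim V') A (\<lambda>x. f x \<odot>\<^bsub>V'\<^esub> y) (\<lambda>a. a) w \<oplus>\<^bsub>tens_group L (bim V') A\<^esub> tmap L (bim V') A h (\<lambda>a. a) w"
      by (rule tmap_add_left[OF tt(1,2) right_lin_comp[OF bim_lin(2)[OF f] bim_lin(2)[OF p]] bim_lin(2)[OF hl(1)]
          bim_lin(2)[OF hl(2)] lin_hom_id _ w]) (simp_all add: finite_rank_step(4))
    moreover have "tmap L (bim V') A (\<lambda>U. U \<odot>\<^bsub>V'\<^esub> y) (\<lambda>a. a) (tmap L RE A f (\<lambda>a. a) w) =
        tmap L (bim V') A (\<lambda>x. f x \<odot>\<^bsub>V'\<^esub> y) (\<lambda>a. a) w"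
      by (rule tmap_comp[OF tt(1,3,2) bim_lin(2)[OF f] lin_hom_id bim_lin(2)[OF p] lin_hom_id w])
    ultimately show "tmap L (bim V') A (\<lambda>U. U \<odot>\<^bsub>V'\<^esub> y) (\<lambda>a. a) (tmap L RE A f (\<lambda>a. a) w)
        \<oplus>\<^bsub>tensor L (bim V') A\<^esub> tmap L (bim V') A h (\<lambda>a. a) w = tmap L (bim V') A h' (\<lambda>a. a) w"
      by simp
  qed
qed

lemma bim_tensor_fgproj:
  assumes V: "left_module E V" "fgproj E V" and A: "fg_module L A"
  shows "fgproj L (tensor L (bim V) A)"
proof -
  note t = tensorableI[OF bimod_overD(2)[OF bim_over[OF V(1)]] fg_moduleD(1)[OF A]]
  show ?thesis
    by (rule finite_rank_cong[OF finite_rank_bim_tensor[OF V(1,1) A V(2)]])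
      (rule tmap_id[OF t], simp_all add: right_lin_id lin_hom_id)
qed

section \<open>Bimodules as modules over the enveloping algebra\<close>

lemma envel_module_simps [simp]:
  "carrier (envel_module M) = carrier M" "add (envel_module M) = add M" "\<zero>\<^bsub>envel_module M\<^esub> = \<zero>\<^bsub>M\<^esub>"
  by (simp_all add: envel_module_def)

text \<open>The centrality of \<open>K\<close> on \<open>M\<close> enters here: it makes (a, b)
  \<mapsto> a m b balanced over \<open>K\<close>.\<close>

lemma envel_module_smult:
  assumes M: "bimodule K L L M" and c: "a \<in> carrier L" "b \<in> carrier L" "m \<in> carrier M"
  shows "t a b \<odot>\<^bsub>envel_module M\<^esub> m = (a \<odot>\<^bsub>M\<^esub> m) \<triangleleft>\<^bsub>M\<^esub> b"
proof -
  note o = bimodule_bimod_over[OF M]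
  note lm = left_moduleD[OF bimod_overD(1)[OF o]] and rm = right_moduleD[OF bimod_overD(2)[OF o]]
  have cen: "(k \<odot> \<one>) \<odot>\<^bsub>M\<^esub> m = m \<triangleleft>\<^bsub>M\<^esub> (k \<odot> \<one>)" if "k \<in> carrier K" for k
    using M c(3) that by (simp add: bimodule_def)
  have "balanced K P Q M (\<lambda>a b. (a \<odot>\<^bsub>M\<^esub> m) \<triangleleft>\<^bsub>M\<^esub> b)"
  proof (rule balancedI)
    fix a k b assume "a \<in> carrier P" and k: "k \<in> carrier K" and "b \<in> carrier Q"
    then have a: "a \<in> carrier L" and b: "b \<in> carrier L" by simp_all
    note kc = scalar(1)[OF k]
    have "(k \<odot> a) \<odot>\<^bsub>M\<^esub> m = (a \<otimes> (k \<odot> \<one>)) \<odot>\<^bsub>M\<^esub> m" using scalar(3)[OF k a] by simp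
    also have "\<dots> = a \<odot>\<^bsub>M\<^esub> (m \<triangleleft>\<^bsub>M\<^esub> (k \<odot> \<one>))" using a kc c(3) by (simp add: lm cen[OF k])
    also have "\<dots> = (a \<odot>\<^bsub>M\<^esub> m) \<triangleleft>\<^bsub>M\<^esub> (k \<odot> \<one>)" by (rule bimod_overD(3)[OF o a kc c(3), symmetric])
    finally have "((k \<odot> a) \<odot>\<^bsub>M\<^esub> m) \<triangleleft>\<^bsub>M\<^esub> b = ((a \<odot>\<^bsub>M\<^esub> m) \<triangleleft>\<^bsub>M\<^esub> (k \<odot> \<one>)) \<triangleleft>\<^bsub>M\<^esub> b" by simp
    also have "\<dots> = (a \<odot>\<^bsub>M\<^esub> m) \<triangleleft>\<^bsub>M\<^esub> ((k \<odot> \<one>) \<otimes> b)" using a b kc c(3) by (simp add: rm lm)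
    finally show "((a \<triangleleft>\<^bsub>P\<^esub> k) \<odot>\<^bsub>M\<^esub> m) \<triangleleft>\<^bsub>M\<^esub> b = (a \<odot>\<^bsub>M\<^esub> m) \<triangleleft>\<^bsub>M\<^esub> (k \<odot>\<^bsub>Q\<^esub> b)" using scalar(2)[OF k b] by simp
  qed (simp_all add: c(3) lm rm)
  from T.tens_lift_tens[OF lmod_abelian_group[OF bimod_overD(1)[OF o]] this, of a b] c(1,2)
  show ?thesis by (simp add: envel_module_def)
qed

text \<open>The actions on \<open>M\<close> and on \<open>bim (envel_module M)\<close> are known to
  agree on the carriers only. So the two are identified by the identity map, linear in both
  directions, and not by an equation of records.\<close>

lemma envel_module_lin:
  assumes M: "bimodule K L L M"
  shows "(\<lambda>x. x) \<in> lin_hom L M (bim (envel_module M))" "(\<lambda>x. x) \<in> right_lin L M (bim (envel_module M))"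
    "(\<lambda>x. x) \<in> lin_hom L (bim (envel_module M)) M" "(\<lambda>x. x) \<in> right_lin L (bim (envel_module M)) M"
proof -
  note o = bimodule_bimod_over[OF M]
  note lm = left_moduleD[OF bimod_overD(1)[OF o]] and rm = right_moduleD[OF bimod_overD(2)[OF o]]
  show "(\<lambda>x. x) \<in> lin_hom L M (bim (envel_module M))" "(\<lambda>x. x) \<in> lin_hom L (bim (envel_module M)) M"
    by (auto intro!: lin_homI simp: envel_module_smult[OF M] lm rm)
  show "(\<lambda>x. x) \<in> right_lin L M (bim (envel_module M))" "(\<lambda>x. x) \<in> right_lin L (bim (envel_module M)) M"
    by (auto intro!: right_linI addhomI simp: envel_module_smult[OF M] lm rm)
qed

end

section \<open>The stable functor of a syzygy bimodule\<close>

lemma tmap_zero_left: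
  assumes t: "tensorable R M Y" "tensorable R M' Y'" and f: "f \<in> right_lin R M M'" "g \<in> lin_hom R Y Y'"
    and z: "\<And>m. m \<in> carrier M \<Longrightarrow> f m = \<zero>\<^bsub>M'\<^esub>" and x: "x \<in> carrier (tens_group R M Y)"
  shows "tmap R M' Y' f g x = \<zero>\<^bsub>tens_group R M' Y'\<^esub>"
proof -
  interpret T: tensor_product R M Y by (rule tensor_product.intro[OF t(1)])
  interpret T': tensor_product R M' Y' by (rule tensor_product.intro[OF t(2)])
  have h: "(\<lambda>_. \<zero>\<^bsub>T'.T\<^esub>) \<in> addhom T.T T'.T" by (rule addhomI) simp_all
  show ?thesis
    by (rule T.addhom_tensor_eq[OF tmap_addhom[OF t f] h T'.T_abelian_group _ x])
      (use addhom_zero[OF T'.tens_addhom(2) T'.abM T'.T_abelian_group] in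
        \<open>simp add: tmap_tens[OF t f] z lin_hom_closed[OF f(2)]\<close>)
qed

text \<open>A splitting by right linear maps \<open>r\<close> and \<open>s\<close> survives
  tensoring over \<open>R\<close>, which makes the tensored sequence exact; the maps
  \<open>i\<close> and \<open>p\<close> of the sequence itself are bimodule maps and give left
  linear maps.\<close>

lemma split_tensor:
  assumes b: "bimod_over L R M'" "bimod_over L R M" "bimod_over L R M''" and Y: "left_module R Y"
    and i: "i \<in> lin_hom L M' M" "i \<in> right_lin R M' M" and p: "p \<in> lin_hom L M M''" "p \<in> right_lin R M M''"
    and r: "r \<in> right_lin R M M'" and s: "s \<in> right_lin R M'' M"
    and e: "\<And>x. x \<in> carrier M' \<Longrightarrow> r (i x) = x" "\<And>x. x \<in> carrier M'' \<Longrightarrow> p (s x) = x"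
      "\<And>x. x \<in> carrier M' \<Longrightarrow> p (i x) = \<zero>\<^bsub>M''\<^esub>" "\<And>x. x \<in> carrier M \<Longrightarrow> x = i (r x) \<oplus>\<^bsub>M\<^esub> s (p x)"
  shows "short_exact L (tensor R M' Y) (tensor R M Y) (tensor R M'' Y)
    (tmap R M Y i (\<lambda>y. y)) (tmap R M'' Y p (\<lambda>y. y))"
proof -
  note t' = tensorableI[OF bimod_overD(2)[OF b(1)] Y] and t = tensorableI[OF bimod_overD(2)[OF b(2)] Y]
    and t'' = tensorableI[OF bimod_overD(2)[OF b(3)] Y]
  interpret T': tensor_product R M' Y by (rule tensor_product.intro[OF t'])
  interpret T: tensor_product R M Y by (rule tensor_product.intro[OF t])
  interpret T'': tensor_product R M'' Y by (rule tensor_product.intro[OF t''])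
  let ?I = "\<lambda>y. y"
  have I: "?I \<in> lin_hom R Y Y" by (rule lin_hom_id)
  note ci = addhom_closed[OF tmap_addhom[OF t' t i(2) I]] and cp = addhom_closed[OF tmap_addhom[OF t t'' p(2) I]]
    and cr = addhom_closed[OF tmap_addhom[OF t t' r I]] and cs = addhom_closed[OF tmap_addhom[OF t'' t s I]]
  have ri: "tmap R M' Y r ?I (tmap R M Y i ?I w) = w" if w: "w \<in> carrier T'.T" for w
    unfolding tmap_comp[OF t' t t' i(2) I r I w]
    by (rule tmap_id[OF t' w]) (simp_all add: e right_lin_comp[OF i(2) r] I)
  have ps: "tmap R M'' Y p ?I (tmap R M Y s ?I w) = w" if w: "w \<in> carrier T''.T" for w
    unfolding tmap_comp[OF t'' t t'' s I p(2) I w]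
    by (rule tmap_id[OF t'' w]) (simp_all add: e right_lin_comp[OF s p(2)] I)
  have pi: "tmap R M'' Y p ?I (tmap R M Y i ?I w) = \<zero>\<^bsub>T''.T\<^esub>" if w: "w \<in> carrier T'.T" for w
    unfolding tmap_comp[OF t' t t'' i(2) I p(2) I w]
    by (rule tmap_zero_left[OF t' t'' right_lin_comp[OF i(2) p(2)] I e(3) w])
  have sum: "w = tmap R M Y i ?I (tmap R M' Y r ?I w) \<oplus>\<^bsub>T.T\<^esub> tmap R M Y s ?I (tmap R M'' Y p ?I w)"
    if w: "w \<in> carrier T.T" for w
  proof -
    have "tmap R M Y ?I ?I w = tmap R M Y (\<lambda>x. i (r x)) ?I w \<oplus>\<^bsub>T.T\<^esub> tmap R M Y (\<lambda>x. s (p x)) ?I w"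
      by (rule tmap_add_left[OF t t right_lin_comp[OF r i(2)] right_lin_comp[OF p(2) s] right_lin_id I e(4) w])
    moreover have "tmap R M Y ?I ?I w = w" by (rule tmap_id[OF t w]) (simp_all add: right_lin_id I)
    ultimately show ?thesis
      unfolding tmap_comp[OF t t' t r I i(2) I w] tmap_comp[OF t t'' t p(2) I s I w] by simp
  qed
  show ?thesis
    unfolding short_exact_def
  proof (intro conjI)
    show "tmap R M Y i ?I \<in> lin_hom L (tensor R M' Y) (tensor R M Y)"
      by (rule tmap_lin_hom[OF b(1,2) Y Y i I])
    show "tmap R M'' Y p ?I \<in> lin_hom L (tensor R M Y) (tensor R M'' Y)"
      by (rule tmap_lin_hom[OF b(2,3) Y Y p I])
    show "inj_on (tmap R M Y i ?I) (carrier (tensor R M' Y))"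
      by (rule inj_on_inverseI[where g = "tmap R M' Y r ?I"]) (simp add: ri)
    show "tmap R M'' Y p ?I ` carrier (tensor R M Y) = carrier (tensor R M'' Y)"
    proof (intro subset_antisym subsetI)
      fix w assume "w \<in> tmap R M'' Y p ?I ` carrier (tensor R M Y)"
      then show "w \<in> carrier (tensor R M'' Y)" using cp by auto
    next
      fix w assume "w \<in> carrier (tensor R M'' Y)"
      then show "w \<in> tmap R M'' Y p ?I ` carrier (tensor R M Y)"
        by (intro image_eqI[of _ _ "tmap R M Y s ?I w"]) (simp_all add: ps cs)
    qed
    show "tmap R M Y i ?I ` carrier (tensor R M' Y) =
      {x \<in> carrier (tensor R M Y). tmap R M'' Y p ?I x = \<zero>\<^bsub>tensor R M'' Y\<^esub>}"
    proof (intro subset_antisym subsetI)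
      fix w assume "w \<in> tmap R M Y i ?I ` carrier (tensor R M' Y)"
      then obtain v where "v \<in> carrier T'.T" "w = tmap R M Y i ?I v" by auto
      then show "w \<in> {x \<in> carrier (tensor R M Y). tmap R M'' Y p ?I x = \<zero>\<^bsub>tensor R M'' Y\<^esub>}"
        using ci pi by simp
    next
      fix w assume "w \<in> {x \<in> carrier (tensor R M Y). tmap R M'' Y p ?I x = \<zero>\<^bsub>tensor R M'' Y\<^esub>}"
      then have w: "w \<in> carrier T.T" "tmap R M'' Y p ?I w = \<zero>\<^bsub>T''.T\<^esub>" by simp_all
      have "tmap R M Y s ?I (tmap R M'' Y p ?I w) = \<zero>\<^bsub>T.T\<^esub>"
        unfolding w(2) by (rule addhom_zero[OF tmap_addhom[OF t'' t s I] T''.T_abelian_group T.T_abelian_group])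
      then have "w = tmap R M Y i ?I (tmap R M' Y r ?I w)"
        using sum[OF w(1)] ci[OF cr[OF w(1)]] by simp
      then show "w \<in> tmap R M Y i ?I ` carrier (tensor R M' Y)"
        using cr[OF w(1)] by (intro image_eqI[of _ _ "tmap R M' Y r ?I w"]) simp_all
    qed
  qed
qed

lemma tmap_natural:
  assumes b: "right_module R M" "right_module R M'" and Y: "left_module R Y" "left_module R Y'"
    and f: "f \<in> right_lin R M M'" and g: "g \<in> lin_hom R Y Y'" and x: "x \<in> carrier (tensor R M Y)"
  shows "tmap R M' Y' f (\<lambda>y. y) (tensor_map R M Y' g x) = tensor_map R M' Y' g (tmap R M' Y f (\<lambda>y. y) x)"
proof -
  have x': "x \<in> carrier (tens_group R M Y)" using x by simp
  note t = tensorableI[OF b(1) Y(1)] tensorableI[OF b(1) Y(2)] tensorableI[OF b(2) Y(1)] tensorableI[OF b(2) Y(2)]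
  show ?thesis
    unfolding tensor_map_tmap tmap_comp[OF t(1,2,4) right_lin_id g f lin_hom_id x']
      tmap_comp[OF t(1,3,4) f lin_hom_id right_lin_id g x'] ..
qed

lemma tmap_lin_iso:
  assumes b: "bimod_over L R M" "bimod_over L R M'" and Y: "left_module R Y"
    and f: "f \<in> lin_hom L M M'" "f \<in> right_lin R M M'" and g: "g \<in> lin_hom L M' M" "g \<in> right_lin R M' M"
    and e: "\<And>x. x \<in> carrier M \<Longrightarrow> g (f x) = x" "\<And>x. x \<in> carrier M' \<Longrightarrow> f (g x) = x"
  shows "tmap R M' Y f (\<lambda>y. y) \<in> lin_iso L (tensor R M Y) (tensor R M' Y)"
proof (rule lin_isoI[OF tmap_lin_hom[OF b Y Y f lin_hom_id] tmap_lin_hom[OF b(2,1) Y Y g lin_hom_id]])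
  note t = tensorableI[OF bimod_overD(2)[OF b(1)] Y] tensorableI[OF bimod_overD(2)[OF b(2)] Y]
  fix x assume "x \<in> carrier (tensor R M Y)"
  then have x: "x \<in> carrier (tens_group R M Y)" by simp
  show "tmap R M Y g (\<lambda>y. y) (tmap R M' Y f (\<lambda>y. y) x) = x"
    unfolding tmap_comp[OF t(1,2,1) f(2) lin_hom_id g(2) lin_hom_id x]
    by (rule tmap_id[OF t(1) x]) (simp_all add: e right_lin_comp[OF f(2) g(2)] lin_hom_id)
next
  note t = tensorableI[OF bimod_overD(2)[OF b(1)] Y] tensorableI[OF bimod_overD(2)[OF b(2)] Y]
  fix x assume "x \<in> carrier (tensor R M' Y)"
  then have x: "x \<in> carrier (tens_group R M' Y)" by simp
  show "tmap R M' Y f (\<lambda>y. y) (tmap R M Y g (\<lambda>y. y) x) = x"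
    unfolding tmap_comp[OF t(2,1,2) g(2) lin_hom_id f(2) lin_hom_id x]
    by (rule tmap_id[OF t(2) x]) (simp_all add: e right_lin_comp[OF g(2) f(2)] lin_hom_id)
qed

text \<open>For genuine isomorphisms the error terms of \<open>stably_bij_transfer\<close> are
  zero.\<close>

lemma stably_bij_iso:
  assumes m: "left_module R WX" "left_module R WY" "left_module R VX" "left_module R VY"
    and W: "\<And>f. f \<in> lin_hom R X Y \<Longrightarrow> W f \<in> lin_hom R WX WY"
    and V: "\<And>f. f \<in> lin_hom R X Y \<Longrightarrow> V f \<in> lin_hom R VX VY"
    and a: "aX \<in> lin_iso R WX VX" "aY \<in> lin_iso R WY VY"
    and nat: "\<And>f x. \<lbrakk>f \<in> lin_hom R X Y; x \<in> carrier WX\<rbrakk> \<Longrightarrow> aY (W f x) = V f (aX x)"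
    and good: "stably_bij R X Y VX VY V"
  shows "stably_bij R X Y WX WY W"
proof -
  interpret WX: abelian_group WX by (rule lmod_abelian_group[OF m(1)])
  interpret WY: abelian_group WY by (rule lmod_abelian_group[OF m(2)])
  interpret VX: abelian_group VX by (rule lmod_abelian_group[OF m(3)])
  note iX = lin_iso_inverse[OF a(1) m(1)] and iY = lin_iso_inverse[OF a(2) m(2)]
  show ?thesis
  proof (rule stably_bij_transfer[OF m W V lin_isoD(1)[OF a(1)] lin_isoD(1)[OF iX(1)] lin_isoD(1)[OF a(2)]
        lin_isoD(1)[OF iY(1)] nat _ _ _ good])
    show "finite_rank R WX WX (\<lambda>x. inv_into (carrier WX) aX (aX x) \<ominus>\<^bsub>WX\<^esub> x)"
      by (rule finite_rank_zero) (simp add: iX)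
    show "finite_rank R VX VX (\<lambda>x. aX (inv_into (carrier WX) aX x) \<ominus>\<^bsub>VX\<^esub> x)"
      by (rule finite_rank_zero) (simp add: iX)
    show "finite_rank R WY WY (\<lambda>x. inv_into (carrier WY) aY (aY x) \<ominus>\<^bsub>WY\<^esub> x)"
      by (rule finite_rank_zero) (simp add: iY)
  qed
qed

section \<open>The regular bimodule as a unit for the tensor product\<close>

lemma regular_bimod_simps [simp]:
  "carrier (regular_bimod L) = carrier L" "add (regular_bimod L) = add L" "\<zero>\<^bsub>regular_bimod L\<^esub> = \<zero>\<^bsub>L\<^esub>"
  "a \<odot>\<^bsub>regular_bimod L\<^esub> x = a \<otimes>\<^bsub>L\<^esub> x" "x \<triangleleft>\<^bsub>regular_bimod L\<^esub> a = x \<otimes>\<^bsub>L\<^esub> a"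
  by (simp_all add: regular_bimod_def)

lemma regular_bimod_over:
  assumes "ring L"
  shows "bimod_over L L (regular_bimod L)"
proof -
  interpret ring L by fact
  show ?thesis
    unfolding bimod_over_def
  proof (intro conjI ballI)
    show "left_module L (regular_bimod L)"
      by (rule left_module_cong[OF regular_left_module[OF assms]]) simp_all
    show "left_module (opp L) (right_part (regular_bimod L))"
      by (rule left_module_cong[OF regular_left_module[OF ring_opp[OF assms]]]) simp_all
  qed (simp add: m_assoc)
qed

lemma regular_bimodule:
  assumes "fd_algebra K L"
  shows "bimodule K L L (regular_bimod L)"
  using regular_bimod_over[OF fd_algebra.ring_L[OF assms]]
  by (simp add: bimodule_def bimod_over_def fd_algebra.scalar_mult[OF assms] fd_algebra.mult_scalar[OF assms])

lemma regular_fgproj_right: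
  fixes L (structure)
  assumes "ring L"
  shows "fgproj (opp L) (right_part (regular_bimod L))"
proof -
  interpret ring L by fact
  let ?R = "right_part (regular_bimod L)"
  have z: "finite_rank (opp L) ?R ?R (\<lambda>_. \<zero>)" by (rule finite_rank_zero) simp
  have f: "(\<lambda>x. x) \<in> functionals (opp L) ?R" by (rule functionalsI) (auto intro: addhomI)
  show ?thesis
  proof (rule finite_rank_step[OF z f])
    show "\<one> \<in> carrier ?R" by simp
    fix x assume "x \<in> carrier ?R"
    then have x: "x \<in> carrier L" by simp
    show "x = x \<odot>\<^bsub>?R\<^esub> \<one> \<oplus>\<^bsub>?R\<^esub> \<zero>" using l_one[OF x] r_zero[OF x] by simp
  qed
qed

definition tens_act :: "('l, 'a, 'z) module_scheme \<Rightarrow> ('l \<times> 'a \<Rightarrow>\<^sub>0 int) set \<Rightarrow> 'a" where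
  "tens_act A = tens_lift A (\<lambda>l a. l \<odot>\<^bsub>A\<^esub> a)"

lemma tens_act:
  fixes L (structure)
  assumes R: "ring L" and A: "left_module L A"
  shows tens_act_iso: "tens_act A \<in> lin_iso L (tensor L (regular_bimod L) A) A"
    and tens_act_tens: "\<lbrakk>l \<in> carrier L; a \<in> carrier A\<rbrakk> \<Longrightarrow> tens_act A (tens L (regular_bimod L) A l a) = l \<odot>\<^bsub>A\<^esub> a"
proof -
  interpret L: ring L by fact
  note lm = left_moduleD[OF A]
  let ?B = "regular_bimod L"
  note o = regular_bimod_over[OF R]
  interpret T: tensor_product L ?B A by (rule tensor_productI[OF bimod_overD(2)[OF o] A])
  have b: "balanced L ?B A A (\<lambda>l a. l \<odot>\<^bsub>A\<^esub> a)" by (rule balancedI) (simp_all add: lm)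
  note u = T.tens_lift_addhom[OF T.abY b, folded tens_act_def] T.tens_lift_tens[OF T.abY b, folded tens_act_def]
  show ut: "\<lbrakk>l \<in> carrier L; a \<in> carrier A\<rbrakk> \<Longrightarrow> tens_act A (tens L ?B A l a) = l \<odot>\<^bsub>A\<^esub> a" for l a
    using u(2)[of l a] by simp
  have ul: "tens_act A \<in> lin_hom L (tensor L ?B A) A"
    unfolding lin_hom_iff
  proof (intro conjI ballI)
    show "tens_act A \<in> addhom (tensor L ?B A) A" using u(1) by simp
    fix x w assume x: "x \<in> carrier L" and "w \<in> carrier (tensor L ?B A)"
    then have w: "w \<in> carrier T.T" by simp
    have "tens_act A (tmap L ?B A (\<lambda>m. x \<odot>\<^bsub>?B\<^esub> m) (\<lambda>a. a) w) = x \<odot>\<^bsub>A\<^esub> tens_act A w"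
      by (rule T.addhom_tensor_eq[OF addhom_comp[OF tmap_addhom[OF T.tensorable T.tensorable smult_right_lin[OF o x] lin_hom_id] u(1)]
          addhom_comp[OF u(1) smult_addhom[OF A x]] T.abY _ w])
        (use tmap_tens[OF T.tensorable T.tensorable smult_right_lin[OF o x] lin_hom_id] in \<open>simp add: ut x lm\<close>)
    then show "tens_act A (x \<odot>\<^bsub>tensor L ?B A\<^esub> w) = x \<odot>\<^bsub>A\<^esub> tens_act A w" by simp
  qed
  have one: "\<one> \<in> carrier ?B" by simp
  \<comment> \<open>The inverse a \<mapsto> 1 \<otimes> a.\<close>
  have v: "tens L ?B A \<one> \<in> addhom A T.T" by (rule T.tens_addhom(1)[OF one])
  have vu: "tens L ?B A \<one> (tens_act A w) = w" if w: "w \<in> carrier T.T" for w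
  proof (rule T.addhom_tensor_eq[OF addhom_comp[OF u(1) v] _ T.T_abelian_group _ w])
    show "(\<lambda>x. x) \<in> addhom T.T T.T" by (simp add: addhom_def)
    fix l a assume c: "l \<in> carrier ?B" "a \<in> carrier A"
    then have l: "l \<in> carrier L" by simp
    have "tens L ?B A (\<one> \<triangleleft>\<^bsub>?B\<^esub> l) a = tens L ?B A \<one> (l \<odot>\<^bsub>A\<^esub> a)"
      using c by (intro T.tens_balanced) simp_all
    then show "tens L ?B A \<one> (tens_act A (tens L ?B A l a)) = tens L ?B A l a"
      unfolding ut[OF l c(2)] using l by simp
  qed
  have "bij_betw (tens_act A) (carrier T.T) (carrier A)"
    by (rule bij_betwI[of _ _ _ "tens L ?B A \<one>"])
      (use vu addhom_closed[OF u(1)] addhom_closed[OF v] in \<open>auto simp: ut lm\<close>)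
  then show "tens_act A \<in> lin_iso L (tensor L ?B A) A" using ul by (simp add: lin_iso_def)
qed

lemma tens_act_natural:
  assumes R: "ring L" and A: "left_module L A" "left_module L A'" and f: "f \<in> lin_hom L A A'"
    and x: "x \<in> carrier (tensor L (regular_bimod L) A)"
  shows "tens_act A' (tensor_map L (regular_bimod L) A' f x) = f (tens_act A x)"
proof -
  let ?B = "regular_bimod L"
  note o = regular_bimod_over[OF R]
  interpret T: tensor_product L ?B A by (rule tensor_productI[OF bimod_overD(2)[OF o] A(1)])
  have x': "x \<in> carrier T.T" using x by simp
  have 1: "tensor_map L ?B A' f \<in> addhom T.T (tens_group L ?B A')"
    using lin_hom_addhom[OF tensor_map_lin_hom[OF o A f]] by simp
  have 2: "tens_act A' \<in> addhom (tens_group L ?B A') A'" "tens_act A \<in> addhom T.T A"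
    using lin_hom_addhom[OF lin_isoD(1)[OF tens_act_iso[OF R A(2)]]] lin_hom_addhom[OF lin_isoD(1)[OF tens_act_iso[OF R A(1)]]]
    by simp_all
  show ?thesis
  proof (rule T.addhom_tensor_eq[OF addhom_comp[OF 1 2(1)] addhom_comp[OF 2(2) lin_hom_addhom[OF f]]
        lmod_abelian_group[OF A(2)] _ x'])
    fix l a assume c: "l \<in> carrier ?B" "a \<in> carrier A"
    then have l: "l \<in> carrier L" by simp
    show "tens_act A' (tensor_map L ?B A' f (tens L ?B A l a)) = f (tens_act A (tens L ?B A l a))"
      unfolding tensor_map_tens[OF bimod_overD(2)[OF o] A f c] tens_act_tens[OF R A(1) l c(2)]
        tens_act_tens[OF R A(2) l lin_hom_closed[OF f c(2)]] lin_hom_smult[OF f l c(2)] ..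
  qed
qed

text \<open>A scalar of \<open>K\<close> passes from left to right through \<open>M\<close>, across
  the tensor sign and through \<open>N\<close>; both given bimodules are central over
  \<open>K\<close>.\<close>

lemma bitensor_bimodule:
  fixes L (structure)
  assumes S: "fd_algebra K S" and L: "fd_algebra K L" and M: "bimodule K L S M" and N: "bimodule K S L N"
  shows "bimodule K L L (bitensor S M N)"
proof -
  note m = bimodule_bimod_over[OF M] and n = bimodule_bimod_over[OF N]
  note o = bitensor_bimod_over[OF m n]
  interpret T: tensor_product S M N by (rule tensor_productI[OF bimod_overD(2)[OF m] bimod_overD(1)[OF n]])
  have "(c \<odot> \<one>) \<odot>\<^bsub>bitensor S M N\<^esub> u = u \<triangleleft>\<^bsub>bitensor S M N\<^esub> (c \<odot> \<one>)"
    if c: "c \<in> carrier K" and "u \<in> carrier (bitensor S M N)" for c u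
  proof -
    have u: "u \<in> carrier T.T" using that by simp
    note kL = fd_algebra.scalar_closed[OF L c] and kS = fd_algebra.scalar_closed[OF S c]
    note f = tmap_addhom[OF T.tensorable T.tensorable smult_right_lin[OF m kL] lin_hom_id]
      tmap_tens[OF T.tensorable T.tensorable smult_right_lin[OF m kL] lin_hom_id]
    note g = tmap_addhom[OF T.tensorable T.tensorable right_lin_id rsmult_lin_hom[OF n kL]]
      tmap_tens[OF T.tensorable T.tensorable right_lin_id rsmult_lin_hom[OF n kL]]
    have "tmap S M N (\<lambda>m. (c \<odot> \<one>) \<odot>\<^bsub>M\<^esub> m) (\<lambda>y. y) u = tmap S M N (\<lambda>m. m) (\<lambda>y. y \<triangleleft>\<^bsub>N\<^esub> (c \<odot> \<one>)) u"
    proof (rule T.addhom_tensor_eq[OF f(1) g(1) T.T_abelian_group _ u])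
      fix x y assume x: "x \<in> carrier M" and y: "y \<in> carrier N"
      have "(c \<odot> \<one>) \<odot>\<^bsub>M\<^esub> x = x \<triangleleft>\<^bsub>M\<^esub> (c \<odot>\<^bsub>S\<^esub> \<one>\<^bsub>S\<^esub>)" using M c x by (simp add: bimodule_def)
      moreover have "(c \<odot>\<^bsub>S\<^esub> \<one>\<^bsub>S\<^esub>) \<odot>\<^bsub>N\<^esub> y = y \<triangleleft>\<^bsub>N\<^esub> (c \<odot> \<one>)" using N c y by (simp add: bimodule_def)
      ultimately show "tmap S M N (\<lambda>m. (c \<odot> \<one>) \<odot>\<^bsub>M\<^esub> m) (\<lambda>y. y) (tens S M N x y) =
          tmap S M N (\<lambda>m. m) (\<lambda>y. y \<triangleleft>\<^bsub>N\<^esub> (c \<odot> \<one>)) (tens S M N x y)"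
        unfolding f(2)[OF x y] g(2)[OF x y] using T.tens_balanced[OF x kS y] by simp
    qed
    then show ?thesis by simp
  qed
  then show ?thesis using o by (simp add: bimodule_def bimod_over_def del: bitensor_simps)
qed

context enveloping
begin

text \<open>The zeroth bimodule syzygy is isomorphic to \<open>L\<close>, and L \<otimes> X is
  naturally isomorphic to X.\<close>

lemma syzygy_tensor_0:
  fixes A :: "('l, 'a) module" and B :: "('l, 'b) module"
  assumes Z: "left_module E Z" and f: "f \<in> lin_iso E (envel_module (regular_bimod L)) Z"
    and A: "is_syzygy L m A" and B: "left_module L B"
  shows "fgproj (opp L) (right_part (bim Z))" "is_syzygy L m (tensor L (bim Z) A)"
    "stably_bij L A B (tensor L (bim Z) A) (tensor L (bim Z) B) (tensor_map L (bim Z) B)"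
proof -
  let ?R = "regular_bimod L"
  note Rb = regular_bimodule[OF fd]
  note o = regular_bimod_over[OF ringL] and oZ = bim_over[OF Z]
  note Am = fg_moduleD(1)[OF is_syzygy_fg[OF A]]
  note f1 = lin_isoD[OF f]
  have fl: "f \<in> lin_hom L ?R (bim Z)" using lin_hom_comp[OF envel_module_lin(1)[OF Rb] bim_lin(1)[OF f1(1)]] .
  have fr: "f \<in> right_lin L ?R (bim Z)" using right_lin_comp[OF envel_module_lin(2)[OF Rb] bim_lin(2)[OF f1(1)]] .
  have il: "f \<in> lin_iso L ?R (bim Z)" using fl f1(4) by (simp add: lin_iso_def)
  have ir: "f \<in> lin_iso (opp L) (right_part ?R) (right_part (bim Z))"
    using fr f1(4) by (simp add: lin_iso_def right_lin_lin_hom)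
  show "fgproj (opp L) (right_part (bim Z))"
    by (rule fgproj_iso[OF regular_fgproj_right[OF ringL] ir bimod_overD(2)[OF o] bimod_overD(2)[OF oZ]])
  let ?g = "inv_into (carrier L) f"
  note i = lin_iso_inverse[OF il bimod_overD(1)[OF o], simplified]
  have gl: "?g \<in> lin_hom L (bim Z) ?R" using i(1) by (rule lin_isoD(1))
  have gr: "?g \<in> right_lin L (bim Z) ?R"
    using lin_isoD(1)[OF lin_iso_inverse(1)[OF ir bimod_overD(2)[OF o]]] by (simp add: right_lin_lin_hom)
  have iso: "tmap L ?R X ?g (\<lambda>y. y) \<in> lin_iso L (tensor L (bim Z) X) (tensor L ?R X)" if "left_module L X"
    for X :: "('l, 'x) module"
    by (rule tmap_lin_iso[OF oZ o that gl gr fl fr]) (simp_all add: i)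
  have u: "(\<lambda>x. tens_act X (tmap L ?R X ?g (\<lambda>y. y) x)) \<in> lin_iso L (tensor L (bim Z) X) X" if "left_module L X"
    for X :: "('l, 'x) module"
    by (rule lin_iso_comp[OF iso[OF that] tens_act_iso[OF ringL that]])
  show "is_syzygy L m (tensor L (bim Z) A)"
    by (rule is_syzygy_iso[OF A u[OF Am] tensor_left_module[OF oZ Am]])
  interpret Bg: abelian_group B by (rule lmod_abelian_group[OF B])
  have bij: "stably_bij L A B A B (\<lambda>g. g)"
    unfolding stably_bij_def
    by (intro conjI ballI impI, assumption, rule bexI, rule finite_rank_zero) (simp_all add: lin_hom_closed)
  show "stably_bij L A B (tensor L (bim Z) A) (tensor L (bim Z) B) (tensor_map L (bim Z) B)"
  proof (rule stably_bij_iso[OF tensor_left_module[OF oZ Am] tensor_left_module[OF oZ B] Am B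
        tensor_map_lin_hom[OF oZ Am B] _ u[OF Am] u[OF B] _ bij])
    fix g x assume g: "g \<in> lin_hom L A B" and x: "x \<in> carrier (tensor L (bim Z) A)"
    have "tmap L ?R A ?g (\<lambda>y. y) x \<in> carrier (tensor L ?R A)" by (rule lin_hom_closed[OF lin_isoD(1)[OF iso[OF Am]] x])
    then show "tens_act B (tmap L ?R B ?g (\<lambda>y. y) (tensor_map L (bim Z) B g x)) = g (tens_act A (tmap L ?R A ?g (\<lambda>y. y) x))"
      unfolding tmap_natural[OF bimod_overD(2)[OF oZ] bimod_overD(2)[OF o] Am B gr g x]
      by (rule tens_act_natural[OF ringL Am B g])
  qed
qed

text \<open>Induction along the bimodule syzygies. Right projectivity of the current syzygy is
  carried along because it splits the next sequence on the right; the order of its product with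
  \<open>A\<close> is carried along because it makes functionals extend there.\<close>

lemma syzygy_tensor:
  fixes I :: "nat \<Rightarrow> ('l, 'k univ) module" and A :: "('l, 'a) module" and B :: "('l, 'b) module"
  assumes res: "injective_resolution L (regular L) d I e \<delta>"
    and Z: "syzygy E (envel_module (regular_bimod L)) l Z"
    and A: "is_syzygy L m A" "d \<le> m" and B: "fg_module L B"
  shows "left_module E Z \<and> fgproj (opp L) (right_part (bim Z)) \<and> is_syzygy L (m + l) (tensor L (bim Z) A) \<and>
    stably_bij L A B (tensor L (bim Z) A) (tensor L (bim Z) B) (tensor_map L (bim Z) B)"
  using Z
proof induction
  case (syzygy_0 Z f)
  then show ?case using syzygy_tensor_0[OF syzygy_0 A(1) fg_moduleD(1)[OF B]] by simp
next
  case (syzygy_Suc l Y P' p)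
  note Am = fg_moduleD(1)[OF is_syzygy_fg[OF A(1)]] and Af = is_syzygy_fg[OF A(1)] and Bm = fg_moduleD(1)[OF B]
  have Ym: "left_module E Y" and Yr: "fgproj (opp L) (right_part (bim Y))"
    and Ys: "is_syzygy L (m + l) (tensor L (bim Y) A)"
    and Yb: "stably_bij L A B (tensor L (bim Y) A) (tensor L (bim Y) B) (tensor_map L (bim Y) B)"
    using syzygy_Suc.IH by simp_all
  note Pm = fg_moduleD[OF syzygy_Suc(2)] and p = syzygy_Suc(4,5)
  note Pp = projective_fgproj[OF small_E Pm(2) syzygy_Suc(3)]
  let ?k = "a_kernel P' Y p"
  let ?Z = "P'\<lparr>carrier := ?k\<rparr>"
  have ks: "submod E P' ?k" by (rule kernel_submod[OF p(1) Pm(1) Ym])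
  have Zm: "left_module E ?Z" by (rule submod_left_module[OF ks Pm(1)])
  have k: "x \<in> ?k \<longleftrightarrow> x \<in> carrier P' \<and> p x = \<zero>\<^bsub>Y\<^esub>" for x by (simp add: a_kernel_def')
  have incl: "(\<lambda>x. x) \<in> lin_hom E ?Z P'" by (rule lin_homI) (simp_all add: k)
  note oY = bim_over[OF Ym] and oP = bim_over[OF Pm(1)] and oZ = bim_over[OF Zm]
  note rY = bimod_overD(2)[OF oY] and rP = bimod_overD(2)[OF oP] and rZ = bimod_overD(2)[OF oZ]
  note Pr = finite_rank_right[OF Pm(1,1) Pp]
  note pl = bim_lin[OF p(1)] and il = bim_lin[OF incl]
  let ?RP = "right_part (bim P')"
  interpret RP: abelian_group ?RP by (rule lmod_abelian_group[OF rP])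
  have pr: "p \<in> lin_hom (opp L) ?RP (right_part (bim Y))" "p ` carrier ?RP = carrier (right_part (bim Y))"
    using pl(2) p(2) by (simp_all add: right_lin_lin_hom)
  \<comment> \<open>A section of \<open>p\<close> that is linear on the right; it exists since
    \<open>Y\<close> is projective as a right module. The map \<open>r\<close> is the complementary
    retraction onto the kernel.\<close>
  obtain s where s: "s \<in> lin_hom (opp L) (right_part (bim Y)) ?RP" "\<And>y. y \<in> carrier (right_part (bim Y)) \<Longrightarrow> p (s y) = y"
    using fgproj_lift[OF Yr rY lin_hom_id pr rP rY] by blast
  define r where "r x = x \<ominus>\<^bsub>?RP\<^esub> s (p x)" for x
  note sp = lin_hom_comp[OF pr(1) s(1)]
  have r0: "r \<in> lin_hom (opp L) ?RP ?RP" unfolding r_def by (rule lin_hom_minus[OF lin_hom_id sp rP])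
  interpret RY: abelian_group "right_part (bim Y)" by (rule lmod_abelian_group[OF rY])
  have rk: "r x \<in> ?k" if x: "x \<in> carrier P'" for x
  proof -
    have x': "x \<in> carrier ?RP" using x by simp
    have "p (r x) = p x \<ominus>\<^bsub>right_part (bim Y)\<^esub> p (s (p x))"
      unfolding r_def by (rule lin_hom_diff[OF pr(1) rP rY x' lin_hom_closed[OF sp x']])
    also have "\<dots> = \<zero>\<^bsub>Y\<^esub>"
      using s(2)[OF lin_hom_closed[OF pr(1) x']] RY.diff_self[OF lin_hom_closed[OF pr(1) x']] by simp
    finally show ?thesis using lin_hom_closed[OF r0 x'] by (simp add: k)
  qed
  have rl: "r \<in> right_lin L (bim P') (bim ?Z)"
    using r0 rk by (auto simp: right_lin_lin_hom right_lin_def addhom_def)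
  have ri: "r x = x" if x: "x \<in> carrier (bim ?Z)" for x
  proof -
    have x': "x \<in> carrier ?RP" "p x = \<zero>\<^bsub>right_part (bim Y)\<^esub>" using x by (simp_all add: k)
    have "s (p x) = \<zero>\<^bsub>?RP\<^esub>" unfolding x'(2) by (rule lin_hom_zero[OF s(1) rY rP])
    then show ?thesis unfolding r_def using RP.diff_zero[OF x'(1)] by simp
  qed
  have Zr: "fgproj (opp L) (right_part (bim ?Z))"
  proof (rule finite_rank_cong[OF finite_rank_through[OF Pr _ _ rP rZ]])
    show "(\<lambda>x. x) \<in> lin_hom (opp L) (right_part (bim ?Z)) ?RP" using il(2) by (simp add: right_lin_lin_hom)
    show "r \<in> lin_hom (opp L) ?RP (right_part (bim ?Z))" using rl by (simp add: right_lin_lin_hom)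
  qed (simp add: ri)
  have sl: "s \<in> right_lin L (bim Y) (bim P')" using s(1) by (simp add: right_lin_lin_hom)
  have sum: "x = r x \<oplus>\<^bsub>bim P'\<^esub> s (p x)" if "x \<in> carrier (bim P')" for x
  proof -
    have x': "x \<in> carrier ?RP" using that by simp
    have "(x \<ominus>\<^bsub>?RP\<^esub> s (p x)) \<oplus>\<^bsub>?RP\<^esub> s (p x) = x" by (rule RP.diff_add_cancel[OF x' lin_hom_closed[OF sp x']])
    then show ?thesis by (simp add: r_def)
  qed
  \<comment> \<open>The sequence is used for both X = A and X = B.\<close>
  have se: "short_exact L (tensor L (bim ?Z) X) (tensor L (bim P') X) (tensor L (bim Y) X)
    (tmap L (bim P') X (\<lambda>x. x) (\<lambda>y. y)) (tmap L (bim Y) X p (\<lambda>y. y))" if "left_module L X" for X :: "('l, 'x) module"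
  proof (rule split_tensor[OF oZ oP oY that il pl rl sl])
    show "r x = x" if "x \<in> carrier (bim ?Z)" for x by (rule ri[OF that])
    show "x = r x \<oplus>\<^bsub>bim P'\<^esub> s (p x)" if "x \<in> carrier (bim P')" for x by (rule sum[OF that])
    show "p (s x) = x" if "x \<in> carrier (bim Y)" for x using s(2) that by simp
    show "p x = \<zero>\<^bsub>bim Y\<^esub>" if "x \<in> carrier (bim ?Z)" for x using that by (simp add: k)
  qed
  note tA = tensor_left_module[OF oZ Am] tensor_left_module[OF oP Am] tensor_left_module[OF oY Am]
  note tB = tensor_left_module[OF oZ Bm] tensor_left_module[OF oP Bm] tensor_left_module[OF oY Bm]
  note PA = bim_tensor_fgproj[OF Pm(1) Pp Af] and PB = bim_tensor_fgproj[OF Pm(1) Pp B]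
  have PAf: "fg_module L (tensor L (bim P') A)" using fgproj_fin_gen[OF PA tA(2)] tA(2) by (simp add: fg_module_def)
  note ZAf = fd_algebra.short_exact_fg[OF fd se[OF Am] PAf tA(1,3)]
  \<comment> \<open>Y \<otimes> A has order m + l, still at least \<open>d\<close>, so functionals
    extend from the next syzygy.\<close>
  have dm: "d \<le> m + l" using A(2) by simp
  note sL = fd_algebra_small_ring[OF fd]
  note ext = syzygy_extends[OF res sL Ys dm PAf PA ZAf se[OF Am]]
  have "is_syzygy L (Suc (m + l)) (tensor L (bim ?Z) A)" by (rule is_syzygy_Suc[OF sL Ys PAf PA ZAf se[OF Am]])
  moreover have "stably_bij L A B (tensor L (bim ?Z) A) (tensor L (bim ?Z) B) (tensor_map L (bim ?Z) B)"
  proof (rule stably_bij_syzygy[OF se[OF Am] se[OF Bm] ext tA tB PA PB tensor_map_lin_hom[OF oY Am Bm]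
      tensor_map_lin_hom[OF oP Am Bm] tensor_map_lin_hom[OF oZ Am Bm] _ _ Yb])
    fix g x assume g: "g \<in> lin_hom L A B" and x: "x \<in> carrier (tensor L (bim P') A)"
    show "tmap L (bim Y) B p (\<lambda>y. y) (tensor_map L (bim P') B g x) =
        tensor_map L (bim Y) B g (tmap L (bim Y) A p (\<lambda>y. y) x)"
      by (rule tmap_natural[OF rP rY Am Bm pl(2) g x])
  next
    fix g x assume g: "g \<in> lin_hom L A B" and x: "x \<in> carrier (tensor L (bim ?Z) A)"
    show "tensor_map L (bim P') B g (tmap L (bim P') A (\<lambda>x. x) (\<lambda>y. y) x) =
        tmap L (bim P') B (\<lambda>x. x) (\<lambda>y. y) (tensor_map L (bim ?Z) B g x)"
      by (rule tmap_natural[OF rZ rP Am Bm il(2) g x, symmetric])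
  qed
  ultimately show ?case using Zm Zr by simp
qed

text \<open>The difference g f - 1 has finite rank over the enveloping algebra, and tensoring it
  with \<open>X\<close> gives a map of finite rank over \<open>L\<close>; additivity in the bimodule
  variable identifies that map with the difference of the tensored maps.\<close>

lemma stable_bim_transfer:
  assumes V: "left_module E V" "left_module E Z" and f: "f \<in> lin_hom E V Z" "g \<in> lin_hom E Z V"
    and fr: "finite_rank E V V (\<lambda>x. g (f x) \<ominus>\<^bsub>V\<^esub> x)" and X: "fg_module L X"
  shows "finite_rank L (tensor L (bim V) X) (tensor L (bim V) X)
    (\<lambda>w. tmap L (bim V) X g (\<lambda>y. y) (tmap L (bim Z) X f (\<lambda>y. y) w) \<ominus>\<^bsub>tensor L (bim V) X\<^esub> w)"
proof -
  note Xm = fg_moduleD(1)[OF X] and oV = bim_over[OF V(1)] and oZ = bim_over[OF V(2)]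
  note t = tensorableI[OF bimod_overD(2)[OF oV] Xm] tensorableI[OF bimod_overD(2)[OF oZ] Xm]
  interpret V: abelian_group V by (rule lmod_abelian_group[OF V(1)])
  interpret T: abelian_group "tensor L (bim V) X" using tensor_left_module[OF oV Xm] by (rule lmod_abelian_group)
  have gf: "(\<lambda>x. g (f x)) \<in> lin_hom E V V" by (rule lin_hom_comp[OF f])
  let ?h = "\<lambda>x. g (f x) \<ominus>\<^bsub>V\<^esub> x"
  have h: "?h \<in> lin_hom E V V" by (rule lin_hom_minus[OF gf lin_hom_id V(1)])
  show ?thesis
  proof (rule finite_rank_cong[OF finite_rank_bim_tensor[OF V(1,1) X fr]])
    fix w assume w: "w \<in> carrier (tensor L (bim V) X)"
    then have w': "w \<in> carrier (tens_group L (bim V) X)" by simp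
    have "tmap L (bim V) X (\<lambda>x. g (f x)) (\<lambda>y. y) w =
        tmap L (bim V) X ?h (\<lambda>y. y) w \<oplus>\<^bsub>tens_group L (bim V) X\<^esub> tmap L (bim V) X (\<lambda>x. x) (\<lambda>y. y) w"
      by (rule tmap_add_left[OF t(1,1) bim_lin(2)[OF h] right_lin_id bim_lin(2)[OF gf] lin_hom_id _ w'])
        (simp add: lin_hom_closed[OF gf] V.diff_add_cancel)
    moreover have "tmap L (bim V) X (\<lambda>x. x) (\<lambda>y. y) w = w"
      by (rule tmap_id[OF t(1) w']) (simp_all add: right_lin_id lin_hom_id)
    moreover have "tmap L (bim V) X ?h (\<lambda>y. y) w \<in> carrier (tensor L (bim V) X)"
      using addhom_closed[OF tmap_addhom[OF t(1,1) bim_lin(2)[OF h] lin_hom_id] w'] by simp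
    ultimately have "tmap L (bim V) X (\<lambda>x. g (f x)) (\<lambda>y. y) w \<ominus>\<^bsub>tensor L (bim V) X\<^esub> w = tmap L (bim V) X ?h (\<lambda>y. y) w"
      using T.add_diff_cancel[of "tmap L (bim V) X ?h (\<lambda>y. y) w" w] w by simp
    then show "tmap L (bim V) X ?h (\<lambda>y. y) w = tmap L (bim V) X g (\<lambda>y. y) (tmap L (bim Z) X f (\<lambda>y. y) w) \<ominus>\<^bsub>tensor L (bim V) X\<^esub> w"
      unfolding tmap_comp[OF t(1,2,1) bim_lin(2)[OF f(1)] lin_hom_id bim_lin(2)[OF f(2)] lin_hom_id w'] by simp
  qed
qed

end

text \<open>M \<otimes> (N \<otimes> A) is naturally isomorphic to (M \<otimes> N) \<otimes> A by
  the associator. In it M \<otimes> N may be read as a module over the enveloping algebra, which is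
  stably isomorphic to the syzygy \<open>Z\<close>; for \<open>Z\<close> the claim is
  \<open>syzygy_tensor\<close>.\<close>

lemma composite_stably_bij:
  fixes I :: "nat \<Rightarrow> ('l, 'k univ) module" and L :: "('k, 'l) module" and S :: "('k, 's) module"
    and A :: "('l, 'a) module" and B :: "('l, 'b) module"
  assumes L: "fd_algebra K L" and S: "fd_algebra K S"
    and res: "injective_resolution L (regular L) d I e \<delta>"
    and M: "bimodule K L S M" and N: "bimodule K S L N"
    and Z: "syzygy (envel K L) (envel_module (regular_bimod L)) l Z"
    and st: "stably_iso (envel K L) (envel_module (bitensor S M N)) Z"
    and A: "is_syzygy L m A" "d \<le> m" and B: "fg_module L B"
  shows "stably_bij L A B (tensor S M (tensor L N A)) (tensor S M (tensor L N B))
    (\<lambda>f. tensor_map S M (tensor L N B) (tensor_map L N B f))"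
proof -
  let ?X = "bitensor S M N"
  let ?V = "envel_module ?X"
  obtain f g where V: "fg_module (envel K L) ?V" "fg_module (envel K L) Z" and f: "f \<in> lin_hom (envel K L) ?V Z"
    and g: "g \<in> lin_hom (envel K L) Z ?V"
    and fp: "factors_projective (envel K L) ?V ?V (\<lambda>x. g (f x) \<ominus>\<^bsub>?V\<^esub> x)"
      "factors_projective (envel K L) Z Z (\<lambda>y. f (g y) \<ominus>\<^bsub>Z\<^esub> y)"
    using st unfolding stably_iso_def by auto
  note Vm = fg_moduleD(1)[OF V(1)] and Zm = fg_moduleD(1)[OF V(2)]
  interpret enveloping K L by (rule enveloping.intro[OF L left_module_ring[OF Vm]])
  note m = bimodule_bimod_over[OF M] and n = bimodule_bimod_over[OF N]
  note Xb = bitensor_bimodule[OF S L M N]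
  note oX = bitensor_bimod_over[OF m n] and oV = bim_over[OF Vm] and oZ = bim_over[OF Zm]
  note Af = is_syzygy_fg[OF A(1)] note Am = fg_moduleD(1)[OF Af] and Bm = fg_moduleD(1)[OF B]
  note fr = factors_projective_finite_rank[OF small_E Vm fp(1)] factors_projective_finite_rank[OF small_E Zm fp(2)]
  have Zb: "stably_bij L A B (tensor L (bim Z) A) (tensor L (bim Z) B) (tensor_map L (bim Z) B)"
    using syzygy_tensor[OF res Z A B] by simp
  have Vb: "stably_bij L A B (tensor L (bim ?V) A) (tensor L (bim ?V) B) (tensor_map L (bim ?V) B)"
  proof (rule stably_bij_transfer[where VX = "tensor L (bim Z) A" and VY = "tensor L (bim Z) B" and V = "tensor_map L (bim Z) B"
        and aX = "tmap L (bim Z) A f (\<lambda>y. y)" and bX = "tmap L (bim ?V) A g (\<lambda>y. y)"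
        and aY = "tmap L (bim Z) B f (\<lambda>y. y)" and bY = "tmap L (bim ?V) B g (\<lambda>y. y)"])
    show "finite_rank L (tensor L (bim ?V) A) (tensor L (bim ?V) A)
        (\<lambda>x. tmap L (bim ?V) A g (\<lambda>y. y) (tmap L (bim Z) A f (\<lambda>y. y) x) \<ominus>\<^bsub>tensor L (bim ?V) A\<^esub> x)"
      by (rule stable_bim_transfer[OF Vm Zm f g _ Af]) (rule fr)
    show "finite_rank L (tensor L (bim Z) A) (tensor L (bim Z) A)
        (\<lambda>x. tmap L (bim Z) A f (\<lambda>y. y) (tmap L (bim ?V) A g (\<lambda>y. y) x) \<ominus>\<^bsub>tensor L (bim Z) A\<^esub> x)"
      by (rule stable_bim_transfer[OF Zm Vm g f _ Af]) (rule fr)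
    show "finite_rank L (tensor L (bim ?V) B) (tensor L (bim ?V) B)
        (\<lambda>x. tmap L (bim ?V) B g (\<lambda>y. y) (tmap L (bim Z) B f (\<lambda>y. y) x) \<ominus>\<^bsub>tensor L (bim ?V) B\<^esub> x)"
      by (rule stable_bim_transfer[OF Vm Zm f g _ B]) (rule fr)
    show "tmap L (bim Z) B f (\<lambda>y. y) (tensor_map L (bim ?V) B h x) =
        tensor_map L (bim Z) B h (tmap L (bim Z) A f (\<lambda>y. y) x)"
      if "h \<in> lin_hom L A B" "x \<in> carrier (tensor L (bim ?V) A)" for h x
      by (rule tmap_natural[OF bimod_overD(2)[OF oV] bimod_overD(2)[OF oZ] Am Bm bim_lin(2)[OF f] that])
  qed (rule tensor_left_module[OF oV Am] tensor_left_module[OF oV Bm]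
        tensor_left_module[OF oZ Am] tensor_left_module[OF oZ Bm] tensor_map_lin_hom[OF oV Am Bm] tensor_map_lin_hom[OF oZ Am Bm]
        tmap_lin_hom[OF oV oZ Am Am bim_lin[OF f] lin_hom_id] tmap_lin_hom[OF oZ oV Am Am bim_lin[OF g] lin_hom_id]
        tmap_lin_hom[OF oV oZ Bm Bm bim_lin[OF f] lin_hom_id] tmap_lin_hom[OF oZ oV Bm Bm bim_lin[OF g] lin_hom_id] Zb | assumption)+
  note el = envel_module_lin[OF Xb]
  have iX: "tmap L (bim ?V) Y (\<lambda>x. x) (\<lambda>y. y) \<in> lin_iso L (tensor L ?X Y) (tensor L (bim ?V) Y)"
    if "left_module L Y" for Y :: "('l, 'y) module"
    by (rule tmap_lin_iso[OF oX oV that el]) simp_all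
  have Xbij: "stably_bij L A B (tensor L ?X A) (tensor L ?X B) (tensor_map L ?X B)"
    by (rule stably_bij_iso[OF tensor_left_module[OF oX Am] tensor_left_module[OF oX Bm]
        tensor_left_module[OF oV Am] tensor_left_module[OF oV Bm] tensor_map_lin_hom[OF oX Am Bm] tensor_map_lin_hom[OF oV Am Bm]
        iX[OF Am] iX[OF Bm] tmap_natural[OF bimod_overD(2)[OF oX] bimod_overD(2)[OF oV] Am Bm el(2)] Vb])
  note NA = tensor_left_module[OF n Am] and NB = tensor_left_module[OF n Bm]
  show ?thesis
    by (rule stably_bij_iso[OF tensor_left_module[OF m NA] tensor_left_module[OF m NB]
        tensor_left_module[OF oX Am] tensor_left_module[OF oX Bm] tensor_map_lin_hom[OF m NA NB tensor_map_lin_hom[OF n Am Bm]]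
        tensor_map_lin_hom[OF oX Am Bm] triple_tensor.assoc_lin_iso[OF triple_tensor.intro[OF m n Am]]
        triple_tensor.assoc_lin_iso[OF triple_tensor.intro[OF m n Bm]] tens_assoc_natural[OF m n Am Bm] Xbij])
qed

text \<open>Write F for N \<otimes> - and G for M \<otimes> -. F reflects stable vanishing since G F
  does and G preserves finite rank. For given \<open>g\<close>, fullness of G F yields
  \<open>f\<close> with G g - G F f of finite rank; applying F and using that F G reflects vanishing
  gives the same for g - F f. The conclusion is spelled out because \<open>stably_bij\<close> fixes
  a single ring.\<close>

lemma tensor_stably_bij:
  fixes I :: "nat \<Rightarrow> ('l, 'k univ) module" and J :: "nat \<Rightarrow> ('s, 'k univ) module"
    and L :: "('k, 'l) module" and S :: "('k, 's) module" and A :: "('l, 'a) module" and B :: "('l, 'b) module"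
  assumes L: "fd_algebra K L" and S: "fd_algebra K S"
    and resL: "injective_resolution L (regular L) d I e \<delta>" and resS: "injective_resolution S (regular S) d' J e' \<delta>'"
    and sing: "singular_equivalence_level K L S M N l"
    and A: "is_syzygy L m A" "d \<le> m" "d' \<le> m" and B: "fg_module L B"
  shows "(\<forall>f \<in> lin_hom L A B. finite_rank S (tensor L N A) (tensor L N B) (tensor_map L N B f) \<longrightarrow> finite_rank L A B f) \<and>
    (\<forall>g \<in> lin_hom S (tensor L N A) (tensor L N B). \<exists>f \<in> lin_hom L A B.
      finite_rank S (tensor L N A) (tensor L N B) (\<lambda>x. g x \<ominus>\<^bsub>tensor L N B\<^esub> tensor_map L N B f x))"
proof -
  let ?F = "tensor L N" and ?G = "tensor S M" and ?Ff = "tensor_map L N"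
  have M: "bimodule K L S M" and N: "bimodule K S L N"
    and pr: "fin_gen L M" "projective L M" "fin_gen (opp S) (right_part M)" "projective (opp S) (right_part M)"
      "fin_gen S N" "projective S N" "fin_gen (opp L) (right_part N)" "projective (opp L) (right_part N)"
    using sing by (simp_all add: singular_equivalence_level_def fg_projective_def)
  obtain ZL where ZL: "syzygy (envel K L) (envel_module (regular_bimod L)) l ZL"
    "stably_iso (envel K L) (envel_module (bitensor S M N)) ZL"
    using sing by (auto simp: singular_equivalence_level_def)
  obtain ZS where ZS: "syzygy (envel K S) (envel_module (regular_bimod S)) l ZS"
    "stably_iso (envel K S) (envel_module (bitensor L N M)) ZS"
    using sing by (auto simp: singular_equivalence_level_def)
  note m = bimodule_bimod_over[OF M] and n = bimodule_bimod_over[OF N]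
  note sL = fd_algebra_small_ring[OF L] and sS = fd_algebra_small_ring[OF S]
  have opp_small: "small_ring (opp L)"
    using sL ring_opp by (auto simp: small_ring_def)
  note pM = projective_fgproj[OF sL pr(1,2)] and pN = projective_fgproj[OF sS pr(5,6)]
  note rN = projective_fgproj[OF opp_small pr(7,8)]
  note Am = fg_moduleD(1)[OF is_syzygy_fg[OF A(1)]] and Bm = fg_moduleD(1)[OF B]
  note NA = tensor_left_module[OF n Am] and NB = tensor_left_module[OF n Bm]
  note NAs = is_syzygy_tensor[OF sS n pN rN A(1)]
  have NBf: "fg_module S (?F B)" by (rule tensor_fg_module[OF n pr(5) B])
  note GF = composite_stably_bij[OF L S resL M N ZL A(1,2) B]
  \<comment> \<open>N \<otimes> A is a syzygy of the same order \<open>m\<close> over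
    \<open>S\<close>, so the bound d' \<le> m applies to it.\<close>
  note FG = composite_stably_bij[OF S L resS N M ZS NAs A(3) NBf]
  note F = tensor_map_lin_hom[OF n Am Bm] and G = tensor_map_lin_hom[OF m NA NB]
  show ?thesis
  proof (intro conjI ballI impI)
    fix f assume f: "f \<in> lin_hom L A B" and fr: "finite_rank S (?F A) (?F B) (?Ff B f)"
    show "finite_rank L A B f" by (rule stably_bijD(1)[OF GF f finite_rank_tensor[OF m pM NA NB fr]])
  next
    fix g assume g: "g \<in> lin_hom S (?F A) (?F B)"
    obtain f where f: "f \<in> lin_hom L A B" "finite_rank L (?G (?F A)) (?G (?F B))
      (\<lambda>x. tensor_map S M (?F B) g x \<ominus>\<^bsub>?G (?F B)\<^esub>
        tensor_map S M (?F B) (?Ff B f) x)"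
      using stably_bijD(2)[OF GF G[OF g]] by blast
    have h: "(\<lambda>x. g x \<ominus>\<^bsub>?F B\<^esub> ?Ff B f x) \<in> lin_hom S (?F A) (?F B)"
      by (rule lin_hom_minus[OF g F[OF f(1)] NB])
    have "finite_rank L (?G (?F A)) (?G (?F B))
        (tensor_map S M (?F B) (\<lambda>x. g x \<ominus>\<^bsub>?F B\<^esub> ?Ff B f x))"
      by (rule finite_rank_cong[OF f(2)]) (rule tensor_map_diff[OF m NA NB g F[OF f(1)], symmetric])
    then have "finite_rank S (?F (?G (?F A))) (?F (?G (?F B)))
      (?Ff (?G (?F B)) (tensor_map S M (?F B) (\<lambda>x. g x \<ominus>\<^bsub>?F B\<^esub> ?Ff B f x)))"
      by (rule finite_rank_tensor[OF n pN tensor_left_module[OF m NA] tensor_left_module[OF m NB]])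
    then have "finite_rank S (?F A) (?F B) (\<lambda>x. g x \<ominus>\<^bsub>?F B\<^esub> ?Ff B f x)"
      by (rule stably_bijD(1)[OF FG h])
    then show "\<exists>f \<in> lin_hom L A B. finite_rank S (?F A) (?F B)
        (\<lambda>x. g x \<ominus>\<^bsub>?F B\<^esub> ?Ff B f x)"
      using f(1) by (intro bexI)
  qed
qed

section \<open>Yoneda extensions and cocycles\<close>

text \<open>One name for the kernel of the map leaving degree \<open>i\<close>, so that exactness
  reads alike whether that map is \<open>prj\<close> or some \<open>dif\<close>.\<close>

definition ext_ker :: "('r, 'a) module \<Rightarrow> ('r, 'u, 'a, 'b) extension \<Rightarrow> nat \<Rightarrow> 'u set" where
  "ext_ker A E i = (case i of 0 \<Rightarrow> {x \<in> carrier (obj E 0). prj E x = \<zero>\<^bsub>A\<^esub>}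
     | Suc j \<Rightarrow> {x \<in> carrier (obj E (Suc j)). dif E j x = \<zero>\<^bsub>obj E j\<^esub>})"

lemma ext_ker_simps [simp]:
  "ext_ker A E 0 = {x \<in> carrier (obj E 0). prj E x = \<zero>\<^bsub>A\<^esub>}"
  "ext_ker A E (Suc j) = {x \<in> carrier (obj E (Suc j)). dif E j x = \<zero>\<^bsub>obj E j\<^esub>}"
  by (simp_all add: ext_ker_def)

text \<open>Writing the length as \<open>Suc N\<close> turns the truncated subtraction and the case
  distinctions of the definition into separate conditions. From here on, \<open>N\<close> is the
  index of the leftmost middle term.\<close>

lemma is_extension_Suc:
  "is_extension R (Suc N) A B E \<longleftrightarrow> (\<forall>i \<le> N. fg_module R (obj E i)) \<and>
     inc E \<in> lin_hom R B (obj E N) \<and> inj_on (inc E) (carrier B) \<and>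
     (\<forall>i < N. dif E i \<in> lin_hom R (obj E (Suc i)) (obj E i)) \<and>
     prj E \<in> lin_hom R (obj E 0) A \<and> prj E ` carrier (obj E 0) = carrier A \<and>
     (\<forall>i < N. dif E i ` carrier (obj E (Suc i)) = ext_ker A E i) \<and> inc E ` carrier B = ext_ker A E N"
proof -
  have k: "(case i of 0 \<Rightarrow> a_kernel (obj E 0) A (prj E) | Suc j \<Rightarrow> a_kernel (obj E i) (obj E j) (dif E j)) = ext_ker A E i" for i
    by (cases i) (simp_all add: a_kernel_def')
  have "(\<forall>i < Suc N. (if i = Suc N - 1 then inc E ` carrier B else dif E i ` carrier (obj E (Suc i))) = ext_ker A E i) \<longleftrightarrow>
      (\<forall>i < N. dif E i ` carrier (obj E (Suc i)) = ext_ker A E i) \<and> inc E ` carrier B = ext_ker A E N" (is "?l \<longleftrightarrow> ?r")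
  proof
    assume l: ?l
    have "dif E i ` carrier (obj E (Suc i)) = ext_ker A E i" if "i < N" for i
      using l[rule_format, of i] that by simp
    moreover have "inc E ` carrier B = ext_ker A E N" using l[rule_format, of N] by simp
    ultimately show ?r by simp
  next
    assume ?r
    then show ?l by (simp add: less_Suc_eq)
  qed
  then show ?thesis
    unfolding is_extension_def k by (simp add: less_Suc_eq_le Suc_le_eq)
qed

lemma is_extensionD:
  assumes "is_extension R (Suc N) A B E"
  shows "i \<le> N \<Longrightarrow> fg_module R (obj E i)" "i \<le> N \<Longrightarrow> left_module R (obj E i)"
    "inc E \<in> lin_hom R B (obj E N)" "inj_on (inc E) (carrier B)"
    "i < N \<Longrightarrow> dif E i \<in> lin_hom R (obj E (Suc i)) (obj E i)"
    "prj E \<in> lin_hom R (obj E 0) A" "prj E ` carrier (obj E 0) = carrier A"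
    "i < N \<Longrightarrow> dif E i ` carrier (obj E (Suc i)) = ext_ker A E i" "inc E ` carrier B = ext_ker A E N"
    "ext_ker A E i \<subseteq> carrier (obj E i)"
proof -
  note * = assms[unfolded is_extension_Suc]
  from * show f: "i \<le> N \<Longrightarrow> fg_module R (obj E i)" by auto
  then show "i \<le> N \<Longrightarrow> left_module R (obj E i)" by (rule fg_moduleD(1))
  from * show "inc E \<in> lin_hom R B (obj E N)" "inj_on (inc E) (carrier B)"
    "i < N \<Longrightarrow> dif E i \<in> lin_hom R (obj E (Suc i)) (obj E i)"
    "prj E \<in> lin_hom R (obj E 0) A" "prj E ` carrier (obj E 0) = carrier A"
    "i < N \<Longrightarrow> dif E i ` carrier (obj E (Suc i)) = ext_ker A E i" "inc E ` carrier B = ext_ker A E N"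
    by simp_all
  show "ext_ker A E i \<subseteq> carrier (obj E i)" by (cases i) auto
qed

lemma ext_hom_Suc:
  "ext_hom R (Suc N) B \<beta> \<alpha> E E' g \<longleftrightarrow>
     (\<forall>i \<le> N. g i \<in> lin_hom R (obj E i) (obj E' i)) \<and>
     (\<forall>b \<in> carrier B. g N (inc E b) = inc E' (\<beta> b)) \<and>
     (\<forall>i < N. \<forall>x \<in> carrier (obj E (Suc i)). g i (dif E i x) = dif E' i (g (Suc i) x)) \<and>
     (\<forall>x \<in> carrier (obj E 0). \<alpha> (prj E x) = prj E' (g 0 x))"
  unfolding ext_hom_def by (simp add: less_Suc_eq_le Suc_le_eq)

lemma ext_homD:
  assumes "ext_hom R (Suc N) B \<beta> \<alpha> E E' g"
  shows "i \<le> N \<Longrightarrow> g i \<in> lin_hom R (obj E i) (obj E' i)"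
    "b \<in> carrier B \<Longrightarrow> g N (inc E b) = inc E' (\<beta> b)"
    "\<lbrakk>i < N; x \<in> carrier (obj E (Suc i))\<rbrakk> \<Longrightarrow> g i (dif E i x) = dif E' i (g (Suc i) x)"
    "x \<in> carrier (obj E 0) \<Longrightarrow> \<alpha> (prj E x) = prj E' (g 0 x)"
  using assms by (auto simp: ext_hom_Suc)

lemma ext_hom_comp:
  assumes g: "ext_hom R (Suc N) B \<beta> \<alpha> E E' g" and h: "ext_hom R (Suc N) B' \<beta>' \<alpha>' E' E'' h"
    and b: "\<And>b. b \<in> carrier B \<Longrightarrow> \<beta> b \<in> carrier B'"
  shows "ext_hom R (Suc N) B (\<lambda>b. \<beta>' (\<beta> b)) (\<lambda>a. \<alpha>' (\<alpha> a)) E E'' (\<lambda>i x. h i (g i x))"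
  unfolding ext_hom_Suc
proof (intro conjI allI impI ballI)
  note G = ext_homD[OF g] and H = ext_homD[OF h]
  show "(\<lambda>x. h i (g i x)) \<in> lin_hom R (obj E i) (obj E'' i)" if "i \<le> N" for i
    by (rule lin_hom_comp[OF G(1)[OF that] H(1)[OF that]])
  show "h N (g N (inc E c)) = inc E'' (\<beta>' (\<beta> c))" if "c \<in> carrier B" for c
    unfolding G(2)[OF that] by (rule H(2)[OF b[OF that]])
  show "h i (g i (dif E i x)) = dif E'' i (h (Suc i) (g (Suc i) x))" if "i < N" "x \<in> carrier (obj E (Suc i))" for i x
    unfolding G(3)[OF that] by (rule H(3)[OF that(1) lin_hom_closed[OF G(1) that(2)]]) (use that in simp)
  show "\<alpha>' (\<alpha> (prj E x)) = prj E'' (h 0 (g 0 x))" if "x \<in> carrier (obj E 0)" for x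
    unfolding G(4)[OF that] by (rule H(4)[OF lin_hom_closed[OF G(1) that]]) simp
qed

lemma ext_ker_submod:
  assumes E: "is_extension R (Suc N) A B E" and A: "left_module R A" and i: "i \<le> N"
  shows "submod R (obj E i) (ext_ker A E i)"
proof (cases i)
  case 0
  then show ?thesis
    using kernel_submod[OF is_extensionD(6)[OF E] is_extensionD(2)[OF E] A] by (simp add: a_kernel_def')
next
  case (Suc j)
  then have j: "j < N" "Suc j \<le> N" "j \<le> N" using i by simp_all
  show ?thesis
    using kernel_submod[OF is_extensionD(5)[OF E j(1)] is_extensionD(2)[OF E j(2)] is_extensionD(2)[OF E j(3)]] Suc
    by (simp add: a_kernel_def')
qed

lemma ext_inc_zero:
  assumes E: "is_extension R (Suc N) A B E" and b: "b \<in> carrier B"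
  shows "inc E b \<in> ext_ker A E N"
  using is_extensionD(9)[OF E] b by blast

lemma ext_dif_zero:
  assumes E: "is_extension R (Suc N) A B E" and i: "i < N" and x: "x \<in> carrier (obj E (Suc i))"
  shows "dif E i x \<in> ext_ker A E i"
  using is_extensionD(8)[OF E i] x by blast

text \<open>Extensions obtained by tensoring or by fibre products have middle terms in other types,
  while \<open>exts\<close> wants the universe. The middle terms are copied one by one, and the maps
  are conjugated by the copying isomorphisms; the end terms keep their types.\<close>

lemma ext_copy:
  fixes R :: "('k, 'r) module" and E :: "('r, 'u, 'a, 'b) extension"
  assumes R: "small_ring R" and E: "is_extension R (Suc N) A B E" and A: "left_module R A"
  obtains G :: "('r, 'k univ, 'a, 'b) extension" and c where "is_extension R (Suc N) A B G"
    "ext_hom R (Suc N) B id id E G c" "\<And>i. i \<le> N \<Longrightarrow> c i \<in> lin_iso R (obj E i) (obj G i)"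
    "ext_hom R (Suc N) B id id G E (\<lambda>i. inv_into (carrier (obj E i)) (c i))"
proof -
  note e = is_extensionD[OF E]
  have "\<forall>i. \<exists>Xc :: ('r, 'k univ) module \<times> ('u \<Rightarrow> 'k univ). i \<le> N \<longrightarrow>
      fg_module R (fst Xc) \<and> snd Xc \<in> lin_iso R (obj E i) (fst Xc)"
  proof
    fix i
    show "\<exists>Xc :: ('r, 'k univ) module \<times> ('u \<Rightarrow> 'k univ). i \<le> N \<longrightarrow>
      fg_module R (fst Xc) \<and> snd Xc \<in> lin_iso R (obj E i) (fst Xc)"
    proof (cases "i \<le> N")
      case True
      obtain Q :: "('r, 'k univ) module" and q where "fg_module R Q" "q \<in> lin_iso R (obj E i) Q"
        by (rule univ_copy[OF R e(1)[OF True]])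
      then show ?thesis by (intro exI[of _ "(Q, q)"]) simp
    qed simp
  qed
  then obtain Xc :: "nat \<Rightarrow> ('r, 'k univ) module \<times> ('u \<Rightarrow> 'k univ)" where
    Xc: "\<And>i. i \<le> N \<Longrightarrow> fg_module R (fst (Xc i)) \<and> snd (Xc i) \<in> lin_iso R (obj E i) (fst (Xc i))"
    using choice[of "\<lambda>i Xc :: ('r, 'k univ) module \<times> ('u \<Rightarrow> 'k univ). i \<le> N \<longrightarrow>
      fg_module R (fst Xc) \<and> snd Xc \<in> lin_iso R (obj E i) (fst Xc)"] by blast
  define X where "X i = fst (Xc i)" for i
  define c where "c i = snd (Xc i)" for i
  define d where "d i = inv_into (carrier (obj E i)) (c i)" for i
  have Xf: "fg_module R (X i)" and c: "c i \<in> lin_iso R (obj E i) (X i)" if "i \<le> N" for i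
    using Xc[OF that] by (simp_all add: X_def c_def)
  note X = Xf fg_moduleD(1)[OF Xf]
  note ch = lin_isoD[OF c]
  have d: "d i \<in> lin_hom R (X i) (obj E i)" "\<And>x. x \<in> carrier (obj E i) \<Longrightarrow> d i (c i x) = x"
    "\<And>x. x \<in> carrier (X i) \<Longrightarrow> c i (d i x) = x" "d i ` carrier (X i) = carrier (obj E i)" if "i \<le> N" for i
    using lin_iso_inverse[OF c[OF that] e(2)[OF that]] lin_isoD(1,3)[OF lin_iso_inverse(1)[OF c[OF that] e(2)[OF that]]]
    by (simp_all add: d_def)
  define G :: "('r, 'k univ, 'a, 'b) extension" where
    "G = \<lparr>obj = X, dif = (\<lambda>i x. c i (dif E i (d (Suc i) x))), inc = (\<lambda>b. c N (inc E b)), prj = (\<lambda>x. prj E (d 0 x))\<rparr>"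
  have Gs: "obj G = X" "dif G = (\<lambda>i x. c i (dif E i (d (Suc i) x)))" "inc G = (\<lambda>b. c N (inc E b))" "prj G = (\<lambda>x. prj E (d 0 x))"
    by (simp_all add: G_def)
  have c0: "c i x = \<zero>\<^bsub>X i\<^esub> \<longleftrightarrow> x = \<zero>\<^bsub>obj E i\<^esub>" if "i \<le> N" "x \<in> carrier (obj E i)" for i x
    using lin_hom_zero[OF ch(1)[OF that(1)] e(2)[OF that(1)] X(2)[OF that(1)]] inj_onD[OF ch(2)[OF that(1)]]
      that(2) lmod_zero[OF e(2)[OF that(1)]] by metis
  have ker: "ext_ker A G i = c i ` ext_ker A E i" if i: "i \<le> N" for i
  proof -
    have "x \<in> ext_ker A G i \<longleftrightarrow> x \<in> carrier (X i) \<and> d i x \<in> ext_ker A E i" for x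
    proof (cases i)
      case 0
      then show ?thesis using lin_hom_closed[OF d(1)[OF i]] by (auto simp: Gs)
    next
      case (Suc j)
      then have j: "j \<le> N" "j < N" "Suc j \<le> N" using i by simp_all
      show ?thesis
        using Suc c0[OF j(1) lin_hom_closed[OF e(5)[OF j(2)]]] lin_hom_closed[OF d(1)[OF i]] by (auto simp: Gs)
    qed
    moreover have "x \<in> carrier (X i) \<and> d i x \<in> ext_ker A E i \<longleftrightarrow> x \<in> c i ` ext_ker A E i" for x
      using d(2,3)[OF i] e(10)[of i] lin_hom_closed[OF ch(1)[OF i]] by (force intro: rev_image_eqI)
    ultimately show ?thesis by blast
  qed
  have GE: "is_extension R (Suc N) A B G"
    unfolding is_extension_Suc
  proof (intro conjI allI impI)
    show "fg_module R (obj G i)" if "i \<le> N" for i using X(1)[OF that] by (simp add: Gs)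
    show "inc G \<in> lin_hom R B (obj G N)" unfolding Gs by (rule lin_hom_comp[OF e(3) ch(1)]) simp
    show "inj_on (inc G) (carrier B)"
    proof (rule inj_onI)
      fix x y assume xy: "x \<in> carrier B" "y \<in> carrier B" "inc G x = inc G y"
      then have "inc E x = inc E y" using inj_onD[OF ch(2)[OF order_refl]] lin_hom_closed[OF e(3)] by (simp add: Gs)
      then show "x = y" by (rule inj_onD[OF e(4) _ xy(1,2)])
    qed
    show "dif G i \<in> lin_hom R (obj G (Suc i)) (obj G i)" if "i < N" for i
      unfolding Gs using that by (intro lin_hom_comp[OF lin_hom_comp[OF d(1) e(5)] ch(1)]) simp_all
    show "prj G \<in> lin_hom R (obj G 0) A" unfolding Gs by (rule lin_hom_comp[OF d(1) e(6)]) simp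
    have "prj G ` carrier (obj G 0) = prj E ` d 0 ` carrier (X 0)" unfolding Gs by (simp add: image_image)
    then show "prj G ` carrier (obj G 0) = carrier A" using d(4)[of 0] e(7) by simp
    show "dif G i ` carrier (obj G (Suc i)) = ext_ker A G i" if i: "i < N" for i
    proof -
      have "dif G i ` carrier (obj G (Suc i)) = c i ` dif E i ` d (Suc i) ` carrier (X (Suc i))"
        unfolding Gs by (simp add: image_image)
      then show ?thesis using d(4)[of "Suc i"] e(8)[OF i] ker[of i] i by simp
    qed
    have "inc G ` carrier B = c N ` inc E ` carrier B" unfolding Gs by (simp add: image_image)
    then show "inc G ` carrier B = ext_ker A G N" using e(9) ker[of N] by simp
  qed
  have h1: "ext_hom R (Suc N) B id id E G c"
    unfolding ext_hom_Suc
  proof (intro conjI allI impI ballI)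
    show "c i \<in> lin_hom R (obj E i) (obj G i)" if "i \<le> N" for i using ch(1)[OF that] by (simp add: Gs)
    show "c i (dif E i x) = dif G i (c (Suc i) x)" if "i < N" "x \<in> carrier (obj E (Suc i))" for i x
      using d(2)[of "Suc i" x] that by (simp add: Gs)
    show "id (prj E x) = prj G (c 0 x)" if "x \<in> carrier (obj E 0)" for x
      using d(2)[of 0 x] that by (simp add: Gs)
  qed (simp add: Gs)
  have h2: "ext_hom R (Suc N) B id id G E d"
    unfolding ext_hom_Suc
  proof (intro conjI allI impI ballI)
    show "d i \<in> lin_hom R (obj G i) (obj E i)" if "i \<le> N" for i using d(1)[OF that] by (simp add: Gs)
    show "d N (inc G b) = inc E (id b)" if "b \<in> carrier B" for b
      using d(2)[of N "inc E b"] lin_hom_closed[OF e(3) that] by (simp add: Gs)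
    show "d i (dif G i x) = dif E i (d (Suc i) x)" if i: "i < N" and x: "x \<in> carrier (obj G (Suc i))" for i x
    proof -
      have "d (Suc i) x \<in> carrier (obj E (Suc i))" using lin_hom_closed[OF d(1)[of "Suc i"]] i x by (simp add: Gs)
      then show ?thesis using d(2)[of i "dif E i (d (Suc i) x)"] lin_hom_closed[OF e(5)[OF i]] i by (simp add: Gs)
    qed
  qed (simp add: Gs)
  show ?thesis
    by (rule that[OF GE h1]) (use c h2 in \<open>simp_all add: Gs d_def[abs_def]\<close>)
qed

section \<open>Direct sums, pushouts and pullbacks of extensions\<close>

lemma dsum_simps [simp]:
  "carrier (dsum X Y) = carrier X \<times> carrier Y" "\<zero>\<^bsub>dsum X Y\<^esub> = (\<zero>\<^bsub>X\<^esub>, \<zero>\<^bsub>Y\<^esub>)"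
  "(x, y) \<oplus>\<^bsub>dsum X Y\<^esub> (x', y') = (x \<oplus>\<^bsub>X\<^esub> x', y \<oplus>\<^bsub>Y\<^esub> y')" "a \<odot>\<^bsub>dsum X Y\<^esub> (x, y) = (a \<odot>\<^bsub>X\<^esub> x, a \<odot>\<^bsub>Y\<^esub> y)"
  by (simp_all add: dsum_def)

lemma dsum_left_module:
  assumes X: "left_module R X" and Y: "left_module R Y"
  shows "left_module R (dsum X Y)"
proof -
  interpret X: abelian_group X by (rule lmod_abelian_group[OF X])
  interpret Y: abelian_group Y by (rule lmod_abelian_group[OF Y])
  have "abelian_group (dsum X Y)"
  proof (rule abelian_groupI)
    fix u assume um: "u \<in> carrier (dsum X Y)"
    obtain x y where u: "u = (x, y)" "x \<in> carrier X" "y \<in> carrier Y"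
      by (rule that[of "fst u" "snd u"]) (use um in \<open>simp_all add: mem_Times_iff\<close>)
    show "\<exists>v \<in> carrier (dsum X Y). v \<oplus>\<^bsub>dsum X Y\<^esub> u = \<zero>\<^bsub>dsum X Y\<^esub>"
      by (rule bexI[of _ "(\<ominus>\<^bsub>X\<^esub> x, \<ominus>\<^bsub>Y\<^esub> y)"]) (simp_all add: u X.l_neg Y.l_neg)
  qed (auto simp: X.a_ac Y.a_ac)
  then show ?thesis
    by (rule left_moduleI[OF left_module_ring[OF X]]) (auto simp: left_moduleD[OF X] left_moduleD[OF Y])
qed

lemma dsum_inl: "left_module R X \<Longrightarrow> left_module R Y \<Longrightarrow> (\<lambda>x. (x, \<zero>\<^bsub>Y\<^esub>)) \<in> lin_hom R X (dsum X Y)"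
  by (rule lin_homI) (simp_all add: lmod_zero lmod_smult_zero abelian_monoid.l_zero[OF abelian_group.axioms(1)[OF lmod_abelian_group]])

lemma dsum_inr: "left_module R X \<Longrightarrow> left_module R Y \<Longrightarrow> (\<lambda>y. (\<zero>\<^bsub>X\<^esub>, y)) \<in> lin_hom R Y (dsum X Y)"
  by (rule lin_homI) (simp_all add: lmod_zero lmod_smult_zero abelian_monoid.l_zero[OF abelian_group.axioms(1)[OF lmod_abelian_group]])

lemma dsum_fst: "fst \<in> lin_hom R (dsum X Y) X" and dsum_snd: "snd \<in> lin_hom R (dsum X Y) Y"
  by (auto intro!: lin_homI)

lemma dsum_fg_module:
  assumes X: "fg_module R X" and Y: "fg_module R Y"
  shows "fg_module R (dsum X Y)"
proof -
  note Xm = fg_moduleD[OF X] and Ym = fg_moduleD[OF Y]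
  note D = dsum_left_module[OF Xm(1) Ym(1)]
  interpret X: abelian_group X by (rule lmod_abelian_group[OF Xm(1)])
  interpret Y: abelian_group Y by (rule lmod_abelian_group[OF Ym(1)])
  obtain A where A: "finite A" "A \<subseteq> carrier X" "carrier X \<subseteq> rspan R X A" using Xm(2) fin_gen_rspan[OF Xm(1)] by auto
  obtain B where B: "finite B" "B \<subseteq> carrier Y" "carrier Y \<subseteq> rspan R Y B" using Ym(2) fin_gen_rspan[OF Ym(1)] by auto
  let ?A = "(\<lambda>x. (x, \<zero>\<^bsub>Y\<^esub>)) ` A" and ?B = "(\<lambda>y. (\<zero>\<^bsub>X\<^esub>, y)) ` B"
  have C: "?A \<union> ?B \<subseteq> carrier (dsum X Y)" using A(2) B(2) by auto
  have "u \<in> rspan R (dsum X Y) (?A \<union> ?B)" if um: "u \<in> carrier (dsum X Y)" for u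
  proof -
    obtain x y where u: "u = (x, y)" "x \<in> carrier X" "y \<in> carrier Y"
      by (rule that[of "fst u" "snd u"]) (use um in \<open>simp_all add: mem_Times_iff\<close>)
    have "(x, \<zero>\<^bsub>Y\<^esub>) \<in> rspan R (dsum X Y) ?A"
      by (rule rspan_image[OF dsum_inl[OF Xm(1) Ym(1)] Xm(1) D A(2)]) (use A(3) u in auto)
    then have 1: "(x, \<zero>\<^bsub>Y\<^esub>) \<in> rspan R (dsum X Y) (?A \<union> ?B)" by (rule rspan_mono) auto
    have "(\<zero>\<^bsub>X\<^esub>, y) \<in> rspan R (dsum X Y) ?B"
      by (rule rspan_image[OF dsum_inr[OF Xm(1) Ym(1)] Ym(1) D B(2)]) (use B(3) u in auto)
    then have 2: "(\<zero>\<^bsub>X\<^esub>, y) \<in> rspan R (dsum X Y) (?A \<union> ?B)" by (rule rspan_mono) auto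
    show ?thesis using rspan_add[OF D C 1 2] u by simp
  qed
  then show ?thesis
    unfolding fg_module_def fin_gen_rspan[OF D] using D A(1) B(1) C by (intro conjI exI[of _ "?A \<union> ?B"]) auto
qed

text \<open>Only the leftmost middle term changes, to the amalgamated sum of B' and that term over
  \<open>B\<close>. The last conclusion is the universal property for morphisms with identity at
  \<open>A\<close>; through it a pushout is joined to every extension that receives a compatible
  morphism.\<close>

lemma pushout_exists:
  fixes R :: "('k, 'r) module" and E :: "('r, 'k univ, 'a, 'b) extension" and B' :: "('r, 'c) module" (structure)
  assumes R: "small_ring R" and E: "is_extension R (Suc N) A B E" and A: "left_module R A" and B: "left_module R B"
    and B': "fg_module R B'" and \<beta>: "\<beta> \<in> lin_hom R B B'"
  obtains F :: "('r, 'k univ, 'a, 'c) extension" where "is_extension R (Suc N) A B' F"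
    "is_pushout R (Suc N) B \<beta> E F"
    "\<forall>E' :: ('r, 'k univ, 'a, 'c) extension. \<forall>g. is_extension R (Suc N) A B' E' \<and> ext_hom R (Suc N) B \<beta> id E E' g \<longrightarrow>
      (\<exists>h. ext_hom R (Suc N) B' id id F E' h)"
proof -
  note e = is_extensionD[OF E]
  note B'm = fg_moduleD(1)[OF B']
  let ?T = "obj E N"
  note Tm = e(2)[OF order_refl]
  interpret B': abelian_group B' by (rule lmod_abelian_group[OF B'm])
  interpret T: abelian_group ?T by (rule lmod_abelian_group[OF Tm])
  let ?D = "dsum B' ?T"
  note Df = dsum_fg_module[OF B' e(1)[OF order_refl]]
  note Dm = fg_moduleD(1)[OF Df]
  interpret D: abelian_group ?D by (rule lmod_abelian_group[OF Dm])
  \<comment> \<open>Dividing by the image of this map identifies the images of inc E b and \<beta>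
    b; the sign is what makes \<open>qinc\<close> come out.\<close>
  let ?u = "\<lambda>b. (\<beta> b, \<ominus>\<^bsub>?T\<^esub> inc E b)"
  have ul: "?u \<in> lin_hom R B ?D"
    by (rule lin_homI) (simp_all add: lin_homD[OF \<beta>] lin_homD[OF e(3)] T.minus_add T.a_ac
        lmod_smult[OF Tm] lmod_neg[OF Tm]
        addhom_neg[OF smult_addhom[OF Tm] T.abelian_group_axioms T.abelian_group_axioms])
  let ?U = "?u ` carrier B"
  have U: "submod R ?D ?U" by (rule image_submod[OF ul B Dm])
  obtain Q :: "('r, 'k univ) module" and q where Q: "left_module R Q" "q \<in> lin_hom R ?D Q"
    "q ` carrier ?D = carrier Q" "\<And>x. x \<in> carrier ?D \<Longrightarrow> q x = \<zero>\<^bsub>Q\<^esub> \<longleftrightarrow> x \<in> ?U"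
    by (rule quotient_copy[OF R fg_moduleD[OF Df] U]) blast
  have Qf: "fg_module R Q" by (rule fg_module_image[OF Df Q(2,3,1)])
  interpret Qg: abelian_group Q by (rule lmod_abelian_group[OF Q(1)])
  note qc = lin_hom_closed[OF Q(2)]
  \<comment> \<open>The universal property of the amalgamated sum \<open>Q\<close>, for targets of
    any type.\<close>
  have out: "\<exists>h. h \<in> lin_hom R Q Y \<and> (\<forall>b x. b \<in> carrier B' \<and> x \<in> carrier ?T \<longrightarrow> h (q (b, x)) = k b \<oplus>\<^bsub>Y\<^esub> l x)"
    if Y: "left_module R Y" and k: "k \<in> lin_hom R B' Y" and l: "l \<in> lin_hom R ?T Y"
      and kl: "\<And>b. b \<in> carrier B \<Longrightarrow> l (inc E b) = k (\<beta> b)" for k l and Y :: "('r, 'y) module"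
  proof -
    interpret Y: abelian_group Y by (rule lmod_abelian_group[OF Y])
    let ?f = "\<lambda>z. k (fst z) \<oplus>\<^bsub>Y\<^esub> l (snd z)"
    have f: "?f \<in> lin_hom R ?D Y" by (rule lin_hom_sum[OF lin_hom_comp[OF dsum_fst k] lin_hom_comp[OF dsum_snd l] Y])
    have "?f z = \<zero>\<^bsub>Y\<^esub>" if z: "z \<in> carrier ?D" "q z = \<zero>\<^bsub>Q\<^esub>" for z
    proof -
      have "z \<in> ?U" using Q(4)[OF z(1)] z(2) by simp
      then obtain b where b: "b \<in> carrier B" "z = ?u b" by blast
      show ?thesis
        using b kl[OF b(1)] lin_hom_neg[OF l Tm Y lin_hom_closed[OF e(3) b(1)]] lin_hom_closed[OF k lin_hom_closed[OF \<beta> b(1)]]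
        by (simp add: Y.r_neg)
    qed
    then obtain h where "h \<in> lin_hom R Q Y" "\<And>z. z \<in> carrier ?D \<Longrightarrow> h (q z) = ?f z"
      using lin_hom_factor_surj[OF Q(2,3) f Dm Q(1) Y] by blast
    then show ?thesis by (intro exI[of _ h]) auto
  qed
  have z: "(\<lambda>_. \<zero>\<^bsub>Y\<^esub>) \<in> lin_hom R B' Y" if "left_module R Y" for Y :: "('r, 'y) module" by (rule lin_hom_zero_map[OF that])
  \<comment> \<open>The map leaving the new term is \<open>prj\<close> if N = 0 and the last
    \<open>dif\<close> otherwise. Each is constructed under its own condition on \<open>N\<close>,
    so that a single record \<open>F\<close> serves both cases.\<close>
  have i0: "\<exists>p. N = 0 \<longrightarrow> p \<in> lin_hom R Q A \<and> (\<forall>b x. b \<in> carrier B' \<and> x \<in> carrier ?T \<longrightarrow> p (q (b, x)) = prj E x)"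
  proof (cases "N = 0")
    case True
    have "\<exists>h. h \<in> lin_hom R Q A \<and> (\<forall>b x. b \<in> carrier B' \<and> x \<in> carrier ?T \<longrightarrow> h (q (b, x)) = \<zero>\<^bsub>A\<^esub> \<oplus>\<^bsub>A\<^esub> prj E x)"
      by (rule out[OF A z[OF A]]) (use e(6) True ext_inc_zero[OF E] in simp_all)
    then obtain h where h: "h \<in> lin_hom R Q A" "\<And>b x. \<lbrakk>b \<in> carrier B'; x \<in> carrier ?T\<rbrakk> \<Longrightarrow> h (q (b, x)) = \<zero>\<^bsub>A\<^esub> \<oplus>\<^bsub>A\<^esub> prj E x"
      by auto
    interpret Ag: abelian_group A by (rule lmod_abelian_group[OF A])
    show ?thesis using h True lin_hom_closed[OF e(6)] by (intro exI[of _ h]) simp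
  qed simp
  then obtain p where p: "N = 0 \<Longrightarrow> p \<in> lin_hom R Q A"
    "\<And>b x. \<lbrakk>N = 0; b \<in> carrier B'; x \<in> carrier ?T\<rbrakk> \<Longrightarrow> p (q (b, x)) = prj E x" by auto
  have "\<exists>d. \<forall>M. N = Suc M \<longrightarrow> d \<in> lin_hom R Q (obj E M) \<and> (\<forall>b x. b \<in> carrier B' \<and> x \<in> carrier ?T \<longrightarrow> d (q (b, x)) = dif E M x)"
  proof (cases N)
    case (Suc M)
    then have M: "M < N" "M \<le> N" by simp_all
    note Mm = e(2)[OF M(2)] and dl = e(5)[OF M(1), folded Suc]
    have "\<exists>h. h \<in> lin_hom R Q (obj E M) \<and> (\<forall>b x. b \<in> carrier B' \<and> x \<in> carrier ?T \<longrightarrow> h (q (b, x)) = \<zero>\<^bsub>obj E M\<^esub> \<oplus>\<^bsub>obj E M\<^esub> dif E M x)"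
      by (rule out[OF Mm z[OF Mm] dl]) (use Suc ext_inc_zero[OF E] in simp)
    then obtain h where h: "h \<in> lin_hom R Q (obj E M)"
      "\<And>b x. \<lbrakk>b \<in> carrier B'; x \<in> carrier ?T\<rbrakk> \<Longrightarrow> h (q (b, x)) = \<zero>\<^bsub>obj E M\<^esub> \<oplus>\<^bsub>obj E M\<^esub> dif E M x" by auto
    interpret Mg: abelian_group "obj E M" by (rule lmod_abelian_group[OF Mm])
    show ?thesis using h Suc lin_hom_closed[OF dl] by (intro exI[of _ h]) simp
  qed simp
  then obtain d where d: "\<And>M. N = Suc M \<Longrightarrow> d \<in> lin_hom R Q (obj E M)"
    "\<And>M b x. \<lbrakk>N = Suc M; b \<in> carrier B'; x \<in> carrier ?T\<rbrakk> \<Longrightarrow> d (q (b, x)) = dif E M x" by auto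
  define F :: "('r, 'k univ, 'a, 'c) extension" where
    "F = \<lparr>obj = (obj E)(N := Q), dif = (\<lambda>i. if Suc i = N then d else dif E i), inc = (\<lambda>b. q (b, \<zero>\<^bsub>?T\<^esub>)),
      prj = (if N = 0 then p else prj E)\<rparr>"
  have Fs: "obj F = (obj E)(N := Q)" "dif F = (\<lambda>i. if Suc i = N then d else dif E i)" "inc F = (\<lambda>b. q (b, \<zero>\<^bsub>?T\<^esub>))"
    "prj F = (if N = 0 then p else prj E)" by (simp_all add: F_def)
  have Qx: "\<exists>b x. y = q (b, x) \<and> b \<in> carrier B' \<and> x \<in> carrier ?T" if yQ: "y \<in> carrier Q" for y
  proof -
    obtain z where "z \<in> carrier ?D" "q z = y" using surj_obtain[OF Q(3) yQ] by blast
    then show ?thesis by (intro exI[of _ "fst z"] exI[of _ "snd z"]) (simp add: mem_Times_iff)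
  qed
  have kerlow: "ext_ker A F i = ext_ker A E i" if "i < N" for i
    using that by (cases i) (auto simp: Fs)
  have kertop: "q (b, x) \<in> ext_ker A F N \<longleftrightarrow> x \<in> ext_ker A E N" if "b \<in> carrier B'" "x \<in> carrier ?T" for b x
    using that qc[of "(b, x)"] p(2) d(2) by (cases N) (auto simp: Fs)
  have qinc: "q (\<zero>, inc E b) = q (\<beta> b, \<zero>\<^bsub>?T\<^esub>)" if b: "b \<in> carrier B" for b
  proof -
    note c = lin_hom_closed[OF \<beta> b] lin_hom_closed[OF e(3) b]
    have "q (?u b) = \<zero>\<^bsub>Q\<^esub>" using Q(4)[OF lin_hom_closed[OF ul b]] b by blast
    moreover have "q (?u b \<oplus>\<^bsub>?D\<^esub> (\<zero>, inc E b)) = q (?u b) \<oplus>\<^bsub>Q\<^esub> q (\<zero>, inc E b)"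
      by (rule lin_hom_add[OF Q(2) lin_hom_closed[OF ul b]]) (simp add: c)
    ultimately show ?thesis using c qc[of "(\<zero>, inc E b)"] by (simp add: T.l_neg)
  qed
  have qsplit: "q (b, x) = q (b, \<zero>\<^bsub>?T\<^esub>) \<oplus>\<^bsub>Q\<^esub> q (\<zero>, x)" if "b \<in> carrier B'" "x \<in> carrier ?T" for b x
    using lin_hom_add[OF Q(2), of "(b, \<zero>\<^bsub>?T\<^esub>)" "(\<zero>, x)"] that by simp
  have inl: "(\<lambda>b. q (b, \<zero>\<^bsub>?T\<^esub>)) \<in> lin_hom R B' Q" by (rule lin_hom_comp[OF dsum_inl[OF B'm Tm] Q(2)])
  have inr: "(\<lambda>x. q (\<zero>, x)) \<in> lin_hom R ?T Q" by (rule lin_hom_comp[OF dsum_inr[OF B'm Tm] Q(2)])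
  have FE: "is_extension R (Suc N) A B' F"
    unfolding is_extension_Suc
  proof (intro conjI allI impI)
    show "fg_module R (obj F i)" if "i \<le> N" for i using e(1)[OF that] Qf by (simp add: Fs)
    show "inc F \<in> lin_hom R B' (obj F N)" using inl by (simp add: Fs)
    show "inj_on (inc F) (carrier B')"
      unfolding Fs lin_hom_inj_iff[OF inl B'm Q(1)]
    proof (intro ballI impI)
      fix b' assume b': "b' \<in> carrier B'" "q (b', \<zero>\<^bsub>?T\<^esub>) = \<zero>\<^bsub>Q\<^esub>"
      then have "(b', \<zero>\<^bsub>?T\<^esub>) \<in> ?U" using Q(4)[of "(b', \<zero>\<^bsub>?T\<^esub>)"] by simp
      then obtain b where b: "b \<in> carrier B" "b' = \<beta> b" "\<zero>\<^bsub>?T\<^esub> = \<ominus>\<^bsub>?T\<^esub> inc E b" by blast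
      have "inc E b = \<ominus>\<^bsub>?T\<^esub> (\<ominus>\<^bsub>?T\<^esub> inc E b)" using lin_hom_closed[OF e(3) b(1)] by simp
      also have "\<dots> = \<zero>\<^bsub>?T\<^esub>" unfolding b(3)[symmetric] by simp
      also have "\<dots> = inc E \<zero>\<^bsub>B\<^esub>" by (rule lin_hom_zero[OF e(3) B Tm, symmetric])
      finally have "b = \<zero>\<^bsub>B\<^esub>" by (rule inj_onD[OF e(4) _ b(1) lmod_zero[OF B]])
      then show "b' = \<zero>" using b(2) lin_hom_zero[OF \<beta> B B'm] by simp
    qed
    show "dif F i \<in> lin_hom R (obj F (Suc i)) (obj F i)" if i: "i < N" for i
      using e(5)[OF i] d(1)[of i] i by (auto simp: Fs)
    show "prj F \<in> lin_hom R (obj F 0) A" using e(6) p(1) by (auto simp: Fs)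
    show "prj F ` carrier (obj F 0) = carrier A"
    proof (cases "N = 0")
      case True
      show ?thesis
      proof (intro subset_antisym subsetI)
        fix a assume "a \<in> prj F ` carrier (obj F 0)"
        then show "a \<in> carrier A" using lin_hom_closed[OF p(1)[OF True]] True by (auto simp: Fs)
      next
        fix a assume "a \<in> carrier A"
        then obtain x where "x \<in> carrier (obj E 0)" "prj E x = a" using surj_obtain[OF e(7)] by blast
        then show "a \<in> prj F ` carrier (obj F 0)"
          using True p(2)[OF True, of "\<zero>" x] qc[of "(\<zero>, x)"]
          by (intro image_eqI[of _ _ "q (\<zero>, x)"]) (simp_all add: Fs)
      qed
    qed (use e(7) in \<open>simp add: Fs\<close>)
    show "dif F i ` carrier (obj F (Suc i)) = ext_ker A F i" if i: "i < N" for i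
    proof (cases "Suc i = N")
      case True
      have "d ` carrier Q = dif E i ` carrier ?T"
      proof (intro subset_antisym subsetI)
        fix y assume "y \<in> d ` carrier Q"
        then obtain b x where "y = d (q (b, x))" "b \<in> carrier B'" "x \<in> carrier ?T" using Qx by blast
        then show "y \<in> dif E i ` carrier ?T" using d(2)[OF True[symmetric]] by auto
      next
        fix y assume "y \<in> dif E i ` carrier ?T"
        then obtain x where x: "x \<in> carrier ?T" "y = dif E i x" by blast
        then show "y \<in> d ` carrier Q"
          using d(2)[OF True[symmetric], of "\<zero>" x] qc[of "(\<zero>, x)"]
          by (intro image_eqI[of _ _ "q (\<zero>, x)"]) simp_all
      qed
      then show ?thesis using e(8)[OF i] kerlow[OF i] True by (simp add: Fs)
    next
      case False
      then show ?thesis using e(8)[OF i] kerlow[OF i] i by (simp add: Fs)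
    qed
    show "inc F ` carrier B' = ext_ker A F N"
    proof (intro subset_antisym subsetI)
      fix y assume "y \<in> inc F ` carrier B'"
      then obtain b where b: "b \<in> carrier B'" "y = q (b, \<zero>\<^bsub>?T\<^esub>)" by (auto simp: Fs)
      have "\<zero>\<^bsub>?T\<^esub> \<in> ext_ker A E N" using ext_ker_submod[OF E A order_refl] by (simp add: submod_def)
      then show "y \<in> ext_ker A F N" using kertop[OF b(1)] b(2) by simp
    next
      fix y assume y: "y \<in> ext_ker A F N"
      then have "y \<in> carrier Q" by (cases N) (simp_all add: Fs)
      then obtain b x where bx: "y = q (b, x)" "b \<in> carrier B'" "x \<in> carrier ?T" using Qx by blast
      then have "x \<in> ext_ker A E N" using kertop y by simp
      then obtain c where c: "c \<in> carrier B" "x = inc E c" unfolding e(9)[symmetric] by blast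
      note \<beta>c = lin_hom_closed[OF \<beta> c(1)]
      have "y = q (b, \<zero>\<^bsub>?T\<^esub>) \<oplus>\<^bsub>Q\<^esub> q (\<beta> c, \<zero>\<^bsub>?T\<^esub>)" using qsplit[OF bx(2,3)] qinc[OF c(1)] bx(1) c(2) by simp
      also have "\<dots> = q (b \<oplus> \<beta> c, \<zero>\<^bsub>?T\<^esub>)" using lin_hom_add[OF inl bx(2) \<beta>c] by simp
      finally show "y \<in> inc F ` carrier B'" using bx(2) \<beta>c by (intro image_eqI[of _ _ "b \<oplus> \<beta> c"]) (simp_all add: Fs)
    qed
  qed
  have po: "is_pushout R (Suc N) B \<beta> E F"
    unfolding is_pushout_def
  proof (intro exI[of _ "\<lambda>i x. if i = N then q (\<zero>, x) else x"] conjI allI impI)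
    show "ext_hom R (Suc N) B \<beta> id E F (\<lambda>i x. if i = N then q (\<zero>, x) else x)"
      unfolding ext_hom_Suc
    proof (intro conjI allI impI ballI)
      show "(\<lambda>x. if i = N then q (\<zero>, x) else x) \<in> lin_hom R (obj E i) (obj F i)" if "i \<le> N" for i
        using inr lin_hom_id[of R "obj E i"] by (cases "i = N") (simp_all add: Fs)
      show "(if N = N then q (\<zero>, inc E b) else inc E b) = inc F (\<beta> b)" if "b \<in> carrier B" for b
        using qinc[OF that] by (simp add: Fs)
      show "(if i = N then q (\<zero>, dif E i x) else dif E i x) = dif F i (if Suc i = N then q (\<zero>, x) else x)"
        if i: "i < N" and x: "x \<in> carrier (obj E (Suc i))" for i x
        using i x d(2)[of i "\<zero>" x] by (auto simp: Fs)
      show "id (prj E x) = prj F (if 0 = N then q (\<zero>, x) else x)" if "x \<in> carrier (obj E 0)" for x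
        using that p(2)[of "\<zero>" x] by (cases "N = 0") (simp_all add: Fs)
    qed
    show "bij_at E F (\<lambda>i x. if i = N then q (\<zero>, x) else x) i" if "i < Suc N - 1" for i
      using that by (simp add: Fs bij_betw_def)
  qed
  show ?thesis
  proof (rule that[OF FE po], intro allI impI)
    fix E' :: "('r, 'k univ, 'a, 'c) extension" and g
    assume "is_extension R (Suc N) A B' E' \<and> ext_hom R (Suc N) B \<beta> id E E' g"
    then have E': "is_extension R (Suc N) A B' E'" and g: "ext_hom R (Suc N) B \<beta> id E E' g" by simp_all
    note e' = is_extensionD[OF E'] and G = ext_homD[OF g]
    note E'm = e'(2)[OF order_refl]
    interpret T': abelian_group "obj E' N" by (rule lmod_abelian_group[OF E'm])
    \<comment> \<open>At the new term the comparison map is induced by \<open>inc\<close> of E' and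
      the given morphism; at the other terms the given morphism already is one.\<close>
    have "\<exists>h. h \<in> lin_hom R Q (obj E' N) \<and>
        (\<forall>b x. b \<in> carrier B' \<and> x \<in> carrier ?T \<longrightarrow> h (q (b, x)) = inc E' b \<oplus>\<^bsub>obj E' N\<^esub> g N x)"
      by (rule out[OF E'm e'(3) G(1)[OF order_refl] G(2)])
    then obtain h where h: "h \<in> lin_hom R Q (obj E' N)"
      "\<And>b x. \<lbrakk>b \<in> carrier B'; x \<in> carrier ?T\<rbrakk> \<Longrightarrow> h (q (b, x)) = inc E' b \<oplus>\<^bsub>obj E' N\<^esub> g N x" by auto
    note gN = lin_hom_closed[OF G(1)[OF order_refl]] and inc' = lin_hom_closed[OF e'(3)]
    have "ext_hom R (Suc N) B' id id F E' (g(N := h))"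
      unfolding ext_hom_Suc
    proof (intro conjI allI impI ballI)
      show "(g(N := h)) i \<in> lin_hom R (obj F i) (obj E' i)" if "i \<le> N" for i
        using h(1) G(1)[OF that] by (simp add: Fs)
      show "(g(N := h)) N (inc F b) = inc E' (id b)" if "b \<in> carrier B'" for b
        using h(2)[OF that, of "\<zero>\<^bsub>?T\<^esub>"] lin_hom_zero[OF G(1)[OF order_refl] Tm E'm] inc'[OF that] by (simp add: Fs)
      show "(g(N := h)) i (dif F i x) = dif E' i ((g(N := h)) (Suc i) x)"
        if i: "i < N" and x: "x \<in> carrier (obj F (Suc i))" for i x
      proof (cases "Suc i = N")
        case True
        then have xQ: "x \<in> carrier Q" using x by (auto simp: Fs)
        obtain b y where bq: "x = q (b, y)" "b \<in> carrier B'" "y \<in> carrier ?T" using Qx[OF xQ] by blast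
        interpret i: abelian_group "obj E' i" using e'(2)[of i] i lmod_abelian_group by auto
        have dE': "dif E' i \<in> lin_hom R (obj E' N) (obj E' i)" using e'(5)[OF i] True by simp
        have "dif E' i (inc E' b) = \<zero>\<^bsub>obj E' i\<^esub>" using ext_inc_zero[OF E' bq(2)] True by auto
        then have "dif E' i (h x) = dif E' i (g N y)"
          using h(2)[OF bq(2,3)] lin_hom_add[OF dE' inc'[OF bq(2)] gN[OF bq(3)]] lin_hom_closed[OF dE' gN[OF bq(3)]] bq(1) by simp
        also have "\<dots> = g i (dif E i y)" using G(3)[OF i, of y] bq(3) True by simp
        also have "dif E i y = d x" using d(2)[OF True[symmetric] bq(2,3)] bq(1) by simp
        finally show ?thesis using i True by (simp add: Fs)
      next
        case False
        then show ?thesis using G(3)[OF i] x i by (simp add: Fs)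
      qed
      show "id (prj F x) = prj E' ((g(N := h)) 0 x)" if x: "x \<in> carrier (obj F 0)" for x
      proof (cases "N = 0")
        case True
        then have xQ: "x \<in> carrier Q" using x by (auto simp: Fs)
        obtain b y where bq: "x = q (b, y)" "b \<in> carrier B'" "y \<in> carrier ?T" using Qx[OF xQ] by blast
        interpret Ag: abelian_group A by (rule lmod_abelian_group[OF A])
        have pE': "prj E' \<in> lin_hom R (obj E' N) A" using e'(6) True by simp
        have "prj E' (inc E' b) = \<zero>\<^bsub>A\<^esub>" using ext_inc_zero[OF E' bq(2)] True by simp
        then have "prj E' (h x) = prj E' (g N y)"
          using h(2)[OF bq(2,3)] lin_hom_add[OF pE' inc'[OF bq(2)] gN[OF bq(3)]] lin_hom_closed[OF pE' gN[OF bq(3)]] bq(1) by simp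
        also have "\<dots> = prj E y" using G(4)[of y] bq(3) True by simp
        finally show ?thesis using p(2)[OF True bq(2,3)] bq(1) True by (simp add: Fs)
      next
        case False
        then show ?thesis using G(4) x by (simp add: Fs)
      qed
    qed
    then show "\<exists>h. ext_hom R (Suc N) B' id id F E' h" by blast
  qed
qed

lemma map_prod_lin_hom:
  "\<lbrakk>f \<in> lin_hom R X X'; g \<in> lin_hom R Y Y'\<rbrakk> \<Longrightarrow> map_prod f g \<in> lin_hom R (dsum X Y) (dsum X' Y')"
  by (rule lin_homI) (auto simp: lin_homD)

lemma map_prod_image: "map_prod f g ` (A \<times> B) = f ` A \<times> g ` B"
  by auto

text \<open>In degree 0 the direct sum is replaced by the fibre product \<open>W\<close> over
  \<open>A\<close>, which is the pullback along the diagonal; the other degrees are unchanged. The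
  result has pairs as elements and is copied into the universe at the end.\<close>

lemma pullback_exists:
  fixes R :: "('k, 'r) module" and E E' :: "('r, 'k univ, 'a, 'b) extension"
  assumes fd: "fd_algebra K R" and E: "is_extension R (Suc N) A B E" and E': "is_extension R (Suc N) A B E'"
    and A: "left_module R A"
  obtains F :: "('r, 'k univ, 'a, 'b \<times> 'b) extension" where "is_extension R (Suc N) A (dsum B B) F"
    "is_pullback R (Suc N) (dsum B B) (\<lambda>a. (a, a)) F (ext_dsum E E')"
proof -
  note e = is_extensionD[OF E] and e' = is_extensionD[OF E']
  let ?D = "\<lambda>i. dsum (obj E i) (obj E' i)"
  define W where "W = {z \<in> carrier (?D 0). prj E (fst z) = prj E' (snd z)}"
  have Df: "fg_module R (?D i)" if "i \<le> N" for i by (rule dsum_fg_module[OF e(1)[OF that] e'(1)[OF that]])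
  interpret A: abelian_group A by (rule lmod_abelian_group[OF A])
  note m0 = e(2)[of 0, simplified] e'(2)[of 0, simplified]
  have W: "submod R (?D 0) W"
    unfolding submod_def
  proof (intro conjI ballI)
    show "\<zero>\<^bsub>?D 0\<^esub> \<in> W"
      using lin_hom_zero[OF e(6) m0(1) A] lin_hom_zero[OF e'(6) m0(2) A] by (simp add: W_def lmod_zero[OF m0(1)] lmod_zero[OF m0(2)])
    fix x assume x: "x \<in> W"
    show "x \<oplus>\<^bsub>?D 0\<^esub> y \<in> W" if y: "y \<in> W" for y
      using x y by (cases x, cases y)
        (simp add: W_def lmod_add[OF m0(1)] lmod_add[OF m0(2)] lin_hom_add[OF e(6)] lin_hom_add[OF e'(6)])
    show "a \<odot>\<^bsub>?D 0\<^esub> x \<in> W" if a: "a \<in> carrier R" for a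
      using x a by (cases x)
        (simp add: W_def lmod_smult[OF m0(1)] lmod_smult[OF m0(2)] lin_hom_smult[OF e(6)] lin_hom_smult[OF e'(6)])
  qed (simp add: W_def)
  define F :: "('r, 'k univ \<times> 'k univ, 'a, 'b \<times> 'b) extension" where
    "F = \<lparr>obj = (\<lambda>i. if i = 0 then ?D 0\<lparr>carrier := W\<rparr> else ?D i), dif = (\<lambda>i. map_prod (dif E i) (dif E' i)),
      inc = map_prod (inc E) (inc E'), prj = (\<lambda>z. prj E (fst z))\<rparr>"
  have Fs: "obj F = (\<lambda>i. if i = 0 then ?D 0\<lparr>carrier := W\<rparr> else ?D i)" "dif F = (\<lambda>i. map_prod (dif E i) (dif E' i))"
    "inc F = map_prod (inc E) (inc E')" "prj F = (\<lambda>z. prj E (fst z))" by (simp_all add: F_def)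
  have ker: "ext_ker A F i = ext_ker A E i \<times> ext_ker A E' i" for i
    by (cases i) (auto simp: Fs W_def)
  \<comment> \<open>The map that ends in degree 0, whether \<open>inc\<close> or \<open>dif\<close>,
    has its values in the kernels of both projections, hence in \<open>W\<close>.\<close>
  have kW: "ext_ker A E 0 \<times> ext_ker A E' 0 \<subseteq> W" by (auto simp: W_def)
  have into: "f \<in> lin_hom R X (obj F i)"
    if f: "f \<in> lin_hom R X (?D i)" and v: "\<And>x. x \<in> carrier X \<Longrightarrow> f x \<in> ext_ker A E i \<times> ext_ker A E' i"
    for f i and X :: "('r, 'x) module"
  proof (cases "i = 0")
    case True
    have "f x \<in> W" if "x \<in> carrier X" for x using v[OF that] kW True by auto
    then show ?thesis using lin_hom_restrict_codomain[of f R X "?D 0" W] f True by (simp add: Fs)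
  qed (use f in \<open>simp add: Fs\<close>)
  have FE: "is_extension R (Suc N) A (dsum B B) F"
    unfolding is_extension_Suc
  proof (intro conjI allI impI)
    show "fg_module R (obj F i)" if "i \<le> N" for i
      using Df[OF that] fd_algebra.fg_module_submod[OF fd Df[of 0] W] by (simp add: Fs)
    show "inc F \<in> lin_hom R (dsum B B) (obj F N)"
      by (rule into) (use map_prod_lin_hom[OF e(3) e'(3)] ext_inc_zero[OF E] ext_inc_zero[OF E'] in \<open>auto simp: Fs\<close>)
    show "inj_on (inc F) (carrier (dsum B B))" using map_prod_inj_on[OF e(4) e'(4)] by (simp add: Fs)
    show "dif F i \<in> lin_hom R (obj F (Suc i)) (obj F i)" if i: "i < N" for i
    proof (rule into)
      show "dif F i \<in> lin_hom R (obj F (Suc i)) (?D i)" using map_prod_lin_hom[OF e(5)[OF i] e'(5)[OF i]] by (simp add: Fs)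
      show "dif F i x \<in> ext_ker A E i \<times> ext_ker A E' i" if "x \<in> carrier (obj F (Suc i))" for x
        using that ext_dif_zero[OF E i] ext_dif_zero[OF E' i] by (auto simp: Fs)
    qed
    have pf: "(\<lambda>z. prj E (fst z)) \<in> lin_hom R (?D 0) A" by (rule lin_hom_comp[OF dsum_fst e(6)])
    show "prj F \<in> lin_hom R (obj F 0) A"
      using lin_hom_restrict_domain[OF pf, of W] W by (simp add: Fs submod_def)
    show "prj F ` carrier (obj F 0) = carrier A"
    proof (intro subset_antisym subsetI)
      fix a assume "a \<in> prj F ` carrier (obj F 0)"
      then obtain z where "z \<in> W" "a = prj E (fst z)" by (auto simp: Fs)
      then show "a \<in> carrier A" using lin_hom_closed[OF e(6), of "fst z"] by (simp add: W_def mem_Times_iff)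
    next
      fix a assume a: "a \<in> carrier A"
      obtain x where x: "x \<in> carrier (obj E 0)" "prj E x = a" using surj_obtain[OF e(7) a] by blast
      obtain y where y: "y \<in> carrier (obj E' 0)" "prj E' y = a" using surj_obtain[OF e'(7) a] by blast
      show "a \<in> prj F ` carrier (obj F 0)" using x y by (intro image_eqI[of _ _ "(x, y)"]) (simp_all add: Fs W_def)
    qed
    show "dif F i ` carrier (obj F (Suc i)) = ext_ker A F i" if i: "i < N" for i
      using e(8)[OF i] e'(8)[OF i] by (simp add: Fs ker map_prod_image)
    show "inc F ` carrier (dsum B B) = ext_ker A F N" using e(9) e'(9) by (simp add: Fs(3) ker map_prod_image)
  qed
  obtain G :: "('r, 'k univ, 'a, 'b \<times> 'b) extension" and c where G: "is_extension R (Suc N) A (dsum B B) G"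
    "\<And>i. i \<le> N \<Longrightarrow> c i \<in> lin_iso R (obj F i) (obj G i)"
    "ext_hom R (Suc N) (dsum B B) id id G F (\<lambda>i. inv_into (carrier (obj F i)) (c i))"
    by (rule ext_copy[OF fd_algebra_small_ring[OF fd] FE A]) blast
  let ?d = "\<lambda>i. inv_into (carrier (obj F i)) (c i)"
  note d = ext_homD[OF G(3)]
  have Es: "obj (ext_dsum E E') = ?D" "dif (ext_dsum E E') = dif F" "inc (ext_dsum E E') = inc F"
    "prj (ext_dsum E E') = map_prod (prj E) (prj E')" by (simp_all add: ext_dsum_def Fs)
  have "is_pullback R (Suc N) (dsum B B) (\<lambda>a. (a, a)) G (ext_dsum E E')"
    unfolding is_pullback_def
  proof (intro exI[of _ ?d] conjI allI impI)
    show "ext_hom R (Suc N) (dsum B B) id (\<lambda>a. (a, a)) G (ext_dsum E E') ?d"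
      unfolding ext_hom_Suc
    proof (intro conjI allI impI ballI)
      show "?d i \<in> lin_hom R (obj G i) (obj (ext_dsum E E') i)" if i: "i \<le> N" for i
        using d(1)[OF i] W lin_hom_extend_codomain[of "?d 0" R "obj G 0" W "?D 0"]
        by (cases "i = 0") (simp_all add: Es Fs submod_def)
      show "?d N (inc G b) = inc (ext_dsum E E') (id b)" if "b \<in> carrier (dsum B B)" for b
        using d(2)[OF that] by (simp add: Es)
      show "?d i (dif G i x) = dif (ext_dsum E E') i (?d (Suc i) x)" if "i < N" "x \<in> carrier (obj G (Suc i))" for i x
        using d(3)[OF that] by (simp add: Es)
      show "(prj G x, prj G x) = prj (ext_dsum E E') (?d 0 x)" if x: "x \<in> carrier (obj G 0)" for x
      proof -
        have "?d 0 x \<in> W" using lin_hom_closed[OF d(1)[OF le0] x] by (simp add: Fs)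
        then show ?thesis using d(4)[OF x] by (cases "?d 0 x") (simp add: Es Fs W_def)
      qed
    qed
    show "bij_at G (ext_dsum E E') ?d i" if i: "i < Suc N" "0 < i" for i
      using bij_betw_inv_into[OF lin_isoD(4)[OF G(2)[of i]]] i by (simp add: Es Fs)
  qed
  then show ?thesis using that G(1) by blast
qed

section \<open>Cocycles on the last syzygy of a projective resolution\<close>

lemma (in fd_algebra) scalar_lin_hom:
  assumes "c \<in> carrier K" and X: "left_module L X"
  shows "(\<lambda>x. (c \<odot>\<^bsub>L\<^esub> \<one>\<^bsub>L\<^esub>) \<odot>\<^bsub>X\<^esub> x) \<in> lin_hom L X X"
  by (rule lin_homI) (simp_all add: left_moduleD[OF X] scalar_closed scalar_mult mult_scalar assms(1) flip: lmod_assoc[OF X])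

text \<open>A resolution truncated after \<open>N\<close>, viewed as an extension of
  \<open>A\<close> by its syzygy \<open>Z\<close>, so that the comparison with other extensions is a
  matter of \<open>ext_hom\<close>. The type of \<open>Z\<close> is left free because the tensored
  resolution, with end N \<otimes> Z, has to be an instance as well.\<close>

locale resolution =
  fixes K :: "('k, 'c) ring_scheme" and R :: "('k, 'r) module" and A :: "('r, 'a) module" and Z :: "('r, 'x) module"
    and P :: "('r, 'k univ, 'a, 'x) extension" and N :: nat
  assumes fd: "fd_algebra K R" and A: "fg_module R A" and Z: "fg_module R Z"
    and P: "is_extension R (Suc N) A Z P" and proj: "i \<le> N \<Longrightarrow> fgproj R (obj P i)"
begin

lemma small: "small_ring R" by (rule fd_algebra_small_ring[OF fd])
lemma Am: "left_module R A" by (rule fg_moduleD(1)[OF A])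
lemma Zm: "left_module R Z" by (rule fg_moduleD(1)[OF Z])

lemmas p = is_extensionD[OF P]

text \<open>The classical comparison between cocycles and extensions, kept as a relation: an
  extension determines its cocycle only up to coboundaries.\<close>

definition represents :: "('r, 'u, 'a, 'b) extension \<Rightarrow> ('x \<Rightarrow> 'b) \<Rightarrow> bool" where
  "represents E \<phi> \<longleftrightarrow> (\<exists>g. ext_hom R (Suc N) Z \<phi> id P E g)"

definition cocycle_class :: "('r, 'b) module \<Rightarrow> ('x \<Rightarrow> 'b) \<Rightarrow> ('r, 'k univ, 'a, 'b) extension set" where
  "cocycle_class B \<phi> = {E \<in> exts R (Suc N) A B. represents E \<phi>}"

text \<open>The image of Hom(P_N, B) in Hom(Z, B), i.e. the maps that are zero in Ext.\<close>

definition coboundary :: "('r, 'b) module \<Rightarrow> ('x \<Rightarrow> 'b) \<Rightarrow> bool" where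
  "coboundary B \<phi> \<longleftrightarrow> (\<exists>h \<in> lin_hom R (obj P N) B. \<forall>z \<in> carrier Z. h (inc P z) = \<phi> z)"

lemma representsI:
  assumes "ext_hom R (Suc N) Z \<phi>' \<alpha> P E g" "\<And>z. z \<in> carrier Z \<Longrightarrow> \<phi>' z = \<phi> z" "\<And>a. a \<in> carrier A \<Longrightarrow> \<alpha> a = a"
  shows "represents E \<phi>"
  using assms lin_hom_closed[OF p(6)] unfolding represents_def ext_hom_Suc by (intro exI[of _ g]) simp

lemma represents_comp:
  assumes "represents E \<phi>" "ext_hom R (Suc N) B \<beta> \<alpha> E E' g" "\<phi> \<in> lin_hom R Z B"
    "\<And>a. a \<in> carrier A \<Longrightarrow> \<alpha> a = a"
  shows "represents E' (\<lambda>z. \<beta> (\<phi> z))"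
proof -
  obtain f where f: "ext_hom R (Suc N) Z \<phi> id P E f" using assms(1) by (auto simp: represents_def)
  show ?thesis
    by (rule representsI[OF ext_hom_comp[OF f assms(2) lin_hom_closed[OF assms(3)]]]) (simp_all add: assms(4))
qed

text \<open>The comparison theorem: the resolution maps to any exact sequence over the identity of
  \<open>A\<close>, one degree after the other, and the map obtained restricts to the left
  ends.\<close>

lemma represents_exists:
  fixes E :: "('r, 'u, 'a, 'b) extension"
  assumes E: "is_extension R (Suc N) A B E" and B: "left_module R B"
  obtains \<phi> where "\<phi> \<in> lin_hom R Z B" "represents E \<phi>"
proof -
  note e = is_extensionD[OF E]
  \<comment> \<open>\<open>C m g\<close> says that \<open>g\<close> is a chain map over the identity
    of \<open>A\<close> in the degrees below \<open>m\<close>. For m = N + 1 it covers every middle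
    term.\<close>
  define C where "C m g \<longleftrightarrow> (\<forall>i < m. g i \<in> lin_hom R (obj P i) (obj E i)) \<and>
      (0 < m \<longrightarrow> (\<forall>x \<in> carrier (obj P 0). prj P x = prj E (g 0 x))) \<and>
      (\<forall>i. Suc i < m \<longrightarrow> (\<forall>x \<in> carrier (obj P (Suc i)). g i (dif P i x) = dif E i (g (Suc i) x)))" for m g
  have ker: "g j y \<in> ext_ker A E j" if Cg: "C m g" "j < m" "m \<le> Suc N" and y: "y \<in> ext_ker A P j" for g m j y
  proof -
    note g = Cg[unfolded C_def]
    have j: "j \<le> N" using g by simp
    have yc: "y \<in> carrier (obj P j)" using p(10) y by auto
    have gc: "g j y \<in> carrier (obj E j)" using g lin_hom_closed[OF _ yc] by blast
    show ?thesis
    proof (cases j)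
      case 0
      then have "prj E (g 0 y) = prj P y" using g(1) g(2) yc by simp
      then show ?thesis using y gc 0 by simp
    next
      case (Suc i)
      then have i: "i \<le> N" "Suc i < m" using j g(2) by simp_all
      have gi: "g i \<in> lin_hom R (obj P i) (obj E i)" using g(1) i(2) by simp
      have "dif E i (g (Suc i) y) = g i (dif P i y)" using g(1) i(2) yc Suc by simp
      also have "\<dots> = \<zero>\<^bsub>obj E i\<^esub>" using y Suc lin_hom_zero[OF gi p(2)[OF i(1)] e(2)[OF i(1)]] by simp
      finally show ?thesis using gc Suc by simp
    qed
  qed
  have "\<exists>g. C m g" if "m \<le> Suc N" for m
    using that
  proof (induction m)
    case (Suc m)
    then obtain g where Cg: "C m g" by auto
    note g = Cg[unfolded C_def]
    have mN: "m \<le> N" using Suc.prems by simp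
    note Pm = p(2)[OF mN] and Em = e(2)[OF mN]
    show ?case
    proof (cases m)
      case 0
      obtain h where h: "h \<in> lin_hom R (obj P 0) (obj E 0)" "\<And>x. x \<in> carrier (obj P 0) \<Longrightarrow> prj E (h x) = prj P x"
        using fgproj_lift[OF proj[OF le0] p(2)[OF le0] p(6) e(6,7) e(2)[OF le0] Am] by blast
      then show ?thesis using 0 by (intro exI[of _ "\<lambda>_. h"]) (simp add: C_def)
    next
      case (Suc j)
      then have j: "j \<le> N" "j < N" "j < m" using mN by simp_all
      have gj: "g j \<in> lin_hom R (obj P j) (obj E j)" using g j(3) by simp
      let ?Y = "obj E j\<lparr>carrier := ext_ker A E j\<rparr>"
      have sY: "submod R (obj E j) (ext_ker A E j)" by (rule ext_ker_submod[OF E Am j(1)])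
      note Ym = submod_left_module[OF sY e(2)[OF j(1)]]
      have f: "(\<lambda>x. g j (dif P j x)) \<in> lin_hom R (obj P m) ?Y"
      proof (rule lin_hom_restrict_codomain)
        show "(\<lambda>x. g j (dif P j x)) \<in> lin_hom R (obj P m) (obj E j)" unfolding Suc by (rule lin_hom_comp[OF p(5)[OF j(2)] gj])
        fix y assume "y \<in> carrier (obj P m)"
        then have dy: "dif P j y \<in> ext_ker A P j" using ext_dif_zero[OF P j(2)] Suc by simp
        have "m \<le> Suc N" using mN by simp
        then show "g j (dif P j y) \<in> ext_ker A E j" by (rule ker[OF Cg j(3) _ dy])
      qed
      have de: "dif E j \<in> lin_hom R (obj E m) ?Y" unfolding Suc
        by (rule lin_hom_restrict_codomain[OF e(5)[OF j(2)] ext_dif_zero[OF E j(2)]])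
      have ds: "dif E j ` carrier (obj E m) = carrier ?Y" using e(8)[OF j(2)] Suc by simp
      obtain h where h: "h \<in> lin_hom R (obj P m) (obj E m)" "\<And>x. x \<in> carrier (obj P m) \<Longrightarrow> dif E j (h x) = g j (dif P j x)"
        using fgproj_lift[OF proj[OF mN] Pm f de ds Em Ym] by blast
      have g1: "g i \<in> lin_hom R (obj P i) (obj E i)" if "i < m" for i using g that by simp
      have g2: "prj P x = prj E (g 0 x)" if "x \<in> carrier (obj P 0)" for x using g that j(3) by simp
      have g3: "g i (dif P i x) = dif E i (g (Suc i) x)" if "Suc i < m" "x \<in> carrier (obj P (Suc i))" for i x
        using g that by simp
      have "C (Suc m) (g(m := h))"
        unfolding C_def
      proof (intro conjI allI impI ballI)
        show "(g(m := h)) i \<in> lin_hom R (obj P i) (obj E i)" if "i < Suc m" for i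
          using g1[of i] h(1) that by (cases "i = m") simp_all
        show "prj P x = prj E ((g(m := h)) 0 x)" if "x \<in> carrier (obj P 0)" for x
          using g2[OF that] Suc by simp
        show "(g(m := h)) i (dif P i x) = dif E i ((g(m := h)) (Suc i) x)"
          if "Suc i < Suc m" "x \<in> carrier (obj P (Suc i))" for i x
          using g3[of i x] h(2)[of x] that Suc by (cases "i = j") simp_all
      qed
      then show ?thesis by (rule exI[of "C (Suc m)"])
    qed
  qed (rule exI[of "C 0" undefined], simp add: C_def)
  then obtain g where Cg: "C (Suc N) g" by blast
  note g = Cg[unfolded C_def]
  have gN: "g N \<in> lin_hom R (obj P N) (obj E N)" using g by simp
  have "(\<lambda>z. g N (inc P z)) z \<in> inc E ` carrier B" if "z \<in> carrier Z" for z
    unfolding e(9) by (rule ker[OF Cg _ _ ext_inc_zero[OF P that]]) simp_all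
  then obtain \<phi> where \<phi>: "\<phi> \<in> lin_hom R Z B" "\<And>z. z \<in> carrier Z \<Longrightarrow> inc E (\<phi> z) = g N (inc P z)"
    using lin_hom_factor_inj[OF e(3,4) lin_hom_comp[OF p(3) gN] B] by blast
  have "ext_hom R (Suc N) Z \<phi> id P E g"
    unfolding ext_hom_Suc using g \<phi>(2) by (simp add: less_Suc_eq_le Suc_le_eq)
  then show ?thesis using that[OF \<phi>(1)] by (auto simp: represents_def)
qed

text \<open>Two comparison maps are homotopic. In the top degree, the difference corrected by the
  homotopy has its values in the image of \<open>B\<close>, and on \<open>Z\<close> it is the
  difference of the two cocycles.\<close>

lemma represents_unique:
  fixes E :: "('r, 'u, 'a, 'b) extension"
  assumes E: "is_extension R (Suc N) A B E" and B: "left_module R B"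
    and r: "represents E \<phi>" "represents E \<phi>'" and h: "\<phi> \<in> lin_hom R Z B" "\<phi>' \<in> lin_hom R Z B"
  shows "coboundary B (\<lambda>z. \<phi> z \<ominus>\<^bsub>B\<^esub> \<phi>' z)"
proof -
  note e = is_extensionD[OF E]
  obtain g g' where "ext_hom R (Suc N) Z \<phi> id P E g" "ext_hom R (Suc N) Z \<phi>' id P E g'"
    using r by (auto simp: represents_def)
  note G = ext_homD[OF this(1)] and G' = ext_homD[OF this(2)]
  \<comment> \<open>\<open>t\<close> is g i - g' i minus the homotopy of the previous degree
    composed with the differential. It takes values in the kernel, so it lifts to the homotopy of
    the next degree; on the kernel of P the correction vanishes.\<close>
  have "\<exists>t \<in> lin_hom R (obj P i) (obj E i). (\<forall>x \<in> carrier (obj P i). t x \<in> ext_ker A E i) \<and>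
      (\<forall>x \<in> ext_ker A P i. t x = g i x \<ominus>\<^bsub>obj E i\<^esub> g' i x)" if "i \<le> N" for i
    using that
  proof (induction i)
    case 0
    interpret A: abelian_group A by (rule lmod_abelian_group[OF Am])
    note d = lin_hom_minus[OF G(1)[OF 0] G'(1)[OF 0] e(2)[OF 0]]
    show ?case
    proof (intro bexI[OF _ d] conjI ballI)
      fix x assume x: "x \<in> carrier (obj P 0)"
      have "prj E (g 0 x \<ominus>\<^bsub>obj E 0\<^esub> g' 0 x) = prj E (g 0 x) \<ominus>\<^bsub>A\<^esub> prj E (g' 0 x)"
        by (rule lin_hom_diff[OF e(6) e(2)[OF 0] Am lin_hom_closed[OF G(1)[OF 0] x] lin_hom_closed[OF G'(1)[OF 0] x]])
      also have "\<dots> = \<zero>\<^bsub>A\<^esub>" using G(4)[OF x] G'(4)[OF x] lin_hom_closed[OF p(6) x] by simp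
      finally show "g 0 x \<ominus>\<^bsub>obj E 0\<^esub> g' 0 x \<in> ext_ker A E 0" using lin_hom_closed[OF d x] by simp
    qed simp
  next
    case (Suc i)
    then have i: "i \<le> N" "i < N" by simp_all
    obtain t where t: "t \<in> lin_hom R (obj P i) (obj E i)" "\<And>x. x \<in> carrier (obj P i) \<Longrightarrow> t x \<in> ext_ker A E i"
      "\<And>x. x \<in> ext_ker A P i \<Longrightarrow> t x = g i x \<ominus>\<^bsub>obj E i\<^esub> g' i x" using Suc.IH[OF i(1)] by auto
    let ?Y = "obj E i\<lparr>carrier := ext_ker A E i\<rparr>"
    have sY: "submod R (obj E i) (ext_ker A E i)" by (rule ext_ker_submod[OF E Am i(1)])
    note Ym = submod_left_module[OF sY e(2)[OF i(1)]]
    note tY = lin_hom_restrict_codomain[OF t(1,2)]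
    note dY = lin_hom_restrict_codomain[OF e(5)[OF i(2)] ext_dif_zero[OF E i(2)]]
    have ds: "dif E i ` carrier (obj E (Suc i)) = carrier ?Y" using e(8)[OF i(2)] by simp
    obtain s where s: "s \<in> lin_hom R (obj P i) (obj E (Suc i))" "\<And>x. x \<in> carrier (obj P i) \<Longrightarrow> dif E i (s x) = t x"
      using fgproj_lift[OF proj[OF i(1)] p(2)[OF i(1)] tY dY ds e(2)[OF Suc.prems] Ym] by blast
    note Es = e(2)[OF Suc.prems] and Ei = e(2)[OF i(1)]
    interpret Es: abelian_group "obj E (Suc i)" by (rule lmod_abelian_group[OF Es])
    interpret Ei: abelian_group "obj E i" by (rule lmod_abelian_group[OF Ei])
    note sd = lin_hom_comp[OF p(5)[OF i(2)] s(1)]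
    note gg = lin_hom_minus[OF G(1)[OF Suc.prems] G'(1)[OF Suc.prems] Es]
    note d = lin_hom_minus[OF gg sd Es]
    show ?case
    proof (intro bexI[OF _ d] conjI ballI)
      fix x assume x: "x \<in> carrier (obj P (Suc i))"
      note c = lin_hom_closed[OF G(1)[OF Suc.prems] x] lin_hom_closed[OF G'(1)[OF Suc.prems] x]
      note dx = ext_dif_zero[OF P i(2) x]
      have dxc: "dif P i x \<in> carrier (obj P i)" using dx p(10) by auto
      have "dif E i (g (Suc i) x \<ominus>\<^bsub>obj E (Suc i)\<^esub> g' (Suc i) x \<ominus>\<^bsub>obj E (Suc i)\<^esub> s (dif P i x)) =
          dif E i (g (Suc i) x \<ominus>\<^bsub>obj E (Suc i)\<^esub> g' (Suc i) x) \<ominus>\<^bsub>obj E i\<^esub> dif E i (s (dif P i x))"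
        by (rule lin_hom_diff[OF e(5)[OF i(2)] Es Ei lin_hom_closed[OF gg x] lin_hom_closed[OF sd x]])
      also have "\<dots> = (g i (dif P i x) \<ominus>\<^bsub>obj E i\<^esub> g' i (dif P i x)) \<ominus>\<^bsub>obj E i\<^esub> t (dif P i x)"
        unfolding lin_hom_diff[OF e(5)[OF i(2)] Es Ei c] s(2)[OF dxc] G(3)[OF i(2) x] G'(3)[OF i(2) x] ..
      also have "\<dots> = \<zero>\<^bsub>obj E i\<^esub>"
        unfolding t(3)[OF dx] using lin_hom_closed[OF G(1)[OF i(1)] dxc] lin_hom_closed[OF G'(1)[OF i(1)] dxc] by simp
      finally show "g (Suc i) x \<ominus>\<^bsub>obj E (Suc i)\<^esub> g' (Suc i) x \<ominus>\<^bsub>obj E (Suc i)\<^esub> s (dif P i x) \<in> ext_ker A E (Suc i)"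
        using lin_hom_closed[OF d x] by simp
    next
      fix x assume x: "x \<in> ext_ker A P (Suc i)"
      then have xc: "x \<in> carrier (obj P (Suc i))" by simp
      have "s (dif P i x) = \<zero>\<^bsub>obj E (Suc i)\<^esub>" using x lin_hom_zero[OF s(1) p(2)[OF i(1)] Es] by simp
      then show "g (Suc i) x \<ominus>\<^bsub>obj E (Suc i)\<^esub> g' (Suc i) x \<ominus>\<^bsub>obj E (Suc i)\<^esub> s (dif P i x) =
          g (Suc i) x \<ominus>\<^bsub>obj E (Suc i)\<^esub> g' (Suc i) x"
        using lin_hom_closed[OF gg xc] by simp
    qed
  qed
  from this[OF order_refl] obtain t where t: "t \<in> lin_hom R (obj P N) (obj E N)"
    "\<And>x. x \<in> carrier (obj P N) \<Longrightarrow> t x \<in> inc E ` carrier B"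
    "\<And>x. x \<in> ext_ker A P N \<Longrightarrow> t x = g N x \<ominus>\<^bsub>obj E N\<^esub> g' N x" unfolding e(9) by auto
  obtain k where k: "k \<in> lin_hom R (obj P N) B" "\<And>x. x \<in> carrier (obj P N) \<Longrightarrow> inc E (k x) = t x"
    using lin_hom_factor_inj[OF e(3,4) t(1) B t(2)] by blast
  show ?thesis
    unfolding coboundary_def
  proof (intro bexI[OF _ k(1)] ballI)
    fix z assume z: "z \<in> carrier Z"
    note c = lin_hom_closed[OF h(1) z] lin_hom_closed[OF h(2) z] lin_hom_closed[OF p(3) z]
    have "inc E (k (inc P z)) = inc E (\<phi> z \<ominus>\<^bsub>B\<^esub> \<phi>' z)"
      unfolding k(2)[OF c(3)] t(3)[OF ext_inc_zero[OF P z]] G(2)[OF z] G'(2)[OF z]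
      by (rule lin_hom_diff[OF e(3) B e(2)[OF order_refl] c(1,2), symmetric])
    then show "k (inc P z) = \<phi> z \<ominus>\<^bsub>B\<^esub> \<phi>' z"
      by (rule inj_onD[OF e(4) _ lin_hom_closed[OF k(1) c(3)] lmod_diff[OF B c(1,2)]])
  qed
qed

text \<open>If the difference of the cocycles extends to \<open>k\<close> on the last projective,
  then adding inc E composed with \<open>k\<close> to the comparison map in the top degree changes
  its restriction as wanted; the other squares still commute because the map after
  \<open>inc\<close> kills the added term.\<close>

lemma represents_coboundary:
  fixes B (structure) and E :: "('r, 'u, 'a, 'b) extension"
  assumes E: "is_extension R (Suc N) A B E" and B: "left_module R B"
    and r: "represents E \<phi>" and h: "\<phi> \<in> lin_hom R Z B" "\<phi>' \<in> lin_hom R Z B"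
    and c: "coboundary B (\<lambda>z. \<phi>' z \<ominus> \<phi> z)"
  shows "represents E \<phi>'"
proof -
  note e = is_extensionD[OF E]
  obtain g where "ext_hom R (Suc N) Z \<phi> id P E g" using r by (auto simp: represents_def)
  note G = ext_homD[OF this]
  obtain k where k: "k \<in> lin_hom R (obj P N) B" "\<And>z. z \<in> carrier Z \<Longrightarrow> k (inc P z) = \<phi>' z \<ominus> \<phi> z"
    using c by (auto simp: coboundary_def)
  interpret B: abelian_group B by (rule lmod_abelian_group[OF B])
  note EN = e(2)[OF order_refl]
  interpret EN: abelian_group "obj E N" by (rule lmod_abelian_group[OF EN])
  let ?t = "\<lambda>x. g N x \<oplus>\<^bsub>obj E N\<^esub> inc E (k x)"
  note kl = lin_hom_comp[OF k(1) e(3)] and gN = G(1)[OF order_refl]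
  have "ext_hom R (Suc N) Z \<phi>' id P E (g(N := ?t))"
    unfolding ext_hom_Suc
  proof (intro conjI allI impI ballI)
    show "(g(N := ?t)) i \<in> lin_hom R (obj P i) (obj E i)" if "i \<le> N" for i
      using G(1)[OF that] lin_hom_sum[OF gN kl EN] by simp
    show "(g(N := ?t)) N (inc P z) = inc E (\<phi>' z)" if z: "z \<in> carrier Z" for z
    proof -
      note cl = lin_hom_closed[OF h(1) z] lin_hom_closed[OF h(2) z]
      have "inc E (\<phi> z) \<oplus>\<^bsub>obj E N\<^esub> inc E (\<phi>' z \<ominus> \<phi> z) = inc E (\<phi> z \<oplus> (\<phi>' z \<ominus> \<phi> z))"
        by (rule lin_hom_add[OF e(3), symmetric]) (simp_all add: cl)
      then show ?thesis using G(2)[OF z] k(2)[OF z] cl by (simp add: B.add_diff_cancel')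
    qed
    show "(g(N := ?t)) i (dif P i x) = dif E i ((g(N := ?t)) (Suc i) x)"
      if i: "i < N" and x: "x \<in> carrier (obj P (Suc i))" for i x
    proof (cases "Suc i = N")
      case True
      interpret Ei: abelian_group "obj E i" using e(2)[of i] i lmod_abelian_group by auto
      have dE: "dif E i \<in> lin_hom R (obj E N) (obj E i)" using e(5)[OF i] True by simp
      have x': "x \<in> carrier (obj P N)" using x True by simp
      have "dif E i (inc E (k x)) = \<zero>\<^bsub>obj E i\<^esub>" using ext_inc_zero[OF E lin_hom_closed[OF k(1) x']] True by auto
      then have "dif E i (?t x) = dif E i (g N x)"
        using lin_hom_add[OF dE lin_hom_closed[OF gN x'] lin_hom_closed[OF kl x']] lin_hom_closed[OF dE lin_hom_closed[OF gN x']] by simp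
      then show ?thesis using G(3)[OF i x] i True by simp
    next
      case False
      then show ?thesis using G(3)[OF i x] i by simp
    qed
    show "id (prj P x) = prj E ((g(N := ?t)) 0 x)" if x: "x \<in> carrier (obj P 0)" for x
    proof (cases "N = 0")
      case True
      interpret A: abelian_group A by (rule lmod_abelian_group[OF Am])
      have pE: "prj E \<in> lin_hom R (obj E N) A" using e(6) True by simp
      have x': "x \<in> carrier (obj P N)" using x True by simp
      have "prj E (inc E (k x)) = \<zero>\<^bsub>A\<^esub>" using ext_inc_zero[OF E lin_hom_closed[OF k(1) x']] True by simp
      then have "prj E (?t x) = prj E (g N x)"
        using lin_hom_add[OF pE lin_hom_closed[OF gN x'] lin_hom_closed[OF kl x']] lin_hom_closed[OF pE lin_hom_closed[OF gN x']] by simp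
      then show ?thesis using G(4)[OF x] True by simp
    next
      case False
      then show ?thesis using G(4)[OF x] by simp
    qed
  qed
  then show ?thesis by (auto simp: represents_def)
qed

text \<open>The pushout of the resolution along \<phi>. By its universal property it maps to every
  extension that \<phi> represents.\<close>

lemma represents_realise:
  assumes B: "fg_module R B" and \<phi>: "\<phi> \<in> lin_hom R Z B"
  obtains F where "F \<in> exts R (Suc N) A B" "represents F \<phi>"
    "\<And>E. \<lbrakk>E \<in> exts R (Suc N) A B; represents E \<phi>\<rbrakk> \<Longrightarrow> \<exists>h. ext_hom R (Suc N) B id id F E h"
proof -
  obtain F :: "('r, 'k univ, 'a, 'b) extension" where F: "is_extension R (Suc N) A B F" "is_pushout R (Suc N) Z \<phi> P F"
    "\<forall>E :: ('r, 'k univ, 'a, 'b) extension. \<forall>g. is_extension R (Suc N) A B E \<and> ext_hom R (Suc N) Z \<phi> id P E g \<longrightarrow>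
      (\<exists>h. ext_hom R (Suc N) B id id F E h)"
    by (rule pushout_exists[OF small P Am Zm B \<phi>]) (rule that)
  show ?thesis
  proof (rule that[of F])
    show "F \<in> exts R (Suc N) A B" using F(1) by (simp add: exts_def)
    show "represents F \<phi>" using F(2) by (auto simp: is_pushout_def represents_def)
    show "\<exists>h. ext_hom R (Suc N) B id id F E h" if "E \<in> exts R (Suc N) A B" "represents E \<phi>" for E
      using F(3) that by (auto simp: exts_def represents_def)
  qed
qed

text \<open>A morphism with identities at the ends carries cocycles forward. Backwards, some cocycle
  of the source is carried forward, it differs from the given one by a coboundary, and coboundaries
  can be absorbed. Conversely, extensions with a common cocycle are linked through the pushout of
  the resolution, which maps to both.\<close>

lemma ext_equiv_represents:
  assumes B: "fg_module R B" and \<phi>: "\<phi> \<in> lin_hom R Z B"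
  shows "(E, E') \<in> ext_equiv R (Suc N) A B \<Longrightarrow> represents E \<phi> \<Longrightarrow> represents E' \<phi>"
    and "\<lbrakk>E \<in> exts R (Suc N) A B; E' \<in> exts R (Suc N) A B; represents E \<phi>; represents E' \<phi>\<rbrakk> \<Longrightarrow>
      (E, E') \<in> ext_equiv R (Suc N) A B"
proof -
  note Bm = fg_moduleD(1)[OF B]
  let ?r = "\<lambda>F F'. F \<in> exts R (Suc N) A B \<and> F' \<in> exts R (Suc N) A B \<and> (\<exists>g. ext_hom R (Suc N) B id id F F' g)"
  interpret Bg: abelian_group B by (rule lmod_abelian_group[OF Bm])
  have fwd: "represents F' \<psi>" if r: "?r F F'" "represents F \<psi>" "\<psi> \<in> lin_hom R Z B" for F F' \<psi>
  proof -
    obtain g where g: "ext_hom R (Suc N) B id id F F' g" using r(1) by blast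
    show ?thesis using represents_comp[OF r(2) g r(3)] by simp
  qed
  have bwd: "represents F \<phi>" if r: "?r F F'" "represents F' \<phi>" for F F'
  proof -
    have FE: "is_extension R (Suc N) A B F" "is_extension R (Suc N) A B F'" using r(1) by (simp_all add: exts_def)
    obtain \<psi> where \<psi>: "\<psi> \<in> lin_hom R Z B" "represents F \<psi>" by (rule represents_exists[OF FE(1) Bm])
    have "represents F' \<psi>" by (rule fwd[OF r(1) \<psi>(2,1)])
    then have "coboundary B (\<lambda>z. \<phi> z \<ominus>\<^bsub>B\<^esub> \<psi> z)" by (rule represents_unique[OF FE(2) Bm r(2) _ \<phi> \<psi>(1)])
    then show ?thesis by (rule represents_coboundary[OF FE(1) Bm \<psi>(2,1) \<phi>])
  qed
  {
    assume "(E, E') \<in> ext_equiv R (Suc N) A B" and E: "represents E \<phi>"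
    then have "equivclp ?r E E'" by (simp add: ext_equiv_def)
    then show "represents E' \<phi>"
      using E
    proof (induction rule: equivclp_induct)
      case (step y z)
      from step(2) show ?case
      proof
        assume "?r y z" then show ?thesis by (rule fwd[OF _ step.IH[OF step.prems] \<phi>])
      next
        assume "?r z y" then show ?thesis by (rule bwd[OF _ step.IH[OF step.prems]])
      qed
    qed
  }
  assume E: "E \<in> exts R (Suc N) A B" "E' \<in> exts R (Suc N) A B" "represents E \<phi>" "represents E' \<phi>"
  obtain F where F: "F \<in> exts R (Suc N) A B" "represents F \<phi>"
    "\<And>E. \<lbrakk>E \<in> exts R (Suc N) A B; represents E \<phi>\<rbrakk> \<Longrightarrow> \<exists>h. ext_hom R (Suc N) B id id F E h"
    by (rule represents_realise[OF B \<phi>]) blast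
  have 1: "?r F E" and 2: "?r F E'" using F E by auto
  have "equivclp ?r E F" using r_into_equivclp[of ?r F E, OF 1] by (rule equivclp_sym)
  moreover have "equivclp ?r F E'" using r_into_equivclp[of ?r F E', OF 2] .
  ultimately have "equivclp ?r E E'" by (rule equivclp_trans)
  then show "(E, E') \<in> ext_equiv R (Suc N) A B" using E by (simp add: ext_equiv_def)
qed

text \<open>Scaling, Baer sum and the tensor functor are all defined as the equivalence image of a
  set of possible results. To compute such an image it suffices that one result exists and that all
  are represented by the same cocycle.\<close>

lemma ext_equiv_Image:
  assumes B: "fg_module R B" and \<phi>: "\<phi> \<in> lin_hom R Z B"
    and ne: "\<exists>G \<in> X. G \<in> exts R (Suc N) A B" and r: "\<And>G. \<lbrakk>G \<in> X; G \<in> exts R (Suc N) A B\<rbrakk> \<Longrightarrow> represents G \<phi>"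
  shows "ext_equiv R (Suc N) A B `` X = cocycle_class B \<phi>"
proof (intro subset_antisym subsetI)
  fix E assume "E \<in> ext_equiv R (Suc N) A B `` X"
  then obtain G where G: "G \<in> X" "(G, E) \<in> ext_equiv R (Suc N) A B" by blast
  then have x: "G \<in> exts R (Suc N) A B" "E \<in> exts R (Suc N) A B" by (simp_all add: ext_equiv_def)
  show "E \<in> cocycle_class B \<phi>"
    using x ext_equiv_represents(1)[OF B \<phi> G(2) r[OF G(1) x(1)]] by (simp add: cocycle_class_def)
next
  fix E assume "E \<in> cocycle_class B \<phi>"
  then have E: "E \<in> exts R (Suc N) A B" "represents E \<phi>" by (simp_all add: cocycle_class_def)
  obtain G where G: "G \<in> X" "G \<in> exts R (Suc N) A B" using ne by blast
  have "(G, E) \<in> ext_equiv R (Suc N) A B" by (rule ext_equiv_represents(2)[OF B \<phi> G(2) E(1) r[OF G] E(2)])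
  then show "E \<in> ext_equiv R (Suc N) A B `` X" using G(1) by blast
qed

lemma cocycle_class_nonempty:
  assumes "fg_module R B" "\<phi> \<in> lin_hom R Z B"
  obtains E where "E \<in> cocycle_class B \<phi>"
  using represents_realise[OF assms] unfolding cocycle_class_def by blast

lemma cocycle_classD:
  assumes "E \<in> cocycle_class B \<phi>"
  shows "E \<in> exts R (Suc N) A B" "is_extension R (Suc N) A B E" "represents E \<phi>"
  using assms by (simp_all add: cocycle_class_def exts_def)

lemma Ext_carrier:
  assumes B: "fg_module R B"
  shows "carrier (Ext K' R (Suc N) A B) = cocycle_class B ` lin_hom R Z B"
proof -
  note Bm = fg_moduleD(1)[OF B]
  have "exts R (Suc N) A B // ext_equiv R (Suc N) A B = cocycle_class B ` lin_hom R Z B"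
  proof (intro subset_antisym subsetI)
    fix C assume "C \<in> exts R (Suc N) A B // ext_equiv R (Suc N) A B"
    then obtain E where E: "E \<in> exts R (Suc N) A B" "C = ext_equiv R (Suc N) A B `` {E}" by (auto simp: quotient_def)
    then have EE: "is_extension R (Suc N) A B E" by (simp add: exts_def)
    obtain \<phi> where \<phi>: "\<phi> \<in> lin_hom R Z B" "represents E \<phi>" by (rule represents_exists[OF EE Bm])
    have "C = cocycle_class B \<phi>" unfolding E(2) by (rule ext_equiv_Image[OF B \<phi>(1)]) (use E(1) \<phi>(2) in auto)
    then show "C \<in> cocycle_class B ` lin_hom R Z B" using \<phi>(1) by blast
  next
    fix C assume "C \<in> cocycle_class B ` lin_hom R Z B"
    then obtain \<phi> where \<phi>: "\<phi> \<in> lin_hom R Z B" "C = cocycle_class B \<phi>" by blast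
    obtain E where E: "E \<in> cocycle_class B \<phi>" by (rule cocycle_class_nonempty[OF B \<phi>(1)])
    have "ext_equiv R (Suc N) A B `` {E} = C" unfolding \<phi>(2)
      by (rule ext_equiv_Image[OF B \<phi>(1)]) (use cocycle_classD[OF E] in auto)
    then show "C \<in> exts R (Suc N) A B // ext_equiv R (Suc N) A B"
      using cocycle_classD(1)[OF E] by (auto simp: quotient_def)
  qed
  then show ?thesis by (simp add: Ext_def)
qed

lemma cocycle_class_cong: "(\<And>z. z \<in> carrier Z \<Longrightarrow> \<phi> z = \<phi>' z) \<Longrightarrow> cocycle_class B \<phi> = cocycle_class B \<phi>'"
  unfolding cocycle_class_def represents_def ext_hom_Suc by simp

lemma cocycle_class_eq_iff:
  fixes B (structure)
  assumes B: "fg_module R B" and h: "\<phi> \<in> lin_hom R Z B" "\<phi>' \<in> lin_hom R Z B"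
  shows "cocycle_class B \<phi> = cocycle_class B \<phi>' \<longleftrightarrow> coboundary B (\<lambda>z. \<phi> z \<ominus> \<phi>' z)"
proof
  note Bm = fg_moduleD(1)[OF B]
  assume eq: "cocycle_class B \<phi> = cocycle_class B \<phi>'"
  obtain E where E: "E \<in> cocycle_class B \<phi>" by (rule cocycle_class_nonempty[OF B h(1)])
  have E': "E \<in> cocycle_class B \<phi>'" using E unfolding eq .
  show "coboundary B (\<lambda>z. \<phi> z \<ominus> \<phi>' z)"
    by (rule represents_unique[OF cocycle_classD(2)[OF E] Bm cocycle_classD(3)[OF E] cocycle_classD(3)[OF E'] h])
next
  note Bm = fg_moduleD(1)[OF B]
  interpret Bg: abelian_group B by (rule lmod_abelian_group[OF Bm])
  assume c: "coboundary B (\<lambda>z. \<phi> z \<ominus> \<phi>' z)"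
  obtain k where k: "k \<in> lin_hom R (obj P N) B" "\<And>z. z \<in> carrier Z \<Longrightarrow> k (inc P z) = \<phi> z \<ominus> \<phi>' z"
    using c by (auto simp: coboundary_def)
  have c': "coboundary B (\<lambda>z. \<phi>' z \<ominus> \<phi> z)"
    unfolding coboundary_def
  proof (intro bexI ballI)
    show "(\<lambda>x. \<zero> \<ominus> k x) \<in> lin_hom R (obj P N) B" by (rule lin_hom_minus[OF lin_hom_zero_map[OF Bm] k(1) Bm])
    fix z assume z: "z \<in> carrier Z"
    show "\<zero> \<ominus> k (inc P z) = \<phi>' z \<ominus> \<phi> z"
      using lin_hom_closed[OF h(1) z] lin_hom_closed[OF h(2) z]
      unfolding k(2)[OF z] by (simp add: a_minus_def Bg.minus_add Bg.a_comm)
  qed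
  show "cocycle_class B \<phi> = cocycle_class B \<phi>'"
  proof (intro subset_antisym subsetI)
    fix E assume E: "E \<in> cocycle_class B \<phi>"
    show "E \<in> cocycle_class B \<phi>'"
      using cocycle_classD(1)[OF E] represents_coboundary[OF cocycle_classD(2)[OF E] Bm cocycle_classD(3)[OF E] h c'] by (simp add: cocycle_class_def)
  next
    fix E assume E: "E \<in> cocycle_class B \<phi>'"
    show "E \<in> cocycle_class B \<phi>"
      using cocycle_classD(1)[OF E] represents_coboundary[OF cocycle_classD(2)[OF E] Bm cocycle_classD(3)[OF E] h(2,1) c] by (simp add: cocycle_class_def)
  qed
qed

text \<open>Pushing out along a map of \<open>B\<close> composes the cocycle with that map.\<close>

lemma Ext_smult:
  assumes B: "fg_module R B" and \<phi>: "\<phi> \<in> lin_hom R Z B" and c: "c \<in> carrier K"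
  shows "(\<lambda>z. (c \<odot>\<^bsub>R\<^esub> \<one>\<^bsub>R\<^esub>) \<odot>\<^bsub>B\<^esub> \<phi> z) \<in> lin_hom R Z B"
    "c \<odot>\<^bsub>Ext K' R (Suc N) A B\<^esub> cocycle_class B \<phi> = cocycle_class B (\<lambda>z. (c \<odot>\<^bsub>R\<^esub> \<one>\<^bsub>R\<^esub>) \<odot>\<^bsub>B\<^esub> \<phi> z)"
proof -
  note Bm = fg_moduleD(1)[OF B]
  let ?m = "\<lambda>b. (c \<odot>\<^bsub>R\<^esub> \<one>\<^bsub>R\<^esub>) \<odot>\<^bsub>B\<^esub> b"
  note ml = fd_algebra.scalar_lin_hom[OF fd c Bm]
  show l: "(\<lambda>z. ?m (\<phi> z)) \<in> lin_hom R Z B" by (rule lin_hom_comp[OF \<phi> ml])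
  have "ext_scale R (Suc N) A B c (cocycle_class B \<phi>) = cocycle_class B (\<lambda>z. ?m (\<phi> z))"
    unfolding ext_scale_def
  proof (rule ext_equiv_Image[OF B l])
    obtain E where E: "E \<in> cocycle_class B \<phi>" by (rule cocycle_class_nonempty[OF B \<phi>])
    obtain F :: "('r, 'k univ, 'a, 'b) extension" where "is_extension R (Suc N) A B F" "is_pushout R (Suc N) B ?m E F"
      by (rule pushout_exists[OF small cocycle_classD(2)[OF E] Am Bm B ml]) (rule that)
    then show "\<exists>G \<in> {F. \<exists>E \<in> cocycle_class B \<phi>. is_pushout R (Suc N) B ?m E F}. G \<in> exts R (Suc N) A B"
      using E by (auto simp: exts_def)
  next
    fix G assume "G \<in> {F. \<exists>E \<in> cocycle_class B \<phi>. is_pushout R (Suc N) B ?m E F}"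
    then obtain E g where E: "E \<in> cocycle_class B \<phi>" "ext_hom R (Suc N) B ?m id E G g" by (auto simp: is_pushout_def)
    show "represents G (\<lambda>z. ?m (\<phi> z))" by (rule represents_comp[OF cocycle_classD(3)[OF E(1)] E(2) \<phi>]) simp
  qed
  then show "c \<odot>\<^bsub>Ext K' R (Suc N) A B\<^esub> cocycle_class B \<phi> = cocycle_class B (\<lambda>z. ?m (\<phi> z))"
    by (simp add: Ext_def)
qed

text \<open>A cocycle \<psi> of the pulled back extension has two coordinates, which are cocycles of
  the two summands and so agree with \<phi> and \<phi>' up to coboundaries. The pushout along
  addition is represented by the sum of the coordinates.\<close>

lemma Ext_add:
  fixes B (structure)
  assumes B: "fg_module R B" and h: "\<phi> \<in> lin_hom R Z B" "\<phi>' \<in> lin_hom R Z B"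
  shows "cocycle_class B \<phi> \<oplus>\<^bsub>Ext K' R (Suc N) A B\<^esub> cocycle_class B \<phi>' = cocycle_class B (\<lambda>z. \<phi> z \<oplus> \<phi>' z)"
proof -
  note Bm = fg_moduleD(1)[OF B]
  interpret Bg: abelian_group B by (rule lmod_abelian_group[OF Bm])
  note l = lin_hom_sum[OF h Bm]
  note D = dsum_left_module[OF Bm Bm]
  let ?s = "\<lambda>(b, b'). b \<oplus> b'"
  have sl: "?s \<in> lin_hom R (dsum B B) B"
    by (rule lin_homI) (auto simp: left_moduleD[OF Bm] Bg.a_ac)
  let ?X = "{G. \<exists>E \<in> cocycle_class B \<phi>. \<exists>E' \<in> cocycle_class B \<phi>'. \<exists>F \<in> exts R (Suc N) A (dsum B B).
           is_pullback R (Suc N) (dsum B B) (\<lambda>a. (a, a)) F (ext_dsum E E') \<and> is_pushout R (Suc N) (dsum B B) ?s F G}"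
  have "baer_sum R (Suc N) A B (cocycle_class B \<phi>) (cocycle_class B \<phi>') = cocycle_class B (\<lambda>z. \<phi> z \<oplus> \<phi>' z)"
    unfolding baer_sum_def
  proof (rule ext_equiv_Image[OF B l])
    obtain E where E: "E \<in> cocycle_class B \<phi>" by (rule cocycle_class_nonempty[OF B h(1)])
    obtain E' where E': "E' \<in> cocycle_class B \<phi>'" by (rule cocycle_class_nonempty[OF B h(2)])
    obtain F :: "('r, 'k univ, 'a, 'b \<times> 'b) extension" where F: "is_extension R (Suc N) A (dsum B B) F" "is_pullback R (Suc N) (dsum B B) (\<lambda>a. (a, a)) F (ext_dsum E E')"
      by (rule pullback_exists[OF fd cocycle_classD(2)[OF E] cocycle_classD(2)[OF E'] Am]) (rule that)
    obtain G :: "('r, 'k univ, 'a, 'b) extension" where "is_extension R (Suc N) A B G" "is_pushout R (Suc N) (dsum B B) ?s F G"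
      by (rule pushout_exists[OF small F(1) Am D B sl]) (rule that)
    then show "\<exists>G \<in> ?X. G \<in> exts R (Suc N) A B" using E E' F by (auto simp: exts_def)
  next
    fix G assume "G \<in> ?X" and Gx: "G \<in> exts R (Suc N) A B"
    then obtain E E' g g' and F :: "('r, 'k univ, 'a, 'b \<times> 'b) extension" where E: "E \<in> cocycle_class B \<phi>" "E' \<in> cocycle_class B \<phi>'" and F: "is_extension R (Suc N) A (dsum B B) F"
      and g: "ext_hom R (Suc N) (dsum B B) id (\<lambda>a. (a, a)) F (ext_dsum E E') g"
      and g': "ext_hom R (Suc N) (dsum B B) ?s id F G g'"
      by (auto simp: is_pullback_def is_pushout_def exts_def)
    obtain \<psi> where \<psi>: "\<psi> \<in> lin_hom R Z (dsum B B)" "represents F \<psi>" by (rule represents_exists[OF F D])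
    obtain f where f: "ext_hom R (Suc N) Z \<psi> id P F f" using \<psi>(2) by (auto simp: represents_def)
    \<comment> \<open>The morphism from the resolution to the direct sum has the diagonal at the
      right end; either projection turns it into a morphism over the identity of
      \<open>A\<close>.\<close>
    note fg = ext_hom_comp[OF f g lin_hom_closed[OF \<psi>(1)]]
    have p1: "ext_hom R (Suc N) (dsum B B) fst fst (ext_dsum E E') E (\<lambda>i. fst)"
      unfolding ext_hom_Suc by (auto simp: ext_dsum_def dsum_fst)
    have p2: "ext_hom R (Suc N) (dsum B B) snd snd (ext_dsum E E') E' (\<lambda>i. snd)"
      unfolding ext_hom_Suc by (auto simp: ext_dsum_def dsum_snd)
    have \<psi>c: "id (\<psi> z) \<in> carrier (dsum B B)" if "z \<in> carrier Z" for z using lin_hom_closed[OF \<psi>(1) that] by simp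
    have r1: "represents E (\<lambda>z. fst (\<psi> z))" by (rule representsI[OF ext_hom_comp[OF fg p1 \<psi>c]]) simp_all
    have r2: "represents E' (\<lambda>z. snd (\<psi> z))" by (rule representsI[OF ext_hom_comp[OF fg p2 \<psi>c]]) simp_all
    note l1 = lin_hom_comp[OF \<psi>(1) dsum_fst] and l2 = lin_hom_comp[OF \<psi>(1) dsum_snd]
    have "coboundary B (\<lambda>z. \<phi> z \<ominus> fst (\<psi> z))"
      by (rule represents_unique[OF cocycle_classD(2)[OF E(1)] Bm cocycle_classD(3)[OF E(1)] r1 h(1) l1])
    then obtain k where k: "k \<in> lin_hom R (obj P N) B" "\<And>z. z \<in> carrier Z \<Longrightarrow> k (inc P z) = \<phi> z \<ominus> fst (\<psi> z)"
      by (auto simp: coboundary_def)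
    have "coboundary B (\<lambda>z. \<phi>' z \<ominus> snd (\<psi> z))"
      by (rule represents_unique[OF cocycle_classD(2)[OF E(2)] Bm cocycle_classD(3)[OF E(2)] r2 h(2) l2])
    then obtain k' where k': "k' \<in> lin_hom R (obj P N) B" "\<And>z. z \<in> carrier Z \<Longrightarrow> k' (inc P z) = \<phi>' z \<ominus> snd (\<psi> z)"
      by (auto simp: coboundary_def)
    have rG: "represents G (\<lambda>z. ?s (\<psi> z))" by (rule represents_comp[OF \<psi>(2) g' \<psi>(1)]) simp
    have "coboundary B (\<lambda>z. (\<phi> z \<oplus> \<phi>' z) \<ominus> ?s (\<psi> z))"
      unfolding coboundary_def
    proof (intro bexI[OF _ lin_hom_sum[OF k(1) k'(1) Bm]] ballI)
      fix z assume z: "z \<in> carrier Z"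
      show "k (inc P z) \<oplus> k' (inc P z) = (\<phi> z \<oplus> \<phi>' z) \<ominus> ?s (\<psi> z)"
        unfolding k(2)[OF z] k'(2)[OF z]
        using Bg.add_diff_add[OF lin_hom_closed[OF h(1) z] lin_hom_closed[OF h(2) z] lin_hom_closed[OF l1 z] lin_hom_closed[OF l2 z]]
        by (simp add: case_prod_unfold)
    qed
    then show "represents G (\<lambda>z. \<phi> z \<oplus> \<phi>' z)"
      using represents_coboundary[OF _ Bm rG lin_hom_comp[OF \<psi>(1) sl] l] Gx by (simp add: exts_def)
  qed
  then show ?thesis by (simp add: Ext_def)
qed

text \<open>The index is shifted by one: the kernel in degree 0 is already a first syzygy of
  \<open>A\<close>.\<close>

lemma ext_ker_syzygy:
  "i \<le> N \<Longrightarrow> is_syzygy R (Suc i) (obj P i\<lparr>carrier := ext_ker A P i\<rparr>)"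
proof (induction i)
  case 0
  note s = ext_ker_submod[OF P Am 0]
  have "short_exact R (obj P 0\<lparr>carrier := ext_ker A P 0\<rparr>) (obj P 0) A (\<lambda>x. x) (prj P)"
    unfolding short_exact_def using p(6,7) lin_hom_restrict_domain[OF lin_hom_id p(10)[of 0], of R] by (auto simp: inj_on_def)
  then show ?case
    by (rule is_syzygy_Suc[OF small is_syzygy_0[OF small A] p(1)[OF 0] proj[OF 0] fd_algebra.fg_module_submod[OF fd p(1)[OF 0] s]])
next
  case (Suc i)
  then have i: "i \<le> N" "i < N" by simp_all
  note s = ext_ker_submod[OF P Am Suc.prems]
  have "short_exact R (obj P (Suc i)\<lparr>carrier := ext_ker A P (Suc i)\<rparr>) (obj P (Suc i)) (obj P i\<lparr>carrier := ext_ker A P i\<rparr>)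
      (\<lambda>x. x) (dif P i)"
    unfolding short_exact_def
    using p(8)[OF i(2)] lin_hom_restrict_domain[OF lin_hom_id p(10)[of "Suc i"], of R]
      lin_hom_restrict_codomain[OF p(5)[OF i(2)] ext_dif_zero[OF P i(2)]] by (auto simp: inj_on_def)
  then show ?case
    by (rule is_syzygy_Suc[OF small Suc.IH[OF i(1)] p(1)[OF Suc.prems] proj[OF Suc.prems]
        fd_algebra.fg_module_submod[OF fd p(1)[OF Suc.prems] s]])
qed

lemma syzygy_Z: "is_syzygy R (Suc N) Z"
proof (rule is_syzygy_iso[OF ext_ker_syzygy[OF order_refl] _ Zm])
  show "inc P \<in> lin_iso R Z (obj P N\<lparr>carrier := ext_ker A P N\<rparr>)"
    using p(4,9) lin_hom_restrict_codomain[OF p(3) ext_inc_zero[OF P]] by (simp add: lin_iso_def bij_betw_def)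
qed

text \<open>The cokernel of \<open>Z\<close> in the last projective is the kernel one degree lower,
  or \<open>A\<close> if N = 0. In both cases it is a syzygy of order N, at least \<open>d\<close>,
  so \<open>syzygy_extends\<close> applies.\<close>

lemma extends_Z:
  fixes I :: "nat \<Rightarrow> ('r, 'k univ) module"
  assumes res: "injective_resolution R (regular R) d I e \<delta>" and d: "d \<le> N"
  shows "extends R Z (obj P N) (inc P)"
proof (cases N)
  case 0
  have "short_exact R Z (obj P N) A (inc P) (prj P)"
    unfolding short_exact_def using p(3,4,6,7,9) 0 by simp
  then show ?thesis
    using syzygy_extends[OF res small is_syzygy_0[OF small A] _ p(1)[OF order_refl] proj[OF order_refl] Z] d 0 by simp
next
  case (Suc i)
  then have i: "i < N" "i \<le> N" "Suc i = N" by simp_all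
  have dl: "dif P i \<in> lin_hom R (obj P N) (obj P i\<lparr>carrier := ext_ker A P i\<rparr>)"
    using lin_hom_restrict_codomain[OF p(5)[OF i(1)] ext_dif_zero[OF P i(1)]] i(3) by simp
  have ds: "dif P i ` carrier (obj P N) = ext_ker A P i" and dk: "ext_ker A P N = {x \<in> carrier (obj P N). dif P i x = \<zero>\<^bsub>obj P i\<^esub>}"
    using p(8)[OF i(1)] by (simp_all flip: i(3))
  have se: "short_exact R Z (obj P N) (obj P i\<lparr>carrier := ext_ker A P i\<rparr>) (inc P) (dif P i)"
    unfolding short_exact_def using p(3,4,9) dl ds dk by simp
  have "d \<le> Suc i" using d i(3) by simp
  then show ?thesis
    by (rule syzygy_extends[OF res small ext_ker_syzygy[OF i(2)] _ p(1)[OF order_refl] proj[OF order_refl] Z se])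
qed

text \<open>For the converse direction: \<open>Z\<close> is a syzygy of order above the injective dimension, so
  functionals on \<open>Z\<close> extend along \<open>inc P\<close>.\<close>

lemma coboundary_iff_finite_rank:
  fixes I :: "nat \<Rightarrow> ('r, 'k univ) module"
  assumes res: "injective_resolution R (regular R) d I e \<delta>" and d: "d \<le> N" and B: "left_module R B"
    and \<phi>: "\<phi> \<in> lin_hom R Z B"
  shows "coboundary B \<phi> \<longleftrightarrow> finite_rank R Z B \<phi>"
proof
  note PN = p(2)[OF order_refl]
  assume "coboundary B \<phi>"
  then obtain h where h: "h \<in> lin_hom R (obj P N) B" "\<And>z. z \<in> carrier Z \<Longrightarrow> h (inc P z) = \<phi> z"
    by (auto simp: coboundary_def)
  show "finite_rank R Z B \<phi>"
    by (rule finite_rank_cong[OF finite_rank_through[OF proj[OF order_refl] p(3) h(1) PN B] h(2)])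
next
  note PN = p(2)[OF order_refl]
  assume "finite_rank R Z B \<phi>"
  then obtain h where "finite_rank R (obj P N) B h" "\<And>z. z \<in> carrier Z \<Longrightarrow> h (inc P z) = \<phi> z"
    using extends_finite_rank[OF extends_Z[OF res d] _ p(3)] by blast
  then show "coboundary B \<phi>" using finite_rank_lin_hom[OF _ PN B] by (auto simp: coboundary_def)
qed

end

text \<open>To lengthen a resolution, cover its last syzygy and splice.\<close>

lemma resolution_exists:
  fixes R :: "('k, 'r) module" and A :: "('r, 'a) module"
  assumes fd: "fd_algebra K R" and A: "fg_module R A"
  obtains Z :: "('r, 'k univ) module" and P where "resolution K R A Z P N"
proof -
  note sm = fd_algebra_small_ring[OF fd]
  have "\<exists>(Z :: ('r, 'k univ) module) P. resolution K R A Z P N"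
  proof (induction N)
    case 0
    obtain Q :: "('r, 'k univ) module" and q where Q: "fg_module R Q" "fgproj R Q" "q \<in> lin_hom R Q A" "q ` carrier Q = carrier A"
      by (rule projective_cover[OF sm A])
    let ?k = "a_kernel Q A q"
    let ?Z = "Q\<lparr>carrier := ?k\<rparr>"
    \<comment> \<open>For N = 0 there is a single middle term and no differential; the value of
      \<open>dif\<close> is a placeholder.\<close>
    define P :: "('r, 'k univ, 'a, 'k univ) extension" where
      "P = \<lparr>obj = (\<lambda>_. Q), dif = (\<lambda>_ x. x), inc = (\<lambda>x. x), prj = q\<rparr>"
    have k: "x \<in> ?k \<longleftrightarrow> x \<in> carrier Q \<and> q x = \<zero>\<^bsub>A\<^esub>" for x by (simp add: a_kernel_def')
    have "is_extension R (Suc 0) A ?Z P"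
      unfolding is_extension_Suc using Q by (auto simp: P_def k inj_on_def intro!: lin_homI)
    moreover have "fg_module R ?Z"
      by (rule fd_algebra.fg_module_submod[OF fd Q(1) kernel_submod[OF Q(3) fg_moduleD(1)[OF Q(1)] fg_moduleD(1)[OF A]]])
    ultimately have "resolution K R A ?Z P 0"
      by (intro resolution.intro fd A) (simp_all add: P_def Q(2))
    then show ?case by blast
  next
    case (Suc N)
    then obtain Z :: "('r, 'k univ) module" and P where "resolution K R A Z P N" by blast
    then interpret r: resolution K R A Z P N .
    obtain Q :: "('r, 'k univ) module" and q where Q: "fg_module R Q" "fgproj R Q" "q \<in> lin_hom R Q Z" "q ` carrier Q = carrier Z"
      by (rule projective_cover[OF sm r.Z])
    let ?k = "a_kernel Q Z q"
    let ?Z = "Q\<lparr>carrier := ?k\<rparr>"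
    \<comment> \<open>The splice: the new differential is the cover of \<open>Z\<close> followed by
      the inclusion of \<open>Z\<close> into the former last term.\<close>
    define P' :: "('r, 'k univ, 'a, 'k univ) extension" where
      "P' = \<lparr>obj = (obj P)(Suc N := Q), dif = (dif P)(N := (\<lambda>x. inc P (q x))), inc = (\<lambda>x. x), prj = prj P\<rparr>"
    have Ps: "obj P' = (obj P)(Suc N := Q)" "dif P' = (dif P)(N := (\<lambda>x. inc P (q x)))" "inc P' = (\<lambda>x. x)" "prj P' = prj P"
      by (simp_all add: P'_def)
    have k: "x \<in> ?k \<longleftrightarrow> x \<in> carrier Q \<and> q x = \<zero>\<^bsub>Z\<^esub>" for x by (simp add: a_kernel_def')
    have low: "ext_ker A P' i = ext_ker A P i" if "i \<le> N" for i using that by (cases i) (simp_all add: Ps)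
    have z: "inc P (q x) = \<zero>\<^bsub>obj P N\<^esub> \<longleftrightarrow> q x = \<zero>\<^bsub>Z\<^esub>" if "x \<in> carrier Q" for x
      using r.p(4)[unfolded lin_hom_inj_iff[OF r.p(3) r.Zm r.p(2)[OF order_refl]]] lin_hom_closed[OF Q(3) that]
        lin_hom_zero[OF r.p(3) r.Zm r.p(2)[OF order_refl]] by auto
    have "is_extension R (Suc (Suc N)) A ?Z P'"
      unfolding is_extension_Suc
    proof (intro conjI allI impI)
      show "fg_module R (obj P' i)" if "i \<le> Suc N" for i using that r.p(1)[of i] Q(1) by (cases "i = Suc N") (simp_all add: Ps)
      show "inc P' \<in> lin_hom R ?Z (obj P' (Suc N))" by (rule lin_homI) (simp_all add: Ps k)
      show "inj_on (inc P') (carrier ?Z)" by (simp add: Ps)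
      show "dif P' i \<in> lin_hom R (obj P' (Suc i)) (obj P' i)" if "i < Suc N" for i
        using that r.p(5)[of i] lin_hom_comp[OF Q(3) r.p(3)] by (cases "i = N") (simp_all add: Ps)
      show "prj P' \<in> lin_hom R (obj P' 0) A" using r.p(6) by (simp add: Ps)
      show "prj P' ` carrier (obj P' 0) = carrier A" using r.p(7) by (simp add: Ps)
      show "dif P' i ` carrier (obj P' (Suc i)) = ext_ker A P' i" if i: "i < Suc N" for i
      proof (cases "i = N")
        case True
        have "(\<lambda>x. inc P (q x)) ` carrier Q = inc P ` q ` carrier Q" by (simp add: image_image)
        then show ?thesis using True Q(4) r.p(9) low[of N] by (simp add: Ps)
      next
        case False
        then show ?thesis using i r.p(8)[of i] low[of i] by (simp add: Ps)
      qed
      show "inc P' ` carrier ?Z = ext_ker A P' (Suc N)"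
        using z lin_hom_zero[OF r.p(3) r.Zm r.p(2)[OF order_refl]] by (auto simp: Ps k)
    qed
    moreover have "fg_module R ?Z"
      by (rule fd_algebra.fg_module_submod[OF fd Q(1) kernel_submod[OF Q(3) fg_moduleD(1)[OF Q(1)] r.Zm]])
    ultimately have "resolution K R A ?Z P' (Suc N)"
      using r.proj Q(2) by (intro resolution.intro fd A) (simp_all add: Ps)
    then show ?case by blast
  qed
  then show ?thesis using that by blast
qed

section \<open>The tensor functor on extensions\<close>

lemma tensor_map_square:
  assumes r: "right_module R M" and m: "left_module R X" "left_module R Y" "left_module R Y'" "left_module R W"
    and f: "f \<in> lin_hom R X Y" "g \<in> lin_hom R Y W" and f': "f' \<in> lin_hom R X Y'" "g' \<in> lin_hom R Y' W"
    and e: "\<And>x. x \<in> carrier X \<Longrightarrow> g (f x) = g' (f' x)" and t: "t \<in> carrier (tensor R M X)"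
  shows "tensor_map R M W g (tensor_map R M Y f t) = tensor_map R M W g' (tensor_map R M Y' f' t)"
  unfolding tensor_map_comp[OF r m(1,2,4) f t] tensor_map_comp[OF r m(1,3,4) f' t]
  by (rule tensor_map_cong[OF r m(1,4) lin_hom_comp[OF f] lin_hom_comp[OF f'] e t])

lemma tensor_extension_simps [simp]:
  "obj (tensor_extension R N n A E) i = tensor R N (obj E i)"
  "dif (tensor_extension R N n A E) i = tensor_map R N (obj E i) (dif E i)"
  "inc (tensor_extension R N (Suc m) A E) = tensor_map R N (obj E m) (inc E)"
  "prj (tensor_extension R N n A E) = tensor_map R N A (prj E)"
  by (simp_all add: tensor_extension_def)

text \<open>Exactness in each degree is \<open>tensor_map_exact\<close>; right projectivity of
  \<open>N\<close> also keeps \<open>inc\<close> injective.\<close>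

lemma is_extension_tensor:
  assumes N: "bimod_over S L N" "fin_gen S N" "fgproj (opp L) (right_part N)"
    and E: "is_extension L (Suc m) A B E" and A: "left_module L A" and B: "left_module L B"
  shows "is_extension S (Suc m) (tensor L N A) (tensor L N B) (tensor_extension L N (Suc m) A E)"
  unfolding is_extension_Suc
proof (intro conjI allI impI)
  let ?T = "tensor_extension L N (Suc m) A E"
  note e = is_extensionD[OF E] and ex = tensor_map_exact[OF N(1,3)]
  have ker: "tensor_map L N (obj E i) f ` carrier (tensor L N X) = ext_ker (tensor L N A) ?T i"
    if i: "i \<le> m" and X: "left_module L X" and f: "f \<in> lin_hom L X (obj E i)" "f ` carrier X = ext_ker A E i" for i f X
  proof (cases i)
    case 0
    show ?thesis using ex[OF X e(2)[OF i] A f(1), of "prj E"] e(6) f(2) 0 by simp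
  next
    case (Suc j)
    then have j: "j < m" "j \<le> m" using i by simp_all
    show ?thesis using ex[OF X e(2)[OF i] e(2)[OF j(2)] f(1), of "dif E j"] e(5)[OF j(1)] f(2) Suc by simp
  qed
  note m0 = e(2)[OF le0]
  show "fg_module S (obj ?T i)" if "i \<le> m" for i using tensor_fg_module[OF N(1,2) e(1)[OF that]] by simp
  show "inc ?T \<in> lin_hom S (tensor L N B) (obj ?T m)" using tensor_map_lin_hom[OF N(1) B e(2)[OF order_refl] e(3)] by simp
  show "inj_on (inc ?T) (carrier (tensor L N B))" using tensor_map_inj[OF N(1,3) B e(2)[OF order_refl] e(3,4)] by simp
  show "dif ?T i \<in> lin_hom S (obj ?T (Suc i)) (obj ?T i)" if i: "i < m" for i
    using tensor_map_lin_hom[OF N(1) e(2) e(2) e(5)[OF i]] i by simp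
  show "prj ?T \<in> lin_hom S (obj ?T 0) (tensor L N A)" using tensor_map_lin_hom[OF N(1) m0 A e(6)] by simp
  show "prj ?T ` carrier (obj ?T 0) = carrier (tensor L N A)" using tensor_map_surj[OF N(1) m0 A e(6,7)] by simp
  show "dif ?T i ` carrier (obj ?T (Suc i)) = ext_ker (tensor L N A) ?T i" if i: "i < m" for i
    using ker[OF _ e(2) e(5)[OF i] e(8)[OF i]] i by simp
  show "inc ?T ` carrier (tensor L N B) = ext_ker (tensor L N A) ?T m"
    using ker[OF order_refl B e(3,9)] by simp
qed

lemma ext_hom_tensor:
  assumes N: "bimod_over S L N" and P: "is_extension L (Suc m) A Z P" and E: "is_extension L (Suc m) A B E"
    and A: "left_module L A" and B: "left_module L B" and Z: "left_module L Z" and \<phi>: "\<phi> \<in> lin_hom L Z B"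
    and g: "ext_hom L (Suc m) Z \<phi> id P E g"
  shows "ext_hom S (Suc m) (tensor L N Z) (tensor_map L N B \<phi>) id
    (tensor_extension L N (Suc m) A P) (tensor_extension L N (Suc m) A E) (\<lambda>i. tensor_map L N (obj E i) (g i))"
  unfolding ext_hom_Suc tensor_extension_simps
proof (intro conjI allI impI ballI)
  note p = is_extensionD[OF P] and e = is_extensionD[OF E] and G = ext_homD[OF g] and r = bimod_overD(2)[OF N]
  show "tensor_map L N (obj E i) (g i) \<in> lin_hom S (tensor L N (obj P i)) (tensor L N (obj E i))" if "i \<le> m" for i
    by (rule tensor_map_lin_hom[OF N p(2)[OF that] e(2)[OF that] G(1)[OF that]])
  show "tensor_map L N (obj E m) (g m) (tensor_map L N (obj P m) (inc P) t) =
      tensor_map L N (obj E m) (inc E) (tensor_map L N B \<phi> t)" if "t \<in> carrier (tensor L N Z)" for t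
    by (rule tensor_map_square[OF r Z p(2)[OF order_refl] B e(2)[OF order_refl] p(3) G(1)[OF order_refl] \<phi> e(3) G(2) that])
  show "tensor_map L N (obj E i) (g i) (tensor_map L N (obj P i) (dif P i) t) =
      tensor_map L N (obj E i) (dif E i) (tensor_map L N (obj E (Suc i)) (g (Suc i)) t)"
    if i: "i < m" and t: "t \<in> carrier (tensor L N (obj P (Suc i)))" for i t
  proof -
    have i': "i \<le> m" "Suc i \<le> m" using i by simp_all
    show ?thesis
      by (rule tensor_map_square[OF r p(2)[OF i'(2)] p(2)[OF i'(1)] e(2)[OF i'(2)] e(2)[OF i'(1)]
          p(5)[OF i] G(1)[OF i'(1)] G(1)[OF i'(2)] e(5)[OF i] G(3)[OF i] t])
  qed
  show "id (tensor_map L N A (prj P) t) = tensor_map L N A (prj E) (tensor_map L N (obj E 0) (g 0) t)"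
    if t: "t \<in> carrier (tensor L N (obj P 0))" for t
    unfolding id_apply tensor_map_comp[OF r p(2)[OF le0] e(2)[OF le0] A G(1)[OF le0] e(6) t]
    by (rule tensor_map_cong[OF r p(2)[OF le0] A p(6) lin_hom_comp[OF G(1)[OF le0] e(6)] G(4)[unfolded id_apply] t])
qed

text \<open>Multiplication by a scalar of \<open>K\<close> moves across the tensor sign and then, by
  centrality on \<open>N\<close>, to the left.\<close>

lemma tensor_map_scalar:
  fixes L (structure)
  assumes L: "fd_algebra K L" and N: "bimodule K S L N" and Y: "left_module L Y" and c: "c \<in> carrier K"
    and S: "fd_algebra K S" and t: "t \<in> carrier (tensor L N Y)"
  shows "tensor_map L N Y (\<lambda>y. (c \<odot> \<one>) \<odot>\<^bsub>Y\<^esub> y) t = (c \<odot>\<^bsub>S\<^esub> \<one>\<^bsub>S\<^esub>) \<odot>\<^bsub>tensor L N Y\<^esub> t"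
proof -
  note n = bimodule_bimod_over[OF N]
  note r = bimod_overD(2)[OF n]
  note s = fd_algebra.scalar_lin_hom[OF L c Y] and k = fd_algebra.scalar_closed[OF L c] fd_algebra.scalar_closed[OF S c]
  note tt = tensorableI[OF r Y]
  interpret T: tensor_product L N Y by (rule tensor_product.intro[OF tt])
  have "tensor_map L N Y (\<lambda>y. (c \<odot> \<one>) \<odot>\<^bsub>Y\<^esub> y) t =
      tmap L N Y (\<lambda>m. (c \<odot>\<^bsub>S\<^esub> \<one>\<^bsub>S\<^esub>) \<odot>\<^bsub>N\<^esub> m) (\<lambda>y. y) t"
  proof (rule T.addhom_tensor_eq[where f = "tensor_map L N Y (\<lambda>y. (c \<odot> \<one>) \<odot>\<^bsub>Y\<^esub> y)" and t = t, OF _ _ T.T_abelian_group])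
    show "tensor_map L N Y (\<lambda>y. (c \<odot> \<one>) \<odot>\<^bsub>Y\<^esub> y) \<in> addhom (tens_group L N Y) (tens_group L N Y)"
      unfolding tensor_map_tmap by (rule tmap_addhom[OF tt tt right_lin_id s])
    show "tmap L N Y (\<lambda>m. (c \<odot>\<^bsub>S\<^esub> \<one>\<^bsub>S\<^esub>) \<odot>\<^bsub>N\<^esub> m) (\<lambda>y. y) \<in> addhom (tens_group L N Y) (tens_group L N Y)"
      by (rule tmap_addhom[OF tt tt smult_right_lin[OF n k(2)] lin_hom_id])
    show "t \<in> carrier (tens_group L N Y)" using t by simp
    fix m y assume my: "m \<in> carrier N" "y \<in> carrier Y"
    have "tens L N Y m ((c \<odot> \<one>) \<odot>\<^bsub>Y\<^esub> y) = tens L N Y (m \<triangleleft>\<^bsub>N\<^esub> (c \<odot> \<one>)) y"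
      by (rule T.tens_balanced[symmetric]) (use my k in simp_all)
    also have "m \<triangleleft>\<^bsub>N\<^esub> (c \<odot> \<one>) = (c \<odot>\<^bsub>S\<^esub> \<one>\<^bsub>S\<^esub>) \<odot>\<^bsub>N\<^esub> m" using N my c by (simp add: bimodule_def)
    finally show "tensor_map L N Y (\<lambda>y. (c \<odot> \<one>) \<odot>\<^bsub>Y\<^esub> y) (tens L N Y m y) =
        tmap L N Y (\<lambda>m. (c \<odot>\<^bsub>S\<^esub> \<one>\<^bsub>S\<^esub>) \<odot>\<^bsub>N\<^esub> m) (\<lambda>y. y) (tens L N Y m y)"
      unfolding tensor_map_tens[OF r Y Y s my] tensor_smult_tens[OF n Y k(2) my] .
  qed
  then show ?thesis by simp
qed

text \<open>Tensoring a resolution of \<open>A\<close> gives, after copying the middle terms into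
  the universe, a resolution of N \<otimes> A with last syzygy N \<otimes> Z. A comparison map for
  \<open>E\<close> is tensored to one for the tensored extension, so on cocycles the functor is
  \<phi> \<mapsto> N \<otimes> \<phi>.\<close>

lemma resolution_tensor:
  fixes L :: "('k, 'l) module" and S :: "('k, 's) module" and P :: "('l, 'k univ, 'a, 'x) extension"
    and N :: "('s, 'l, 'n) bimod"
  assumes r: "resolution K L A Z P m" and S: "fd_algebra K S"
    and N: "bimod_over S L N" "fgproj S N" "fgproj (opp L) (right_part N)"
  obtains P' where "resolution K S (tensor L N A) (tensor L N Z) P' m"
    "\<forall>(B :: ('l, 'b) module) \<phi>. fg_module L B \<and> \<phi> \<in> lin_hom L Z B \<longrightarrow>
      Ext_tensor L S N (Suc m) A B (resolution.cocycle_class L A Z P m B \<phi>) =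
      resolution.cocycle_class S (tensor L N A) (tensor L N Z) P' m (tensor L N B) (tensor_map L N B \<phi>)"
proof -
  let ?F = "tensor L N"
  interpret rL: resolution K L A Z P m by (rule r)
  note small = fd_algebra_small_ring[OF S]
  have fgN: "fin_gen S N" by (rule fgproj_fin_gen[OF N(2) bimod_overD(1)[OF N(1)]])
  note ext = is_extension_tensor[OF N(1) fgN N(3) _ rL.Am]
  note FA = tensor_fg_module[OF N(1) fgN rL.A] and FZ = tensor_fg_module[OF N(1) fgN rL.Z]
  let ?T = "tensor_extension L N (Suc m) A"
  note TP = ext[OF rL.P rL.Zm]
  obtain P' :: "('s, 'k univ, ('n \<times> 'a \<Rightarrow>\<^sub>0 int) set, ('n \<times> 'x \<Rightarrow>\<^sub>0 int) set) extension" and c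
    where P': "is_extension S (Suc m) (?F A) (?F Z) P'"
      "\<And>i. i \<le> m \<Longrightarrow> c i \<in> lin_iso S (obj (?T P) i) (obj P' i)"
      "ext_hom S (Suc m) (?F Z) id id P' (?T P) (\<lambda>i. inv_into (carrier (obj (?T P) i)) (c i))"
    by (rule ext_copy[OF small TP fg_moduleD(1)[OF FA]]) blast
  have fp: "fgproj S (obj P' i)" if i: "i \<le> m" for i
    using fgproj_iso[OF fgproj_tensor[OF N(1,2) rL.p(2)[OF i] rL.proj[OF i]] P'(2)[OF i, simplified]
        is_extensionD(2)[OF TP i, simplified] is_extensionD(2)[OF P'(1) i]] .
  have rS: "resolution K S (?F A) (?F Z) P' m"
    by (rule resolution.intro[OF S FA FZ P'(1) fp])
  interpret rS: resolution K S "?F A" "?F Z" P' m by (rule rS)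
  show ?thesis
  proof (rule that[OF rS], intro allI impI, elim conjE)
    fix B :: "('l, 'b) module" and \<phi> assume B: "fg_module L B" and \<phi>: "\<phi> \<in> lin_hom L Z B"
    note Bm = fg_moduleD(1)[OF B] and FB = tensor_fg_module[OF N(1) fgN B]
    note F\<phi> = tensor_map_lin_hom[OF N(1) rL.Zm Bm \<phi>]
    show "Ext_tensor L S N (Suc m) A B (rL.cocycle_class B \<phi>) = rS.cocycle_class (?F B) (tensor_map L N B \<phi>)"
      unfolding Ext_tensor_def
    proof (rule rS.ext_equiv_Image[OF FB F\<phi>])
      let ?X = "{G \<in> exts S (Suc m) (?F A) (?F B).
        \<exists>E \<in> rL.cocycle_class B \<phi>. ext_iso S (Suc m) (?F B) (?T E) G}"
      obtain E where E: "E \<in> rL.cocycle_class B \<phi>" by (rule rL.cocycle_class_nonempty[OF B \<phi>])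
      obtain G :: "('s, 'k univ, ('n \<times> 'a \<Rightarrow>\<^sub>0 int) set, ('n \<times> 'b \<Rightarrow>\<^sub>0 int) set) extension" and c
        where G: "is_extension S (Suc m) (?F A) (?F B) G"
          "ext_hom S (Suc m) (?F B) id id (?T E) G c" "\<And>i. i \<le> m \<Longrightarrow> c i \<in> lin_iso S (obj (?T E) i) (obj G i)"
        by (rule ext_copy[OF small ext[OF rL.cocycle_classD(2)[OF E] Bm] fg_moduleD(1)[OF FA]]) blast
      have "ext_iso S (Suc m) (?F B) (?T E) G"
        unfolding ext_iso_def using G(2) lin_isoD(4)[OF G(3)] by (intro exI[of _ c]) (simp add: less_Suc_eq_le)
      then show "\<exists>G \<in> ?X. G \<in> exts S (Suc m) (?F A) (?F B)" using G(1) E by (auto simp: exts_def)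
    next
      fix G assume "G \<in> {G \<in> exts S (Suc m) (?F A) (?F B).
        \<exists>E \<in> rL.cocycle_class B \<phi>. ext_iso S (Suc m) (?F B) (?T E) G}"
      then obtain E h where E: "E \<in> rL.cocycle_class B \<phi>" and h: "ext_hom S (Suc m) (?F B) id id (?T E) G h"
        by (auto simp: ext_iso_def)
      obtain g where g: "ext_hom L (Suc m) Z \<phi> id P E g" using rL.cocycle_classD(3)[OF E] by (auto simp: rL.represents_def)
      note Tg = ext_hom_tensor[OF N(1) rL.P rL.cocycle_classD(2)[OF E] rL.Am Bm rL.Zm \<phi> g]
      have idZ: "id t \<in> carrier (?F Z)" if "t \<in> carrier (?F Z)" for t using that by simp
      have F\<phi>c: "tensor_map L N B \<phi> (id t) \<in> carrier (?F B)" if "t \<in> carrier (?F Z)" for t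
        using lin_hom_closed[OF F\<phi> that] by simp
      show "rS.represents G (tensor_map L N B \<phi>)"
        by (rule rS.representsI[OF ext_hom_comp[OF ext_hom_comp[OF P'(3) Tg idZ] h F\<phi>c]]) simp_all
    qed
  qed
qed

text \<open>On cocycle classes linearity is that of \<open>tensor_map\<close>. Over both algebras
  the coboundaries are the maps of finite rank, so injectivity and surjectivity are the two halves
  of the stable bijection on maps out of \<open>Z\<close>.\<close>

lemma Ext_tensor_iso:
  fixes I :: "nat \<Rightarrow> ('l, 'k univ) module" and J :: "nat \<Rightarrow> ('s, 'k univ) module"
    and L :: "('k, 'l) module" and S :: "('k, 's) module" and A :: "('l, 'a) module" and B :: "('l, 'b) module"
  assumes L: "fd_algebra K L" and S: "fd_algebra K S"
    and resL: "injective_resolution L (regular L) d I e \<delta>" "d \<le> m"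
    and resS: "injective_resolution S (regular S) d' J e' \<delta>'" "d' \<le> m"
    and sing: "singular_equivalence_level K L S M N l" and A: "fg_module L A" and B: "fg_module L B"
  shows "Ext_tensor L S N (Suc m) A B \<in> lin_iso K (Ext K L (Suc m) A B) (Ext K S (Suc m) (tensor L N A) (tensor L N B))"
proof -
  let ?N = "tensor L N"
  have N: "bimodule K S L N" and pr: "fin_gen S N" "projective S N" "fin_gen (opp L) (right_part N)" "projective (opp L) (right_part N)"
    using sing by (simp_all add: singular_equivalence_level_def fg_projective_def)
  note n = bimodule_bimod_over[OF N]
  have opp_small: "small_ring (opp L)"
    using fd_algebra_small_ring[OF L] ring_opp by (auto simp: small_ring_def)
  note pN = projective_fgproj[OF fd_algebra_small_ring[OF S] pr(1,2)] and rN = projective_fgproj[OF opp_small pr(3,4)]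
  obtain Z :: "('l, 'k univ) module" and P where P: "resolution K L A Z P m" by (rule resolution_exists[OF L A])
  obtain P' where P': "resolution K S (?N A) (?N Z) P' m"
    "\<forall>(B :: ('l, 'b) module) \<phi>. fg_module L B \<and> \<phi> \<in> lin_hom L Z B \<longrightarrow>
      Ext_tensor L S N (Suc m) A B (resolution.cocycle_class L A Z P m B \<phi>) =
      resolution.cocycle_class S (?N A) (?N Z) P' m (?N B) (tensor_map L N B \<phi>)"
    by (rule resolution_tensor[OF P S n pN rN]) (rule that)
  interpret rL: resolution K L A Z P m by (rule P)
  interpret rS: resolution K S "?N A" "?N Z" P' m by (rule P'(1))
  note Bm = fg_moduleD(1)[OF B] and Zm = rL.Zm and r = bimod_overD(2)[OF n]
  note FBf = tensor_fg_module[OF n pr(1) B] and FZm = rS.Zm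
  note FBm = fg_moduleD(1)[OF FBf]
  let ?F = "tensor_map L N B" and ?X = "Ext_tensor L S N (Suc m) A B"
  let ?cL = "rL.cocycle_class B" and ?cS = "rS.cocycle_class (?N B)"
  let ?E = "Ext K L (Suc m) A B" and ?E' = "Ext K S (Suc m) (?N A) (?N B)"
  note F = tensor_map_lin_hom[OF n Zm Bm]
  have X: "?X (?cL \<phi>) = ?cS (?F \<phi>)" if "\<phi> \<in> lin_hom L Z B" for \<phi> using P'(2) B that by blast
  note E = rL.Ext_carrier[OF B, of K] and E' = rS.Ext_carrier[OF FBf, of K]
  \<comment> \<open>\<open>Z\<close> is a syzygy of order m + 1, while the bounds are stated for
    \<open>m\<close>, the index of the last projective.\<close>
  note sb = tensor_stably_bij[OF L S resL(1) resS(1) sing rL.syzygy_Z le_SucI[OF resL(2)] le_SucI[OF resS(2)] B]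
  have Xl: "?X \<in> lin_hom K ?E ?E'"
  proof (rule lin_homI)
    fix x assume "x \<in> carrier ?E"
    then obtain \<phi> where \<phi>: "\<phi> \<in> lin_hom L Z B" "x = ?cL \<phi>" unfolding E by blast
    show "?X x \<in> carrier ?E'" unfolding \<phi>(2) X[OF \<phi>(1)] E' using F[OF \<phi>(1)] by (rule imageI)
  next
    fix x y assume "x \<in> carrier ?E" "y \<in> carrier ?E"
    then obtain \<phi> \<psi> where \<phi>: "\<phi> \<in> lin_hom L Z B" "x = ?cL \<phi>" and \<psi>: "\<psi> \<in> lin_hom L Z B" "y = ?cL \<psi>" unfolding E by blast
    show "?X (x \<oplus>\<^bsub>?E\<^esub> y) = ?X x \<oplus>\<^bsub>?E'\<^esub> ?X y"
      unfolding \<phi>(2) \<psi>(2) rL.Ext_add[OF B \<phi>(1) \<psi>(1)] X[OF lin_hom_sum[OF \<phi>(1) \<psi>(1) Bm]] X[OF \<phi>(1)] X[OF \<psi>(1)]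
        rS.Ext_add[OF FBf F[OF \<phi>(1)] F[OF \<psi>(1)]]
      by (rule rS.cocycle_class_cong) (rule tensor_map_add[OF r Zm Bm \<phi>(1) \<psi>(1)])
  next
    fix c x assume c: "c \<in> carrier K" and "x \<in> carrier ?E"
    then obtain \<phi> where \<phi>: "\<phi> \<in> lin_hom L Z B" "x = ?cL \<phi>" unfolding E by blast
    note s = fd_algebra.scalar_lin_hom[OF L c Bm]
    show "?X (c \<odot>\<^bsub>?E\<^esub> x) = c \<odot>\<^bsub>?E'\<^esub> ?X x"
      unfolding \<phi>(2) rL.Ext_smult(2)[OF B \<phi>(1) c] X[OF rL.Ext_smult(1)[OF B \<phi>(1) c]] X[OF \<phi>(1)]
        rS.Ext_smult(2)[OF FBf F[OF \<phi>(1)] c]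
    proof (rule rS.cocycle_class_cong)
      fix t assume t: "t \<in> carrier (?N Z)"
      show "?F (\<lambda>z. (c \<odot>\<^bsub>L\<^esub> \<one>\<^bsub>L\<^esub>) \<odot>\<^bsub>B\<^esub> \<phi> z) t = (c \<odot>\<^bsub>S\<^esub> \<one>\<^bsub>S\<^esub>) \<odot>\<^bsub>?N B\<^esub> ?F \<phi> t"
        unfolding tensor_map_scalar[OF L N Bm c S lin_hom_closed[OF F[OF \<phi>(1)] t], symmetric]
        by (rule tensor_map_comp[OF r Zm Bm Bm \<phi>(1) s t, symmetric])
    qed
  qed
  have "bij_betw ?X (carrier ?E) (carrier ?E')"
    unfolding bij_betw_def
  proof (intro conjI inj_onI equalityI[OF subsetI subsetI, of "_ ` _"])
    fix x y assume "x \<in> carrier ?E" "y \<in> carrier ?E" and eq: "?X x = ?X y"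
    then obtain \<phi> \<psi> where h: "\<phi> \<in> lin_hom L Z B" "x = ?cL \<phi>" "\<psi> \<in> lin_hom L Z B" "y = ?cL \<psi>" unfolding E by blast
    note D = lin_hom_minus[OF h(1,3) Bm] and FD = lin_hom_minus[OF F[OF h(1)] F[OF h(3)] FBm]
    have "rS.coboundary (?N B) (\<lambda>t. ?F \<phi> t \<ominus>\<^bsub>?N B\<^esub> ?F \<psi> t)"
      using eq unfolding h(2,4) X[OF h(1)] X[OF h(3)] rS.cocycle_class_eq_iff[OF FBf F[OF h(1)] F[OF h(3)]] .
    then have "finite_rank S (?N Z) (?N B) (\<lambda>t. ?F \<phi> t \<ominus>\<^bsub>?N B\<^esub> ?F \<psi> t)"
      unfolding rS.coboundary_iff_finite_rank[OF resS FBm FD] .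
    then have "finite_rank S (?N Z) (?N B) (?F (\<lambda>z. \<phi> z \<ominus>\<^bsub>B\<^esub> \<psi> z))"
      by (rule finite_rank_cong) (rule tensor_map_diff[OF n Zm Bm h(1,3), symmetric])
    then have "finite_rank L Z B (\<lambda>z. \<phi> z \<ominus>\<^bsub>B\<^esub> \<psi> z)" using sb D by blast
    then show "x = y"
      unfolding h(2,4) rL.cocycle_class_eq_iff[OF B h(1,3)] rL.coboundary_iff_finite_rank[OF resL Bm D] .
  next
    fix y assume "y \<in> ?X ` carrier ?E"
    then show "y \<in> carrier ?E'" using lin_hom_closed[OF Xl] by blast
  next
    fix y assume "y \<in> carrier ?E'"
    then obtain \<psi> where \<psi>: "\<psi> \<in> lin_hom S (?N Z) (?N B)" "y = ?cS \<psi>" unfolding E' by blast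
    obtain f where f: "f \<in> lin_hom L Z B" "finite_rank S (?N Z) (?N B) (\<lambda>t. \<psi> t \<ominus>\<^bsub>?N B\<^esub> ?F f t)"
      using sb \<psi>(1) by blast
    have "?cS \<psi> = ?cS (?F f)"
      unfolding rS.cocycle_class_eq_iff[OF FBf \<psi>(1) F[OF f(1)]]
        rS.coboundary_iff_finite_rank[OF resS FBm lin_hom_minus[OF \<psi>(1) F[OF f(1)] FBm]] by (rule f(2))
    then have "y = ?X (?cL f)" unfolding \<psi>(2) X[OF f(1)] .
    then show "y \<in> ?X ` carrier ?E" unfolding E using f(1) by blast
  qed
  then show ?thesis using Xl by (simp add: lin_iso_def)
qed

lemma singular_equivalence_level_sym:
  "singular_equivalence_level K L S M N l \<Longrightarrow> singular_equivalence_level K S L N M l"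
  by (simp add: singular_equivalence_level_def)

theorem proposition5p4:
  fixes K :: "'k ring"
    and L :: "('k, 'l) module" and S :: "('k, 's) module"
    and M :: "('l, 's, 'm) bimod" and N :: "('s, 'l, 'n) bimod"
    and n :: nat
  assumes "field K"
    and "fd_algebra K L" and "fd_algebra K S"
    and "gorenstein L" and "gorenstein S"
    and "singular_equivalence K L S M N"
    and "enat n > max (inj_dim L (regular L)) (inj_dim S (regular S))"
  shows "(\<forall>(A :: ('l, 'a) module) (B :: ('l, 'b) module).
            fg_module L A \<and> fg_module L B \<longrightarrow>
            Ext_tensor L S N n A B \<in>
              lin_iso K (Ext K L n A B) (Ext K S n (tensor L N A) (tensor L N B))) \<and>
         (\<forall>(A' :: ('s, 'c) module) (B' :: ('s, 'd) module).
            fg_module S A' \<and> fg_module S B' \<longrightarrow>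
            Ext_tensor S L M n A' B' \<in>
              lin_iso K (Ext K S n A' B') (Ext K L n (tensor S M A') (tensor S M B')))"
proof -
  have n: "inj_dim L (regular L) < enat n" "inj_dim S (regular S) < enat n" using assms(7) by simp_all
  obtain d e \<delta> and I :: "nat \<Rightarrow> ('l, 'k univ) module" where I: "d < n" "injective_resolution L (regular L) d I e \<delta>"
    by (rule inj_dim_resolution[OF n(1)])
  obtain d' e' \<delta>' and J :: "nat \<Rightarrow> ('s, 'k univ) module" where J: "d' < n" "injective_resolution S (regular S) d' J e' \<delta>'"
    by (rule inj_dim_resolution[OF n(2)])
  \<comment> \<open>\<open>n\<close> exceeds the length of some injective resolution over each
    algebra. So it is positive, and its predecessor is at least both lengths, which is the weak
    bound that extending functionals from the n-th syzygy requires.\<close>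
  obtain m where m: "n = Suc m" "d \<le> m" "d' \<le> m" using I(1) J(1) by (cases n) auto
  obtain l where l: "singular_equivalence_level K L S M N l" using assms(6) by (auto simp: singular_equivalence_def)
  show ?thesis
    unfolding m(1)
  proof (intro conjI allI impI; elim conjE)
    show "Ext_tensor L S N (Suc m) A B \<in> lin_iso K (Ext K L (Suc m) A B) (Ext K S (Suc m) (tensor L N A) (tensor L N B))"
      if "fg_module L A" "fg_module L B" for A :: "('l, 'a) module" and B :: "('l, 'b) module"
      by (rule Ext_tensor_iso[OF assms(2,3) I(2) m(2) J(2) m(3) l that])
    show "Ext_tensor S L M (Suc m) A B \<in> lin_iso K (Ext K S (Suc m) A B) (Ext K L (Suc m) (tensor S M A) (tensor S M B))"
      if "fg_module S A" "fg_module S B" for A :: "('s, 'c) module" and B :: "('s, 'd) module"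
      by (rule Ext_tensor_iso[OF assms(3,2) J(2) m(3) I(2) m(2) singular_equivalence_level_sym[OF l] that])
  qed
qed

end
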